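(* Let $\mathcal{A}$ be a homological category in which every normal epimorphism is an effective descent morphism, and let $\mathcal{N}$ be the class of normal epimorphisms in $\mathcal{A}$. Then any torsion theory $(\mathcal{T},\mathcal{F})$ in $\mathcal{A}$ satisfying conditions (P) and (N) induces, for any $n\geq 1$, a torsion theory $(\mathcal{T}_n,\mathrm{NExt}^n_{\mathcal{F}}(\mathcal{A}))$ in the category $\mathrm{Ext}^n_{\mathcal{N}}(\mathcal{A})$ of $n$-fold $\mathcal{N}$-extensions. Here $\mathcal{T}_n$ is the replete image of $\mathcal{T}$ under the functor $\iota^n\colon\mathcal{A}\to\mathrm{Arr}^n(\mathcal{A})$, and $\mathrm{NExt}^n_{\mathcal{F}}(\mathcal{A})=\mathcal{F}_n\cap\mathrm{Ext}^n_{\mathcal{N}}(\mathcal{A})$ consists of all $n$-fold $\mathcal{N}$-extensions that are normal extensions with respect to the Galois structure $\Gamma_{\mathrm{NExt}^{n-1}_{\mathcal{F}}(\mathcal{A})}$ (where $\mathrm{NExt}^0_{\mathcal{F}}(\mathcal{A})=\mathcal{F}$). Moreover, for any $n\geq 1$ and any $n$-fold $\mathcal{N}$-extension $A$ with initial ribs $a_1,\dots,a_n$, $$A\in\mathrm{NExt}^n_{\mathcal{F}}(\mathcal{A})\ \Longleftrightarrow\ \bigcap_{1\leq i\leq n}K[a_i]\in\mathcal{F}.$$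
   Context: Basic notions. A category is pointed if it has a zero object $0$; $\ker(f)\colon K[f]\to A$ is the kernel of $f\colon A\to B$. Normal monomorphisms (epimorphisms) are kernels (cokernels) of some morphism. A short exact sequence is a composable pair $(k,f)$ with $k=\ker(f)$, $f=\mathrm{coker}(k)$; a split short exact sequence is a triple $(k,f,s)$ with $k=\ker(f)$, $f\circ s=1$. A pointed category with pullbacks along split epimorphisms is protomodular if the split short five lemma holds. A homological category is a pointed protomodular regular category. A functor between pointed protomodular categories is protoadditive if it preserves split short exact sequences. A morphism $p\colon E\to B$ is an effective descent morphism if $p^*\colon(\mathcal{A}\downarrow B)\to(\mathcal{A}\downarrow E)$ is monadic. Torsion theories. A torsion theory in a pointed category $\mathcal{A}$ is a pair $(\mathcal{T},\mathcal{F})$ of full replete subcategories such that $\mathrm{Hom}_{\mathcal{A}}(T,F)=\{0\}$ for all $T\in\mathcal{T}$, $F\in\mathcal{F}$, and every object $A$ admits a short exact sequence $0\to T(A)\xrightarrow{t_A}A\xrightarrow{\eta_A}F(A)\to 0$ with $T(A)\in\mathcal{T}$, $F(A)\in\mathcal{F}$. Condition (P): the reflector $F\colon\mathcal{A}\to\mathcal{F}$ is protoadditive. Condition (N): for any morphism $f\colon A\to B$ in $\mathcal{A}$, $\ker(f)\circ t_{K[f]}\colon T(K[f])\to A$ is a normal monomorphism. Higher arrows and extensions. $\mathrm{Arr}^0(\mathcal{A})=\mathcal{A}$, and $\mathrm{Arr}^{n}(\mathcal{A})=\mathrm{Arr}(\mathrm{Arr}^{n-1}(\mathcal{A}))$ is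 the category of $n$-fold morphisms; an object of it is a commutative $n$-dimensional cube in $\mathcal{A}$. Its initial ribs $a_1,\dots,a_n$ are the $n$ edges of the cube starting at its initial vertex. The functor $\iota$ sends an object $A$ to the morphism $A\to 0$, and $\iota^n\colon\mathcal{A}\to\mathrm{Arr}^n(\mathcal{A})$ is its $n$-fold iterate. For a class $\mathcal{E}$ of morphisms in a category, $\mathcal{E}^1$ is the class of morphisms $(f,f')\colon a\to b$ in its arrow category ($a\colon A\to A'$, $b\colon B\to B'$, $b\circ f=f'\circ a$) such that $f,f',a,b$, the projections of the pullback $A'\times_{B'}B$ and the comparison $A\to A'\times_{B'}B$ all lie in $\mathcal{E}$. Put $\mathcal{N}^0=\mathcal{N}$ and $\mathcal{N}^n=(\mathcal{N}^{n-1})^1$, a class of morphisms in $\mathrm{Arr}^n(\mathcal{A})$. For $n\geq1$, an $n$-fold $\mathcal{N}$-extension is an element of $\mathcal{N}^{n-1}$, and $\mathrm{Ext}^n_{\mathcal{N}}(\mathcal{A})$ is the corresponding full subcategory of $\mathrm{Arr}^n(\mathcal{A})$; $\mathrm{Ext}^0_{\mathcal{N}}(\mathcal{A})=\mathcal{A}$. The subcategories $\mathcal{F}_n$. $\mathcal{F}_0=\mathcal{F}$ and, for $n\geq 1$, $\mathcal{F}_n$ is the full subcategory of $\mathrm{Arr}^n(\mathcal{A})$ of those morphisms $f$ of $\mathrm{Arr}^{n-1}(\mathcal{A})$ with $K[f]\in\mathcal{F}_{n-1}$. Galois structures. $\Gamma_{\mathrm{NExt}^{n-1}_{\mathcal{F}}(\mathcal{A})}$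 is the Galois structure given by the reflection $F_{n-1}\colon\mathrm{Ext}^{n-1}_{\mathcal{N}}(\mathcal{A})\to\mathrm{NExt}^{n-1}_{\mathcal{F}}(\mathcal{A})$ (with unit $\eta^{n-1}$, $F_0=F$) together with the class $\mathcal{N}^{n-1}$ of $n$-fold $\mathcal{N}$-extensions. In a Galois structure given by a reflection $F\colon\mathcal{X}\to\mathcal{Y}$ with unit $\eta$ and a class $\mathcal{E}$ of morphisms of $\mathcal{X}$, a morphism $f\colon A\to B$ in $\mathcal{E}$ is a trivial extension if the naturality square $\eta_B\circ f=F(f)\circ\eta_A$ is a pullback; it is a monadic extension if pulling back along $f$ is a monadic functor $(\mathcal{X}\downarrow_{\mathcal{E}}B)\to(\mathcal{X}\downarrow_{\mathcal{E}}A)$ between the full subcategories of the slice categories on the morphisms in $\mathcal{E}$; it is a normal extension if it is a monadic extension and $f^*(f)$ (a kernel pair projection of $f$) is a trivial extension. *)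

theory Defs
  imports Main
begin

section \<open>Categories, functors, natural transformations\<close>

record ('o, 'm) cat =
  Ob :: "'o set"
  Mor :: "'m set"
  Dom :: "'m \<Rightarrow> 'o"
  Cod :: "'m \<Rightarrow> 'o"
  Id :: "'o \<Rightarrow> 'm"
  Cmp :: "'m \<Rightarrow> 'm \<Rightarrow> 'm"  (infixl "\<cdot>\<index>" 70)

text \<open>\<open>g \<cdot>\<^bsub>C\<^esub> f\<close> is \<open>g\<close> after \<open>f\<close>; its value is irrelevant when \<open>Dom C g \<noteq> Cod C f\<close>.\<close>

definition hom :: "('o, 'm) cat \<Rightarrow> 'o \<Rightarrow> 'o \<Rightarrow> 'm set" where
  "hom C X Y = {f \<in> Mor C. Dom C f = X \<and> Cod C f = Y}"

definition category :: "('o, 'm) cat \<Rightarrow> bool" where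
  "category C \<longleftrightarrow>
     (\<forall>f \<in> Mor C. Dom C f \<in> Ob C \<and> Cod C f \<in> Ob C) \<and>
     (\<forall>X \<in> Ob C. Id C X \<in> hom C X X) \<and>
     (\<forall>f \<in> Mor C. \<forall>g \<in> Mor C. Dom C g = Cod C f \<longrightarrow> g \<cdot>\<^bsub>C\<^esub> f \<in> hom C (Dom C f) (Cod C g)) \<and>
     (\<forall>f \<in> Mor C. f \<cdot>\<^bsub>C\<^esub> Id C (Dom C f) = f \<and> Id C (Cod C f) \<cdot>\<^bsub>C\<^esub> f = f) \<and>
     (\<forall>f \<in> Mor C. \<forall>g \<in> Mor C. \<forall>h \<in> Mor C. Dom C g = Cod C f \<longrightarrow> Dom C h = Cod C g \<longrightarrow>
        h \<cdot>\<^bsub>C\<^esub> (g \<cdot>\<^bsub>C\<^esub> f) = (h \<cdot>\<^bsub>C\<^esub> g) \<cdot>\<^bsub>C\<^esub> f)"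

definition full_sub :: "('o, 'm) cat \<Rightarrow> 'o set \<Rightarrow> ('o, 'm) cat" where
  "full_sub C S = C\<lparr>Ob := Ob C \<inter> S, Mor := {f \<in> Mor C. Dom C f \<in> S \<and> Cod C f \<in> S}\<rparr>"

definition is_iso :: "('o, 'm) cat \<Rightarrow> 'm \<Rightarrow> bool" where
  "is_iso C f \<longleftrightarrow> f \<in> Mor C \<and>
     (\<exists>g \<in> hom C (Cod C f) (Dom C f). g \<cdot>\<^bsub>C\<^esub> f = Id C (Dom C f) \<and> f \<cdot>\<^bsub>C\<^esub> g = Id C (Cod C f))"

definition isomorphic :: "('o, 'm) cat \<Rightarrow> 'o \<Rightarrow> 'o \<Rightarrow> bool" where
  "isomorphic C X Y \<longleftrightarrow> (\<exists>f \<in> hom C X Y. is_iso C f)"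

definition replete :: "('o, 'm) cat \<Rightarrow> 'o set \<Rightarrow> bool" where
  "replete C S \<longleftrightarrow> S \<subseteq> Ob C \<and> (\<forall>X \<in> S. \<forall>Y \<in> Ob C. isomorphic C X Y \<longrightarrow> Y \<in> S)"

record ('o, 'm, 'p, 'q) func =
  on_ob :: "'o \<Rightarrow> 'p"
  on_mor :: "'m \<Rightarrow> 'q"

definition is_functor :: "('o, 'm) cat \<Rightarrow> ('p, 'q) cat \<Rightarrow> ('o, 'm, 'p, 'q) func \<Rightarrow> bool" where
  "is_functor C D F \<longleftrightarrow>
     (\<forall>X \<in> Ob C. on_ob F X \<in> Ob D \<and> on_mor F (Id C X) = Id D (on_ob F X)) \<and>
     (\<forall>f \<in> Mor C. on_mor F f \<in> hom D (on_ob F (Dom C f)) (on_ob F (Cod C f))) \<and>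
     (\<forall>f \<in> Mor C. \<forall>g \<in> Mor C. Dom C g = Cod C f \<longrightarrow>
        on_mor F (g \<cdot>\<^bsub>C\<^esub> f) = on_mor F g \<cdot>\<^bsub>D\<^esub> on_mor F f)"

definition id_func :: "('o, 'm, 'o, 'm) func" where
  "id_func = \<lparr>on_ob = (\<lambda>X. X), on_mor = (\<lambda>f. f)\<rparr>"

definition comp_func ::
  "('p, 'q, 'r, 's) func \<Rightarrow> ('o, 'm, 'p, 'q) func \<Rightarrow> ('o, 'm, 'r, 's) func" where
  "comp_func G F = \<lparr>on_ob = on_ob G \<circ> on_ob F, on_mor = on_mor G \<circ> on_mor F\<rparr>"

definition nat_trans :: "('o, 'm) cat \<Rightarrow> ('p, 'q) cat \<Rightarrow>
    ('o, 'm, 'p, 'q) func \<Rightarrow> ('o, 'm, 'p, 'q) func \<Rightarrow> ('o \<Rightarrow> 'q) \<Rightarrow> bool" where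
  "nat_trans C D F G \<tau> \<longleftrightarrow>
     (\<forall>X \<in> Ob C. \<tau> X \<in> hom D (on_ob F X) (on_ob G X)) \<and>
     (\<forall>f \<in> Mor C. \<tau> (Cod C f) \<cdot>\<^bsub>D\<^esub> on_mor F f = on_mor G f \<cdot>\<^bsub>D\<^esub> \<tau> (Dom C f))"

definition nat_iso :: "('o, 'm) cat \<Rightarrow> ('p, 'q) cat \<Rightarrow>
    ('o, 'm, 'p, 'q) func \<Rightarrow> ('o, 'm, 'p, 'q) func \<Rightarrow> ('o \<Rightarrow> 'q) \<Rightarrow> bool" where
  "nat_iso C D F G \<tau> \<longleftrightarrow> nat_trans C D F G \<tau> \<and> (\<forall>X \<in> Ob C. is_iso D (\<tau> X))"

definition is_equivalence :: "('o, 'm) cat \<Rightarrow> ('p, 'q) cat \<Rightarrow> ('o, 'm, 'p, 'q) func \<Rightarrow> bool" where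
  "is_equivalence C D F \<longleftrightarrow> is_functor C D F \<and>
     (\<exists>G. is_functor D C G \<and>
        (\<exists>\<sigma>. nat_iso C C id_func (comp_func G F) \<sigma>) \<and>
        (\<exists>\<tau>. nat_iso D D (comp_func F G) id_func \<tau>))"

section \<open>Monadic functors\<close>

text \<open>\<open>L : C \<rightarrow> D\<close> is left adjoint to \<open>R : D \<rightarrow> C\<close>, with unit \<open>\<eta>\<close> and counit \<open>\<epsilon>\<close>.\<close>

definition adjunction :: "('o, 'm) cat \<Rightarrow> ('p, 'q) cat \<Rightarrow>
    ('o, 'm, 'p, 'q) func \<Rightarrow> ('p, 'q, 'o, 'm) func \<Rightarrow> ('o \<Rightarrow> 'm) \<Rightarrow> ('p \<Rightarrow> 'q) \<Rightarrow> bool" where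
  "adjunction C D L R \<eta> \<epsilon> \<longleftrightarrow>
     is_functor C D L \<and> is_functor D C R \<and>
     nat_trans C C id_func (comp_func R L) \<eta> \<and>
     nat_trans D D (comp_func L R) id_func \<epsilon> \<and>
     (\<forall>X \<in> Ob C. \<epsilon> (on_ob L X) \<cdot>\<^bsub>D\<^esub> on_mor L (\<eta> X) = Id D (on_ob L X)) \<and>
     (\<forall>Y \<in> Ob D. on_mor R (\<epsilon> Y) \<cdot>\<^bsub>C\<^esub> \<eta> (on_ob R Y) = Id C (on_ob R Y))"

text \<open>The Eilenberg-Moore category of a monad \<open>(T, \<eta>, \<mu>)\<close> on \<open>C\<close>.\<close>

definition em_algs :: "('o, 'm) cat \<Rightarrow> ('o, 'm, 'o, 'm) func \<Rightarrow>
    ('o \<Rightarrow> 'm) \<Rightarrow> ('o \<Rightarrow> 'm) \<Rightarrow> ('o \<times> 'm) set" where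
  "em_algs C T \<eta> \<mu> = {(X, h). X \<in> Ob C \<and> h \<in> hom C (on_ob T X) X \<and>
     h \<cdot>\<^bsub>C\<^esub> \<eta> X = Id C X \<and> h \<cdot>\<^bsub>C\<^esub> on_mor T h = h \<cdot>\<^bsub>C\<^esub> \<mu> X}"

definition em_cat :: "('o, 'm) cat \<Rightarrow> ('o, 'm, 'o, 'm) func \<Rightarrow> ('o \<Rightarrow> 'm) \<Rightarrow> ('o \<Rightarrow> 'm) \<Rightarrow>
    ('o \<times> 'm, ('o \<times> 'm) \<times> 'm \<times> ('o \<times> 'm)) cat" where
  "em_cat C T \<eta> \<mu> = \<lparr>
     Ob = em_algs C T \<eta> \<mu>,
     Mor = {(a, f, b). a \<in> em_algs C T \<eta> \<mu> \<and> b \<in> em_algs C T \<eta> \<mu> \<and>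
              f \<in> hom C (fst a) (fst b) \<and> f \<cdot>\<^bsub>C\<^esub> snd a = snd b \<cdot>\<^bsub>C\<^esub> on_mor T f},
     Dom = (\<lambda>(a, f, b). a),
     Cod = (\<lambda>(a, f, b). b),
     Id = (\<lambda>a. (a, Id C (fst a), a)),
     Cmp = (\<lambda>(b, g, c) (a, f, b'). (a, g \<cdot>\<^bsub>C\<^esub> f, c))\<rparr>"

definition comparison :: "('p, 'q) cat \<Rightarrow> ('p, 'q, 'o, 'm) func \<Rightarrow> ('p \<Rightarrow> 'q) \<Rightarrow>
    ('p, 'q, 'o \<times> 'm, ('o \<times> 'm) \<times> 'm \<times> ('o \<times> 'm)) func" where
  "comparison D R \<epsilon> = (let alg = (\<lambda>Y. (on_ob R Y, on_mor R (\<epsilon> Y))) in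
     \<lparr>on_ob = alg, on_mor = (\<lambda>f. (alg (Dom D f), on_mor R f, alg (Cod D f)))\<rparr>)"

definition monadic :: "('p, 'q) cat \<Rightarrow> ('o, 'm) cat \<Rightarrow> ('p, 'q, 'o, 'm) func \<Rightarrow> bool" where
  "monadic D C R \<longleftrightarrow> (\<exists>L \<eta> \<epsilon>. adjunction C D L R \<eta> \<epsilon> \<and>
     is_equivalence D
       (em_cat C (comp_func R L) \<eta> (\<lambda>X. on_mor R (\<epsilon> (on_ob L X))))
       (comparison D R \<epsilon>))"

section \<open>Pullbacks, slices and descent\<close>

text \<open>The square has \<open>f \<cdot> p = g \<cdot> q\<close>, so \<open>p\<close> is the pullback of \<open>g\<close> along \<open>f\<close>.\<close>

definition is_pullback :: "('o, 'm) cat \<Rightarrow> 'm \<Rightarrow> 'm \<Rightarrow> 'm \<Rightarrow> 'm \<Rightarrow> bool" where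
  "is_pullback C f g p q \<longleftrightarrow>
     f \<in> Mor C \<and> g \<in> Mor C \<and> p \<in> Mor C \<and> q \<in> Mor C \<and>
     Cod C f = Cod C g \<and> Dom C p = Dom C q \<and> Cod C p = Dom C f \<and> Cod C q = Dom C g \<and>
     f \<cdot>\<^bsub>C\<^esub> p = g \<cdot>\<^bsub>C\<^esub> q \<and>
     (\<forall>u \<in> Mor C. \<forall>v \<in> Mor C.
        Dom C u = Dom C v \<longrightarrow> Cod C u = Dom C f \<longrightarrow> Cod C v = Dom C g \<longrightarrow>
        f \<cdot>\<^bsub>C\<^esub> u = g \<cdot>\<^bsub>C\<^esub> v \<longrightarrow>
        (\<exists>!h. h \<in> hom C (Dom C u) (Dom C p) \<and> p \<cdot>\<^bsub>C\<^esub> h = u \<and> q \<cdot>\<^bsub>C\<^esub> h = v))"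

definition slice :: "('o, 'm) cat \<Rightarrow> 'o \<Rightarrow> ('m, 'm \<times> 'm \<times> 'm) cat" where
  "slice C B = \<lparr>
     Ob = {x \<in> Mor C. Cod C x = B},
     Mor = {(x, f, y). x \<in> Mor C \<and> y \<in> Mor C \<and> Cod C x = B \<and> Cod C y = B \<and>
              f \<in> hom C (Dom C x) (Dom C y) \<and> y \<cdot>\<^bsub>C\<^esub> f = x},
     Dom = (\<lambda>(x, f, y). x),
     Cod = (\<lambda>(x, f, y). y),
     Id = (\<lambda>x. (x, Id C (Dom C x), x)),
     Cmp = (\<lambda>(y, g, z) (x, f, y'). (x, g \<cdot>\<^bsub>C\<^esub> f, z))\<rparr>"

text \<open>The functor \<open>p\<^sup>*\<close> (change of base along \<open>p : E \<rightarrow> B\<close>), defined from a choice of pullbacks.\<close>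

definition pb_choice :: "('o, 'm) cat \<Rightarrow> 'm \<Rightarrow> 'm \<Rightarrow> 'm \<times> 'm" where
  "pb_choice C p x = (SOME uv. is_pullback C p x (fst uv) (snd uv))"

definition change_base :: "('o, 'm) cat \<Rightarrow> 'm \<Rightarrow> ('m, 'm \<times> 'm \<times> 'm, 'm, 'm \<times> 'm \<times> 'm) func" where
  "change_base C p = \<lparr>
     on_ob = (\<lambda>x. fst (pb_choice C p x)),
     on_mor = (\<lambda>(x, f, y). case (pb_choice C p x, pb_choice C p y) of ((u, v), (u', v')) \<Rightarrow>
       (u, (THE h. h \<in> hom C (Dom C u) (Dom C u') \<and> u' \<cdot>\<^bsub>C\<^esub> h = u \<and> v' \<cdot>\<^bsub>C\<^esub> h = f \<cdot>\<^bsub>C\<^esub> v), u'))\<rparr>"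

definition effective_descent :: "('o, 'm) cat \<Rightarrow> 'm \<Rightarrow> bool" where
  "effective_descent C p \<longleftrightarrow> p \<in> Mor C \<and>
     monadic (slice C (Cod C p)) (slice C (Dom C p)) (change_base C p)"

section \<open>Pointed, protomodular, regular and homological categories\<close>

definition is_terminal :: "('o, 'm) cat \<Rightarrow> 'o \<Rightarrow> bool" where
  "is_terminal C Z \<longleftrightarrow> Z \<in> Ob C \<and> (\<forall>X \<in> Ob C. \<exists>!f. f \<in> hom C X Z)"

definition is_zero_ob :: "('o, 'm) cat \<Rightarrow> 'o \<Rightarrow> bool" where
  "is_zero_ob C Z \<longleftrightarrow> is_terminal C Z \<and> (\<forall>X \<in> Ob C. \<exists>!f. f \<in> hom C Z X)"

definition pointed :: "('o, 'm) cat \<Rightarrow> bool" where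
  "pointed C \<longleftrightarrow> (\<exists>Z. is_zero_ob C Z)"

definition is_zero_mor :: "('o, 'm) cat \<Rightarrow> 'm \<Rightarrow> bool" where
  "is_zero_mor C f \<longleftrightarrow> (\<exists>Z. is_zero_ob C Z \<and>
     (\<exists>g \<in> hom C (Dom C f) Z. \<exists>h \<in> hom C Z (Cod C f). f = h \<cdot>\<^bsub>C\<^esub> g))"

definition is_kernel :: "('o, 'm) cat \<Rightarrow> 'm \<Rightarrow> 'm \<Rightarrow> bool" where
  "is_kernel C k f \<longleftrightarrow> k \<in> Mor C \<and> f \<in> Mor C \<and> Cod C k = Dom C f \<and> is_zero_mor C (f \<cdot>\<^bsub>C\<^esub> k) \<and>
     (\<forall>g \<in> Mor C. Cod C g = Dom C f \<longrightarrow> is_zero_mor C (f \<cdot>\<^bsub>C\<^esub> g) \<longrightarrow>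
        (\<exists>!h. h \<in> hom C (Dom C g) (Dom C k) \<and> k \<cdot>\<^bsub>C\<^esub> h = g))"

definition is_cokernel :: "('o, 'm) cat \<Rightarrow> 'm \<Rightarrow> 'm \<Rightarrow> bool" where
  "is_cokernel C c f \<longleftrightarrow> c \<in> Mor C \<and> f \<in> Mor C \<and> Dom C c = Cod C f \<and> is_zero_mor C (c \<cdot>\<^bsub>C\<^esub> f) \<and>
     (\<forall>g \<in> Mor C. Dom C g = Cod C f \<longrightarrow> is_zero_mor C (g \<cdot>\<^bsub>C\<^esub> f) \<longrightarrow>
        (\<exists>!h. h \<in> hom C (Cod C c) (Cod C g) \<and> h \<cdot>\<^bsub>C\<^esub> c = g))"

definition normal_mono :: "('o, 'm) cat \<Rightarrow> 'm \<Rightarrow> bool" where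
  "normal_mono C k \<longleftrightarrow> (\<exists>f. is_kernel C k f)"

definition normal_epi :: "('o, 'm) cat \<Rightarrow> 'm \<Rightarrow> bool" where
  "normal_epi C c \<longleftrightarrow> (\<exists>f. is_cokernel C c f)"

definition short_exact :: "('o, 'm) cat \<Rightarrow> 'm \<Rightarrow> 'm \<Rightarrow> bool" where
  "short_exact C k f \<longleftrightarrow> is_kernel C k f \<and> is_cokernel C f k"

definition section_of :: "('o, 'm) cat \<Rightarrow> 'm \<Rightarrow> 'm \<Rightarrow> bool" where
  "section_of C s f \<longleftrightarrow> f \<in> Mor C \<and> s \<in> hom C (Cod C f) (Dom C f) \<and> f \<cdot>\<^bsub>C\<^esub> s = Id C (Cod C f)"

definition split_short_exact :: "('o, 'm) cat \<Rightarrow> 'm \<Rightarrow> 'm \<Rightarrow> 'm \<Rightarrow> bool" where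
  "split_short_exact C k f s \<longleftrightarrow> is_kernel C k f \<and> section_of C s f"

definition split_short_five :: "('o, 'm) cat \<Rightarrow> bool" where
  "split_short_five C \<longleftrightarrow> (\<forall>k f s k' f' s' u v w.
     split_short_exact C k f s \<longrightarrow> split_short_exact C k' f' s' \<longrightarrow>
     u \<in> hom C (Dom C k) (Dom C k') \<longrightarrow>
     v \<in> hom C (Dom C f) (Dom C f') \<longrightarrow>
     w \<in> hom C (Cod C f) (Cod C f') \<longrightarrow>
     v \<cdot>\<^bsub>C\<^esub> k = k' \<cdot>\<^bsub>C\<^esub> u \<longrightarrow> w \<cdot>\<^bsub>C\<^esub> f = f' \<cdot>\<^bsub>C\<^esub> v \<longrightarrow> v \<cdot>\<^bsub>C\<^esub> s = s' \<cdot>\<^bsub>C\<^esub> w \<longrightarrow>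
     is_iso C u \<longrightarrow> is_iso C w \<longrightarrow> is_iso C v)"

definition protomodular :: "('o, 'm) cat \<Rightarrow> bool" where
  "protomodular C \<longleftrightarrow> pointed C \<and>
     (\<forall>f s g. section_of C s f \<longrightarrow> g \<in> Mor C \<longrightarrow> Cod C g = Cod C f \<longrightarrow>
        (\<exists>p q. is_pullback C f g p q)) \<and>
     split_short_five C"

definition finitely_complete :: "('o, 'm) cat \<Rightarrow> bool" where
  "finitely_complete C \<longleftrightarrow> (\<exists>Z. is_terminal C Z) \<and>
     (\<forall>f \<in> Mor C. \<forall>g \<in> Mor C. Cod C f = Cod C g \<longrightarrow> (\<exists>p q. is_pullback C f g p q))"

definition is_coequalizer :: "('o, 'm) cat \<Rightarrow> 'm \<Rightarrow> 'm \<Rightarrow> 'm \<Rightarrow> bool" where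
  "is_coequalizer C p q c \<longleftrightarrow> p \<in> Mor C \<and> q \<in> Mor C \<and> c \<in> Mor C \<and>
     Dom C p = Dom C q \<and> Cod C p = Cod C q \<and> Dom C c = Cod C p \<and> c \<cdot>\<^bsub>C\<^esub> p = c \<cdot>\<^bsub>C\<^esub> q \<and>
     (\<forall>g \<in> Mor C. Dom C g = Cod C p \<longrightarrow> g \<cdot>\<^bsub>C\<^esub> p = g \<cdot>\<^bsub>C\<^esub> q \<longrightarrow>
        (\<exists>!h. h \<in> hom C (Cod C c) (Cod C g) \<and> h \<cdot>\<^bsub>C\<^esub> c = g))"

definition regular_epi :: "('o, 'm) cat \<Rightarrow> 'm \<Rightarrow> bool" where
  "regular_epi C c \<longleftrightarrow> (\<exists>p q. is_coequalizer C p q c)"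

definition regular :: "('o, 'm) cat \<Rightarrow> bool" where
  "regular C \<longleftrightarrow> finitely_complete C \<and>
     (\<forall>f p q. is_pullback C f f p q \<longrightarrow> (\<exists>c. is_coequalizer C p q c)) \<and>
     (\<forall>f g p q. is_pullback C f g p q \<longrightarrow> regular_epi C g \<longrightarrow> regular_epi C p)"

definition homological :: "('o, 'm) cat \<Rightarrow> bool" where
  "homological C \<longleftrightarrow> category C \<and> pointed C \<and> protomodular C \<and> regular C"

definition protoadditive :: "('o, 'm) cat \<Rightarrow> ('p, 'q) cat \<Rightarrow> ('o, 'm, 'p, 'q) func \<Rightarrow> bool" where
  "protoadditive C D F \<longleftrightarrow> is_functor C D F \<and>
     (\<forall>k f s. split_short_exact C k f s \<longrightarrow>
        split_short_exact D (on_mor F k) (on_mor F f) (on_mor F s))"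

section \<open>Reflections and torsion theories\<close>

text \<open>Full replete subcategories are represented by their sets of objects.\<close>

definition reflection :: "('o, 'm) cat \<Rightarrow> 'o set \<Rightarrow> ('o, 'm, 'o, 'm) func \<Rightarrow> ('o \<Rightarrow> 'm) \<Rightarrow> bool" where
  "reflection C S R \<eta> \<longleftrightarrow> S \<subseteq> Ob C \<and>
     is_functor C (full_sub C S) R \<and> nat_trans C C id_func R \<eta> \<and>
     (\<forall>X \<in> Ob C. \<forall>Y \<in> S. \<forall>g \<in> hom C X Y. \<exists>!h. h \<in> hom C (on_ob R X) Y \<and> h \<cdot>\<^bsub>C\<^esub> \<eta> X = g)"

definition torsion_theory :: "('o, 'm) cat \<Rightarrow> 'o set \<Rightarrow> 'o set \<Rightarrow> bool" where
  "torsion_theory C T F \<longleftrightarrow> category C \<and> pointed C \<and> replete C T \<and> replete C F \<and>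
     (\<forall>X \<in> T. \<forall>Y \<in> F. \<forall>f \<in> hom C X Y. is_zero_mor C f) \<and>
     (\<forall>X \<in> Ob C. \<exists>t e. short_exact C t e \<and> Cod C t = X \<and> Dom C t \<in> T \<and> Cod C e \<in> F)"

definition condition_P :: "('o, 'm) cat \<Rightarrow> 'o set \<Rightarrow> bool" where
  "condition_P C F \<longleftrightarrow> (\<exists>R \<eta>. reflection C F R \<eta> \<and> protoadditive C (full_sub C F) R)"

definition condition_N :: "('o, 'm) cat \<Rightarrow> 'o set \<Rightarrow> 'o set \<Rightarrow> bool" where
  "condition_N C T F \<longleftrightarrow> (\<forall>f k t e. is_kernel C k f \<longrightarrow>
     short_exact C t e \<longrightarrow> Cod C t = Dom C k \<longrightarrow> Dom C t \<in> T \<longrightarrow> Cod C e \<in> F \<longrightarrow>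
     normal_mono C (k \<cdot>\<^bsub>C\<^esub> t))"

section \<open>Galois structures\<close>

text \<open>A Galois structure is given by a category \<open>C\<close>, a reflection \<open>(R, \<eta>)\<close> onto a full
  subcategory, and a class \<open>E\<close> of morphisms of \<open>C\<close>.\<close>

definition trivial_extension ::
  "('o, 'm) cat \<Rightarrow> ('o, 'm, 'o, 'm) func \<Rightarrow> ('o \<Rightarrow> 'm) \<Rightarrow> 'm set \<Rightarrow> 'm \<Rightarrow> bool" where
  "trivial_extension C R \<eta> E f \<longleftrightarrow> f \<in> E \<and>
     is_pullback C (\<eta> (Cod C f)) (on_mor R f) f (\<eta> (Dom C f))"

definition monadic_extension :: "('o, 'm) cat \<Rightarrow> 'm set \<Rightarrow> 'm \<Rightarrow> bool" where
  "monadic_extension C E f \<longleftrightarrow> f \<in> E \<and> f \<in> Mor C \<and>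
     monadic (full_sub (slice C (Cod C f)) E) (full_sub (slice C (Dom C f)) E) (change_base C f)"

definition normal_extension ::
  "('o, 'm) cat \<Rightarrow> ('o, 'm, 'o, 'm) func \<Rightarrow> ('o \<Rightarrow> 'm) \<Rightarrow> 'm set \<Rightarrow> 'm \<Rightarrow> bool" where
  "normal_extension C R \<eta> E f \<longleftrightarrow> monadic_extension C E f \<and>
     trivial_extension C R \<eta> E (on_ob (change_base C f) f)"

section \<open>Higher arrows and higher extensions\<close>

text \<open>A single type for the cells of all the categories of \<open>n\<close>-fold arrows. The objects of the
  arrow category are the morphisms of the given category; its morphism \<open>Square a b f f'\<close> is the
  pair \<open>(f, f') : a \<rightarrow> b\<close>, with \<open>f\<close> between the domains and \<open>f'\<close> between the codomains.\<close>

datatype ('o, 'm) cell =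
    Vertex 'o
  | Edge 'm
  | Square "('o, 'm) cell" "('o, 'm) cell" "('o, 'm) cell" "('o, 'm) cell"

type_synonym ('o, 'm) cell_cat = "(('o, 'm) cell, ('o, 'm) cell) cat"

definition base_cat :: "('o, 'm) cat \<Rightarrow> ('o, 'm) cell_cat" where
  "base_cat A = \<lparr>
     Ob = Vertex ` Ob A,
     Mor = Edge ` Mor A,
     Dom = (\<lambda>x. case x of Edge f \<Rightarrow> Vertex (Dom A f)),
     Cod = (\<lambda>x. case x of Edge f \<Rightarrow> Vertex (Cod A f)),
     Id = (\<lambda>x. case x of Vertex X \<Rightarrow> Edge (Id A X)),
     Cmp = (\<lambda>y x. case (y, x) of (Edge g, Edge f) \<Rightarrow> Edge (g \<cdot>\<^bsub>A\<^esub> f))\<rparr>"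

definition arrow_cat :: "('o, 'm) cell_cat \<Rightarrow> ('o, 'm) cell_cat" where
  "arrow_cat C = \<lparr>
     Ob = Mor C,
     Mor = {Square a b f f' | a b f f'. a \<in> Mor C \<and> b \<in> Mor C \<and>
              f \<in> hom C (Dom C a) (Dom C b) \<and> f' \<in> hom C (Cod C a) (Cod C b) \<and>
              b \<cdot>\<^bsub>C\<^esub> f = f' \<cdot>\<^bsub>C\<^esub> a},
     Dom = (\<lambda>x. case x of Square a b f f' \<Rightarrow> a),
     Cod = (\<lambda>x. case x of Square a b f f' \<Rightarrow> b),
     Id = (\<lambda>a. Square a a (Id C (Dom C a)) (Id C (Cod C a))),
     Cmp = (\<lambda>y x. case (y, x) of (Square b c g g', Square a b' f f') \<Rightarrow>
              Square a c (g \<cdot>\<^bsub>C\<^esub> f) (g' \<cdot>\<^bsub>C\<^esub> f'))\<rparr>"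

primrec Arr :: "nat \<Rightarrow> ('o, 'm) cat \<Rightarrow> ('o, 'm) cell_cat" where
  "Arr 0 A = base_cat A"
| "Arr (Suc n) A = arrow_cat (Arr n A)"

text \<open>\<open>\<E>\<^sup>1\<close>: below, \<open>(p, q)\<close> are the projections of the pullback of \<open>f'\<close> and \<open>b\<close>, and \<open>c\<close> is the
  comparison morphism into it.\<close>

definition ext_class :: "('o, 'm) cell_cat \<Rightarrow> ('o, 'm) cell set \<Rightarrow> ('o, 'm) cell set" where
  "ext_class C E = {Square a b f f' | a b f f'.
     Square a b f f' \<in> Mor (arrow_cat C) \<and> f \<in> E \<and> f' \<in> E \<and> a \<in> E \<and> b \<in> E \<and>
     (\<exists>p q c. is_pullback C f' b p q \<and> p \<in> E \<and> q \<in> E \<and>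
        c \<in> hom C (Dom C a) (Dom C p) \<and> p \<cdot>\<^bsub>C\<^esub> c = a \<and> q \<cdot>\<^bsub>C\<^esub> c = f \<and> c \<in> E)}"

text \<open>\<open>Ncls A N n\<close> is \<open>\<N>\<^sup>n\<close>, a class of morphisms in \<open>Arr n A\<close>.\<close>

primrec Ncls :: "('o, 'm) cat \<Rightarrow> 'm set \<Rightarrow> nat \<Rightarrow> ('o, 'm) cell set" where
  "Ncls A N 0 = Edge ` N"
| "Ncls A N (Suc n) = ext_class (Arr n A) (Ncls A N n)"

fun Ext :: "('o, 'm) cat \<Rightarrow> 'm set \<Rightarrow> nat \<Rightarrow> ('o, 'm) cell_cat" where
  "Ext A N 0 = Arr 0 A"
| "Ext A N (Suc n) = full_sub (Arr (Suc n) A) (Ncls A N n)"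

text \<open>The objects of \<open>\<F>\<^sub>n\<close>. The choice of kernel is immaterial, as \<open>\<F>\<^sub>n\<close> is replete.\<close>

primrec Fsub :: "('o, 'm) cat \<Rightarrow> 'o set \<Rightarrow> nat \<Rightarrow> ('o, 'm) cell set" where
  "Fsub A F 0 = Vertex ` F"
| "Fsub A F (Suc n) = {f \<in> Mor (Arr n A). \<exists>k. is_kernel (Arr n A) k f \<and> Dom (Arr n A) k \<in> Fsub A F n}"

definition NExt :: "('o, 'm) cat \<Rightarrow> 'm set \<Rightarrow> 'o set \<Rightarrow> nat \<Rightarrow> ('o, 'm) cell set" where
  "NExt A N F n = Fsub A F n \<inter> Ob (Ext A N n)"

text \<open>The object part of \<open>\<iota>\<close>, for a chosen zero object of \<open>C\<close>; only the replete image of its iterates is used.\<close>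

definition iota :: "('o, 'm) cell_cat \<Rightarrow> ('o, 'm) cell \<Rightarrow> ('o, 'm) cell" where
  "iota C X = (THE f. f \<in> hom C X (SOME Z. is_zero_ob C Z))"

primrec iota_pow :: "('o, 'm) cat \<Rightarrow> nat \<Rightarrow> 'o \<Rightarrow> ('o, 'm) cell" where
  "iota_pow A 0 X = Vertex X"
| "iota_pow A (Suc n) X = iota (Arr n A) (iota_pow A n X)"

definition Tsub :: "('o, 'm) cat \<Rightarrow> 'o set \<Rightarrow> nat \<Rightarrow> ('o, 'm) cell set" where
  "Tsub A T n = {Y \<in> Ob (Arr n A). \<exists>X \<in> T. isomorphic (Arr n A) (iota_pow A n X) Y}"

section \<open>Initial ribs and intersections of subobjects\<close>

text \<open>An object \<open>Square a b f f'\<close> of \<open>Arr\<^sup>n\<close> is the cube whose initial ribs are those of its domain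
  \<open>a\<close> together with the edge of \<open>f\<close> at the initial vertex.\<close>

fun initial_edge :: "('o, 'm) cell \<Rightarrow> 'm" where
  "initial_edge (Edge f) = f"
| "initial_edge (Square a b f f') = initial_edge f"
| "initial_edge (Vertex X) = undefined"

fun initial_ribs :: "('o, 'm) cell \<Rightarrow> 'm list" where
  "initial_ribs (Vertex X) = []"
| "initial_ribs (Edge f) = [f]"
| "initial_ribs (Square a b f f') = initial_edge f # initial_ribs a"

text \<open>\<open>m\<close> is the intersection (wide pullback) of the subobjects \<open>ks\<close> of a common object.\<close>

definition is_intersection :: "('o, 'm) cat \<Rightarrow> 'm list \<Rightarrow> 'm \<Rightarrow> bool" where
  "is_intersection C ks m \<longleftrightarrow> m \<in> Mor C \<and>
     (\<forall>k \<in> set ks. k \<in> Mor C \<and> Cod C k = Cod C m \<and> (\<exists>h \<in> hom C (Dom C m) (Dom C k). k \<cdot>\<^bsub>C\<^esub> h = m)) \<and>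
     (\<forall>g \<in> Mor C. Cod C g = Cod C m \<longrightarrow>
        (\<forall>k \<in> set ks. \<exists>h \<in> hom C (Dom C g) (Dom C k). k \<cdot>\<^bsub>C\<^esub> h = g) \<longrightarrow>
        (\<exists>!h. h \<in> hom C (Dom C g) (Dom C m) \<and> m \<cdot>\<^bsub>C\<^esub> h = g))"

definition ribs_kernel_in :: "('o, 'm) cat \<Rightarrow> 'o set \<Rightarrow> ('o, 'm) cell \<Rightarrow> bool" where
  "ribs_kernel_in A F X \<longleftrightarrow> (\<exists>ks m. list_all2 (is_kernel A) ks (initial_ribs X) \<and>
     is_intersection A ks m \<and> Dom A m \<in> F)"

end

(* Torsion is concentrated at the initial vertex: the torsion part of an extension f in Arr^n(A) is
   T(K[f]) -> 0, included by the torsion part of K[f] followed by ker(f). By (N) that inclusion is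
   normal, so f can be divided by it and the quotient is again an extension, with kernel F(K[f]);
   hence (T_1, F_1) is a torsion theory. All hypotheses used - pullbacks, the split short five
   lemma, descent along the given class of epimorphisms, (N), and the effect of (P) on split
   extensions - pass to arrow categories, so the step can be iterated.

   An extension f is normal iff K[f] lies in F_{n-1}. If the kernel pair projection of f is a trivial
   extension, then K[f] is the kernel of a morphism between objects of F_{n-1}. Conversely, if
   K[f] is in F_{n-1}, the split epimorphism f^*(f) induces an isomorphism of torsion parts by (P),
   so its naturality square is a pullback. Monadicity of f^* on extensions is reduced to an
   elementwise form of descent data, which is also how descent is transferred between levels.

   Taking kernels direction by direction turns the iterated kernel of an n-fold extension into the
   intersection of the kernels of its initial ribs. *)

theory Submission imports Defs begin

text \<open>Two classes of epimorphisms travel together. The extensions \<open>E\<close> satisfy the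
  comparison condition, but above level 0 a kernel need not be the kernel of a member of
  \<open>E\<close>; for the pointwise class \<open>Q\<close> it is, and cokernels and descent can be
  treated vertex by vertex. The link is that the quotient supplied by (N) lies in \<open>E\<close>
  whenever the given morphism does.

  An equivalence with a category of algebras does not split over the vertices of a cube, but the
  equations of a single algebra do: they can be tested on elements of the domain carried along an
  arrow and on elements placed at its codomain alone. This is why descent is phrased with
  generalized elements.

  (N) one level up is (N) below, applied to the comparison of a square with its pullback, whose
  kernel is the intersection of two kernels. (P) is remembered as a statement on torsion inclusions,
  which are unique up to isomorphism; hence no reflector has to be transported, and normality is
  settled for every choice of reflection.\<close>

lemma homD:
  assumes "f \<in> hom C X Y"
  shows "f \<in> Mor C" "Dom C f = X" "Cod C f = Y"
  using assms by (auto simp: hom_def)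

section \<open>Composition, isomorphisms and pullbacks in a category\<close>

locale cat_loc =
  fixes C :: "('o, 'm) cat" (structure)
  assumes is_cat: "category C"
begin

lemma Mor_hom: "f \<in> Mor C \<Longrightarrow> f \<in> hom C (Dom C f) (Cod C f)"
  by (simp add: hom_def)

lemma hom_Ob1: "f \<in> hom C X Y \<Longrightarrow> X \<in> Ob C"
  and hom_Ob2: "f \<in> hom C X Y \<Longrightarrow> Y \<in> Ob C"
  using is_cat by (auto simp: category_def hom_def)

lemma comp_hom: "g \<in> hom C Y Z \<Longrightarrow> f \<in> hom C X Y \<Longrightarrow> g \<cdot> f \<in> hom C X Z"
  using is_cat by (auto simp: category_def hom_def)

lemma id_hom: "X \<in> Ob C \<Longrightarrow> Id C X \<in> hom C X X"
  using is_cat by (auto simp: category_def)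

lemma id_left: "f \<in> hom C X Y \<Longrightarrow> Id C Y \<cdot> f = f"
  and id_right: "f \<in> hom C X Y \<Longrightarrow> f \<cdot> Id C X = f"
  using is_cat by (auto simp: category_def hom_def)

lemma assoc:
  assumes "f \<in> hom C W X" "g \<in> hom C X Y" "h \<in> hom C Y Z"
  shows "(h \<cdot> g) \<cdot> f = h \<cdot> (g \<cdot> f)"
  using assms is_cat by (simp add: category_def hom_def)

lemma cmp_Mor: "f \<in> Mor C \<Longrightarrow> g \<in> Mor C \<Longrightarrow> Dom C g = Cod C f \<Longrightarrow> g \<cdot> f \<in> Mor C"
  and cmp_Dom: "f \<in> Mor C \<Longrightarrow> g \<in> Mor C \<Longrightarrow> Dom C g = Cod C f \<Longrightarrow> Dom C (g \<cdot> f) = Dom C f"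
  and cmp_Cod: "f \<in> Mor C \<Longrightarrow> g \<in> Mor C \<Longrightarrow> Dom C g = Cod C f \<Longrightarrow> Cod C (g \<cdot> f) = Cod C g"
  and cmp_assoc: "f \<in> Mor C \<Longrightarrow> g \<in> Mor C \<Longrightarrow> h \<in> Mor C \<Longrightarrow> Dom C g = Cod C f \<Longrightarrow>
    Dom C h = Cod C g \<Longrightarrow> (h \<cdot> g) \<cdot> f = h \<cdot> (g \<cdot> f)"
  and id_Mor: "X \<in> Ob C \<Longrightarrow> Id C X \<in> Mor C"
  and id_Dom: "X \<in> Ob C \<Longrightarrow> Dom C (Id C X) = X"
  and id_Cod: "X \<in> Ob C \<Longrightarrow> Cod C (Id C X) = X"
  and cmp_idl: "f \<in> Mor C \<Longrightarrow> Cod C f = Y \<Longrightarrow> Id C Y \<cdot> f = f"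
  and cmp_idr: "f \<in> Mor C \<Longrightarrow> Dom C f = X \<Longrightarrow> f \<cdot> Id C X = f"
  using is_cat by (auto simp: category_def hom_def)

lemmas cs = hom_def cmp_Mor cmp_Dom cmp_Cod cmp_assoc id_Mor id_Dom id_Cod cmp_idl cmp_idr

text \<open>The rules \<open>cs\<close> bracket composites to the right, which hides a subterm
  \<open>g \<cdot> f\<close> inside \<open>g \<cdot> (f \<cdot> h)\<close>. Instances of this rule
  at a known equation make that equation applicable in the normal form.\<close>

lemma cmp_eq:
  "g \<cdot> f = k \<Longrightarrow> f \<in> Mor C \<Longrightarrow> g \<in> Mor C \<Longrightarrow> h \<in> Mor C \<Longrightarrow> Dom C g = Cod C f \<Longrightarrow>
    Dom C f = Cod C h \<Longrightarrow> g \<cdot> (f \<cdot> h) = k \<cdot> h"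
  by (metis cmp_assoc)

lemma isoE:
  assumes "is_iso C f" "f \<in> hom C X Y"
  obtains g where "g \<in> hom C Y X" "g \<cdot> f = Id C X" "f \<cdot> g = Id C Y"
  using assms by (auto simp: is_iso_def hom_def)

lemma isoI:
  assumes "f \<in> hom C X Y" "g \<in> hom C Y X" "g \<cdot> f = Id C X" "f \<cdot> g = Id C Y"
  shows "is_iso C f"
  using assms by (auto simp: is_iso_def hom_def)

lemma iso_id: "X \<in> Ob C \<Longrightarrow> is_iso C (Id C X)"
  by (meson id_hom id_left isoI)

lemma iso_inv:
  assumes "is_iso C f" "f \<in> hom C X Y"
  obtains g where "g \<in> hom C Y X" "g \<cdot> f = Id C X" "f \<cdot> g = Id C Y" "is_iso C g"
  using assms isoE isoI by metis

lemma iso_mono: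
  assumes "is_iso C i" "i \<in> hom C X Y" "u \<in> hom C W X" "v \<in> hom C W X" "i \<cdot> u = i \<cdot> v"
  shows "u = v"
proof -
  obtain j where "j \<in> hom C Y X" "j \<cdot> i = Id C X" using assms isoE by metis
  then have "j \<cdot> (i \<cdot> u) = u" "j \<cdot> (i \<cdot> v) = v"
    using assms(2-4) by (simp_all add: cs cmp_eq[OF \<open>j \<cdot> i = Id C X\<close>])
  then show ?thesis using assms(5) by metis
qed

lemma iso_refl: "X \<in> Ob C \<Longrightarrow> isomorphic C X X"
  unfolding isomorphic_def using id_hom iso_id by blast

lemma pullbackI:
  assumes "f \<in> hom C X Z" "g \<in> hom C Y Z" "p \<in> hom C P X" "q \<in> hom C P Y"
    and "f \<cdot> p = g \<cdot> q"
    and "\<And>W u v. u \<in> hom C W X \<Longrightarrow> v \<in> hom C W Y \<Longrightarrow> f \<cdot> u = g \<cdot> v \<Longrightarrow>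
      \<exists>h \<in> hom C W P. p \<cdot> h = u \<and> q \<cdot> h = v"
    and "\<And>W h h'. h \<in> hom C W P \<Longrightarrow> h' \<in> hom C W P \<Longrightarrow> p \<cdot> h = p \<cdot> h' \<Longrightarrow> q \<cdot> h = q \<cdot> h' \<Longrightarrow> h = h'"
  shows "is_pullback C f g p q"
proof -
  have "\<exists>!h. h \<in> hom C (Dom C u) (Dom C p) \<and> p \<cdot> h = u \<and> q \<cdot> h = v"
    if "u \<in> Mor C" "v \<in> Mor C" "Dom C u = Dom C v" "Cod C u = Dom C f" "Cod C v = Dom C g"
      "f \<cdot> u = g \<cdot> v" for u v
  proof -
    have h: "u \<in> hom C (Dom C u) X" "v \<in> hom C (Dom C u) Y"
      using that assms(1,2) by (auto simp: hom_def)
    show ?thesis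
      using assms(6)[OF h that(6)] assms(7) assms(3) by (auto simp: homD(2))
  qed
  then show ?thesis
    using assms(1-5) by (auto simp: is_pullback_def hom_def)
qed

lemma pullbackE:
  assumes "is_pullback C f g p q"
  obtains X Y Z P where "f \<in> hom C X Z" "g \<in> hom C Y Z" "p \<in> hom C P X" "q \<in> hom C P Y" "f \<cdot> p = g \<cdot> q"
  using assms by (auto simp: is_pullback_def hom_def)

lemma pullback_comm: "is_pullback C f g p q \<Longrightarrow> f \<cdot> p = g \<cdot> q"
  by (simp add: is_pullback_def)

lemma pullback_lift:
  assumes "is_pullback C f g p q" "f \<in> hom C X Z" "g \<in> hom C Y Z" "p \<in> hom C P X"
    and "u \<in> hom C W X" "v \<in> hom C W Y" "f \<cdot> u = g \<cdot> v"
  obtains h where "h \<in> hom C W P" "p \<cdot> h = u" "q \<cdot> h = v"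
proof -
  have "u \<in> Mor C" "v \<in> Mor C" "Dom C u = Dom C v" "Cod C u = Dom C f" "Cod C v = Dom C g"
    using assms by (simp_all add: hom_def)
  then have "\<exists>!h. h \<in> hom C (Dom C u) (Dom C p) \<and> p \<cdot> h = u \<and> q \<cdot> h = v"
    using assms(1,7) unfolding is_pullback_def by blast
  then show thesis using that assms(4,5) by (auto simp: homD(2))
qed

lemma pullback_unique:
  assumes "is_pullback C f g p q" "p \<in> hom C P X" "h \<in> hom C W P" "h' \<in> hom C W P"
    and "p \<cdot> h = p \<cdot> h'" "q \<cdot> h = q \<cdot> h'"
  shows "h = h'"
proof -
  obtain X' Y Z P' where H: "f \<in> hom C X' Z" "g \<in> hom C Y Z" "p \<in> hom C P' X'" "q \<in> hom C P' Y"
    "f \<cdot> p = g \<cdot> q" using pullbackE[OF assms(1)] by metis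
  have e: "P' = P" "X' = X" using H(3) assms(2) by (auto simp: hom_def)
  note H = H[unfolded e]
  have u: "p \<cdot> h \<in> hom C W X" "q \<cdot> h \<in> hom C W Y" using H assms comp_hom by blast+
  have "f \<cdot> (p \<cdot> h) = g \<cdot> (q \<cdot> h)" using H assms by (simp add: cs cmp_eq[OF H(5)])
  moreover have "\<exists>!k. k \<in> hom C (Dom C u) (Dom C p) \<and> p \<cdot> k = u \<and> q \<cdot> k = v"
    if "u \<in> Mor C" "v \<in> Mor C" "Dom C u = Dom C v" "Cod C u = Dom C f" "Cod C v = Dom C g"
      "f \<cdot> u = g \<cdot> v" for u v
    using assms(1) that unfolding is_pullback_def by blast
  ultimately have "\<exists>!k. k \<in> hom C W P \<and> p \<cdot> k = p \<cdot> h \<and> q \<cdot> k = q \<cdot> h"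
    using u H(1-3) by (metis homD)
  then show ?thesis using assms by metis
qed

lemma pullback_sym: "is_pullback C f g p q \<Longrightarrow> is_pullback C g f q p"
  unfolding is_pullback_def by (metis (no_types, lifting))

lemma pullback_iso:
  assumes "is_pullback C f g p q" "is_pullback C f g p' q'"
    and "p \<in> hom C P X" "p' \<in> hom C P' X"
  obtains i where "i \<in> hom C P' P" "is_iso C i" "p \<cdot> i = p'" "q \<cdot> i = q'"
proof -
  obtain Z Y where H: "f \<in> hom C X Z" "g \<in> hom C Y Z" "q \<in> hom C P Y" "q' \<in> hom C P' Y"
    using assms by (auto simp: is_pullback_def hom_def)
  obtain i where i: "i \<in> hom C P' P" "p \<cdot> i = p'" "q \<cdot> i = q'"
    using pullback_lift[OF assms(1) H(1,2) assms(3,4) H(4) pullback_comm[OF assms(2)]] by metis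
  obtain j where j: "j \<in> hom C P P'" "p' \<cdot> j = p" "q' \<cdot> j = q"
    using pullback_lift[OF assms(2) H(1,2) assms(4,3) H(3) pullback_comm[OF assms(1)]] by metis
  have P: "P \<in> Ob C" "P' \<in> Ob C" using i hom_Ob1 hom_Ob2 by auto
  have "i \<cdot> j = Id C P"
    by (rule pullback_unique[OF assms(1,3)])
      (use i j assms(3,4) H P in \<open>simp_all add: cs cmp_eq[OF i(2)] cmp_eq[OF i(3)]\<close>)
  moreover have "j \<cdot> i = Id C P'"
    by (rule pullback_unique[OF assms(2,4)])
      (use i j assms(3,4) H P in \<open>simp_all add: cs cmp_eq[OF j(2)] cmp_eq[OF j(3)]\<close>)
  ultimately show thesis using that i j isoI by metis
qed

lemma pullback_of_iso:
  assumes "is_pullback C f g p q" "i \<in> hom C P' P" "is_iso C i" "p \<in> hom C P X"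
  shows "is_pullback C f g (p \<cdot> i) (q \<cdot> i)"
proof -
  obtain X' Y Z P0 where H: "f \<in> hom C X' Z" "g \<in> hom C Y Z" "p \<in> hom C P0 X'" "q \<in> hom C P0 Y"
    "f \<cdot> p = g \<cdot> q" using pullbackE[OF assms(1)] by metis
  have e: "P0 = P" "X' = X" using H(3) assms(4) by (auto simp: hom_def)
  note H = H[unfolded e]
  obtain j where j: "j \<in> hom C P P'" "j \<cdot> i = Id C P'" "i \<cdot> j = Id C P"
    using isoE[OF assms(3,2)] by metis
  show ?thesis
  proof (rule pullbackI[OF H(1,2)])
    fix W u v assume uv: "u \<in> hom C W X" "v \<in> hom C W Y" "f \<cdot> u = g \<cdot> v"
    obtain h where h: "h \<in> hom C W P" "p \<cdot> h = u" "q \<cdot> h = v"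
      using pullback_lift[OF assms(1) H(1,2,3) uv] by metis
    have ij: "i \<cdot> (j \<cdot> h) = h" using assoc[OF h(1) j(1) assms(2)] j id_left[OF h(1)] by simp
    show "\<exists>h \<in> hom C W P'. (p \<cdot> i) \<cdot> h = u \<and> (q \<cdot> i) \<cdot> h = v"
      by (rule bexI[of _ "j \<cdot> h"]) (use ij h j assms(2) H in \<open>simp_all add: cs\<close>)
  next
    fix W h h' assume hh: "h \<in> hom C W P'" "h' \<in> hom C W P'" "(p \<cdot> i) \<cdot> h = (p \<cdot> i) \<cdot> h'" "(q \<cdot> i) \<cdot> h = (q \<cdot> i) \<cdot> h'"
    have "i \<cdot> h = i \<cdot> h'"
      by (rule pullback_unique[OF assms(1) H(3)])
        (use hh assms(2) H in \<open>simp_all add: cs\<close>)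
    then show "h = h'" using iso_mono[OF assms(3,2)] hh by metis
  qed (use assms(2) H in \<open>simp_all add: cs cmp_eq[OF H(5)]\<close>)
qed

lemma pullback_paste:
  assumes "is_pullback C f g p q" "is_pullback C q h p' q'"
  shows "is_pullback C f (g \<cdot> h) (p \<cdot> p') q'"
proof -
  obtain X Y Z P where H: "f \<in> hom C X Z" "g \<in> hom C Y Z" "p \<in> hom C P X" "q \<in> hom C P Y"
    "f \<cdot> p = g \<cdot> q" using pullbackE[OF assms(1)] by metis
  obtain P' V where H': "h \<in> hom C V Y" "p' \<in> hom C P' P" "q' \<in> hom C P' V" "q \<cdot> p' = h \<cdot> q'"
    using pullbackE[OF assms(2)] H(4) by (metis homD(2,3))
  show ?thesis
  proof (rule pullbackI[where X = X and Z = Z and Y = V and P = P'])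
    fix W u v assume uv: "u \<in> hom C W X" "v \<in> hom C W V" "f \<cdot> u = (g \<cdot> h) \<cdot> v"
    have hv: "h \<cdot> v \<in> hom C W Y" using comp_hom uv H' by blast
    have "f \<cdot> u = g \<cdot> (h \<cdot> v)" using uv H H' assoc by metis
    then obtain a where a: "a \<in> hom C W P" "p \<cdot> a = u" "q \<cdot> a = h \<cdot> v"
      using pullback_lift[OF assms(1) H(1-3) uv(1) hv] by metis
    obtain b where b: "b \<in> hom C W P'" "p' \<cdot> b = a" "q' \<cdot> b = v"
      using pullback_lift[OF assms(2) H(4) H'(1,2) a(1) uv(2) a(3)] by metis
    then show "\<exists>h \<in> hom C W P'. (p \<cdot> p') \<cdot> h = u \<and> q' \<cdot> h = v"
      using a assoc[OF b(1) H'(2) H(3)] by metis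
  next
    fix W a b assume ab: "a \<in> hom C W P'" "b \<in> hom C W P'" "(p \<cdot> p') \<cdot> a = (p \<cdot> p') \<cdot> b" "q' \<cdot> a = q' \<cdot> b"
    have "p' \<cdot> a = p' \<cdot> b"
    proof (rule pullback_unique[OF assms(1) H(3)])
      show "p \<cdot> (p' \<cdot> a) = p \<cdot> (p' \<cdot> b)" using ab H H' assoc by metis
      show "q \<cdot> (p' \<cdot> a) = q \<cdot> (p' \<cdot> b)" using ab H H' by (simp add: cs cmp_eq[OF H'(4)])
    qed (use ab H' comp_hom in blast)+
    then show "a = b" using pullback_unique[OF assms(2) H'(2)] ab by metis
  next
    show "f \<cdot> (p \<cdot> p') = (g \<cdot> h) \<cdot> q'" using H H' by (simp add: cs cmp_eq[OF H(5)])
  qed (use H H' comp_hom in auto)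
qed

text \<open>The cancellation half of the pasting law. It exhibits maps induced between pullbacks as
  pullbacks of comparison morphisms, which is how extensions are shown to be stable under
  composition and under pullback.\<close>

lemma pullback_unpaste:
  assumes "is_pullback C f g p q" "is_pullback C f (g \<cdot> h) r q'"
    and "h \<in> hom C V Y" "g \<in> hom C Y Z" "p' \<in> hom C P' P" "p \<in> hom C P X"
    and "p \<cdot> p' = r" "q \<cdot> p' = h \<cdot> q'"
  shows "is_pullback C q h p' q'"
proof -
  obtain P1 where H: "f \<in> hom C X Z" "q \<in> hom C P Y" "f \<cdot> p = g \<cdot> q"
    using pullbackE[OF assms(1)] assms(4,6) by (metis homD(2,3))
  have gh: "g \<cdot> h \<in> hom C V Z" using assms comp_hom by blast
  have "r \<in> hom C P' X" using assms comp_hom by blast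
  then have H': "q' \<in> hom C P' V" "r \<in> hom C P' X"
    using assms(2,3,4) gh by (auto simp: is_pullback_def hom_def)
  show ?thesis
  proof (rule pullbackI[where X = P and Z = Y and Y = V and P = P'])
    fix W u v assume uv: "u \<in> hom C W P" "v \<in> hom C W V" "q \<cdot> u = h \<cdot> v"
    have pu: "p \<cdot> u \<in> hom C W X" using uv assms comp_hom by blast
    have "f \<cdot> (p \<cdot> u) = (g \<cdot> h) \<cdot> v" using uv assms(3,4,6) H by (simp add: cs cmp_eq[OF H(3)])
    then obtain a where a: "a \<in> hom C W P'" "r \<cdot> a = p \<cdot> u" "q' \<cdot> a = v"
      using pullback_lift[OF assms(2) H(1) gh H'(2) pu uv(2)] by metis
    have "p' \<cdot> a = u"
    proof (rule pullback_unique[OF assms(1,6)])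
      show "p \<cdot> (p' \<cdot> a) = p \<cdot> u" using a assms(5,6) by (simp add: cs flip: assms(7))
      show "q \<cdot> (p' \<cdot> a) = q \<cdot> u" using a assms(3,5) uv H H' by (simp add: cs cmp_eq[OF assms(8)])
    qed (use a uv assms comp_hom in auto)
    then show "\<exists>h \<in> hom C W P'. p' \<cdot> h = u \<and> q' \<cdot> h = v" using a by blast
  next
    fix W a b assume ab: "a \<in> hom C W P'" "b \<in> hom C W P'" "p' \<cdot> a = p' \<cdot> b" "q' \<cdot> a = q' \<cdot> b"
    show "a = b"
      by (rule pullback_unique[OF assms(2) H'(2) ab(1,2)]) (use ab assms(5,6) in \<open>simp_all add: cs flip: assms(7)\<close>)
  qed (use assms H H' in auto)
qed

end

section \<open>Full subcategories\<close>

lemma full_sub_simps [simp]: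
  "Ob (full_sub C S) = Ob C \<inter> S"
  "Mor (full_sub C S) = {f \<in> Mor C. Dom C f \<in> S \<and> Cod C f \<in> S}"
  "Dom (full_sub C S) = Dom C" "Cod (full_sub C S) = Cod C"
  "Id (full_sub C S) = Id C" "Cmp (full_sub C S) = Cmp C"
  by (simp_all add: full_sub_def)

lemma hom_full_sub: "X \<in> S \<Longrightarrow> Y \<in> S \<Longrightarrow> hom (full_sub C S) X Y = hom C X Y"
  by (auto simp: hom_def)

lemma hom_full_subD: "f \<in> hom (full_sub C S) X Y \<Longrightarrow> f \<in> hom C X Y \<and> X \<in> S \<and> Y \<in> S"
  by (auto simp: hom_def)

lemma full_sub_UNIV: "full_sub C UNIV = C"
  by (simp add: full_sub_def)

lemma full_sub_Ob: "category C \<Longrightarrow> full_sub C (Ob C) = C"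
  unfolding full_sub_def category_def by (rule cat.equality) auto

lemma category_full_sub: "category C \<Longrightarrow> category (full_sub C S)"
  unfolding category_def by (auto simp: hom_def)

section \<open>Zero morphisms, kernels and cokernels\<close>

text \<open>\<open>is_zero_mor\<close> is an existential statement; one canonical zero morphism for
  each pair of objects turns vanishing into an equation that can be rewritten. The description is
  meaningful between objects of a pointed category, by \<open>zero_mor_ex\<close> and
  \<open>zero_mor_unique\<close>.\<close>

definition zm :: "('o, 'm) cat \<Rightarrow> 'o \<Rightarrow> 'o \<Rightarrow> 'm" where
  "zm C X Y = (THE f. f \<in> hom C X Y \<and> is_zero_mor C f)"

locale pt_cat = cat_loc +
  assumes is_pointed: "pointed C"
begin

lemma zero_obE:
  obtains Z where "is_zero_ob C Z" "Z \<in> Ob C"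
  using is_pointed by (auto simp: pointed_def is_zero_ob_def is_terminal_def)

lemma zero_ob_Ob: "is_zero_ob C Z \<Longrightarrow> Z \<in> Ob C"
  by (auto simp: is_zero_ob_def is_terminal_def)

lemma to_zero_unique: "is_zero_ob C Z \<Longrightarrow> f \<in> hom C X Z \<Longrightarrow> g \<in> hom C X Z \<Longrightarrow> f = g"
  using hom_Ob1 unfolding is_zero_ob_def is_terminal_def by blast

lemma from_zero_unique: "is_zero_ob C Z \<Longrightarrow> f \<in> hom C Z X \<Longrightarrow> g \<in> hom C Z X \<Longrightarrow> f = g"
  using hom_Ob2 unfolding is_zero_ob_def is_terminal_def by blast

lemma zero_mor_ex: "X \<in> Ob C \<Longrightarrow> Y \<in> Ob C \<Longrightarrow> \<exists>f. f \<in> hom C X Y \<and> is_zero_mor C f"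
proof -
  assume XY: "X \<in> Ob C" "Y \<in> Ob C"
  obtain Z where Z: "is_zero_ob C Z" using zero_obE by metis
  then obtain g h where gh: "g \<in> hom C X Z" "h \<in> hom C Z Y"
    using XY unfolding is_zero_ob_def is_terminal_def by blast
  then have "h \<cdot> g \<in> hom C X Y" using comp_hom by blast
  moreover have "is_zero_mor C (h \<cdot> g)"
    unfolding is_zero_mor_def using Z gh calculation homD by metis
  ultimately show ?thesis by blast
qed

lemma zero_mor_unique:
  assumes "f \<in> hom C X Y" "g \<in> hom C X Y" "is_zero_mor C f" "is_zero_mor C g"
  shows "f = g"
proof -
  obtain Z a b where 1: "is_zero_ob C Z" "a \<in> hom C X Z" "b \<in> hom C Z Y" "f = b \<cdot> a"
    using assms unfolding is_zero_mor_def by (metis homD(2,3))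
  obtain Z' a' b' where 2: "is_zero_ob C Z'" "a' \<in> hom C X Z'" "b' \<in> hom C Z' Y" "g = b' \<cdot> a'"
    using assms unfolding is_zero_mor_def by (metis homD(2,3))
  \<comment> \<open>The two factorizations may use different zero objects; the morphism
    \<open>u\<close> between them identifies both halves.\<close>
  obtain u where u: "u \<in> hom C Z Z'"
    using 2(1) zero_ob_Ob[OF 1(1)] unfolding is_zero_ob_def is_terminal_def by blast
  have "u \<cdot> a = a'" using to_zero_unique[OF 2(1)] comp_hom u 1 2 by blast
  moreover have "b' \<cdot> u = b" using from_zero_unique[OF 1(1)] comp_hom u 1 2 by blast
  ultimately show ?thesis using 1 2 u assoc by metis
qed

lemma zm_props: "X \<in> Ob C \<Longrightarrow> Y \<in> Ob C \<Longrightarrow> zm C X Y \<in> hom C X Y \<and> is_zero_mor C (zm C X Y)"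
  unfolding zm_def by (rule theI') (use zero_mor_ex zero_mor_unique in blast)

lemma zm_hom: "X \<in> Ob C \<Longrightarrow> Y \<in> Ob C \<Longrightarrow> zm C X Y \<in> hom C X Y"
  using zm_props by blast

lemma zero_iff: "f \<in> hom C X Y \<Longrightarrow> is_zero_mor C f \<longleftrightarrow> f = zm C X Y"
  using zm_props zero_mor_unique hom_Ob1 hom_Ob2 by metis

lemma zm_comp: "f \<in> hom C X Y \<Longrightarrow> Z \<in> Ob C \<Longrightarrow> zm C Y Z \<cdot> f = zm C X Z"
proof -
  assume f: "f \<in> hom C X Y" and Z: "Z \<in> Ob C"
  have z: "zm C Y Z \<in> hom C Y Z" "is_zero_mor C (zm C Y Z)" using zm_props f Z hom_Ob2 by auto
  then obtain V a b where 1: "is_zero_ob C V" "a \<in> hom C Y V" "b \<in> hom C V Z" "zm C Y Z = b \<cdot> a"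
    unfolding is_zero_mor_def by (metis homD(2,3))
  have "zm C Y Z \<cdot> f = b \<cdot> (a \<cdot> f)" "zm C Y Z \<cdot> f \<in> hom C X Z" "a \<cdot> f \<in> hom C X V"
    using 1 f assoc comp_hom z by metis+
  then show ?thesis using zero_iff 1 homD unfolding is_zero_mor_def by metis
qed

lemma comp_zm: "f \<in> hom C Y Z \<Longrightarrow> X \<in> Ob C \<Longrightarrow> f \<cdot> zm C X Y = zm C X Z"
proof -
  assume f: "f \<in> hom C Y Z" and X: "X \<in> Ob C"
  have z: "zm C X Y \<in> hom C X Y" "is_zero_mor C (zm C X Y)" using zm_props f X hom_Ob1 by auto
  then obtain V a b where 1: "is_zero_ob C V" "a \<in> hom C X V" "b \<in> hom C V Y" "zm C X Y = b \<cdot> a"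
    unfolding is_zero_mor_def by (metis homD(2,3))
  have "f \<cdot> zm C X Y = (f \<cdot> b) \<cdot> a" "f \<cdot> zm C X Y \<in> hom C X Z" "f \<cdot> b \<in> hom C V Z"
    using 1 f assoc comp_hom z by metis+
  then show ?thesis using zero_iff 1 homD unfolding is_zero_mor_def by metis
qed

lemma zm_to_zero: "is_zero_ob C Z \<Longrightarrow> f \<in> hom C X Z \<Longrightarrow> f = zm C X Z"
  using to_zero_unique zm_hom hom_Ob1 zero_ob_Ob by metis

lemma zm_from_zero: "is_zero_ob C Z \<Longrightarrow> f \<in> hom C Z X \<Longrightarrow> f = zm C Z X"
  using from_zero_unique zm_hom hom_Ob2 zero_ob_Ob by metis

lemma zero_ob_iso:
  assumes "is_zero_ob C Z" "is_zero_ob C Z'"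
  obtains i where "i \<in> hom C Z Z'" "is_iso C i"
proof -
  have O: "Z \<in> Ob C" "Z' \<in> Ob C" using assms zero_ob_Ob by auto
  have "zm C Z' Z \<cdot> zm C Z Z' = Id C Z" "zm C Z Z' \<cdot> zm C Z' Z = Id C Z'"
    by (rule to_zero_unique[OF assms(1) comp_hom[OF zm_hom zm_hom] id_hom]
        to_zero_unique[OF assms(2) comp_hom[OF zm_hom zm_hom] id_hom]; use O in blast)+
  then show thesis using that isoI zm_hom O by metis
qed

text \<open>The identity of \<open>Y\<close> factors through \<open>Z\<close>, hence is zero, and
  composing with it shows that every morphism into or out of \<open>Y\<close> is zero.\<close>

lemma zero_ob_of_iso:
  assumes "is_zero_ob C Z" "i \<in> hom C Z Y" "is_iso C i"
  shows "is_zero_ob C Y"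
proof -
  obtain j where j: "j \<in> hom C Y Z" "j \<cdot> i = Id C Z" "i \<cdot> j = Id C Y"
    using isoE assms by metis
  have O: "Y \<in> Ob C" "Z \<in> Ob C" using assms hom_Ob1 hom_Ob2 by auto
  have idz: "Id C Y = zm C Y Y"
    using j zm_to_zero[OF assms(1) j(1)] comp_zm[OF assms(2) O(1)] by metis
  have "f = zm C X Y" if "f \<in> hom C X Y" for f X
    using that idz id_left zm_comp O by metis
  moreover have "f = zm C Y X" if "f \<in> hom C Y X" for f X
    using that idz id_right comp_zm O by metis
  ultimately show ?thesis unfolding is_zero_ob_def is_terminal_def using O zm_hom by metis
qed

lemma kernelI:
  assumes "k \<in> hom C K A" "f \<in> hom C A B" "f \<cdot> k = zm C K B"
    and "\<And>W g. g \<in> hom C W A \<Longrightarrow> f \<cdot> g = zm C W B \<Longrightarrow> \<exists>h \<in> hom C W K. k \<cdot> h = g"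
    and "\<And>W g h. g \<in> hom C W K \<Longrightarrow> h \<in> hom C W K \<Longrightarrow> k \<cdot> g = k \<cdot> h \<Longrightarrow> g = h"
  shows "is_kernel C k f"
proof -
  have "is_zero_mor C (f \<cdot> k)" using assms zero_iff comp_hom by metis
  moreover have "\<exists>!h. h \<in> hom C (Dom C g) (Dom C k) \<and> k \<cdot> h = g"
    if "g \<in> Mor C" "Cod C g = Dom C f" "is_zero_mor C (f \<cdot> g)" for g
  proof -
    have g: "g \<in> hom C (Dom C g) A" using that assms(2) by (auto simp: hom_def)
    then have "f \<cdot> g = zm C (Dom C g) B" using zero_iff comp_hom that assms by metis
    then show ?thesis using assms(4)[OF g] assms(1,5) homD(2) by metis
  qed
  ultimately show ?thesis using assms(1,2) unfolding is_kernel_def by (auto simp: hom_def)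
qed

lemma kernelE:
  assumes "is_kernel C k f"
  obtains K A B where "k \<in> hom C K A" "f \<in> hom C A B" "f \<cdot> k = zm C K B"
proof -
  have "k \<in> hom C (Dom C k) (Dom C f)" "f \<in> hom C (Dom C f) (Cod C f)"
    using assms by (auto simp: is_kernel_def hom_def)
  then show thesis using that assms zero_iff comp_hom unfolding is_kernel_def by metis
qed

lemma kernel_zero: "is_kernel C k f \<Longrightarrow> k \<in> hom C K A \<Longrightarrow> f \<in> hom C A B \<Longrightarrow> f \<cdot> k = zm C K B"
  using zero_iff comp_hom unfolding is_kernel_def by metis

lemma kernel_lift:
  assumes "is_kernel C k f" "k \<in> hom C K A" "f \<in> hom C A B" "g \<in> hom C W A" "f \<cdot> g = zm C W B"
  obtains h where "h \<in> hom C W K" "k \<cdot> h = g"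
proof -
  have "is_zero_mor C (f \<cdot> g)" using assms zero_iff comp_hom by metis
  then show thesis using that assms unfolding is_kernel_def by (metis homD)
qed

lemma kernel_mono:
  assumes "is_kernel C k f" "k \<in> hom C K A" "g \<in> hom C W K" "h \<in> hom C W K" "k \<cdot> g = k \<cdot> h"
  shows "g = h"
proof -
  obtain B where f: "f \<in> hom C A B" using assms(1,2) by (metis kernelE homD(3))
  have "f \<cdot> (k \<cdot> g) = zm C W B"
    using assoc[OF assms(3,2) f] kernel_zero[OF assms(1,2) f] zm_comp[OF assms(3)] hom_Ob2[OF f] by metis
  then have "is_zero_mor C (f \<cdot> (k \<cdot> g))"
    using zero_iff[OF comp_hom[OF f comp_hom[OF assms(2,3)]]] by simp
  moreover have "\<exists>!h. h \<in> hom C (Dom C u) (Dom C k) \<and> k \<cdot> h = u"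
    if "u \<in> Mor C" "Cod C u = Dom C f" "is_zero_mor C (f \<cdot> u)" for u
    using assms(1) that unfolding is_kernel_def by blast
  ultimately have "\<exists>!h. h \<in> hom C W K \<and> k \<cdot> h = k \<cdot> g"
    using comp_hom[OF assms(2,3)] f assms(2) by (metis homD)
  then show ?thesis using assms by metis
qed

lemma cokernelI:
  assumes "c \<in> hom C B D" "f \<in> hom C A B" "c \<cdot> f = zm C A D"
    and "\<And>W g. g \<in> hom C B W \<Longrightarrow> g \<cdot> f = zm C A W \<Longrightarrow> \<exists>h \<in> hom C D W. h \<cdot> c = g"
    and "\<And>W g h. g \<in> hom C D W \<Longrightarrow> h \<in> hom C D W \<Longrightarrow> g \<cdot> c = h \<cdot> c \<Longrightarrow> g = h"
  shows "is_cokernel C c f"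
proof -
  have "is_zero_mor C (c \<cdot> f)" using assms zero_iff comp_hom by metis
  moreover have "\<exists>!h. h \<in> hom C (Cod C c) (Cod C g) \<and> h \<cdot> c = g"
    if "g \<in> Mor C" "Dom C g = Cod C f" "is_zero_mor C (g \<cdot> f)" for g
  proof -
    have g: "g \<in> hom C B (Cod C g)" using that assms(2) by (auto simp: hom_def)
    then have "g \<cdot> f = zm C A (Cod C g)" using zero_iff comp_hom that assms by metis
    then show ?thesis using assms(4)[OF g] assms(1,5) homD(3) by metis
  qed
  ultimately show ?thesis using assms(1,2) unfolding is_cokernel_def by (auto simp: hom_def)
qed

lemma cokernelE:
  assumes "is_cokernel C c f"
  obtains A B D where "f \<in> hom C A B" "c \<in> hom C B D" "c \<cdot> f = zm C A D"
proof -
  have "f \<in> hom C (Dom C f) (Cod C f)" "c \<in> hom C (Cod C f) (Cod C c)"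
    using assms by (auto simp: is_cokernel_def hom_def)
  then show thesis using that assms zero_iff comp_hom unfolding is_cokernel_def by metis
qed

lemma cokernel_zero: "is_cokernel C c f \<Longrightarrow> f \<in> hom C A B \<Longrightarrow> c \<in> hom C B D \<Longrightarrow> c \<cdot> f = zm C A D"
  using zero_iff comp_hom unfolding is_cokernel_def by metis

lemma cokernel_desc:
  assumes "is_cokernel C c f" "f \<in> hom C A B" "c \<in> hom C B D" "g \<in> hom C B W" "g \<cdot> f = zm C A W"
  obtains h where "h \<in> hom C D W" "h \<cdot> c = g"
proof -
  have "is_zero_mor C (g \<cdot> f)" using assms zero_iff comp_hom by metis
  then show thesis using that assms unfolding is_cokernel_def by (metis homD)
qed

lemma cokernel_epi:
  assumes "is_cokernel C c f" "c \<in> hom C B D" "g \<in> hom C D W" "h \<in> hom C D W" "g \<cdot> c = h \<cdot> c"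
  shows "g = h"
proof -
  obtain A where f: "f \<in> hom C A B" using assms(1,2) by (metis cokernelE homD(2))
  have "(g \<cdot> c) \<cdot> f = zm C A W"
    using assoc[OF f assms(2,3)] cokernel_zero[OF assms(1) f assms(2)] comp_zm[OF assms(3)] hom_Ob1[OF f] by metis
  then have "is_zero_mor C ((g \<cdot> c) \<cdot> f)"
    using zero_iff[OF comp_hom[OF comp_hom[OF assms(3,2)] f]] by simp
  moreover have "\<exists>!h. h \<in> hom C (Cod C c) (Cod C u) \<and> h \<cdot> c = u"
    if "u \<in> Mor C" "Dom C u = Cod C f" "is_zero_mor C (u \<cdot> f)" for u
    using assms(1) that unfolding is_cokernel_def by blast
  ultimately have "\<exists>!h. h \<in> hom C D W \<and> h \<cdot> c = g \<cdot> c"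
    using comp_hom[OF assms(3,2)] f assms(2) by (metis homD)
  then show ?thesis using assms by metis
qed

lemma kernel_iso:
  assumes "is_kernel C k f" "is_kernel C k' f" "k \<in> hom C K A" "k' \<in> hom C K' A"
  obtains i where "i \<in> hom C K' K" "is_iso C i" "k \<cdot> i = k'"
proof -
  obtain B where f: "f \<in> hom C A B" using assms(1,3) by (metis kernelE homD(3))
  obtain i where i: "i \<in> hom C K' K" "k \<cdot> i = k'"
    using kernel_lift[OF assms(1,3) f assms(4) kernel_zero[OF assms(2,4) f]] by metis
  obtain j where j: "j \<in> hom C K K'" "k' \<cdot> j = k"
    using kernel_lift[OF assms(2,4) f assms(3) kernel_zero[OF assms(1,3) f]] by metis
  have O: "K \<in> Ob C" "K' \<in> Ob C" using i hom_Ob1 hom_Ob2 by auto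
  have "i \<cdot> j = Id C K"
    by (rule kernel_mono[OF assms(1,3)]) (use i j assms(3,4) O in \<open>simp_all add: cs cmp_eq[OF i(2)]\<close>)
  moreover have "j \<cdot> i = Id C K'"
    by (rule kernel_mono[OF assms(2,4)]) (use i j assms(3,4) O in \<open>simp_all add: cs cmp_eq[OF j(2)]\<close>)
  ultimately show thesis using that i j isoI by metis
qed

lemma cokernel_iso:
  assumes "is_cokernel C c f" "is_cokernel C c' f" "c \<in> hom C B D" "c' \<in> hom C B D'"
  obtains i where "i \<in> hom C D D'" "is_iso C i" "i \<cdot> c = c'"
proof -
  obtain A where f: "f \<in> hom C A B" using assms(1,3) by (metis cokernelE homD(2))
  obtain i where i: "i \<in> hom C D D'" "i \<cdot> c = c'"
    using cokernel_desc[OF assms(1) f assms(3,4) cokernel_zero[OF assms(2) f assms(4)]] by metis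
  obtain j where j: "j \<in> hom C D' D" "j \<cdot> c' = c"
    using cokernel_desc[OF assms(2) f assms(4,3) cokernel_zero[OF assms(1) f assms(3)]] by metis
  have O: "D \<in> Ob C" "D' \<in> Ob C" using i hom_Ob1 hom_Ob2 by auto
  have "j \<cdot> i = Id C D"
    by (rule cokernel_epi[OF assms(1,3)]) (use i j assms(3,4) O in \<open>simp_all add: cs\<close>)
  moreover have "i \<cdot> j = Id C D'"
    by (rule cokernel_epi[OF assms(2,4)]) (use i j assms(3,4) O in \<open>simp_all add: cs\<close>)
  ultimately show thesis using that i j isoI by metis
qed

lemma kernel_of_iso:
  assumes "is_kernel C k f" "k \<in> hom C K A" "i \<in> hom C K' K" "is_iso C i"
  shows "is_kernel C (k \<cdot> i) f"
proof -
  obtain B where f: "f \<in> hom C A B" using assms(1,2) by (metis kernelE homD(3))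
  obtain j where j: "j \<in> hom C K K'" "j \<cdot> i = Id C K'" "i \<cdot> j = Id C K"
    using isoE[OF assms(4,3)] by metis
  show ?thesis
  proof (rule kernelI[OF _ f])
    show "k \<cdot> i \<in> hom C K' A" using comp_hom assms by blast
    show "f \<cdot> (k \<cdot> i) = zm C K' B"
      using assoc[OF assms(3,2) f] kernel_zero[OF assms(1,2) f] zm_comp[OF assms(3)] hom_Ob2[OF f] by metis
  next
    fix W g assume g: "g \<in> hom C W A" "f \<cdot> g = zm C W B"
    obtain h where h: "h \<in> hom C W K" "k \<cdot> h = g" using kernel_lift[OF assms(1,2) f g] by metis
    have ij: "i \<cdot> (j \<cdot> h) = h" using assoc[OF h(1) j(1) assms(3)] j id_left[OF h(1)] by simp
    show "\<exists>h \<in> hom C W K'. (k \<cdot> i) \<cdot> h = g"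
      by (rule bexI[of _ "j \<cdot> h"]) (use ij h j assms(2,3) in \<open>simp_all add: cs\<close>)
  next
    fix W g h assume gh: "g \<in> hom C W K'" "h \<in> hom C W K'" "(k \<cdot> i) \<cdot> g = (k \<cdot> i) \<cdot> h"
    have "i \<cdot> g = i \<cdot> h"
      by (rule kernel_mono[OF assms(1,2)]) (use gh assms(2,3) in \<open>simp_all add: cs\<close>)
    then show "g = h" using iso_mono[OF assms(4,3)] gh by metis
  qed
qed

lemma cokernel_of_iso:
  assumes "is_cokernel C c f" "f \<in> hom C A B" "i \<in> hom C A' A" "is_iso C i"
  shows "is_cokernel C c (f \<cdot> i)"
proof -
  obtain D where c: "c \<in> hom C B D" using assms(1,2) by (metis cokernelE homD(3))
  obtain j where j: "j \<in> hom C A A'" "j \<cdot> i = Id C A'" "i \<cdot> j = Id C A"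
    using isoE[OF assms(4,3)] by metis
  show ?thesis
  proof (rule cokernelI[OF c])
    show "f \<cdot> i \<in> hom C A' B" using comp_hom assms by blast
    show "c \<cdot> (f \<cdot> i) = zm C A' D"
      using assoc[OF assms(3,2) c] cokernel_zero[OF assms(1,2) c] zm_comp[OF assms(3)] hom_Ob2[OF c] by metis
  next
    fix W g assume g: "g \<in> hom C B W" "g \<cdot> (f \<cdot> i) = zm C A' W"
    have "g \<cdot> f = (g \<cdot> (f \<cdot> i)) \<cdot> j"
      using g(1) assms(2,3) j by (simp add: cs)
    also have "\<dots> = zm C A W" using g j zm_comp hom_Ob2 by metis
    finally show "\<exists>h \<in> hom C D W. h \<cdot> c = g" using cokernel_desc[OF assms(1,2) c g(1)] by metis
  qed (use cokernel_epi[OF assms(1) c] in blast)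
qed

lemma kernel_comp_mono:
  assumes "is_kernel C k f" "f \<in> hom C A B" "m \<in> hom C B D"
    and "\<And>W g h. g \<in> hom C W B \<Longrightarrow> h \<in> hom C W B \<Longrightarrow> m \<cdot> g = m \<cdot> h \<Longrightarrow> g = h"
  shows "is_kernel C k (m \<cdot> f)"
proof -
  obtain K where k: "k \<in> hom C K A" using assms(1,2) by (metis kernelE homD(2))
  show ?thesis
  proof (rule kernelI[OF k])
    show "m \<cdot> f \<in> hom C A D" using comp_hom assms by blast
    show "(m \<cdot> f) \<cdot> k = zm C K D"
      using assoc[OF k assms(2,3)] kernel_zero[OF assms(1) k assms(2)] comp_zm[OF assms(3)] hom_Ob1[OF k] by metis
  next
    fix W g assume g: "g \<in> hom C W A" "(m \<cdot> f) \<cdot> g = zm C W D"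
    have "m \<cdot> (f \<cdot> g) = m \<cdot> zm C W B"
      using g assms assoc comp_zm hom_Ob1 by metis
    then have "f \<cdot> g = zm C W B"
      using assms g comp_hom zm_hom hom_Ob1 hom_Ob2 by metis
    then show "\<exists>h \<in> hom C W K. k \<cdot> h = g" using kernel_lift[OF assms(1) k assms(2) g(1)] by metis
  qed (use kernel_mono[OF assms(1) k] in blast)
qed

text \<open>Pullback preserves the kernel object. Here a kernel of the pulled back morphism gives
  one of the original morphism; \<open>kernel_pullback'\<close> goes the other way.\<close>

lemma kernel_pullback:
  assumes "is_pullback C f g p q" "p \<in> hom C P X" "q \<in> hom C P Y" "is_kernel C k p" "k \<in> hom C K P"
  shows "is_kernel C (q \<cdot> k) g"
proof -
  obtain Z where H: "f \<in> hom C X Z" "g \<in> hom C Y Z" "f \<cdot> p = g \<cdot> q"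
    using pullbackE[OF assms(1)] assms(2,3) by (metis homD(3))
  have O: "X \<in> Ob C" "K \<in> Ob C" "Z \<in> Ob C" using H assms hom_Ob1 hom_Ob2 by auto
  show ?thesis
  proof (rule kernelI[OF _ H(2)])
    show "q \<cdot> k \<in> hom C K Y" using assms comp_hom by blast
    have "g \<cdot> (q \<cdot> k) = f \<cdot> (p \<cdot> k)" using assms(2,3,5) H by (simp add: cs cmp_eq[OF H(3)])
    then show "g \<cdot> (q \<cdot> k) = zm C K Z"
      using kernel_zero[OF assms(4,5,2)] comp_zm[OF H(1)] O by metis
  next
    fix W h assume h: "h \<in> hom C W Y" "g \<cdot> h = zm C W Z"
    have W: "W \<in> Ob C" using h hom_Ob1 by auto
    have "f \<cdot> zm C W X = g \<cdot> h" using h comp_zm[OF H(1) W] by simp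
    then obtain a where a: "a \<in> hom C W P" "p \<cdot> a = zm C W X" "q \<cdot> a = h"
      using pullback_lift[OF assms(1) H(1,2) assms(2) zm_hom[OF W O(1)] h(1)] by metis
    obtain b where b: "b \<in> hom C W K" "k \<cdot> b = a"
      using kernel_lift[OF assms(4,5,2) a(1,2)] by metis
    then show "\<exists>h' \<in> hom C W K. (q \<cdot> k) \<cdot> h' = h" using a assoc[OF b(1) assms(5,3)] by metis
  next
    fix W u v assume uv: "u \<in> hom C W K" "v \<in> hom C W K" "(q \<cdot> k) \<cdot> u = (q \<cdot> k) \<cdot> v"
    have z: "p \<cdot> (k \<cdot> u) = zm C W X" if "u \<in> hom C W K" for u
      using that assms kernel_zero[OF assms(4,5,2)] assoc[OF that assms(5,2)] zm_comp[OF that O(1)] by metis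
    have "k \<cdot> u = k \<cdot> v"
      by (rule pullback_unique[OF assms(1,2)]) (use uv z assms(2,3,5) in \<open>simp_all add: cs\<close>)
    then show "u = v" using kernel_mono[OF assms(4,5)] uv by metis
  qed
qed

lemma kernel_pullback':
  assumes "is_pullback C f g p q" "p \<in> hom C P X" "q \<in> hom C P Y" "is_kernel C k g"
    "k' \<in> hom C K P" "q \<cdot> k' = k" "p \<cdot> k' = zm C K X"
  shows "is_kernel C k' p"
proof -
  obtain Z where H: "f \<in> hom C X Z" "g \<in> hom C Y Z" "f \<cdot> p = g \<cdot> q"
    using pullbackE[OF assms(1)] assms(2,3) by (metis homD(3))
  have k: "k \<in> hom C K Y" using assms comp_hom by metis
  have O: "X \<in> Ob C" "K \<in> Ob C" "Z \<in> Ob C" using H k hom_Ob1 hom_Ob2 by auto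
  show ?thesis
  proof (rule kernelI[OF assms(5,2,7)])
    fix W h assume h: "h \<in> hom C W P" "p \<cdot> h = zm C W X"
    have W: "W \<in> Ob C" using h hom_Ob1 by auto
    have "g \<cdot> (q \<cdot> h) = f \<cdot> (p \<cdot> h)" using h(1) assms(2,3) H by (simp add: cs cmp_eq[OF H(3)])
    then have "g \<cdot> (q \<cdot> h) = zm C W Z" using h comp_zm[OF H(1) W] by simp
    then obtain b where b: "b \<in> hom C W K" "k \<cdot> b = q \<cdot> h"
      using kernel_lift[OF assms(4) k H(2) comp_hom[OF assms(3) h(1)]] by metis
    have "k' \<cdot> b = h"
    proof (rule pullback_unique[OF assms(1,2)])
      show "p \<cdot> (k' \<cdot> b) = p \<cdot> h" using b h assms zm_comp[OF b(1) O(1)] assoc by metis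
      show "q \<cdot> (k' \<cdot> b) = q \<cdot> h" using b h assms assoc by metis
    qed (use b h assms comp_hom in blast)+
    then show "\<exists>h' \<in> hom C W K. k' \<cdot> h' = h" using b by blast
  next
    fix W u v assume uv: "u \<in> hom C W K" "v \<in> hom C W K" "k' \<cdot> u = k' \<cdot> v"
    have "k \<cdot> u = k \<cdot> v" using uv assms(3,5) by (simp add: cs flip: assms(6))
    then show "u = v" using kernel_mono[OF assms(4) k] uv by metis
  qed
qed

text \<open>The identity also annihilates \<open>f\<close>, so it factors through \<open>c\<close>.
  Two later conclusions rest on this: a member of \<open>Q\<close> with zero kernel is invertible,
  and an object with zero torsion part is isomorphic to its torsion free quotient.\<close>

lemma cokernel_zero_iso:
  assumes "is_cokernel C c f" "f = zm C A B" "f \<in> hom C A B" "c \<in> hom C B D"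
  shows "is_iso C c"
proof -
  have O: "A \<in> Ob C" "B \<in> Ob C" "D \<in> Ob C" using assms hom_Ob1 hom_Ob2 by auto
  have "Id C B \<cdot> f = zm C A B" using assms id_left by metis
  then obtain h where h: "h \<in> hom C D B" "h \<cdot> c = Id C B"
    using cokernel_desc[OF assms(1,3,4) id_hom[OF O(2)]] by metis
  have "c \<cdot> h = Id C D"
    by (rule cokernel_epi[OF assms(1,4)]) (use h assms(4) O in \<open>simp_all add: cs\<close>)
  then show ?thesis using h assms isoI by metis
qed

end

section \<open>The arrow category\<close>

lemma arrow_cat_simps [simp]:
  "Ob (arrow_cat C) = Mor C"
  "Dom (arrow_cat C) (Square a b f f') = a"
  "Cod (arrow_cat C) (Square a b f f') = b"
  "Id (arrow_cat C) a = Square a a (Id C (Dom C a)) (Id C (Cod C a))"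
  "Cmp (arrow_cat C) (Square b' c g g') (Square a b f f') = Square a c (g \<cdot>\<^bsub>C\<^esub> f) (g' \<cdot>\<^bsub>C\<^esub> f')"
  by (simp_all add: arrow_cat_def)

lemma arr_hom_iff:
  "Square a b f f' \<in> hom (arrow_cat C) a' b' \<longleftrightarrow> a' = a \<and> b' = b \<and> a \<in> Mor C \<and> b \<in> Mor C \<and>
    f \<in> hom C (Dom C a) (Dom C b) \<and> f' \<in> hom C (Cod C a) (Cod C b) \<and> b \<cdot>\<^bsub>C\<^esub> f = f' \<cdot>\<^bsub>C\<^esub> a"
  by (auto simp: hom_def arrow_cat_def)

lemma arr_Mor_iff:
  "Square a b f f' \<in> Mor (arrow_cat C) \<longleftrightarrow> a \<in> Mor C \<and> b \<in> Mor C \<and>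
    f \<in> hom C (Dom C a) (Dom C b) \<and> f' \<in> hom C (Cod C a) (Cod C b) \<and> b \<cdot>\<^bsub>C\<^esub> f = f' \<cdot>\<^bsub>C\<^esub> a"
  by (auto simp: hom_def arrow_cat_def)

lemma arr_MorE:
  assumes "x \<in> Mor (arrow_cat C)"
  obtains a b f f' A A' B B' where "x = Square a b f f'" "a \<in> hom C A A'" "b \<in> hom C B B'"
    "f \<in> hom C A B" "f' \<in> hom C A' B'" "b \<cdot>\<^bsub>C\<^esub> f = f' \<cdot>\<^bsub>C\<^esub> a"
  using assms by (auto simp: hom_def arrow_cat_def)

lemma arr_homE:
  assumes "x \<in> hom (arrow_cat C) a b" "a \<in> hom C A A'" "b \<in> hom C B B'"
  obtains f f' where "x = Square a b f f'" "f \<in> hom C A B" "f' \<in> hom C A' B'" "b \<cdot>\<^bsub>C\<^esub> f = f' \<cdot>\<^bsub>C\<^esub> a"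
  using assms by (auto simp: hom_def arrow_cat_def)

lemma arr_homI:
  assumes "a \<in> hom C A A'" "b \<in> hom C B B'" "f \<in> hom C A B" "f' \<in> hom C A' B'" "b \<cdot>\<^bsub>C\<^esub> f = f' \<cdot>\<^bsub>C\<^esub> a"
  shows "Square a b f f' \<in> hom (arrow_cat C) a b"
  using assms by (auto simp: hom_def arrow_cat_def)

lemma arr_homD:
  assumes "Square a b f f' \<in> hom (arrow_cat C) a b" "a \<in> hom C A A'" "b \<in> hom C B B'"
  shows "f \<in> hom C A B" "f' \<in> hom C A' B'" "b \<cdot>\<^bsub>C\<^esub> f = f' \<cdot>\<^bsub>C\<^esub> a"
  using assms by (auto simp: hom_def arrow_cat_def)

lemma arr_hom_Ob:
  assumes "x \<in> hom (arrow_cat C) a b"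
  shows "a \<in> hom C (Dom C a) (Cod C a)" "b \<in> hom C (Dom C b) (Cod C b)"
  using assms by (auto simp: hom_def arrow_cat_def)

locale cell_cat_loc = cat_loc C for C :: "('o, 'm) cell_cat" (structure)
begin

lemma arr_category: "category (arrow_cat C)"
proof -
  have "Dom (arrow_cat C) x \<in> Mor C \<and> Cod (arrow_cat C) x \<in> Mor C" if "x \<in> Mor (arrow_cat C)" for x
    using that by (auto simp: arrow_cat_def)
  moreover have "Id (arrow_cat C) X \<in> hom (arrow_cat C) X X" if "X \<in> Mor C" for X
    using that hom_Ob1[OF Mor_hom[OF that]] hom_Ob2[OF Mor_hom[OF that]]
    by (simp add: arr_hom_iff id_hom id_left id_right Mor_hom) (metis Mor_hom id_left id_right)
  moreover have "y \<cdot>\<^bsub>arrow_cat C\<^esub> x \<in> hom (arrow_cat C) (Dom (arrow_cat C) x) (Cod (arrow_cat C) y)"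
    if xy: "x \<in> Mor (arrow_cat C)" "y \<in> Mor (arrow_cat C)" "Dom (arrow_cat C) y = Cod (arrow_cat C) x" for x y
  proof -
    obtain a b f f' A A' B B' where x: "x = Square a b f f'" "a \<in> hom C A A'" "b \<in> hom C B B'"
      "f \<in> hom C A B" "f' \<in> hom C A' B'" "b \<cdot> f = f' \<cdot> a" using arr_MorE[OF xy(1)] by metis
    obtain b' c g g' B0 B0' D D' where y: "y = Square b' c g g'" "b' \<in> hom C B0 B0'" "c \<in> hom C D D'"
      "g \<in> hom C B0 D" "g' \<in> hom C B0' D'" "c \<cdot> g = g' \<cdot> b'" using arr_MorE[OF xy(2)] by metis
    have "b' = b" using xy(3) x(1) y(1) by simp
    then have "Square a c (g \<cdot> f) (g' \<cdot> f') \<in> hom (arrow_cat C) a c"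
      using x y by (intro arr_homI[where A = A and A' = A' and B = D and B' = D'])
        (auto simp: cs cmp_eq[OF y(6)])
    then show ?thesis using x(1) y(1) by simp
  qed
  moreover have "x \<cdot>\<^bsub>arrow_cat C\<^esub> Id (arrow_cat C) (Dom (arrow_cat C) x) = x \<and>
      Id (arrow_cat C) (Cod (arrow_cat C) x) \<cdot>\<^bsub>arrow_cat C\<^esub> x = x" if "x \<in> Mor (arrow_cat C)" for x
    by (rule arr_MorE[OF that]) (simp add: cs)
  moreover have "z \<cdot>\<^bsub>arrow_cat C\<^esub> (y \<cdot>\<^bsub>arrow_cat C\<^esub> x) = z \<cdot>\<^bsub>arrow_cat C\<^esub> y \<cdot>\<^bsub>arrow_cat C\<^esub> x"
    if "x \<in> Mor (arrow_cat C)" "y \<in> Mor (arrow_cat C)" "z \<in> Mor (arrow_cat C)"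
      "Dom (arrow_cat C) y = Cod (arrow_cat C) x" "Dom (arrow_cat C) z = Cod (arrow_cat C) y" for x y z
    using that
    by (elim arr_MorE) (auto simp: cs)
  ultimately show ?thesis unfolding category_def by simp
qed

sublocale arr: cat_loc "arrow_cat C"
  by unfold_locales (rule arr_category)

lemma arr_isoI:
  assumes "Square a b f f' \<in> hom (arrow_cat C) a b" "is_iso C f" "is_iso C f'"
  shows "is_iso (arrow_cat C) (Square a b f f')"
proof -
  obtain A A' B B' where h: "a \<in> hom C A A'" "b \<in> hom C B B'" "f \<in> hom C A B" "f' \<in> hom C A' B'"
    "b \<cdot> f = f' \<cdot> a" by (rule that[OF arr_hom_Ob[OF assms(1)] arr_homD[OF assms(1) arr_hom_Ob[OF assms(1)]]])
  obtain g where g: "g \<in> hom C B A" "g \<cdot> f = Id C A" "f \<cdot> g = Id C B" using isoE[OF assms(2) h(3)] .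
  obtain g' where g': "g' \<in> hom C B' A'" "g' \<cdot> f' = Id C A'" "f' \<cdot> g' = Id C B'" using isoE[OF assms(3) h(4)] .
  have "a \<cdot> g = g' \<cdot> (f' \<cdot> a) \<cdot> g" using h(1,4) g(1) g' by (simp add: cs cmp_eq[OF g'(2)])
  also have "\<dots> = g' \<cdot> (b \<cdot> f) \<cdot> g" using h(5) by simp
  also have "\<dots> = g' \<cdot> b" using h(1-4) g g' by (simp add: cs)
  finally have "Square b a g g' \<in> hom (arrow_cat C) b a" using h g g' by (intro arr_homI) auto
  then show ?thesis using assms(1) g g' h by (intro arr.isoI) (auto simp: homD)
qed

lemma arr_isoD:
  assumes "is_iso (arrow_cat C) (Square a b f f')"
  shows "is_iso C f" "is_iso C f'"
proof -
  have x: "Square a b f f' \<in> hom (arrow_cat C) a b"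
    using assms by (auto simp: is_iso_def hom_def)
  obtain A A' B B' where h: "a \<in> hom C A A'" "b \<in> hom C B B'" "f \<in> hom C A B" "f' \<in> hom C A' B'"
    "b \<cdot> f = f' \<cdot> a" by (rule that[OF arr_hom_Ob[OF x] arr_homD[OF x arr_hom_Ob[OF x]]])
  obtain y where y: "y \<in> hom (arrow_cat C) b a" "y \<cdot>\<^bsub>arrow_cat C\<^esub> Square a b f f' = Id (arrow_cat C) a"
    "Square a b f f' \<cdot>\<^bsub>arrow_cat C\<^esub> y = Id (arrow_cat C) b"
    using arr.isoE[OF assms x] .
  obtain g g' where g: "y = Square b a g g'" "g \<in> hom C B A" "g' \<in> hom C B' A'" "a \<cdot> g = g' \<cdot> b"
    using arr_homE[OF y(1) h(2,1)] by metis
  have "g \<cdot> f = Id C A" "g' \<cdot> f' = Id C A'" "f \<cdot> g = Id C B" "f' \<cdot> g' = Id C B'"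
    using y(2,3) g(1) h by (simp_all add: homD)
  then show "is_iso C f" "is_iso C f'" using isoI h g by blast+
qed

text \<open>Morphisms from the identity of \<open>W\<close> to \<open>a\<close> are the
  \<open>W\<close>-elements of the domain of \<open>a\<close>, carried along to its codomain.
  Testing a universal property on them extracts its domain half.\<close>

lemma arr_el1:
  assumes "m \<in> hom C W A" "a \<in> hom C A A'"
  shows "Square (Id C W) a m (a \<cdot> m) \<in> hom (arrow_cat C) (Id C W) a" "Id C W \<in> hom C W W"
proof -
  show i: "Id C W \<in> hom C W W" using id_hom hom_Ob1[OF assms(1)] .
  show "Square (Id C W) a m (a \<cdot> m) \<in> hom (arrow_cat C) (Id C W) a"
    by (rule arr_homI[OF i assms(2,1) comp_hom[OF assms(2,1)]])
      (simp add: id_right[OF comp_hom[OF assms(2,1)]])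
qed

end

locale cell_pt_cat = pt_cat C + cell_cat_loc C for C :: "('o, 'm) cell_cat" (structure)
begin

lemma arr_zero_ob:
  assumes "is_zero_ob C Z"
  shows "is_zero_ob (arrow_cat C) (Id C Z)"
proof -
  have Z: "Z \<in> Ob C" using zero_ob_Ob[OF assms] .
  have i: "Id C Z \<in> hom C Z Z" using id_hom[OF Z] .
  have "\<exists>!x. x \<in> hom (arrow_cat C) a (Id C Z)" if "a \<in> Mor C" for a
  proof -
    have a: "a \<in> hom C (Dom C a) (Cod C a)" using Mor_hom[OF that] .
    note O = hom_Ob1[OF a] hom_Ob2[OF a]
    note z = zm_hom[OF O(1) Z] zm_hom[OF O(2) Z]
    have "Square a (Id C Z) (zm C (Dom C a) Z) (zm C (Cod C a) Z) \<in> hom (arrow_cat C) a (Id C Z)"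
      using a i z by (intro arr_homI) (auto simp: id_left zm_comp[OF a Z])
    moreover have "x = Square a (Id C Z) (zm C (Dom C a) Z) (zm C (Cod C a) Z)"
      if "x \<in> hom (arrow_cat C) a (Id C Z)" for x
      using arr_homE[OF that a i] zm_to_zero[OF assms] by metis
    ultimately show ?thesis by blast
  qed
  moreover have "\<exists>!x. x \<in> hom (arrow_cat C) (Id C Z) a" if "a \<in> Mor C" for a
  proof -
    have a: "a \<in> hom C (Dom C a) (Cod C a)" using Mor_hom[OF that] .
    note O = hom_Ob1[OF a] hom_Ob2[OF a]
    note z = zm_hom[OF Z O(1)] zm_hom[OF Z O(2)]
    have "Square (Id C Z) a (zm C Z (Dom C a)) (zm C Z (Cod C a)) \<in> hom (arrow_cat C) (Id C Z) a"
      using a i z by (intro arr_homI) (auto simp: id_right comp_zm[OF a Z])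
    moreover have "x = Square (Id C Z) a (zm C Z (Dom C a)) (zm C Z (Cod C a))"
      if "x \<in> hom (arrow_cat C) (Id C Z) a" for x
      using arr_homE[OF that i a] zm_from_zero[OF assms] by metis
    ultimately show ?thesis by blast
  qed
  ultimately show ?thesis
    unfolding is_zero_ob_def is_terminal_def using i by (auto simp: homD)
qed

sublocale arr: pt_cat "arrow_cat C"
  by unfold_locales (use zero_obE arr_zero_ob in \<open>metis pointed_def\<close>)

lemma arr_zm:
  assumes "a \<in> hom C A A'" "b \<in> hom C B B'"
  shows "zm (arrow_cat C) a b = Square a b (zm C A B) (zm C A' B')"
proof -
  obtain Z where Z: "is_zero_ob C Z" "Z \<in> Ob C" using zero_obE .
  have i: "Id C Z \<in> hom C Z Z" using id_hom[OF Z(2)] .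
  have ab: "a \<in> Mor C" "b \<in> Mor C" using assms by (auto simp: hom_def)
  note O = hom_Ob1[OF assms(1)] hom_Ob2[OF assms(1)] hom_Ob1[OF assms(2)] hom_Ob2[OF assms(2)]
  let ?x = "zm (arrow_cat C) a (Id C Z)" and ?y = "zm (arrow_cat C) (Id C Z) b"
  have xh: "?x \<in> hom (arrow_cat C) a (Id C Z)" "?y \<in> hom (arrow_cat C) (Id C Z) b"
    using arr.zm_hom ab i by (auto simp: homD)
  obtain f f' where f: "?x = Square a (Id C Z) f f'" "f \<in> hom C A Z" "f' \<in> hom C A' Z"
    using arr_homE[OF xh(1) assms(1) i] by metis
  obtain g g' where g: "?y = Square (Id C Z) b g g'" "g \<in> hom C Z B" "g' \<in> hom C Z B'"
    using arr_homE[OF xh(2) i assms(2)] by metis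
  have "zm (arrow_cat C) a b = ?y \<cdot>\<^bsub>arrow_cat C\<^esub> ?x"
    using arr.comp_zm[OF xh(2)] ab by simp
  moreover have "g \<cdot> f = zm C A B" "g' \<cdot> f' = zm C A' B'"
    using zm_to_zero[OF Z(1) f(2)] zm_to_zero[OF Z(1) f(3)] comp_zm g O by auto
  ultimately show ?thesis using f g by simp
qed

text \<open>Morphisms from the arrow \<open>zm C Z W\<close> to \<open>a\<close> are the
  \<open>W\<close>-elements of the codomain of \<open>a\<close>, because the component starting at
  the zero object is forced. They isolate the codomain half of a universal property.\<close>

lemma arr_el2:
  assumes "m \<in> hom C W A'" "a \<in> hom C A A'" "is_zero_ob C Z"
  shows "Square (zm C Z W) a (zm C Z A) m \<in> hom (arrow_cat C) (zm C Z W) a" "zm C Z W \<in> hom C Z W"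
proof -
  note O = hom_Ob1[OF assms(1)] hom_Ob1[OF assms(2)] hom_Ob2[OF assms(2)] zero_ob_Ob[OF assms(3)]
  show 1: "zm C Z W \<in> hom C Z W" using O zm_hom by blast
  show "Square (zm C Z W) a (zm C Z A) m \<in> hom (arrow_cat C) (zm C Z W) a"
    using assms 1 O zm_hom by (intro arr_homI) (auto simp: comp_zm)
qed

lemma arr_kernelI:
  assumes "k \<in> hom C K K'" "a \<in> hom C A A'" "b \<in> hom C B B'"
    and "Square k a u u' \<in> hom (arrow_cat C) k a" "Square a b f f' \<in> hom (arrow_cat C) a b"
    and "is_kernel C u f" "is_kernel C u' f'"
  shows "is_kernel (arrow_cat C) (Square k a u u') (Square a b f f')"
proof -
  have u: "u \<in> hom C K A" "u' \<in> hom C K' A'" "a \<cdot> u = u' \<cdot> k"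
    using assms(1,2,4) by (blast intro: arr_homD)+
  have f: "f \<in> hom C A B" "f' \<in> hom C A' B'" "b \<cdot> f = f' \<cdot> a"
    using assms(2,3,5) by (blast intro: arr_homD)+
  show ?thesis
  proof (rule arr.kernelI[OF assms(4,5)])
    show "Square a b f f' \<cdot>\<^bsub>arrow_cat C\<^esub> Square k a u u' = zm (arrow_cat C) k b"
      using arr_zm[OF assms(1,3)] kernel_zero[OF assms(6) u(1) f(1)] kernel_zero[OF assms(7) u(2) f(2)] by simp
  next
    fix w x assume x: "x \<in> hom (arrow_cat C) w a" "Square a b f f' \<cdot>\<^bsub>arrow_cat C\<^esub> x = zm (arrow_cat C) w b"
    obtain W W' where w: "w \<in> hom C W W'" using arr_hom_Ob(1)[OF x(1)] by blast
    obtain g g' where g: "x = Square w a g g'" "g \<in> hom C W A" "g' \<in> hom C W' A'" "a \<cdot> g = g' \<cdot> w"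
      using arr_homE[OF x(1) w assms(2)] by metis
    have z: "f \<cdot> g = zm C W B" "f' \<cdot> g' = zm C W' B'" using x(2) g(1) arr_zm[OF w assms(3)] by auto
    obtain h where h: "h \<in> hom C W K" "u \<cdot> h = g" using kernel_lift[OF assms(6) u(1) f(1) g(2) z(1)] .
    obtain h' where h': "h' \<in> hom C W' K'" "u' \<cdot> h' = g'" using kernel_lift[OF assms(7) u(2) f(2) g(3) z(2)] .
    have "k \<cdot> h = h' \<cdot> w"
    proof (rule kernel_mono[OF assms(7) u(2)])
      have "u' \<cdot> (k \<cdot> h) = a \<cdot> (u \<cdot> h)" using u h(1) assms(1,2) by (simp add: cs cmp_eq[OF u(3)])
      also have "\<dots> = u' \<cdot> (h' \<cdot> w)" using h h' g u w by (simp add: cs cmp_eq[OF h'(2)])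
      finally show "u' \<cdot> (k \<cdot> h) = u' \<cdot> (h' \<cdot> w)" .
    qed (use h h' w assms(1) comp_hom in blast)+
    then have "Square w k h h' \<in> hom (arrow_cat C) w k" using w assms(1) h h' by (intro arr_homI) auto
    then show "\<exists>h\<in>hom (arrow_cat C) w k. Square k a u u' \<cdot>\<^bsub>arrow_cat C\<^esub> h = x"
      using g(1) h(2) h'(2) by (intro bexI) auto
  next
    fix w x y assume xy: "x \<in> hom (arrow_cat C) w k" "y \<in> hom (arrow_cat C) w k"
      "Square k a u u' \<cdot>\<^bsub>arrow_cat C\<^esub> x = Square k a u u' \<cdot>\<^bsub>arrow_cat C\<^esub> y"
    obtain W W' where w: "w \<in> hom C W W'" using arr_hom_Ob(1)[OF xy(1)] by blast
    obtain g g' where g: "x = Square w k g g'" "g \<in> hom C W K" "g' \<in> hom C W' K'"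
      using arr_homE[OF xy(1) w assms(1)] by metis
    obtain h h' where h: "y = Square w k h h'" "h \<in> hom C W K" "h' \<in> hom C W' K'"
      using arr_homE[OF xy(2) w assms(1)] by metis
    show "x = y" using kernel_mono[OF assms(6) u(1) g(2) h(2)] kernel_mono[OF assms(7) u(2) g(3) h(3)] xy(3) g(1) h(1)
      by simp
  qed
qed

text \<open>The universal property at the domain is tested on arrows from \<open>arr_el1\<close>,
  the one at the codomain on arrows from \<open>arr_el2\<close>. The same division serves
  \<open>arr_pullbackD\<close>.\<close>

lemma arr_kernelD:
  assumes "is_kernel (arrow_cat C) (Square k a u u') (Square a b f f')"
  shows "is_kernel C u f" "is_kernel C u' f'"
proof -
  have x: "Square k a u u' \<in> hom (arrow_cat C) k a" "Square a b f f' \<in> hom (arrow_cat C) a b"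
    using arr.kernelE[OF assms] by (metis arr_hom_iff)+
  obtain K K' A A' B B' where h: "k \<in> hom C K K'" "a \<in> hom C A A'" "b \<in> hom C B B'"
    using arr_hom_Ob x by metis
  have u: "u \<in> hom C K A" "u' \<in> hom C K' A'" "a \<cdot> u = u' \<cdot> k"
    using h x by (blast intro: arr_homD)+
  have f: "f \<in> hom C A B" "f' \<in> hom C A' B'" "b \<cdot> f = f' \<cdot> a"
    using h x by (blast intro: arr_homD)+
  have z: "f \<cdot> u = zm C K B" "f' \<cdot> u' = zm C K' B'"
    using arr.kernel_zero[OF assms x] arr_zm[OF h(1,3)] by auto
  show "is_kernel C u f"
  proof (rule kernelI[OF u(1) f(1) z(1)])
    fix W g assume g: "g \<in> hom C W A" "f \<cdot> g = zm C W B"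
    note e = arr_el1[OF g(1) h(2)]
    have "f' \<cdot> (a \<cdot> g) = b \<cdot> (f \<cdot> g)" using g(1) f h by (simp add: cs cmp_eq[OF f(3)])
    then have "f' \<cdot> (a \<cdot> g) = zm C W B'" using g comp_zm[OF h(3) hom_Ob1[OF g(1)]] by simp
    then have "Square a b f f' \<cdot>\<^bsub>arrow_cat C\<^esub> Square (Id C W) a g (a \<cdot> g) = zm (arrow_cat C) (Id C W) b"
      using arr_zm[OF e(2) h(3)] g by simp
    then obtain y where y: "y \<in> hom (arrow_cat C) (Id C W) k" "Square k a u u' \<cdot>\<^bsub>arrow_cat C\<^esub> y = Square (Id C W) a g (a \<cdot> g)"
      using arr.kernel_lift[OF assms x e(1)] by metis
    then show "\<exists>h\<in>hom C W K. u \<cdot> h = g"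
      using arr_homE[OF y(1) e(2) h(1)] by (metis arrow_cat_simps(5) cell.inject(3))
  next
    fix W g g' assume g: "g \<in> hom C W K" "g' \<in> hom C W K" "u \<cdot> g = u \<cdot> g'"
    have "u' \<cdot> (k \<cdot> g) = u' \<cdot> (k \<cdot> g')"
    proof -
      have "u' \<cdot> (k \<cdot> g) = a \<cdot> (u \<cdot> g)" using u g(1) h by (simp add: cs cmp_eq[OF u(3)])
      also have "\<dots> = a \<cdot> (u \<cdot> g')" using g(3) by simp
      also have "\<dots> = u' \<cdot> (k \<cdot> g')" using u g(2) h by (simp add: cs cmp_eq[OF u(3)])
      finally show ?thesis .
    qed
    then have "Square (Id C W) k g (k \<cdot> g) = Square (Id C W) k g' (k \<cdot> g')"
      using arr.kernel_mono[OF assms x(1) arr_el1(1)[OF g(1) h(1)] arr_el1(1)[OF g(2) h(1)]] g(3) by simp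
    then show "g = g'" by simp
  qed
  obtain Z where Z: "is_zero_ob C Z" "Z \<in> Ob C" using zero_obE .
  show "is_kernel C u' f'"
  proof (rule kernelI[OF u(2) f(2) z(2)])
    fix W g assume g: "g \<in> hom C W A'" "f' \<cdot> g = zm C W B'"
    note e = arr_el2[OF g(1) h(2) Z(1)]
    have "Square a b f f' \<cdot>\<^bsub>arrow_cat C\<^esub> Square (zm C Z W) a (zm C Z A) g = zm (arrow_cat C) (zm C Z W) b"
      using arr_zm[OF e(2) h(3)] g comp_zm[OF f(1) Z(2)] by simp
    then obtain y where y: "y \<in> hom (arrow_cat C) (zm C Z W) k"
      "Square k a u u' \<cdot>\<^bsub>arrow_cat C\<^esub> y = Square (zm C Z W) a (zm C Z A) g"
      using arr.kernel_lift[OF assms x e(1)] by metis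
    then show "\<exists>h\<in>hom C W K'. u' \<cdot> h = g"
      using arr_homE[OF y(1) e(2) h(1)] by (metis arrow_cat_simps(5) cell.inject(3))
  next
    fix W g g' assume g: "g \<in> hom C W K'" "g' \<in> hom C W K'" "u' \<cdot> g = u' \<cdot> g'"
    have "Square (zm C Z W) k (zm C Z K) g = Square (zm C Z W) k (zm C Z K) g'"
      using arr.kernel_mono[OF assms x(1) arr_el2(1)[OF g(1) h(1) Z(1)] arr_el2(1)[OF g(2) h(1) Z(1)]] g(3) by simp
    then show "g = g'" by simp
  qed
qed

lemma arr_pullbackI:
  assumes "p0 \<in> hom C P P'" "x \<in> hom C X X'" "y \<in> hom C Y Y'" "z \<in> hom C Z Z'"
    and "Square x z f f' \<in> hom (arrow_cat C) x z" "Square y z g g' \<in> hom (arrow_cat C) y z"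
    and "Square p0 x p p' \<in> hom (arrow_cat C) p0 x" "Square p0 y q q' \<in> hom (arrow_cat C) p0 y"
    and "is_pullback C f g p q" "is_pullback C f' g' p' q'"
  shows "is_pullback (arrow_cat C) (Square x z f f') (Square y z g g') (Square p0 x p p') (Square p0 y q q')"
proof -
  have f: "f \<in> hom C X Z" "f' \<in> hom C X' Z'" "z \<cdot> f = f' \<cdot> x"
    using assms(2,4,5) by (blast intro: arr_homD)+
  have g: "g \<in> hom C Y Z" "g' \<in> hom C Y' Z'" "z \<cdot> g = g' \<cdot> y"
    using assms(3,4,6) by (blast intro: arr_homD)+
  have p: "p \<in> hom C P X" "p' \<in> hom C P' X'" "x \<cdot> p = p' \<cdot> p0"
    using assms(1,2,7) by (blast intro: arr_homD)+
  have q: "q \<in> hom C P Y" "q' \<in> hom C P' Y'" "y \<cdot> q = q' \<cdot> p0"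
    using assms(1,3,8) by (blast intro: arr_homD)+
  show ?thesis
  proof (rule arr.pullbackI[OF assms(5-8)])
    show "Square x z f f' \<cdot>\<^bsub>arrow_cat C\<^esub> Square p0 x p p' = Square y z g g' \<cdot>\<^bsub>arrow_cat C\<^esub> Square p0 y q q'"
      using pullback_comm[OF assms(9)] pullback_comm[OF assms(10)] by simp
  next
    fix w s t assume st: "s \<in> hom (arrow_cat C) w x" "t \<in> hom (arrow_cat C) w y"
      "Square x z f f' \<cdot>\<^bsub>arrow_cat C\<^esub> s = Square y z g g' \<cdot>\<^bsub>arrow_cat C\<^esub> t"
    obtain W W' where w: "w \<in> hom C W W'" using arr_hom_Ob(1)[OF st(1)] by blast
    obtain u u' where u: "s = Square w x u u'" "u \<in> hom C W X" "u' \<in> hom C W' X'" "x \<cdot> u = u' \<cdot> w"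
      using arr_homE[OF st(1) w assms(2)] by metis
    obtain v v' where v: "t = Square w y v v'" "v \<in> hom C W Y" "v' \<in> hom C W' Y'" "y \<cdot> v = v' \<cdot> w"
      using arr_homE[OF st(2) w assms(3)] by metis
    have e: "f \<cdot> u = g \<cdot> v" "f' \<cdot> u' = g' \<cdot> v'" using st(3) u(1) v(1) by auto
    obtain h where h: "h \<in> hom C W P" "p \<cdot> h = u" "q \<cdot> h = v"
      using pullback_lift[OF assms(9) f(1) g(1) p(1) u(2) v(2) e(1)] .
    obtain h' where h': "h' \<in> hom C W' P'" "p' \<cdot> h' = u'" "q' \<cdot> h' = v'"
      using pullback_lift[OF assms(10) f(2) g(2) p(2) u(3) v(3) e(2)] .
    have "p0 \<cdot> h = h' \<cdot> w"
    proof (rule pullback_unique[OF assms(10) p(2)])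
      have "p' \<cdot> (p0 \<cdot> h) = x \<cdot> (p \<cdot> h)" using p h(1) assms(1,2) by (simp add: cs cmp_eq[OF p(3)])
      also have "\<dots> = p' \<cdot> (h' \<cdot> w)" using h h' u p w by (simp add: cs cmp_eq[OF h'(2)])
      finally show "p' \<cdot> (p0 \<cdot> h) = p' \<cdot> (h' \<cdot> w)" .
      have "q' \<cdot> (p0 \<cdot> h) = y \<cdot> (q \<cdot> h)" using q h(1) assms(1,3) by (simp add: cs cmp_eq[OF q(3)])
      also have "\<dots> = q' \<cdot> (h' \<cdot> w)" using h h' v q w by (simp add: cs cmp_eq[OF h'(3)])
      finally show "q' \<cdot> (p0 \<cdot> h) = q' \<cdot> (h' \<cdot> w)" .
    qed (use h h' w assms(1) comp_hom in blast)+
    then have "Square w p0 h h' \<in> hom (arrow_cat C) w p0" using w assms(1) h h' by (intro arr_homI) auto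
    then show "\<exists>h\<in>hom (arrow_cat C) w p0. Square p0 x p p' \<cdot>\<^bsub>arrow_cat C\<^esub> h = s \<and> Square p0 y q q' \<cdot>\<^bsub>arrow_cat C\<^esub> h = t"
      using u(1) v(1) h h' by (intro bexI) auto
  next
    fix w s t assume st: "s \<in> hom (arrow_cat C) w p0" "t \<in> hom (arrow_cat C) w p0"
      "Square p0 x p p' \<cdot>\<^bsub>arrow_cat C\<^esub> s = Square p0 x p p' \<cdot>\<^bsub>arrow_cat C\<^esub> t"
      "Square p0 y q q' \<cdot>\<^bsub>arrow_cat C\<^esub> s = Square p0 y q q' \<cdot>\<^bsub>arrow_cat C\<^esub> t"
    obtain W W' where w: "w \<in> hom C W W'" using arr_hom_Ob(1)[OF st(1)] by blast
    obtain u u' where u: "s = Square w p0 u u'" "u \<in> hom C W P" "u' \<in> hom C W' P'"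
      using arr_homE[OF st(1) w assms(1)] by metis
    obtain v v' where v: "t = Square w p0 v v'" "v \<in> hom C W P" "v' \<in> hom C W' P'"
      using arr_homE[OF st(2) w assms(1)] by metis
    show "s = t"
      using pullback_unique[OF assms(9) p(1) u(2) v(2)] pullback_unique[OF assms(10) p(2) u(3) v(3)]
        st(3,4) u(1) v(1) by simp
  qed
qed

lemma arr_pullbackD:
  assumes "is_pullback (arrow_cat C) (Square x z f f') (Square y z g g') (Square p0 x p p') (Square p0 y q q')"
  shows "is_pullback C f g p q" "is_pullback C f' g' p' q'"
proof -
  have m: "Square x z f f' \<in> hom (arrow_cat C) x z" "Square y z g g' \<in> hom (arrow_cat C) y z"
    "Square p0 x p p' \<in> hom (arrow_cat C) p0 x" "Square p0 y q q' \<in> hom (arrow_cat C) p0 y"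
    using assms by (auto simp: is_pullback_def hom_def)
  obtain P P' X X' Y Y' Z Z' where h: "p0 \<in> hom C P P'" "x \<in> hom C X X'" "y \<in> hom C Y Y'" "z \<in> hom C Z Z'"
    using arr_hom_Ob[OF m(1)] arr_hom_Ob[OF m(4)] by metis
  have f: "f \<in> hom C X Z" "f' \<in> hom C X' Z'" "z \<cdot> f = f' \<cdot> x"
    using h m by (blast intro: arr_homD)+
  have g: "g \<in> hom C Y Z" "g' \<in> hom C Y' Z'" "z \<cdot> g = g' \<cdot> y"
    using h m by (blast intro: arr_homD)+
  have p: "p \<in> hom C P X" "p' \<in> hom C P' X'" "x \<cdot> p = p' \<cdot> p0"
    using h m by (blast intro: arr_homD)+
  have q: "q \<in> hom C P Y" "q' \<in> hom C P' Y'" "y \<cdot> q = q' \<cdot> p0"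
    using h m by (blast intro: arr_homD)+
  have c: "f \<cdot> p = g \<cdot> q" "f' \<cdot> p' = g' \<cdot> q'" using arr.pullback_comm[OF assms] by auto
  obtain N where N: "is_zero_ob C N" "N \<in> Ob C" using zero_obE .
  show "is_pullback C f g p q"
  proof (rule pullbackI[OF f(1) g(1) p(1) q(1) c(1)])
    fix W u v assume uv: "u \<in> hom C W X" "v \<in> hom C W Y" "f \<cdot> u = g \<cdot> v"
    note eu = arr_el1[OF uv(1) h(2)] and ev = arr_el1[OF uv(2) h(3)]
    have "f' \<cdot> (x \<cdot> u) = z \<cdot> (f \<cdot> u)" using uv(1) f h by (simp add: cs cmp_eq[OF f(3)])
    also have "\<dots> = g' \<cdot> (y \<cdot> v)" using uv g h by (simp add: cs cmp_eq[OF g(3)])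
    finally have e: "f' \<cdot> (x \<cdot> u) = g' \<cdot> (y \<cdot> v)" .
    obtain t where t: "t \<in> hom (arrow_cat C) (Id C W) p0"
        "Square p0 x p p' \<cdot>\<^bsub>arrow_cat C\<^esub> t = Square (Id C W) x u (x \<cdot> u)"
        "Square p0 y q q' \<cdot>\<^bsub>arrow_cat C\<^esub> t = Square (Id C W) y v (y \<cdot> v)"
      using arr.pullback_lift[OF assms m(1-3) eu(1) ev(1)] e uv(3) by auto
    obtain a a' where "t = Square (Id C W) p0 a a'" "a \<in> hom C W P"
      using arr_homE[OF t(1) eu(2) h(1)] by metis
    then show "\<exists>h\<in>hom C W P. p \<cdot> h = u \<and> q \<cdot> h = v" using t(2,3) by auto
  next
    fix W u v assume uv: "u \<in> hom C W P" "v \<in> hom C W P" "p \<cdot> u = p \<cdot> v" "q \<cdot> u = q \<cdot> v"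
    have e: "p' \<cdot> (p0 \<cdot> u) = x \<cdot> (p \<cdot> u)" "q' \<cdot> (p0 \<cdot> u) = y \<cdot> (q \<cdot> u)" if "u \<in> hom C W P" for u
      using that p q h by (simp_all add: cs cmp_eq[OF p(3)] cmp_eq[OF q(3)])
    have "Square (Id C W) p0 u (p0 \<cdot> u) = Square (Id C W) p0 v (p0 \<cdot> v)"
      by (rule arr.pullback_unique[OF assms m(3) arr_el1(1)[OF uv(1) h(1)] arr_el1(1)[OF uv(2) h(1)]])
        (use uv(3,4) e[OF uv(1)] e[OF uv(2)] in simp_all)
    then show "u = v" by simp
  qed
  show "is_pullback C f' g' p' q'"
  proof (rule pullbackI[OF f(2) g(2) p(2) q(2) c(2)])
    fix W u v assume uv: "u \<in> hom C W X'" "v \<in> hom C W Y'" "f' \<cdot> u = g' \<cdot> v"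
    note eu = arr_el2[OF uv(1) h(2) N(1)] and ev = arr_el2[OF uv(2) h(3) N(1)]
    have e: "f \<cdot> zm C N X = g \<cdot> zm C N Y" using comp_zm[OF f(1) N(2)] comp_zm[OF g(1) N(2)] by simp
    obtain t where t: "t \<in> hom (arrow_cat C) (zm C N W) p0"
        "Square p0 x p p' \<cdot>\<^bsub>arrow_cat C\<^esub> t = Square (zm C N W) x (zm C N X) u"
        "Square p0 y q q' \<cdot>\<^bsub>arrow_cat C\<^esub> t = Square (zm C N W) y (zm C N Y) v"
      using arr.pullback_lift[OF assms m(1-3) eu(1) ev(1)] e uv(3) by auto
    obtain a a' where "t = Square (zm C N W) p0 a a'" "a' \<in> hom C W P'"
      using arr_homE[OF t(1) eu(2) h(1)] by metis
    then show "\<exists>h\<in>hom C W P'. p' \<cdot> h = u \<and> q' \<cdot> h = v" using t(2,3) by auto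
  next
    fix W u v assume uv: "u \<in> hom C W P'" "v \<in> hom C W P'" "p' \<cdot> u = p' \<cdot> v" "q' \<cdot> u = q' \<cdot> v"
    have "Square (zm C N W) p0 (zm C N P) u = Square (zm C N W) p0 (zm C N P) v"
      by (rule arr.pullback_unique[OF assms m(3) arr_el2(1)[OF uv(1) h(1) N(1)] arr_el2(1)[OF uv(2) h(1) N(1)]])
        (use uv(3,4) in simp_all)
    then show "u = v" by simp
  qed
qed

lemma arr_cokernelI:
  assumes "a \<in> hom C A A'" "b \<in> hom C B B'" "d \<in> hom C D D'"
    and "Square a b f f' \<in> hom (arrow_cat C) a b" "Square b d c c' \<in> hom (arrow_cat C) b d"
    and "is_cokernel C c f" "is_cokernel C c' f'"
  shows "is_cokernel (arrow_cat C) (Square b d c c') (Square a b f f')"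
proof -
  have f: "f \<in> hom C A B" "f' \<in> hom C A' B'" "b \<cdot> f = f' \<cdot> a"
    using assms(1-4) by (blast intro: arr_homD)+
  have c: "c \<in> hom C B D" "c' \<in> hom C B' D'" "d \<cdot> c = c' \<cdot> b"
    using assms(1-5) by (blast intro: arr_homD)+
  show ?thesis
  proof (rule arr.cokernelI[OF assms(5,4)])
    show "Square b d c c' \<cdot>\<^bsub>arrow_cat C\<^esub> Square a b f f' = zm (arrow_cat C) a d"
      using arr_zm[OF assms(1,3)] cokernel_zero[OF assms(6) f(1) c(1)] cokernel_zero[OF assms(7) f(2) c(2)] by simp
  next
    fix w x assume x: "x \<in> hom (arrow_cat C) b w" "x \<cdot>\<^bsub>arrow_cat C\<^esub> Square a b f f' = zm (arrow_cat C) a w"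
    obtain W W' where w: "w \<in> hom C W W'" using arr_hom_Ob(2)[OF x(1)] by blast
    obtain g g' where g: "x = Square b w g g'" "g \<in> hom C B W" "g' \<in> hom C B' W'" "w \<cdot> g = g' \<cdot> b"
      using arr_homE[OF x(1) assms(2) w] by metis
    have z: "g \<cdot> f = zm C A W" "g' \<cdot> f' = zm C A' W'" using x(2) g(1) arr_zm[OF assms(1) w] by auto
    obtain h where h: "h \<in> hom C D W" "h \<cdot> c = g" using cokernel_desc[OF assms(6) f(1) c(1) g(2) z(1)] .
    obtain h' where h': "h' \<in> hom C D' W'" "h' \<cdot> c' = g'" using cokernel_desc[OF assms(7) f(2) c(2) g(3) z(2)] .
    have "w \<cdot> h = h' \<cdot> d"
    proof (rule cokernel_epi[OF assms(6) c(1)])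
      have "(w \<cdot> h) \<cdot> c = (h' \<cdot> c') \<cdot> b" using g h h' w c by (simp add: cs)
      also have "\<dots> = (h' \<cdot> d) \<cdot> c" using h'(1) c assms(2,3) by (simp add: cs)
      finally show "(w \<cdot> h) \<cdot> c = (h' \<cdot> d) \<cdot> c" .
    qed (use h h' w assms(3) comp_hom in blast)+
    then have "Square d w h h' \<in> hom (arrow_cat C) d w" using w assms(3) h h' by (intro arr_homI) auto
    then show "\<exists>h\<in>hom (arrow_cat C) d w. h \<cdot>\<^bsub>arrow_cat C\<^esub> Square b d c c' = x"
      using g(1) h(2) h'(2) by (intro bexI) auto
  next
    fix w x y assume xy: "x \<in> hom (arrow_cat C) d w" "y \<in> hom (arrow_cat C) d w"
      "x \<cdot>\<^bsub>arrow_cat C\<^esub> Square b d c c' = y \<cdot>\<^bsub>arrow_cat C\<^esub> Square b d c c'"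
    obtain W W' where w: "w \<in> hom C W W'" using arr_hom_Ob(2)[OF xy(1)] by blast
    obtain g g' where g: "x = Square d w g g'" "g \<in> hom C D W" "g' \<in> hom C D' W'"
      using arr_homE[OF xy(1) assms(3) w] by metis
    obtain h h' where h: "y = Square d w h h'" "h \<in> hom C D W" "h' \<in> hom C D' W'"
      using arr_homE[OF xy(2) assms(3) w] by metis
    show "x = y" using cokernel_epi[OF assms(6) c(1) g(2) h(2)] cokernel_epi[OF assms(7) c(2) g(3) h(3)] xy(3) g(1) h(1)
      by simp
  qed
qed

lemma arr_pullback_ex:
  assumes "x \<in> hom C X X'" "y \<in> hom C Y Y'" "z \<in> hom C Z Z'"
    and "Square x z f f' \<in> hom (arrow_cat C) x z" "Square y z g g' \<in> hom (arrow_cat C) y z"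
    and "is_pullback C f g p q" "is_pullback C f' g' p' q'" "p \<in> hom C P X" "p' \<in> hom C P' X'"
  obtains p0 where "p0 \<in> hom C P P'" "Square p0 x p p' \<in> hom (arrow_cat C) p0 x"
    "Square p0 y q q' \<in> hom (arrow_cat C) p0 y"
    "is_pullback (arrow_cat C) (Square x z f f') (Square y z g g') (Square p0 x p p') (Square p0 y q q')"
proof -
  have f: "f \<in> hom C X Z" "f' \<in> hom C X' Z'" "z \<cdot> f = f' \<cdot> x"
    using assms(1,3,4) by (blast intro: arr_homD)+
  have g: "g \<in> hom C Y Z" "g' \<in> hom C Y' Z'" "z \<cdot> g = g' \<cdot> y"
    using assms(2,3,5) by (blast intro: arr_homD)+
  have q: "q \<in> hom C P Y" "q' \<in> hom C P' Y'" "f \<cdot> p = g \<cdot> q"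
    using assms(6-9) f g by (auto simp: is_pullback_def hom_def)
  have "f' \<cdot> (x \<cdot> p) = z \<cdot> (f \<cdot> p)" using f assms(1,3,8) by (simp add: cs cmp_eq[OF f(3)])
  also have "\<dots> = g' \<cdot> (y \<cdot> q)" using q g assms(2,3) by (simp add: cs cmp_eq[OF g(3)])
  finally obtain p0 where p0: "p0 \<in> hom C P P'" "p' \<cdot> p0 = x \<cdot> p" "q' \<cdot> p0 = y \<cdot> q"
    using pullback_lift[OF assms(7) f(2) g(2) assms(9) comp_hom[OF assms(1,8)] comp_hom[OF assms(2) q(1)]] by metis
  then have s: "Square p0 x p p' \<in> hom (arrow_cat C) p0 x" "Square p0 y q q' \<in> hom (arrow_cat C) p0 y"
    using assms q by (auto intro!: arr_homI)
  then show thesis using that p0 arr_pullbackI[OF p0(1) assms(1-5) s assms(6,7)] by blast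
qed

lemma arr_section_iff:
  assumes "a \<in> hom C A A'" "b \<in> hom C B B'"
    and "Square a b f f' \<in> hom (arrow_cat C) a b" "Square b a s s' \<in> hom (arrow_cat C) b a"
  shows "section_of (arrow_cat C) (Square b a s s') (Square a b f f') \<longleftrightarrow> section_of C s f \<and> section_of C s' f'"
  using assms(3,4) arr_homD[OF assms(3,1,2)] arr_homD[OF assms(4,2,1)] assms(1,2)
  by (auto simp: section_of_def homD)

lemma arr_split_short_five:
  assumes "split_short_five C"
  shows "split_short_five (arrow_cat C)"
  unfolding split_short_five_def
proof (intro allI impI)
  fix k f s k' f' s' u v w
  assume E: "split_short_exact (arrow_cat C) k f s" "split_short_exact (arrow_cat C) k' f' s'"
    and u: "u \<in> hom (arrow_cat C) (Dom (arrow_cat C) k) (Dom (arrow_cat C) k')"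
    and v: "v \<in> hom (arrow_cat C) (Dom (arrow_cat C) f) (Dom (arrow_cat C) f')"
    and w: "w \<in> hom (arrow_cat C) (Cod (arrow_cat C) f) (Cod (arrow_cat C) f')"
    and c: "v \<cdot>\<^bsub>arrow_cat C\<^esub> k = k' \<cdot>\<^bsub>arrow_cat C\<^esub> u" "w \<cdot>\<^bsub>arrow_cat C\<^esub> f = f' \<cdot>\<^bsub>arrow_cat C\<^esub> v"
      "v \<cdot>\<^bsub>arrow_cat C\<^esub> s = s' \<cdot>\<^bsub>arrow_cat C\<^esub> w"
    and i: "is_iso (arrow_cat C) u" "is_iso (arrow_cat C) w"
  have ss: "\<exists>x a b k1 k2 f1 f2 s1 s2. k = Square x a k1 k2 \<and> f = Square a b f1 f2 \<and> s = Square b a s1 s2 \<and>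
      split_short_exact C k1 f1 s1 \<and> split_short_exact C k2 f2 s2 \<and>
      k1 \<in> hom C (Dom C x) (Dom C a) \<and> k2 \<in> hom C (Cod C x) (Cod C a) \<and>
      f1 \<in> hom C (Dom C a) (Dom C b) \<and> f2 \<in> hom C (Cod C a) (Cod C b)"
    if "split_short_exact (arrow_cat C) k f s" for k f s
  proof -
    have ks: "is_kernel (arrow_cat C) k f" "section_of (arrow_cat C) s f"
      using that by (auto simp: split_short_exact_def)
    obtain x a b where h: "k \<in> hom (arrow_cat C) x a" "f \<in> hom (arrow_cat C) a b"
      using arr.kernelE[OF ks(1)] by metis
    have hs: "s \<in> hom (arrow_cat C) b a" using ks(2) h by (auto simp: section_of_def hom_def)
    note O = arr_hom_Ob[OF h(1)] arr_hom_Ob[OF h(2)]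
    obtain k1 k2 where k: "k = Square x a k1 k2" "k1 \<in> hom C (Dom C x) (Dom C a)" "k2 \<in> hom C (Cod C x) (Cod C a)"
      using arr_homE[OF h(1) O(1,2)] by metis
    obtain f1 f2 where f: "f = Square a b f1 f2" "f1 \<in> hom C (Dom C a) (Dom C b)" "f2 \<in> hom C (Cod C a) (Cod C b)"
      using arr_homE[OF h(2) O(2,4)] by metis
    obtain s1 s2 where s: "s = Square b a s1 s2" using arr_homE[OF hs O(4,2)] by metis
    have "section_of C s1 f1 \<and> section_of C s2 f2"
      using arr_section_iff[OF O(2,4) h(2)[unfolded f(1)] hs[unfolded s]] ks(2) f(1) s by simp
    then have "split_short_exact C k1 f1 s1 \<and> split_short_exact C k2 f2 s2"
      using arr_kernelD[OF ks(1)[unfolded k(1) f(1)]] by (auto simp: split_short_exact_def)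
    then show ?thesis using k f s by blast
  qed
  obtain x a b k1 k2 f1 f2 s1 s2 where 1: "k = Square x a k1 k2" "f = Square a b f1 f2" "s = Square b a s1 s2"
      "split_short_exact C k1 f1 s1" "split_short_exact C k2 f2 s2"
      "k1 \<in> hom C (Dom C x) (Dom C a)" "k2 \<in> hom C (Cod C x) (Cod C a)"
      "f1 \<in> hom C (Dom C a) (Dom C b)" "f2 \<in> hom C (Cod C a) (Cod C b)"
    using ss[OF E(1)] by metis
  obtain x' a' b' k1' k2' f1' f2' s1' s2' where 2: "k' = Square x' a' k1' k2'" "f' = Square a' b' f1' f2'" "s' = Square b' a' s1' s2'"
      "split_short_exact C k1' f1' s1'" "split_short_exact C k2' f2' s2'"
      "k1' \<in> hom C (Dom C x') (Dom C a')" "k2' \<in> hom C (Cod C x') (Cod C a')"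
      "f1' \<in> hom C (Dom C a') (Dom C b')" "f2' \<in> hom C (Cod C a') (Cod C b')"
    using ss[OF E(2)] by metis
  have h: "u \<in> hom (arrow_cat C) x x'" "v \<in> hom (arrow_cat C) a a'" "w \<in> hom (arrow_cat C) b b'"
    using u v w 1 2 by simp_all
  obtain u1 u2 where u: "u = Square x x' u1 u2" "u1 \<in> hom C (Dom C x) (Dom C x')" "u2 \<in> hom C (Cod C x) (Cod C x')"
    using arr_homE[OF h(1) arr_hom_Ob[OF h(1)]] by metis
  obtain v1 v2 where v: "v = Square a a' v1 v2" "v1 \<in> hom C (Dom C a) (Dom C a')" "v2 \<in> hom C (Cod C a) (Cod C a')"
    using arr_homE[OF h(2) arr_hom_Ob[OF h(2)]] by metis
  obtain w1 w2 where w: "w = Square b b' w1 w2" "w1 \<in> hom C (Dom C b) (Dom C b')" "w2 \<in> hom C (Cod C b) (Cod C b')"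
    using arr_homE[OF h(3) arr_hom_Ob[OF h(3)]] by metis
  have "is_iso C v1"
    by (rule assms[unfolded split_short_five_def, rule_format, OF 1(4) 2(4), of u1 _ w1])
      (use c 1 2 u v w arr_isoD[OF i(1)[unfolded u(1)]] arr_isoD[OF i(2)[unfolded w(1)]] in \<open>simp_all add: homD\<close>)
  moreover have "is_iso C v2"
    by (rule assms[unfolded split_short_five_def, rule_format, OF 1(5) 2(5), of u2 _ w2])
      (use c 1 2 u v w arr_isoD[OF i(1)[unfolded u(1)]] arr_isoD[OF i(2)[unfolded w(1)]] in \<open>simp_all add: homD\<close>)
  ultimately show "is_iso (arrow_cat C) v" using arr_isoI h(2) v(1) by simp
qed

end

section \<open>Regular structure, extensions and torsion\<close>

text \<open>An Eilenberg-Moore algebra of the monad induced by \<open>p\<^sub>! \<stileturn> p\<^sup>*\<close>, with \<open>h\<close> the action and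
  its two axioms stated on generalized elements.\<close>

definition descent_alg :: "('o, 'm) cat \<Rightarrow> 'm \<Rightarrow> 'm \<Rightarrow> 'm \<Rightarrow> 'm \<Rightarrow> 'm \<Rightarrow> bool" where
  "descent_alg C p x u v h \<longleftrightarrow> x \<in> Mor C \<and> Cod C x = Dom C p \<and>
     is_pullback C p (p \<cdot>\<^bsub>C\<^esub> x) u v \<and> h \<in> hom C (Dom C u) (Dom C x) \<and> x \<cdot>\<^bsub>C\<^esub> h = u \<and>
     (\<forall>W. \<forall>m \<in> hom C W (Dom C u). u \<cdot>\<^bsub>C\<^esub> m = x \<cdot>\<^bsub>C\<^esub> (v \<cdot>\<^bsub>C\<^esub> m) \<longrightarrow> h \<cdot>\<^bsub>C\<^esub> m = v \<cdot>\<^bsub>C\<^esub> m) \<and>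
     (\<forall>W. \<forall>m \<in> hom C W (Dom C u). \<forall>m' \<in> hom C W (Dom C u). \<forall>m'' \<in> hom C W (Dom C u).
        v \<cdot>\<^bsub>C\<^esub> m'' = h \<cdot>\<^bsub>C\<^esub> m' \<longrightarrow> u \<cdot>\<^bsub>C\<^esub> m'' = u \<cdot>\<^bsub>C\<^esub> m \<longrightarrow> v \<cdot>\<^bsub>C\<^esub> m = v \<cdot>\<^bsub>C\<^esub> m' \<longrightarrow>
        h \<cdot>\<^bsub>C\<^esub> m'' = h \<cdot>\<^bsub>C\<^esub> m)"

text \<open>Essential surjectivity of the comparison functor of \<open>p\<close>, freed from slices
  and adjoints: \<open>x\<close> is a pullback of some \<open>y\<close> along \<open>p\<close>, and
  the requirement that \<open>q\<close> does not distinguish \<open>h\<close> from \<open>v\<close>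
  says that \<open>h\<close> is the canonical action on such a pullback.\<close>

definition effective_algs :: "('o, 'm) cat \<Rightarrow> 'm \<Rightarrow> bool" where
  "effective_algs C p \<longleftrightarrow> (\<forall>x u v h. descent_alg C p x u v h \<longrightarrow>
     (\<exists>y q. is_pullback C p y x q \<and> q \<cdot>\<^bsub>C\<^esub> h = q \<cdot>\<^bsub>C\<^esub> v))"

text \<open>What an arrow category inherits from a homological category with descent. Arrow categories of
  \<open>\<A>\<close> have cokernels that are hard to control, so the normal epimorphisms of \<open>\<A>\<close> are replaced
  by a class \<open>Q\<close> which at level \<open>n\<close> consists of the pointwise ones, and \<open>Q_normal\<close> keeps only
  the fact that every kernel is the kernel of a member of \<open>Q\<close>.\<close>

locale hml = pt_cat +
  fixes Q :: "'m set"
  assumes pb_ex: "f \<in> hom C X Z \<Longrightarrow> g \<in> hom C Y Z \<Longrightarrow> \<exists>p q. is_pullback C f g p q"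
    and ssf: "split_short_five C"
    and Q_Mor: "f \<in> Q \<Longrightarrow> f \<in> Mor C"
    and Q_pb: "is_pullback C f g p q \<Longrightarrow> g \<in> Q \<Longrightarrow> p \<in> Q"
    and Q_coker: "q \<in> Q \<Longrightarrow> is_kernel C k q \<Longrightarrow> is_cokernel C q k"
    and Q_normal: "is_kernel C k f \<Longrightarrow> \<exists>q \<in> Q. is_kernel C k q"
    and Q_cancel: "f \<in> hom C X Y \<Longrightarrow> g \<in> hom C Y Z \<Longrightarrow> g \<cdot> f \<in> Q \<Longrightarrow> g \<in> Q"
    and Q_iso: "is_iso C f \<Longrightarrow> f \<in> Q"
    and Q_descent: "f \<in> Q \<Longrightarrow> effective_algs C f"

context cat_loc
begin

lemma pullback_homs:
  assumes "is_pullback C f g p q" "f \<in> hom C X Z" "g \<in> hom C Y Z"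
  shows "p \<in> hom C (Dom C p) X" "q \<in> hom C (Dom C p) Y"
  using assms by (auto simp: is_pullback_def hom_def)

lemma iso_pullback:
  assumes "is_pullback C f g p q" "is_iso C g"
  shows "is_iso C p"
proof -
  obtain X Y Z P where H: "f \<in> hom C X Z" "g \<in> hom C Y Z" "p \<in> hom C P X" "q \<in> hom C P Y"
    "f \<cdot> p = g \<cdot> q" using pullbackE[OF assms(1)] by metis
  obtain g' where g': "g' \<in> hom C Z Y" "g' \<cdot> g = Id C Y" "g \<cdot> g' = Id C Z" using isoE[OF assms(2) H(2)] .
  have O: "X \<in> Ob C" "P \<in> Ob C" using H hom_Ob1 by auto
  have "f \<cdot> Id C X = g \<cdot> (g' \<cdot> f)" using H(1,2) g' by (simp add: cs cmp_eq[OF g'(3)])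
  then obtain s where s: "s \<in> hom C X P" "p \<cdot> s = Id C X" "q \<cdot> s = g' \<cdot> f"
    using pullback_lift[OF assms(1) H(1-3) id_hom[OF O(1)] comp_hom[OF g'(1) H(1)]] by metis
  have e: "g' \<cdot> (f \<cdot> p) = q" using H g' by (simp add: cs cmp_eq[OF g'(2)])
  have "s \<cdot> p = Id C P"
    by (rule pullback_unique[OF assms(1) H(3)])
      (use s(1,2) H(1,3,4) g'(1) O e in \<open>simp_all add: cs cmp_eq[OF s(2)] cmp_eq[OF s(3)]\<close>)
  then show ?thesis using isoI[OF H(3) s(1)] s(2) by simp
qed

end

context hml
begin

lemma pbE:
  assumes "f \<in> hom C X Z" "g \<in> hom C Y Z"
  obtains P p q where "is_pullback C f g p q" "p \<in> hom C P X" "q \<in> hom C P Y"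
  using pb_ex[OF assms] pullback_homs assms by metis

lemma kernel_ex:
  assumes "f \<in> hom C A B"
  obtains K k where "k \<in> hom C K A" "is_kernel C k f"
proof -
  obtain Z where Z: "is_zero_ob C Z" "Z \<in> Ob C" using zero_obE .
  have B: "B \<in> Ob C" using assms hom_Ob2 by blast
  note z = zm_hom[OF Z(2) B]
  obtain K k q where k: "is_pullback C f (zm C Z B) k q" "k \<in> hom C K A" "q \<in> hom C K Z"
    using pbE[OF assms z] .
  have "is_kernel C k f"
  proof (rule kernelI[OF k(2) assms])
    show "f \<cdot> k = zm C K B" using pullback_comm[OF k(1)] zm_comp[OF k(3) B] by simp
  next
    fix W g assume g: "g \<in> hom C W A" "f \<cdot> g = zm C W B"
    have W: "W \<in> Ob C" using g hom_Ob1 by blast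
    have "f \<cdot> g = zm C Z B \<cdot> zm C W Z" using g zm_comp[OF zm_hom[OF W Z(2)] B] by simp
    then show "\<exists>h\<in>hom C W K. k \<cdot> h = g"
      using pullback_lift[OF k(1) assms z k(2) g(1) zm_hom[OF W Z(2)]] by metis
  next
    fix W g h assume gh: "g \<in> hom C W K" "h \<in> hom C W K" "k \<cdot> g = k \<cdot> h"
    show "g = h"
      by (rule pullback_unique[OF k(1,2) gh(1,2,3) to_zero_unique[OF Z(1)]])
        (use gh k(3) comp_hom in blast)+
  qed
  then show thesis using that k by blast
qed

text \<open>The split short five lemma is applied after pulling back along \<open>e\<close>: the
  morphisms \<open>e\<close> and \<open>e'\<close> become the split epimorphisms \<open>p1\<close>
  and \<open>r1\<close> with the same kernel object, so the induced \<open>d\<close> is invertible.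
  This writes a member of \<open>Q\<close> as a composite ending in \<open>c\<close>, so that
  \<open>c\<close> is in \<open>Q\<close>; its kernel is zero, and hence \<open>c\<close> is
  invertible.\<close>

lemma Q_short_five:
  assumes "e \<in> Q" "e' \<in> Q" "e \<in> hom C X B" "e' \<in> hom C X' B" "c \<in> hom C X X'" "e' \<cdot> c = e"
    and "is_kernel C k e" "k \<in> hom C K X" "is_kernel C (c \<cdot> k) e'"
  shows "is_iso C c"
proof -
  obtain P p1 p2 where p: "is_pullback C e e p1 p2" "p1 \<in> hom C P X" "p2 \<in> hom C P X"
    using pbE[OF assms(3,3)] .
  obtain R r1 r2 where r: "is_pullback C e e' r1 r2" "r1 \<in> hom C R X" "r2 \<in> hom C R X'"
    using pbE[OF assms(3,4)] .
  have O: "X \<in> Ob C" "K \<in> Ob C" "B \<in> Ob C" "X' \<in> Ob C" using assms hom_Ob1 hom_Ob2 by auto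
  have ck: "c \<cdot> k \<in> hom C K X'" using comp_hom assms by blast
  have "e \<cdot> p1 = e' \<cdot> (c \<cdot> p2)"
    using pullback_comm[OF p(1)] assms(4,5) p by (simp add: cs cmp_eq[OF assms(6)])
  then obtain d where d: "d \<in> hom C P R" "r1 \<cdot> d = p1" "r2 \<cdot> d = c \<cdot> p2"
    using pullback_lift[OF r(1) assms(3,4) r(2) p(2) comp_hom[OF assms(5) p(3)]] by metis
  have "e \<cdot> Id C X = e' \<cdot> c" using assms(3,6) by (simp add: id_right)
  then obtain s where s: "s \<in> hom C X P" "p1 \<cdot> s = Id C X" "p2 \<cdot> s = Id C X"
    using pullback_lift[OF p(1) assms(3,3) p(2) id_hom[OF O(1)] id_hom[OF O(1)]] by metis
  have z: "e \<cdot> zm C K X = e \<cdot> k" using kernel_zero[OF assms(7,8,3)] comp_zm[OF assms(3) O(2)] by simp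
  obtain k1 where k1: "k1 \<in> hom C K P" "p1 \<cdot> k1 = zm C K X" "p2 \<cdot> k1 = k"
    using pullback_lift[OF p(1) assms(3,3) p(2) zm_hom[OF O(2,1)] assms(8) z] by metis
  have K1: "is_kernel C k1 p1" by (rule kernel_pullback'[OF p(1-3) assms(7) k1(1,3,2)])
  have dk: "d \<cdot> k1 \<in> hom C K R" "r2 \<cdot> (d \<cdot> k1) = c \<cdot> k" "r1 \<cdot> (d \<cdot> k1) = zm C K X"
    using d(1) k1 r(2,3) p(3) assms(5) comp_hom[OF d(1) k1(1)] by (simp_all add: cs cmp_eq[OF d(2)] cmp_eq[OF d(3)])
  have K2: "is_kernel C (d \<cdot> k1) r1"
    by (rule kernel_pullback'[OF r assms(9) dk])
  have sp: "section_of C s p1" "section_of C (d \<cdot> s) r1"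
    using s p(2) r(2) d(1) comp_hom[OF d(1) s(1)] by (auto simp: section_of_def cs cmp_eq[OF d(2)])
  have "is_iso C d"
    by (rule ssf[unfolded split_short_five_def, rule_format, where k = k1 and f = p1 and s = s and
        k' = "d \<cdot> k1" and f' = r1 and s' = "d \<cdot> s" and u = "Id C K" and w = "Id C X"])
      (use K1 K2 sp d(1,2) k1(1) dk(1) s(1) p(2) r(2) O iso_id id_hom in
        \<open>simp_all add: split_short_exact_def homD[OF k1(1)] homD[OF dk(1)] homD[OF p(2)] homD[OF r(2)]
          id_left[OF p(2)] id_right[OF dk(1)] id_right[OF comp_hom[OF d(1) s(1)]]\<close>)
  have "r2 \<in> Q" using Q_pb[OF pullback_sym[OF r(1)] assms(1)] .
  obtain d' where d': "d' \<in> hom C R P" "d \<cdot> d' = Id C R" using isoE[OF \<open>is_iso C d\<close> d(1)] by metis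
  have "c \<cdot> (p2 \<cdot> d') = r2 \<cdot> (d \<cdot> d')" using d(1) d'(1) p(3) r(3) assms(5)
    by (simp add: cs cmp_eq[OF d(3)])
  also have "\<dots> = r2" using d'(2) id_right[OF r(3)] by simp
  finally have "c \<cdot> (p2 \<cdot> d') = r2" .
  then have cQ: "c \<in> Q" using Q_cancel[OF comp_hom[OF p(3) d'(1)] assms(5)] \<open>r2 \<in> Q\<close> by simp
  obtain N j where j: "j \<in> hom C N X" "is_kernel C j c" using kernel_ex[OF assms(5)] .
  have N: "N \<in> Ob C" using j hom_Ob1 by blast
  have "e \<cdot> j = e' \<cdot> (c \<cdot> j)" using assms(3-5) j by (simp add: cs cmp_eq[OF assms(6)])
  then have "e \<cdot> j = zm C N B" using kernel_zero[OF j(2,1) assms(5)] comp_zm[OF assms(4) N] by simp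
  then obtain l where l: "l \<in> hom C N K" "k \<cdot> l = j"
    using kernel_lift[OF assms(7,8,3) j(1)] by metis
  have "(c \<cdot> k) \<cdot> l = (c \<cdot> k) \<cdot> zm C N K"
    using kernel_zero[OF j(2,1) assms(5)] comp_zm[OF ck N] assoc[OF l(1) assms(8,5)] l(2) by simp
  then have "l = zm C N K" using kernel_mono[OF assms(9) ck l(1) zm_hom[OF N O(2)]] by simp
  then have "j = zm C N X" using l(2) comp_zm[OF assms(8) N] by simp
  then show ?thesis using cokernel_zero_iso[OF Q_coker[OF cQ j(2)] _ j(1) assms(5)] by simp
qed

text \<open>Comparing the kernel of \<open>q\<close> with the zero morphism shows that
  \<open>g\<close> vanishes on that kernel, and \<open>q\<close> is its cokernel. The elementwise
  hypothesis is the form in which descent data provide the information.\<close>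

lemma Q_factor:
  assumes "q \<in> Q" "q \<in> hom C X Y" "g \<in> hom C X W"
    and "\<And>V a b. a \<in> hom C V X \<Longrightarrow> b \<in> hom C V X \<Longrightarrow> q \<cdot> a = q \<cdot> b \<Longrightarrow> g \<cdot> a = g \<cdot> b"
  obtains h where "h \<in> hom C Y W" "h \<cdot> q = g"
proof -
  obtain K k where k: "k \<in> hom C K X" "is_kernel C k q" using kernel_ex[OF assms(2)] .
  have O: "K \<in> Ob C" "X \<in> Ob C" using k hom_Ob1 hom_Ob2 by auto
  have "g \<cdot> k = g \<cdot> zm C K X"
    by (rule assms(4)[OF k(1) zm_hom[OF O]])
      (use kernel_zero[OF k(2,1) assms(2)] comp_zm[OF assms(2) O(1)] in simp)
  then have "g \<cdot> k = zm C K W" using comp_zm[OF assms(3) O(1)] by simp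
  then show thesis using cokernel_desc[OF Q_coker[OF assms(1) k(2)] k(1) assms(2,3)] that by metis
qed

lemma Q_epi:
  assumes "q \<in> Q" "q \<in> hom C X Y" "g \<in> hom C Y W" "h \<in> hom C Y W" "g \<cdot> q = h \<cdot> q"
  shows "g = h"
proof -
  obtain K k where k: "k \<in> hom C K X" "is_kernel C k q" using kernel_ex[OF assms(2)] .
  show ?thesis using cokernel_epi[OF Q_coker[OF assms(1) k(2)] assms(2-5)] .
qed

end

text \<open>At level \<open>n\<close>, \<open>S\<close> is the class of \<open>n\<close>-fold extensions and \<open>E\<close> is \<open>\<N>\<^sup>n\<close>.\<close>

locale hml_ext = hml +
  fixes S :: "'o set" and E :: "'m set"
  assumes O_Ob: "X \<in> S \<Longrightarrow> X \<in> Ob C"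
    and E_Q: "f \<in> E \<Longrightarrow> f \<in> Q"
    and E_O: "f \<in> E \<Longrightarrow> Dom C f \<in> S \<and> Cod C f \<in> S"
    and E_iso: "is_iso C f \<Longrightarrow> f \<in> hom C X Y \<Longrightarrow> X \<in> S \<Longrightarrow> f \<in> E"
    and E_comp: "f \<in> hom C X Y \<Longrightarrow> g \<in> hom C Y Z \<Longrightarrow> f \<in> E \<Longrightarrow> g \<in> E \<Longrightarrow> g \<cdot> f \<in> E"
    and E_pb: "is_pullback C f g p q \<Longrightarrow> g \<in> E \<Longrightarrow> Dom C f \<in> S \<Longrightarrow> p \<in> E"
    and E_cancel: "f \<in> hom C X Y \<Longrightarrow> g \<in> hom C Y Z \<Longrightarrow> f \<in> E \<Longrightarrow> g \<cdot> f \<in> E \<Longrightarrow> g \<in> E"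
    and E_zero: "is_zero_ob C Z \<Longrightarrow> f \<in> hom C X Z \<Longrightarrow> X \<in> S \<Longrightarrow> f \<in> E"
    and O_zero: "is_zero_ob C Z \<Longrightarrow> Z \<in> S"
    and E_desc: "is_pullback C p y x q \<Longrightarrow> p \<in> E \<Longrightarrow> x \<in> E \<Longrightarrow> Dom C y \<in> S"
begin

lemma E_Mor: "f \<in> E \<Longrightarrow> f \<in> Mor C"
  using E_Q Q_Mor by blast

lemma E_O1: "f \<in> E \<Longrightarrow> f \<in> hom C X Y \<Longrightarrow> X \<in> S"
  and E_O2: "f \<in> E \<Longrightarrow> f \<in> hom C X Y \<Longrightarrow> Y \<in> S"
  using E_O by (auto simp: hom_def)

end

text \<open>Recorded as a property of an inclusion instead of the value of a chosen reflector. It is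
  stable under isomorphism and unique up to isomorphism, so it can be followed from level to level
  without a choice of functor.\<close>

definition torsion_part :: "('o, 'm) cat \<Rightarrow> 'o set \<Rightarrow> 'o set \<Rightarrow> 'm \<Rightarrow> bool" where
  "torsion_part C T F t \<longleftrightarrow> Dom C t \<in> T \<and> (\<exists>e. short_exact C t e \<and> Cod C e \<in> F)"

section \<open>Torsion theories in a pointed category\<close>

locale tors_cat = pt_cat +
  fixes T F :: "'o set"
  assumes tt: "torsion_theory C T F"
begin

lemma T_Ob: "X \<in> T \<Longrightarrow> X \<in> Ob C" and F_Ob: "X \<in> F \<Longrightarrow> X \<in> Ob C"
  using tt by (auto simp: torsion_theory_def replete_def)

lemma T_replete: "X \<in> T \<Longrightarrow> i \<in> hom C X Y \<Longrightarrow> is_iso C i \<Longrightarrow> Y \<in> T"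
  and F_replete: "X \<in> F \<Longrightarrow> i \<in> hom C X Y \<Longrightarrow> is_iso C i \<Longrightarrow> Y \<in> F"
  using tt hom_Ob2 unfolding torsion_theory_def replete_def isomorphic_def by blast+

lemma T_F_zero:
  assumes "f \<in> hom C X Y" "X \<in> T" "Y \<in> F"
  shows "f = zm C X Y"
proof -
  have "is_zero_mor C f" using tt assms unfolding torsion_theory_def by blast
  then show ?thesis using zero_iff assms(1) by blast
qed

lemma torsion_part_ex:
  assumes "X \<in> Ob C"
  obtains T0 t where "t \<in> hom C T0 X" "torsion_part C T F t"
proof -
  obtain t e where te: "short_exact C t e" "Cod C t = X" "Dom C t \<in> T" "Cod C e \<in> F"
    using tt assms unfolding torsion_theory_def by blast
  then have "t \<in> hom C (Dom C t) X" by (auto simp: short_exact_def is_kernel_def hom_def)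
  then show thesis using that te unfolding torsion_part_def by blast
qed

lemma torsion_partE:
  assumes "torsion_part C T F t" "t \<in> hom C T0 X"
  obtains e Y where "e \<in> hom C X Y" "is_kernel C t e" "is_cokernel C e t" "T0 \<in> T" "Y \<in> F"
proof -
  obtain e where e: "short_exact C t e" "Cod C e \<in> F" "Dom C t \<in> T"
    using assms unfolding torsion_part_def by blast
  then have "e \<in> hom C X (Cod C e)" using assms(2) by (auto simp: short_exact_def is_kernel_def hom_def)
  moreover have "T0 \<in> T" using e(3) homD(2)[OF assms(2)] by simp
  ultimately show thesis using that e unfolding short_exact_def by blast
qed

lemma torsion_partI:
  assumes "t \<in> hom C T0 X" "e \<in> hom C X Y" "is_kernel C t e" "is_cokernel C e t" "T0 \<in> T" "Y \<in> F"
  shows "torsion_part C T F t"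
  using assms unfolding torsion_part_def short_exact_def by (auto simp: homD)

lemma torsion_part_iso:
  assumes "torsion_part C T F t" "t \<in> hom C T0 X" "i \<in> hom C T1 T0" "is_iso C i"
  shows "torsion_part C T F (t \<cdot> i)"
proof -
  obtain e Y where e: "e \<in> hom C X Y" "is_kernel C t e" "is_cokernel C e t" "T0 \<in> T" "Y \<in> F"
    using torsion_partE[OF assms(1,2)] .
  obtain j where "j \<in> hom C T0 T1" "is_iso C j" using iso_inv[OF assms(4,3)] by metis
  then have "T1 \<in> T" using T_replete e(4) by blast
  then show ?thesis
    using torsion_partI[OF comp_hom[OF assms(2,3)] e(1) kernel_of_iso[OF e(2) assms(2-4)]
        cokernel_of_iso[OF e(3) assms(2-4)]] e(5) by blast
qed

text \<open>A morphism from a torsion object becomes zero in the torsion free quotient, so it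
  factors through the torsion part; this is applied in both directions.\<close>

lemma torsion_part_unique:
  assumes "torsion_part C T F t" "t \<in> hom C T0 X" "torsion_part C T F t'" "t' \<in> hom C T1 X"
  obtains i where "i \<in> hom C T1 T0" "is_iso C i" "t \<cdot> i = t'"
proof -
  have lift: "\<exists>i \<in> hom C T1 T0. t \<cdot> i = t'"
    if t: "torsion_part C T F t" "t \<in> hom C T0 X" and t': "torsion_part C T F t'" "t' \<in> hom C T1 X"
    for t t' T0 T1
  proof -
    obtain e Y where e: "e \<in> hom C X Y" "is_kernel C t e" "is_cokernel C e t" "T0 \<in> T" "Y \<in> F"
      using torsion_partE[OF t] .
    have "T1 \<in> T" using torsion_partE[OF t'] by metis
    then have "e \<cdot> t' = zm C T1 Y" using T_F_zero comp_hom[OF e(1) t'(2)] e(5) by blast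
    then show ?thesis using kernel_lift[OF e(2) t(2) e(1) t'(2)] by metis
  qed
  have mono: "g = h" if m: "torsion_part C T F t" "t \<in> hom C T0 X" "g \<in> hom C W T0" "h \<in> hom C W T0" "t \<cdot> g = t \<cdot> h"
    for t g h W T0
  proof -
    obtain e Y where "is_kernel C t e" using torsion_partE[OF m(1,2)] by metis
    then show ?thesis using kernel_mono m by metis
  qed
  obtain i where i: "i \<in> hom C T1 T0" "t \<cdot> i = t'" using lift[OF assms] by blast
  obtain j where j: "j \<in> hom C T0 T1" "t' \<cdot> j = t" using lift[OF assms(3,4,1,2)] by blast
  have O: "T0 \<in> Ob C" "T1 \<in> Ob C" using i hom_Ob1 hom_Ob2 by auto
  have "i \<cdot> j = Id C T0"
    by (rule mono[OF assms(1,2)]) (use i j assms(2,4) O in \<open>simp_all add: cs cmp_eq[OF i(2)]\<close>)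
  moreover have "j \<cdot> i = Id C T1"
    by (rule mono[OF assms(3,4)]) (use i j assms(2,4) O in \<open>simp_all add: cs cmp_eq[OF j(2)]\<close>)
  ultimately show thesis using that i j isoI by metis
qed

text \<open>The torsion part of \<open>X\<close> is killed by \<open>m\<close>, hence is zero, so
  \<open>X\<close> is isomorphic to its torsion free quotient. Monicity is expressed by cancellation
  because \<open>m\<close> need not be a kernel.\<close>

lemma F_subobject:
  assumes "m \<in> hom C X Y" "Y \<in> F"
    and "\<And>W g h. g \<in> hom C W X \<Longrightarrow> h \<in> hom C W X \<Longrightarrow> m \<cdot> g = m \<cdot> h \<Longrightarrow> g = h"
  shows "X \<in> F"
proof -
  have X: "X \<in> Ob C" using assms hom_Ob1 by blast
  obtain T0 t where t: "t \<in> hom C T0 X" "torsion_part C T F t" using torsion_part_ex[OF X] .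
  obtain e Y0 where e: "e \<in> hom C X Y0" "is_kernel C t e" "is_cokernel C e t" "T0 \<in> T" "Y0 \<in> F"
    using torsion_partE[OF t(2,1)] .
  have T0: "T0 \<in> Ob C" using t hom_Ob1 by blast
  have "m \<cdot> t = m \<cdot> zm C T0 X"
    using T_F_zero[OF comp_hom[OF assms(1) t(1)] e(4) assms(2)] comp_zm[OF assms(1) T0] by simp
  then have "t = zm C T0 X" using assms(3)[OF t(1) zm_hom[OF T0 X]] by blast
  then have "is_iso C e" using cokernel_zero_iso[OF e(3) _ t(1) e(1)] by blast
  then obtain j where "j \<in> hom C Y0 X" "is_iso C j" using iso_inv[OF _ e(1)] by metis
  then show ?thesis using F_replete e(5) by blast
qed

end

text \<open>The two axioms are what remains of conditions (N) and (P). Protoadditivity enters only through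
  \<open>tors_split\<close>: a split epimorphism with kernel in \<open>F\<close> induces an isomorphism of torsion parts.\<close>

locale hml_tors = hml_ext + tors_cat +
  assumes tors_normal: "is_kernel C k f \<Longrightarrow> torsion_part C T F t \<Longrightarrow> Cod C t = Dom C k \<Longrightarrow>
      \<exists>q \<in> Q. is_kernel C (k \<cdot> t) q \<and> (f \<in> E \<longrightarrow> q \<in> E)"
    and tors_split: "split_short_exact C k p s \<Longrightarrow> Dom C k \<in> F \<Longrightarrow>
      \<exists>t. torsion_part C T F t \<and> Cod C t = Dom C p \<and> torsion_part C T F (p \<cdot> t)"

section \<open>Inheritance by the arrow category\<close>

text \<open>Membership is pointwise, with no condition on the comparison to the pullback; that
  condition is what distinguishes \<open>ext_class\<close>.\<close>

definition sqQ :: "('o, 'm) cell_cat \<Rightarrow> ('o, 'm) cell set \<Rightarrow> ('o, 'm) cell set" where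
  "sqQ C Q = {Square a b f f' | a b f f'. Square a b f f' \<in> Mor (arrow_cat C) \<and> f \<in> Q \<and> f' \<in> Q}"

lemma descent_alg_act:
  assumes "descent_alg C p x u v h" "m \<in> hom C W (Dom C u)" "m' \<in> hom C W (Dom C u)" "m'' \<in> hom C W (Dom C u)"
    "v \<cdot>\<^bsub>C\<^esub> m'' = h \<cdot>\<^bsub>C\<^esub> m'" "u \<cdot>\<^bsub>C\<^esub> m'' = u \<cdot>\<^bsub>C\<^esub> m" "v \<cdot>\<^bsub>C\<^esub> m = v \<cdot>\<^bsub>C\<^esub> m'"
  shows "h \<cdot>\<^bsub>C\<^esub> m'' = h \<cdot>\<^bsub>C\<^esub> m"
  using assms unfolding descent_alg_def by blast

locale cell_hml = hml C Q + cell_pt_cat C for C :: "('o, 'm) cell_cat" (structure) and Q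
begin

lemma sqQ_iff: "Square a b f f' \<in> hom (arrow_cat C) a b \<Longrightarrow> Square a b f f' \<in> sqQ C Q \<longleftrightarrow> f \<in> Q \<and> f' \<in> Q"
  unfolding sqQ_def by (auto simp: hom_def)

lemma sqQ_D: "Square a b f f' \<in> sqQ C Q \<Longrightarrow> Square a b f f' \<in> hom (arrow_cat C) a b \<and> f \<in> Q \<and> f' \<in> Q"
  unfolding sqQ_def by (auto simp: hom_def)

lemma sqQ_E:
  assumes "x \<in> sqQ C Q"
  obtains a b f f' where "x = Square a b f f'" "Square a b f f' \<in> hom (arrow_cat C) a b" "f \<in> Q" "f' \<in> Q"
  using assms unfolding sqQ_def by (auto simp: hom_def)

lemma arr_pb_squares:
  assumes "is_pullback (arrow_cat C) f g p q"
  obtains x y z w f1 f2 g1 g2 p1 p2 q1 q2 where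
    "f = Square x z f1 f2" "g = Square y z g1 g2" "p = Square w x p1 p2" "q = Square w y q1 q2"
    "Square x z f1 f2 \<in> hom (arrow_cat C) x z" "Square y z g1 g2 \<in> hom (arrow_cat C) y z"
    "Square w x p1 p2 \<in> hom (arrow_cat C) w x" "Square w y q1 q2 \<in> hom (arrow_cat C) w y"
    "is_pullback C f1 g1 p1 q1" "is_pullback C f2 g2 p2 q2"
proof -
  obtain x y z w where h: "f \<in> hom (arrow_cat C) x z" "g \<in> hom (arrow_cat C) y z"
    "p \<in> hom (arrow_cat C) w x" "q \<in> hom (arrow_cat C) w y" using arr.pullbackE[OF assms] by metis
  obtain f1 f2 where f: "f = Square x z f1 f2" using arr_homE[OF h(1) arr_hom_Ob[OF h(1)]] by metis
  obtain g1 g2 where g: "g = Square y z g1 g2" using arr_homE[OF h(2) arr_hom_Ob[OF h(2)]] by metis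
  obtain p1 p2 where p: "p = Square w x p1 p2" using arr_homE[OF h(3) arr_hom_Ob[OF h(3)]] by metis
  obtain q1 q2 where q: "q = Square w y q1 q2" using arr_homE[OF h(4) arr_hom_Ob[OF h(4)]] by metis
  show thesis using that[OF f g p q] h arr_pullbackD[OF assms[unfolded f g p q]] f g p q by simp
qed

lemma arr_ker_squares:
  assumes "is_kernel (arrow_cat C) k f"
  obtains x a b u u' f1 f2 where "k = Square x a u u'" "f = Square a b f1 f2"
    "Square x a u u' \<in> hom (arrow_cat C) x a" "Square a b f1 f2 \<in> hom (arrow_cat C) a b"
    "is_kernel C u f1" "is_kernel C u' f2"
proof -
  obtain x a b where h: "k \<in> hom (arrow_cat C) x a" "f \<in> hom (arrow_cat C) a b"
    using arr.kernelE[OF assms] by metis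
  obtain u u' where k: "k = Square x a u u'" using arr_homE[OF h(1) arr_hom_Ob[OF h(1)]] by metis
  obtain f1 f2 where f: "f = Square a b f1 f2" using arr_homE[OF h(2) arr_hom_Ob[OF h(2)]] by metis
  show thesis using that[OF k f] h arr_kernelD[OF assms[unfolded k f]] k f by simp
qed

text \<open>Descent is carried out at the two vertices separately and the results are glued. The
  algebra restricts to each vertex by evaluation on the elements of \<open>arr_el1\<close> and
  \<open>arr_el2\<close>. The missing arrow \<open>\<upsilon>\<close> between the descended objects
  exists because the action determines which elements \<open>q\<close> identifies, and the actions
  at the two vertices are compatible.\<close>

lemma arr_effective_algs:
  assumes "Square a b p p' \<in> hom (arrow_cat C) a b" "p \<in> Q" "p' \<in> Q"
  shows "effective_algs (arrow_cat C) (Square a b p p')"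
  unfolding effective_algs_def
proof (intro allI impI)
  fix xx uu vv hh
  assume alg: "descent_alg (arrow_cat C) (Square a b p p') xx uu vv hh"
  obtain A A' B B' where ab: "a \<in> hom C A A'" "b \<in> hom C B B'" using arr_hom_Ob[OF assms(1)] by blast
  note P = arr_homD[OF assms(1) ab]
  have xx: "xx \<in> hom (arrow_cat C) (Dom (arrow_cat C) xx) a"
    using alg by (auto simp: descent_alg_def hom_def)
  obtain \<xi> where "\<xi> = Dom (arrow_cat C) xx" by blast
  note xx = xx[folded this]
  obtain X X' where \<xi>: "\<xi> \<in> hom C X X'" using arr_hom_Ob[OF xx] by blast
  obtain x x' where x: "xx = Square \<xi> a x x'" "x \<in> hom C X A" "x' \<in> hom C X' A'" "a \<cdot> x = x' \<cdot> \<xi>"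
    using arr_homE[OF xx \<xi> ab(1)] .
  have pb: "is_pullback (arrow_cat C) (Square a b p p') (Square \<xi> b (p \<cdot> x) (p' \<cdot> x')) uu vv"
    using alg x(1) by (simp add: descent_alg_def)
  obtain a0 b0 \<xi>0 \<pi> where uv0: "Square a b p p' \<in> hom (arrow_cat C) a0 b0"
    "Square \<xi> b (p \<cdot> x) (p' \<cdot> x') \<in> hom (arrow_cat C) \<xi>0 b0"
    "uu \<in> hom (arrow_cat C) \<pi> a0" "vv \<in> hom (arrow_cat C) \<pi> \<xi>0" using arr.pullbackE[OF pb] .
  have "a0 = a" "\<xi>0 = \<xi>" using uv0(1,2) by (simp_all add: arr_hom_iff)
  note uv = uv0(3,4)[unfolded this]
  obtain P P' where \<pi>: "\<pi> \<in> hom C P P'" using arr_hom_Ob[OF uv(1)] by blast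
  obtain u u' where u: "uu = Square \<pi> a u u'" "u \<in> hom C P A" "u' \<in> hom C P' A'" "a \<cdot> u = u' \<cdot> \<pi>"
    using arr_homE[OF uv(1) \<pi> ab(1)] .
  obtain v v' where v: "vv = Square \<pi> \<xi> v v'" "v \<in> hom C P X" "v' \<in> hom C P' X'" "\<xi> \<cdot> v = v' \<cdot> \<pi>"
    using arr_homE[OF uv(2) \<pi> \<xi>] .
  have hh: "hh \<in> hom (arrow_cat C) \<pi> \<xi>" using alg u(1) x(1) by (simp add: descent_alg_def)
  obtain h h' where h: "hh = Square \<pi> \<xi> h h'" "h \<in> hom C P X" "h' \<in> hom C P' X'" "\<xi> \<cdot> h = h' \<cdot> \<pi>"
    using arr_homE[OF hh \<pi> \<xi>] .
  note pbs = arr_pullbackD[OF pb[unfolded u(1) v(1)]]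
  have c: "x \<cdot> h = u" "x' \<cdot> h' = u'" using alg x(1) h(1) u(1) by (auto simp: descent_alg_def)
  have unit: "hh \<cdot>\<^bsub>arrow_cat C\<^esub> m = vv \<cdot>\<^bsub>arrow_cat C\<^esub> m"
    if "m \<in> hom (arrow_cat C) W \<pi>" "uu \<cdot>\<^bsub>arrow_cat C\<^esub> m = xx \<cdot>\<^bsub>arrow_cat C\<^esub> (vv \<cdot>\<^bsub>arrow_cat C\<^esub> m)" for W m
    using alg that u(1) by (auto simp: descent_alg_def)
  have act: "hh \<cdot>\<^bsub>arrow_cat C\<^esub> m'' = hh \<cdot>\<^bsub>arrow_cat C\<^esub> m"
    if "m \<in> hom (arrow_cat C) W \<pi>" "m' \<in> hom (arrow_cat C) W \<pi>" "m'' \<in> hom (arrow_cat C) W \<pi>"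
      "vv \<cdot>\<^bsub>arrow_cat C\<^esub> m'' = hh \<cdot>\<^bsub>arrow_cat C\<^esub> m'" "uu \<cdot>\<^bsub>arrow_cat C\<^esub> m'' = uu \<cdot>\<^bsub>arrow_cat C\<^esub> m"
      "vv \<cdot>\<^bsub>arrow_cat C\<^esub> m = vv \<cdot>\<^bsub>arrow_cat C\<^esub> m'" for W m m' m''
    using descent_alg_act[OF alg, unfolded homD(2)[OF uv(1)]] that by blast
  have uP: "u' \<cdot> (\<pi> \<cdot> m) = a \<cdot> (u \<cdot> m)" "v' \<cdot> (\<pi> \<cdot> m) = \<xi> \<cdot> (v \<cdot> m)" "h' \<cdot> (\<pi> \<cdot> m) = \<xi> \<cdot> (h \<cdot> m)"
    if "m \<in> hom C W P" for W m
    using that u v h ab(1) \<pi> \<xi> by (simp_all add: cs cmp_eq[OF u(4)] cmp_eq[OF v(4)] cmp_eq[OF h(4)])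
  have alg1: "descent_alg C p x u v h"
    unfolding descent_alg_def homD(2)[OF u(2)] homD(2)[OF x(2)]
  proof (intro conjI allI ballI impI)
    show "x \<in> Mor C" "Cod C x = Dom C p" using x(2) P(1) by (auto simp: hom_def)
    show "is_pullback C p (p \<cdot> x) u v" by (rule pbs(1))
    show "h \<in> hom C P X" "x \<cdot> h = u" using h c by auto
  next
    fix W m assume m: "m \<in> hom C W P" "u \<cdot> m = x \<cdot> (v \<cdot> m)"
    have "u' \<cdot> (\<pi> \<cdot> m) = x' \<cdot> (v' \<cdot> (\<pi> \<cdot> m))"
      unfolding uP[OF m(1)] m(2) using x v(2) m(1) ab(1) \<xi> by (simp add: cs cmp_eq[OF x(4)])
    then show "h \<cdot> m = v \<cdot> m"
      using unit[OF arr_el1(1)[OF m(1) \<pi>]] u(1) v(1) x(1) h(1) m(2) by simp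
  next
    fix W m m' m'' assume m: "m \<in> hom C W P" "m' \<in> hom C W P" "m'' \<in> hom C W P" and
      e: "v \<cdot> m'' = h \<cdot> m'" "u \<cdot> m'' = u \<cdot> m" "v \<cdot> m = v \<cdot> m'"
    show "h \<cdot> m'' = h \<cdot> m"
      using act[OF arr_el1(1)[OF m(1) \<pi>] arr_el1(1)[OF m(2) \<pi>] arr_el1(1)[OF m(3) \<pi>]]
        u(1) v(1) h(1) e uP m by simp
  qed
  obtain N where N: "is_zero_ob C N" "N \<in> Ob C" using zero_obE .
  have alg2: "descent_alg C p' x' u' v' h'"
    unfolding descent_alg_def homD(2)[OF u(3)] homD(2)[OF x(3)]
  proof (intro conjI allI ballI impI)
    show "x' \<in> Mor C" "Cod C x' = Dom C p'" using x(3) P(2) by (auto simp: hom_def)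
    show "is_pullback C p' (p' \<cdot> x') u' v'" by (rule pbs(2))
    show "h' \<in> hom C P' X'" "x' \<cdot> h' = u'" using h c by auto
  next
    fix W m assume m: "m \<in> hom C W P'" "u' \<cdot> m = x' \<cdot> (v' \<cdot> m)"
    have "u \<cdot> zm C N P = x \<cdot> (v \<cdot> zm C N P)"
      using comp_zm[OF u(2) N(2)] comp_zm[OF v(2) N(2)] comp_zm[OF x(2) N(2)] by simp
    then show "h' \<cdot> m = v' \<cdot> m"
      using unit[OF arr_el2(1)[OF m(1) \<pi> N(1)]] u(1) v(1) x(1) h(1) m(2) by simp
  next
    fix W m m' m'' assume m: "m \<in> hom C W P'" "m' \<in> hom C W P'" "m'' \<in> hom C W P'" and
      e: "v' \<cdot> m'' = h' \<cdot> m'" "u' \<cdot> m'' = u' \<cdot> m" "v' \<cdot> m = v' \<cdot> m'"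
    have "v \<cdot> zm C N P = h \<cdot> zm C N P" using comp_zm[OF h(2) N(2)] comp_zm[OF v(2) N(2)] by simp
    then show "h' \<cdot> m'' = h' \<cdot> m"
      using act[OF arr_el2(1)[OF m(1) \<pi> N(1)] arr_el2(1)[OF m(2) \<pi> N(1)] arr_el2(1)[OF m(3) \<pi> N(1)]]
        u(1) v(1) h(1) e by simp
  qed
  obtain y q where yq: "is_pullback C p y x q" "q \<cdot> h = q \<cdot> v"
    using Q_descent[OF assms(2)] alg1 unfolding effective_algs_def by blast
  obtain y' q' where yq': "is_pullback C p' y' x' q'" "q' \<cdot> h' = q' \<cdot> v'"
    using Q_descent[OF assms(3)] alg2 unfolding effective_algs_def by blast
  obtain Y where Y: "y \<in> hom C Y B" "q \<in> hom C X Y" "p \<cdot> x = y \<cdot> q"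
    using pullbackE[OF yq(1)] P(1) x(2) by (metis homD(2,3))
  obtain Y' where Y': "y' \<in> hom C Y' B'" "q' \<in> hom C X' Y'" "p' \<cdot> x' = y' \<cdot> q'"
    using pullbackE[OF yq'(1)] P(2) x(3) by (metis homD(2,3))
  have qQ: "q \<in> Q" "q' \<in> Q"
    using Q_pb[OF pullback_sym[OF yq(1)] assms(2)] Q_pb[OF pullback_sym[OF yq'(1)] assms(3)] .
  \<comment> \<open>Elements with the same image under \<open>q\<close> differ by the action: one
    element \<open>m\<close> of the pullback has \<open>v \<cdot> m = s\<close> and
    \<open>h \<cdot> m = t\<close>. Moving \<open>m\<close> to the codomain vertex, where
    \<open>q'\<close> does not distinguish \<open>h'\<close> from \<open>v'\<close>, gives the
    claim.\<close>
  have "(q' \<cdot> \<xi>) \<cdot> s = (q' \<cdot> \<xi>) \<cdot> t" if st: "s \<in> hom C V X" "t \<in> hom C V X" "q \<cdot> s = q \<cdot> t" for V s t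
  proof -
    have "p \<cdot> (x \<cdot> t) = (p \<cdot> x) \<cdot> s" using st P(1) x(2) Y(1,2) by (simp add: cs cmp_eq[OF Y(3)])
    then obtain m where m: "m \<in> hom C V P" "u \<cdot> m = x \<cdot> t" "v \<cdot> m = s"
      using pullback_lift[OF pbs(1) P(1) comp_hom[OF P(1) x(2)] u(2) comp_hom[OF x(2) st(2)] st(1)] by metis
    have "h \<cdot> m = t"
    proof (rule pullback_unique[OF yq(1) x(2)])
      show "x \<cdot> (h \<cdot> m) = x \<cdot> t" using m(1,2) h(2) x(2) by (simp add: cs cmp_eq[OF c(1)])
      show "q \<cdot> (h \<cdot> m) = q \<cdot> t" using m(1,3) h(2) v(2) Y(2) st(3) by (simp add: cs cmp_eq[OF yq(2)])
    qed (use m h st comp_hom in blast)+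
    then have "(q' \<cdot> \<xi>) \<cdot> t = q' \<cdot> (\<xi> \<cdot> (h \<cdot> m))" using st \<xi> Y'(2) by (simp add: cs)
    also have "\<dots> = q' \<cdot> (h' \<cdot> (\<pi> \<cdot> m))" using uP(3)[OF m(1)] by simp
    also have "\<dots> = q' \<cdot> (v' \<cdot> (\<pi> \<cdot> m))" using m(1) \<pi> h(3) v(3) Y'(2) by (simp add: cs cmp_eq[OF yq'(2)])
    also have "\<dots> = (q' \<cdot> \<xi>) \<cdot> s" using uP(2)[OF m(1)] m(3) st(1) \<xi> Y'(2) by (simp add: cs)
    finally show ?thesis by simp
  qed
  then obtain \<upsilon> where \<upsilon>: "\<upsilon> \<in> hom C Y Y'" "\<upsilon> \<cdot> q = q' \<cdot> \<xi>"
    using Q_factor[OF qQ(1) Y(2) comp_hom[OF Y'(2) \<xi>]] by metis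
  have "b \<cdot> y = y' \<cdot> \<upsilon>"
  proof (rule Q_epi[OF qQ(1) Y(2)])
    have "(b \<cdot> y) \<cdot> q = b \<cdot> (p \<cdot> x)" using ab(2) Y by (simp add: cs)
    also have "\<dots> = p' \<cdot> (a \<cdot> x)" using P ab x(2) by (simp add: cs cmp_eq[OF P(3)])
    also have "\<dots> = (p' \<cdot> x') \<cdot> \<xi>" using P(2) x(3,4) \<xi> by (simp add: cs)
    also have "\<dots> = (y' \<cdot> \<upsilon>) \<cdot> q" using Y Y' \<upsilon> \<xi> by (simp add: cs)
    finally show "(b \<cdot> y) \<cdot> q = (y' \<cdot> \<upsilon>) \<cdot> q" .
  qed (use ab Y Y' \<upsilon> comp_hom in blast)+
  then have s: "Square \<upsilon> b y y' \<in> hom (arrow_cat C) \<upsilon> b" "Square \<xi> \<upsilon> q q' \<in> hom (arrow_cat C) \<xi> \<upsilon>"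
    using \<upsilon> Y Y' ab \<xi> by (auto intro!: arr_homI)
  have "is_pullback (arrow_cat C) (Square a b p p') (Square \<upsilon> b y y') xx (Square \<xi> \<upsilon> q q')"
    unfolding x(1) by (rule arr_pullbackI[OF \<xi> ab(1) \<upsilon>(1) ab(2) assms(1) s(1) xx[unfolded x(1)] s(2) yq(1) yq'(1)])
  moreover have "Square \<xi> \<upsilon> q q' \<cdot>\<^bsub>arrow_cat C\<^esub> hh = Square \<xi> \<upsilon> q q' \<cdot>\<^bsub>arrow_cat C\<^esub> vv"
    using h(1) v(1) yq(2) yq'(2) by simp
  ultimately show "\<exists>y q. is_pullback (arrow_cat C) (Square a b p p') y xx q \<and>
      q \<cdot>\<^bsub>arrow_cat C\<^esub> hh = q \<cdot>\<^bsub>arrow_cat C\<^esub> vv" by blast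
qed

lemma arr_pb_ex:
  assumes "f \<in> hom (arrow_cat C) x z" "g \<in> hom (arrow_cat C) y z"
  shows "\<exists>p q. is_pullback (arrow_cat C) f g p q"
proof -
  note O = arr_hom_Ob[OF assms(1)] arr_hom_Ob[OF assms(2)]
  obtain f1 f2 where f: "f = Square x z f1 f2" "f1 \<in> hom C (Dom C x) (Dom C z)" "f2 \<in> hom C (Cod C x) (Cod C z)"
    using arr_homE[OF assms(1) O(1,2)] .
  obtain g1 g2 where g: "g = Square y z g1 g2" "g1 \<in> hom C (Dom C y) (Dom C z)" "g2 \<in> hom C (Cod C y) (Cod C z)"
    using arr_homE[OF assms(2) O(3,4)] .
  obtain P p q where 1: "is_pullback C f1 g1 p q" "p \<in> hom C P (Dom C x)" using pbE[OF f(2) g(2)] .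
  obtain P' p' q' where 2: "is_pullback C f2 g2 p' q'" "p' \<in> hom C P' (Cod C x)" using pbE[OF f(3) g(3)] .
  obtain p0 where "is_pullback (arrow_cat C) (Square x z f1 f2) (Square y z g1 g2) (Square p0 x p p') (Square p0 y q q')"
    using arr_pullback_ex[OF O(1,3,2) assms(1)[unfolded f(1)] assms(2)[unfolded g(1)] 1(1) 2(1) 1(2) 2(2)] .
  then show ?thesis using f g by blast
qed

theorem hml_arrow: "hml (arrow_cat C) (sqQ C Q)"
proof unfold_locales
  fix f g :: "('o, 'm) cell" and X Y Z
  show "f \<in> hom (arrow_cat C) X Z \<Longrightarrow> g \<in> hom (arrow_cat C) Y Z \<Longrightarrow> \<exists>p q. is_pullback (arrow_cat C) f g p q"
    by (rule arr_pb_ex)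
next
  show "split_short_five (arrow_cat C)" by (rule arr_split_short_five[OF ssf])
next
  fix f assume "f \<in> sqQ C Q" then show "f \<in> Mor (arrow_cat C)" by (auto simp: sqQ_def)
next
  fix f g p q assume a: "is_pullback (arrow_cat C) f g p q" "g \<in> sqQ C Q"
  obtain x y z w f1 f2 g1 g2 p1 p2 q1 q2 where *:
    "f = Square x z f1 f2" "g = Square y z g1 g2" "p = Square w x p1 p2" "q = Square w y q1 q2"
    "Square x z f1 f2 \<in> hom (arrow_cat C) x z" "Square y z g1 g2 \<in> hom (arrow_cat C) y z"
    "Square w x p1 p2 \<in> hom (arrow_cat C) w x" "Square w y q1 q2 \<in> hom (arrow_cat C) w y"
    "is_pullback C f1 g1 p1 q1" "is_pullback C f2 g2 p2 q2" using arr_pb_squares[OF a(1)] .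
  show "p \<in> sqQ C Q" using Q_pb *(9,10) sqQ_D a(2) *(2,3) sqQ_iff[OF *(7)] by metis
next
  fix q k assume a: "q \<in> sqQ C Q" "is_kernel (arrow_cat C) k q"
  obtain x a b u u' f1 f2 where *: "k = Square x a u u'" "q = Square a b f1 f2"
    "Square x a u u' \<in> hom (arrow_cat C) x a" "Square a b f1 f2 \<in> hom (arrow_cat C) a b"
    "is_kernel C u f1" "is_kernel C u' f2" using arr_ker_squares[OF a(2)] .
  have "f1 \<in> Q" "f2 \<in> Q" using sqQ_D a(1) *(2) by auto
  then have "is_cokernel C f1 u" "is_cokernel C f2 u'" using Q_coker *(5,6) by auto
  then show "is_cokernel (arrow_cat C) q k" unfolding *(1,2)
    using arr_cokernelI[OF arr_hom_Ob(1)[OF *(3)] arr_hom_Ob[OF *(4)] *(3,4)] by blast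
next
  fix k f assume a: "is_kernel (arrow_cat C) k f"
  obtain x a b u u' f1 f2 where *: "k = Square x a u u'" "f = Square a b f1 f2"
    "Square x a u u' \<in> hom (arrow_cat C) x a" "Square a b f1 f2 \<in> hom (arrow_cat C) a b"
    "is_kernel C u f1" "is_kernel C u' f2" using arr_ker_squares[OF a] .
  obtain K K' A A' where h: "x \<in> hom C K K'" "a \<in> hom C A A'" using arr_hom_Ob[OF *(3)] by blast
  note u = arr_homD[OF *(3) h]
  obtain q where q: "q \<in> Q" "is_kernel C u q" using Q_normal[OF *(5)] by blast
  obtain q' where q': "q' \<in> Q" "is_kernel C u' q'" using Q_normal[OF *(6)] by blast
  obtain D where D: "q \<in> hom C A D" using q(2) u(1) by (metis kernelE homD(3))
  obtain D' where D': "q' \<in> hom C A' D'" using q'(2) u(2) by (metis kernelE homD(3))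
  \<comment> \<open>The quotients \<open>q\<close> and \<open>q'\<close> are chosen independently at
    the two vertices. An arrow between their codomains exists because \<open>q\<close> is a cokernel
    of \<open>u\<close> and \<open>q' \<cdot> a\<close> vanishes on \<open>u\<close>.\<close>
  have "(q' \<cdot> a) \<cdot> u = (q' \<cdot> u') \<cdot> x" using D' u h by (simp add: cs)
  then have "(q' \<cdot> a) \<cdot> u = zm C K D'"
    using kernel_zero[OF q'(2) u(2) D'] zm_comp[OF h(1)] hom_Ob2[OF D'] by simp
  then obtain d where d: "d \<in> hom C D D'" "d \<cdot> q = q' \<cdot> a"
    using cokernel_desc[OF Q_coker[OF q] u(1) D comp_hom[OF D' h(2)]] by metis
  have s: "Square a d q q' \<in> hom (arrow_cat C) a d" using h D D' d by (intro arr_homI) auto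
  then have "Square a d q q' \<in> sqQ C Q" using sqQ_iff q q' by blast
  then show "\<exists>q\<in>sqQ C Q. is_kernel (arrow_cat C) k q"
    using arr_kernelI[OF h d(1) *(3) s q(2) q'(2)] *(1) by blast
next
  fix f g :: "('o, 'm) cell" and X Y Z
  assume a: "f \<in> hom (arrow_cat C) X Y" "g \<in> hom (arrow_cat C) Y Z" "g \<cdot>\<^bsub>arrow_cat C\<^esub> f \<in> sqQ C Q"
  note O = arr_hom_Ob[OF a(1)] arr_hom_Ob[OF a(2)]
  obtain f1 f2 where f: "f = Square X Y f1 f2" "f1 \<in> hom C (Dom C X) (Dom C Y)" "f2 \<in> hom C (Cod C X) (Cod C Y)"
    using arr_homE[OF a(1) O(1,2)] .
  obtain g1 g2 where g: "g = Square Y Z g1 g2" "g1 \<in> hom C (Dom C Y) (Dom C Z)" "g2 \<in> hom C (Cod C Y) (Cod C Z)"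
    using arr_homE[OF a(2) O(3,4)] .
  have "Square X Z (g1 \<cdot> f1) (g2 \<cdot> f2) \<in> sqQ C Q" using a(3) f(1) g(1) by simp
  then have "g1 \<in> Q" "g2 \<in> Q"
    using sqQ_D Q_cancel[OF f(2) g(2)] Q_cancel[OF f(3) g(3)] by blast+
  then show "g \<in> sqQ C Q" using sqQ_iff[OF a(2)[unfolded g(1)]] unfolding g(1) by simp
next
  fix f assume a: "is_iso (arrow_cat C) f"
  then have "f \<in> Mor (arrow_cat C)" by (simp add: is_iso_def)
  moreover from this obtain a b f1 f2 where "f = Square a b f1 f2" unfolding arrow_cat_def by auto
  ultimately show "f \<in> sqQ C Q" using arr_isoD a Q_iso unfolding sqQ_def by blast
next
  fix f assume "f \<in> sqQ C Q"
  then show "effective_algs (arrow_cat C) f" using sqQ_E arr_effective_algs by metis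
qed

end

context pt_cat
begin

lemma id_pullback:
  assumes "g \<in> hom C Y X"
  shows "is_pullback C (Id C X) g g (Id C Y)"
proof -
  have O: "X \<in> Ob C" "Y \<in> Ob C" using assms hom_Ob1 hom_Ob2 by auto
  show ?thesis
  proof (rule pullbackI[OF id_hom[OF O(1)] assms assms id_hom[OF O(2)]])
    show "Id C X \<cdot> g = g \<cdot> Id C Y" using assms by (simp add: id_left id_right)
  next
    fix W u v assume "u \<in> hom C W X" "v \<in> hom C W Y" "Id C X \<cdot> u = g \<cdot> v"
    then show "\<exists>h\<in>hom C W Y. g \<cdot> h = u \<and> Id C Y \<cdot> h = v" by (metis id_left)
  next
    fix W u v assume "u \<in> hom C W Y" "v \<in> hom C W Y" "Id C Y \<cdot> u = Id C Y \<cdot> v"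
    then show "u = v" by (metis id_left)
  qed
qed

lemma zero_kernel_id:
  assumes "X \<in> Ob C" "is_zero_ob C Z"
  shows "is_kernel C (zm C Z X) (Id C X)" "is_cokernel C (Id C X) (zm C Z X)"
proof -
  have Z: "Z \<in> Ob C" using zero_ob_Ob[OF assms(2)] .
  note z = zm_hom[OF Z assms(1)] and i = id_hom[OF assms(1)]
  show "is_kernel C (zm C Z X) (Id C X)"
  proof (rule kernelI[OF z i])
    show "Id C X \<cdot> zm C Z X = zm C Z X" by (rule id_left[OF z])
  next
    fix W g assume g: "g \<in> hom C W X" "Id C X \<cdot> g = zm C W X"
    have W: "W \<in> Ob C" using g hom_Ob1 by blast
    have "zm C Z X \<cdot> zm C W Z = g" using zm_comp[OF zm_hom[OF W Z] assms(1)] g id_left by metis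
    then show "\<exists>h\<in>hom C W Z. zm C Z X \<cdot> h = g" using zm_hom[OF W Z] by blast
  qed (use to_zero_unique[OF assms(2)] in blast)
  show "is_cokernel C (Id C X) (zm C Z X)"
  proof (rule cokernelI[OF i z])
    show "Id C X \<cdot> zm C Z X = zm C Z X" by (rule id_left[OF z])
  next
    fix W g assume "g \<in> hom C X W" "g \<cdot> zm C Z X = zm C Z W"
    then show "\<exists>h\<in>hom C X W. h \<cdot> Id C X = g" by (metis id_right)
  next
    fix W g h assume "g \<in> hom C X W" "h \<in> hom C X W" "g \<cdot> Id C X = h \<cdot> Id C X"
    then show "g = h" by (metis id_right)
  qed
qed

end

section \<open>Closure properties of extensions in the arrow category\<close>

locale cell_ext = hml_ext C Q S E + cell_hml C Q for C :: "('o, 'm) cell_cat" (structure) and Q S E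
begin

lemma ext_I:
  assumes "Square a b f f' \<in> hom (arrow_cat C) a b" "f \<in> E" "f' \<in> E" "a \<in> E" "b \<in> E"
    and "is_pullback C f' b p q" "c \<in> hom C (Dom C a) (Dom C p)" "p \<cdot> c = a" "q \<cdot> c = f" "c \<in> E"
  shows "Square a b f f' \<in> ext_class C E"
proof -
  have "f' \<in> hom C (Cod C a) (Cod C b)" "f \<in> hom C (Dom C a) (Dom C b)"
    using assms(1) by (auto simp: arr_hom_iff)
  then have "p \<in> E" "q \<in> E"
    using E_pb[OF assms(6,5)] E_pb[OF pullback_sym[OF assms(6)] assms(3)] E_O assms(3,5) by auto
  then show ?thesis using assms unfolding ext_class_def by (auto simp: hom_def)
qed

lemma ext_E:
  assumes "x \<in> ext_class C E"
  obtains a b f f' A A' B B' P p q c where "x = Square a b f f'" "a \<in> hom C A A'" "b \<in> hom C B B'"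
    "f \<in> hom C A B" "f' \<in> hom C A' B'" "b \<cdot> f = f' \<cdot> a" "x \<in> hom (arrow_cat C) a b"
    "a \<in> E" "b \<in> E" "f \<in> E" "f' \<in> E" "is_pullback C f' b p q" "p \<in> hom C P A'" "q \<in> hom C P B"
    "c \<in> hom C A P" "p \<cdot> c = a" "q \<cdot> c = f" "c \<in> E" "p \<in> E" "q \<in> E"
proof -
  obtain a b f f' p q c where *: "x = Square a b f f'" "Square a b f f' \<in> Mor (arrow_cat C)"
    "f \<in> E" "f' \<in> E" "a \<in> E" "b \<in> E" "is_pullback C f' b p q" "p \<in> E" "q \<in> E"
    "c \<in> hom C (Dom C a) (Dom C p)" "p \<cdot> c = a" "q \<cdot> c = f" "c \<in> E"
    using assms unfolding ext_class_def by auto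
  have h: "Square a b f f' \<in> hom (arrow_cat C) a b" using *(2) by (simp add: hom_def)
  note O = arr_hom_Ob[OF h]
  note s = arr_homD[OF h O]
  note pq = pullback_homs[OF *(7) s(2) O(2)]
  show thesis by (rule that[OF *(1) O s _ *(5,6,3,4,7) pq *(10-13,8,9)]) (use h *(1) in simp)
qed

lemma ext_D:
  assumes "Square a b f f' \<in> ext_class C E"
  shows "Square a b f f' \<in> hom (arrow_cat C) a b" "f \<in> E" "f' \<in> E" "a \<in> E" "b \<in> E"
  using assms unfolding ext_class_def by (auto simp: hom_def)

text \<open>Membership in \<open>ext_class\<close> speaks of one pullback. The comparison with any
  other pullback differs from the given one by an isomorphism, which lies in
  \<open>E\<close>.\<close>

lemma ext_comparison:
  assumes "Square a b f f' \<in> ext_class C E" "is_pullback C f' b p q" "p \<in> hom C P A'"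
    and "c \<in> hom C A P" "p \<cdot> c = a" "q \<cdot> c = f"
  shows "c \<in> E"
proof -
  note h = ext_D[OF assms(1)]
  note O = arr_hom_Ob[OF h(1)]
  note s = arr_homD[OF h(1) O]
  obtain p0 q0 c0 where *: "is_pullback C f' b p0 q0" "c0 \<in> hom C (Dom C a) (Dom C p0)"
    "p0 \<cdot> c0 = a" "q0 \<cdot> c0 = f" "c0 \<in> E" using assms(1) unfolding ext_class_def by auto
  note pq = pullback_homs[OF *(1) s(2) O(2)]
  have e: "Cod C a = A'" "Dom C a = A" 
    using pullback_homs[OF assms(2) s(2) O(2)] assms(3,4,5) comp_hom[OF assms(3,4)] by (auto simp: hom_def)
  obtain i where i: "i \<in> hom C P (Dom C p0)" "is_iso C i" "p0 \<cdot> i = p" "q0 \<cdot> i = q"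
    using pullback_iso[OF *(1) assms(2) pq(1)] assms(3) e(1) by metis
  obtain j where j: "j \<in> hom C (Dom C p0) P" "j \<cdot> i = Id C P" "i \<cdot> j = Id C (Dom C p0)" "is_iso C j"
    using iso_inv[OF i(2,1)] .
  have ic: "i \<cdot> c \<in> hom C (Dom C a) (Dom C p0)" using comp_hom[OF i(1)] assms(4) e by simp
  have "i \<cdot> c = c0"
  proof (rule pullback_unique[OF *(1) pq(1) ic *(2)])
    show "p0 \<cdot> (i \<cdot> c) = p0 \<cdot> c0" using i(1) pq assms(4,5) *(3) by (simp add: cs cmp_eq[OF i(3)])
    show "q0 \<cdot> (i \<cdot> c) = q0 \<cdot> c0" using i(1) pq assms(4,6) *(4) by (simp add: cs cmp_eq[OF i(4)])
  qed
  then have "j \<cdot> c0 = c" using i(1) j(1) assms(4) by (auto simp: cs cmp_eq[OF j(2)])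
  moreover have "j \<in> E" using E_iso[OF j(4,1)] E_O[OF *(5)] *(2) by (simp add: hom_def)
  ultimately show ?thesis using E_comp[OF *(2) j(1) *(5)] by simp
qed

text \<open>\<open>b\<close> is in \<open>E\<close> by cancelling \<open>f\<close> from
  \<open>b \<cdot> f = f' \<cdot> a\<close>. As a pullback of \<open>f'\<close>, the projection
  \<open>q\<close> is invertible, so the comparison is \<open>f\<close> followed by an
  isomorphism.\<close>

lemma ext_iso:
  assumes "is_iso (arrow_cat C) x" "x \<in> hom (arrow_cat C) a b" "a \<in> E"
  shows "x \<in> ext_class C E"
proof -
  note O = arr_hom_Ob[OF assms(2)]
  obtain f f' where x: "x = Square a b f f'" "f \<in> hom C (Dom C a) (Dom C b)" "f' \<in> hom C (Cod C a) (Cod C b)"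
    "b \<cdot> f = f' \<cdot> a" using arr_homE[OF assms(2) O] .
  note i = arr_isoD[OF assms(1)[unfolded x(1)]]
  have fE: "f \<in> E" "f' \<in> E" using E_iso[OF i(1) x(2)] E_iso[OF i(2) x(3)] E_O[OF assms(3)] by auto
  have "b \<cdot> f \<in> E" using E_comp[OF O(1) x(3) assms(3) fE(2)] x(4) by simp
  then have bE: "b \<in> E" using E_cancel[OF x(2) O(2) fE(1)] by simp
  obtain P p q where pb: "is_pullback C f' b p q" "p \<in> hom C P (Cod C a)" "q \<in> hom C P (Dom C b)"
    using pbE[OF x(3) O(2)] .
  obtain c where c: "c \<in> hom C (Dom C a) P" "p \<cdot> c = a" "q \<cdot> c = f"
    using pullback_lift[OF pb(1) x(3) O(2) pb(2) O(1) x(2)] x(4) by metis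
  have qi: "is_iso C q" using iso_pullback[OF pullback_sym[OF pb(1)] i(2)] .
  obtain j where j: "j \<in> hom C (Dom C b) P" "is_iso C j" "j \<cdot> q = Id C P" using iso_inv[OF qi pb(3)] .
  have "j \<in> E" using E_iso[OF j(2,1)] E_O[OF bE] by blast
  then have "j \<cdot> f \<in> E" using E_comp[OF x(2) j(1) fE(1)] by blast
  moreover have "j \<cdot> f = c" unfolding c(3)[symmetric] using j(1) pb(3) c(1) by (simp add: cs cmp_eq[OF j(3)])
  ultimately have "c \<in> E" by simp
  then show ?thesis unfolding x(1)
    using ext_I[OF assms(2)[unfolded x(1)] fE assms(3) bE pb(1)] c pb(2) by (simp add: homD)
qed

text \<open>By pasting, \<open>k\<close> is the comparison morphism of the composite square, and
  \<open>l2 \<cdot> k = e \<cdot> f\<close> ties it to the comparison \<open>e\<close> of the second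
  square. Composition reads this equation in one direction, cancellation in the other.\<close>

lemma ext_compose_data:
  assumes "Square a b f f' \<in> hom (arrow_cat C) a b" "Square b c g g' \<in> hom (arrow_cat C) b c" "f' \<in> E" "c \<in> E" "g' \<in> E"
    and "is_pullback C g' c r s" "r \<in> hom C R (Cod C b)" "e \<in> hom C (Dom C b) R" "r \<cdot> e = b" "s \<cdot> e = g"
  obtains L l1 l2 k where "is_pullback C f' r l1 l2" "is_pullback C (g' \<cdot> f') c l1 (s \<cdot> l2)"
    "l1 \<in> hom C L (Cod C a)" "l2 \<in> hom C L R" "l1 \<in> E" "l2 \<in> E"
    "k \<in> hom C (Dom C a) L" "l1 \<cdot> k = a" "l2 \<cdot> k = e \<cdot> f"
proof -
  note O = arr_hom_Ob[OF assms(1)] arr_hom_Ob[OF assms(2)]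
  note f = arr_homD[OF assms(1) O(1,2)] and g = arr_homD[OF assms(2) O(3,4)]
  have s: "s \<in> hom C R (Dom C c)" using pullback_homs[OF assms(6) g(2) O(4)] assms(7) by (simp add: homD)
  have rE: "r \<in> E" using E_pb[OF assms(6,4)] E_O[OF assms(5)] by blast
  obtain L l1 l2 where L: "is_pullback C f' r l1 l2" "l1 \<in> hom C L (Cod C a)" "l2 \<in> hom C L R"
    using pbE[OF f(2) assms(7)] .
  have lE: "l1 \<in> E" "l2 \<in> E"
    using E_pb[OF L(1) rE] E_pb[OF pullback_sym[OF L(1)] assms(3)] E_O[OF assms(3)] E_O[OF rE] by auto
  have "is_pullback C c (g' \<cdot> f') (s \<cdot> l2) l1"
    using pullback_paste[OF pullback_sym[OF assms(6)] pullback_sym[OF L(1)]] .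
  then have big: "is_pullback C (g' \<cdot> f') c l1 (s \<cdot> l2)" by (rule pullback_sym)
  have "f' \<cdot> a = r \<cdot> (e \<cdot> f)" using f assms(7,8) by (simp add: cs cmp_eq[OF assms(9)] flip: f(3))
  then obtain k where k: "k \<in> hom C (Dom C a) L" "l1 \<cdot> k = a" "l2 \<cdot> k = e \<cdot> f"
    using pullback_lift[OF L(1) f(2) assms(7) L(2) O(1) comp_hom[OF assms(8) f(1)]] by metis
  show thesis using that[OF L(1) big L(2,3) lE k] .
qed

text \<open>The comparison of the composite is \<open>e' \<cdot> d\<close>, where \<open>d\<close>
  is the comparison of the first square and \<open>e'\<close> is the pullback along
  \<open>l2\<close> of the comparison \<open>e\<close> of the second.\<close>

lemma ext_comp:
  assumes "x \<in> hom (arrow_cat C) a b" "y \<in> hom (arrow_cat C) b c" "x \<in> ext_class C E" "y \<in> ext_class C E"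
  shows "y \<cdot>\<^bsub>arrow_cat C\<^esub> x \<in> ext_class C E"
proof -
  note O = arr_hom_Ob[OF assms(1)] arr_hom_Ob[OF assms(2)]
  obtain f f' where x: "x = Square a b f f'" using arr_homE[OF assms(1) O(1,2)] by metis
  obtain g g' where y: "y = Square b c g g'" using arr_homE[OF assms(2) O(3,4)] by metis
  note X = ext_D[OF assms(3)[unfolded x]] and Y = ext_D[OF assms(4)[unfolded y]]
  note f = arr_homD[OF X(1) O(1,2)] and g = arr_homD[OF Y(1) O(3,4)]
  obtain R r s where R: "is_pullback C g' c r s" "r \<in> hom C R (Cod C b)" "s \<in> hom C R (Dom C c)"
    using pbE[OF g(2) O(4)] .
  obtain e where e: "e \<in> hom C (Dom C b) R" "r \<cdot> e = b" "s \<cdot> e = g"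
    using pullback_lift[OF R(1) g(2) O(4) R(2) O(3) g(1)] g(3) by metis
  have eE: "e \<in> E" using ext_comparison[OF assms(4)[unfolded y] R(1,2) e] .
  obtain L l1 l2 k where L: "is_pullback C f' r l1 l2" "is_pullback C (g' \<cdot> f') c l1 (s \<cdot> l2)"
    "l1 \<in> hom C L (Cod C a)" "l2 \<in> hom C L R" "l1 \<in> E" "l2 \<in> E"
    "k \<in> hom C (Dom C a) L" "l1 \<cdot> k = a" "l2 \<cdot> k = e \<cdot> f"
    using ext_compose_data[OF X(1) Y(1) X(3) Y(5,3) R(1,2) e] .
  obtain P p q where P: "is_pullback C f' b p q" "p \<in> hom C P (Cod C a)" "q \<in> hom C P (Dom C b)"
    using pbE[OF f(2) O(2)] .
  obtain d where d: "d \<in> hom C (Dom C a) P" "p \<cdot> d = a" "q \<cdot> d = f"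
    using pullback_lift[OF P(1) f(2) O(2) P(2) O(1) f(1)] f(3) by metis
  have dE: "d \<in> E" using ext_comparison[OF assms(3)[unfolded x] P(1,2) d] .
  have "f' \<cdot> p = r \<cdot> (e \<cdot> q)" using pullback_comm[OF P(1)] P(3) R(2) e(1) by (simp add: cs cmp_eq[OF e(2)])
  then obtain e' where e': "e' \<in> hom C P L" "l1 \<cdot> e' = p" "l2 \<cdot> e' = e \<cdot> q"
    using pullback_lift[OF L(1) f(2) R(2) L(3) P(2) comp_hom[OF e(1) P(3)]] by metis
  have "is_pullback C l2 e e' q"
    using pullback_unpaste[OF L(1) _ e(1) R(2) e'(1) L(3) e'(2,3)] P(1) e(2) by simp
  then have e'E: "e' \<in> E" using E_pb eE E_O[OF L(6)] E_O[OF L(5)] L(3,4) by (metis homD(2))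
  have "e' \<cdot> d = k"
  proof (rule pullback_unique[OF L(1,3) comp_hom[OF e'(1) d(1)] L(7)])
    show "l1 \<cdot> (e' \<cdot> d) = l1 \<cdot> k" using L d e' by (simp add: cs cmp_eq[OF e'(2)])
    show "l2 \<cdot> (e' \<cdot> d) = l2 \<cdot> k" using L(4,9) d e'(1) e(1) P(3) f by (simp add: cs cmp_eq[OF e'(3)])
  qed
  then have kE: "k \<in> E" using E_comp[OF d(1) e'(1) dE e'E] by simp
  have "Square a c (g \<cdot> f) (g' \<cdot> f') \<in> ext_class C E"
  proof (rule ext_I[OF _ _ _ X(4) Y(5) L(2) _ L(8) _ kE])
    show "Square a c (g \<cdot> f) (g' \<cdot> f') \<in> hom (arrow_cat C) a c"
      using arr.comp_hom[OF assms(2,1)] x y by simp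
    show "g \<cdot> f \<in> E" "g' \<cdot> f' \<in> E" using E_comp f g X Y by blast+
    show "k \<in> hom C (Dom C a) (Dom C l1)" using L(3,7) by (simp add: homD)
    show "(s \<cdot> l2) \<cdot> k = g \<cdot> f" using L(4,7,9) R(3) e(1) f by (simp add: cs cmp_eq[OF e(3)])
  qed
  then show ?thesis using x y by simp
qed

text \<open>The comparison \<open>k\<close> of the composite is in \<open>E\<close>, so
  \<open>e \<cdot> f = l2 \<cdot> k\<close> is in \<open>E\<close>, and cancelling \<open>f\<close>
  leaves the comparison \<open>e\<close> of the second square.\<close>

lemma ext_cancel:
  assumes "x \<in> hom (arrow_cat C) a b" "y \<in> hom (arrow_cat C) b c" "x \<in> ext_class C E"
    "y \<cdot>\<^bsub>arrow_cat C\<^esub> x \<in> ext_class C E"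
  shows "y \<in> ext_class C E"
proof -
  note O = arr_hom_Ob[OF assms(1)] arr_hom_Ob[OF assms(2)]
  obtain f f' where x: "x = Square a b f f'" using arr_homE[OF assms(1) O(1,2)] by metis
  obtain g g' where y: "y = Square b c g g'" using arr_homE[OF assms(2) O(3,4)] by metis
  note X = ext_D[OF assms(3)[unfolded x]]
  have XY: "Square a c (g \<cdot> f) (g' \<cdot> f') \<in> ext_class C E" using assms(4) x y by simp
  note f = arr_homD[OF X(1) O(1,2)] and g = arr_homD[OF assms(2)[unfolded y] O(3,4)]
  have gE: "g \<in> E" "g' \<in> E" "c \<in> E"
    using E_cancel[OF f(1) g(1) X(2)] E_cancel[OF f(2) g(2) X(3)] ext_D[OF XY] by auto
  obtain R r s where R: "is_pullback C g' c r s" "r \<in> hom C R (Cod C b)" "s \<in> hom C R (Dom C c)"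
    using pbE[OF g(2) O(4)] .
  obtain e where e: "e \<in> hom C (Dom C b) R" "r \<cdot> e = b" "s \<cdot> e = g"
    using pullback_lift[OF R(1) g(2) O(4) R(2) O(3) g(1)] g(3) by metis
  obtain L l1 l2 k where L: "is_pullback C f' r l1 l2" "is_pullback C (g' \<cdot> f') c l1 (s \<cdot> l2)"
    "l1 \<in> hom C L (Cod C a)" "l2 \<in> hom C L R" "l1 \<in> E" "l2 \<in> E"
    "k \<in> hom C (Dom C a) L" "l1 \<cdot> k = a" "l2 \<cdot> k = e \<cdot> f"
    using ext_compose_data[OF X(1) assms(2)[unfolded y] X(3) gE(3,2) R(1,2) e] .
  have "(s \<cdot> l2) \<cdot> k = g \<cdot> f" using L(4,7,9) R(3) e(1) f by (simp add: cs cmp_eq[OF e(3)])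
  then have "k \<in> E" using ext_comparison[OF XY L(2,3,7,8)] by blast
  then have "e \<cdot> f \<in> E" using E_comp[OF L(7,4)] L(6,9) by simp
  then have "e \<in> E" using E_cancel[OF f(1) e(1) X(2)] by simp
  then have "Square b c g g' \<in> ext_class C E"
    using ext_I[OF assms(2)[unfolded y] gE(1,2) X(5) gE(3) R(1)] e R(2) by (simp add: homD)
  then show ?thesis using y by simp
qed

text \<open>Two pastings in the cube show that the comparison \<open>c\<close> of the pulled back
  square is the pullback along \<open>w\<close> of the comparison \<open>d\<close> of
  \<open>F\<close>. The arrow \<open>\<pi>\<close> then lies in \<open>E\<close> as
  \<open>m1 \<cdot> c\<close>.\<close>

lemma ext_pb:
  assumes "is_pullback (arrow_cat C) G F p q" "F \<in> ext_class C E" "Dom (arrow_cat C) G \<in> E"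
  shows "p \<in> ext_class C E"
proof -
  obtain \<gamma> a b \<pi> g g' f f' p1 p2 q1 q2 where *:
    "G = Square \<gamma> b g g'" "F = Square a b f f'" "p = Square \<pi> \<gamma> p1 p2" "q = Square \<pi> a q1 q2"
    "Square \<gamma> b g g' \<in> hom (arrow_cat C) \<gamma> b" "Square a b f f' \<in> hom (arrow_cat C) a b"
    "Square \<pi> \<gamma> p1 p2 \<in> hom (arrow_cat C) \<pi> \<gamma>" "Square \<pi> a q1 q2 \<in> hom (arrow_cat C) \<pi> a"
    "is_pullback C g f p1 q1" "is_pullback C g' f' p2 q2" using arr_pb_squares[OF assms(1)] .
  have \<gamma>E: "\<gamma> \<in> E" using assms(3) *(1) by simp
  note X = ext_D[OF assms(2)[unfolded *(2)]]
  note O = arr_hom_Ob[OF *(5)] arr_hom_Ob[OF *(8)]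
  note g = arr_homD[OF *(5) O(1,2)] and f = arr_homD[OF *(6) O(4,2)]
    and p = arr_homD[OF *(7) O(3,1)] and q = arr_homD[OF *(8) O(3,4)]
  have pE: "p1 \<in> E" "p2 \<in> E"
    using E_pb[OF *(9) X(2)] E_pb[OF *(10) X(3)] E_O[OF \<gamma>E] g by (auto simp: homD)
  obtain M m1 m2 where M: "is_pullback C p2 \<gamma> m1 m2" "m1 \<in> hom C M (Cod C \<pi>)" "m2 \<in> hom C M (Dom C \<gamma>)"
    using pbE[OF p(2) O(1)] .
  obtain c where c: "c \<in> hom C (Dom C \<pi>) M" "m1 \<cdot> c = \<pi>" "m2 \<cdot> c = p1"
    using pullback_lift[OF M(1) p(2) O(1) M(2) O(3) p(1)] p(3) by metis
  obtain N n1 n2 where N: "is_pullback C f' b n1 n2" "n1 \<in> hom C N (Cod C a)" "n2 \<in> hom C N (Dom C b)"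
    using pbE[OF f(2) O(2)] .
  obtain d where d: "d \<in> hom C (Dom C a) N" "n1 \<cdot> d = a" "n2 \<cdot> d = f"
    using pullback_lift[OF N(1) f(2) O(2) N(2) O(4) f(1)] f(3) by metis
  have dE: "d \<in> E" using ext_comparison[OF assms(2)[unfolded *(2)] N(1,2) d] .
  have m1E: "m1 \<in> E" using E_pb[OF M(1) \<gamma>E] E_O[OF pE(2)] by blast
  have "is_pullback C f' (g' \<cdot> \<gamma>) (q2 \<cdot> m1) m2"
    by (rule pullback_paste[OF pullback_sym[OF *(10)] M(1)])
  then have L1: "is_pullback C f' (b \<cdot> g) (q2 \<cdot> m1) m2" using g(3) by simp
  have "f' \<cdot> (q2 \<cdot> m1) = b \<cdot> (g \<cdot> m2)"
    using pullback_comm[OF L1] assoc[OF M(3) g(1) O(2)] by simp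
  then obtain w where w: "w \<in> hom C M N" "n1 \<cdot> w = q2 \<cdot> m1" "n2 \<cdot> w = g \<cdot> m2"
    using pullback_lift[OF N(1) f(2) O(2) N(2) comp_hom[OF q(2) M(2)] comp_hom[OF g(1) M(3)]] by metis
  have R1: "is_pullback C g n2 m2 w"
    by (rule pullback_sym[OF pullback_unpaste[OF N(1) L1 g(1) O(2) w(1) N(2) w(2,3)]])
  have "w \<cdot> c = d \<cdot> q1"
  proof (rule pullback_unique[OF N(1,2) comp_hom[OF w(1) c(1)] comp_hom[OF d(1) q(1)]])
    show "n1 \<cdot> (w \<cdot> c) = n1 \<cdot> (d \<cdot> q1)"
      using N(2) w(1) c(1,2) d(1) q M(2) by (simp add: cs cmp_eq[OF w(2)] cmp_eq[OF d(2)])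
    show "n2 \<cdot> (w \<cdot> c) = n2 \<cdot> (d \<cdot> q1)"
      using N(3) w(1) c(1,3) d(1) q(1) g(1) M(3) pullback_comm[OF *(9)] by (simp add: cs cmp_eq[OF w(3)] cmp_eq[OF d(3)])
  qed
  then have "is_pullback C w d c q1"
    using pullback_unpaste[OF R1 _ d(1) N(3) c(1) M(3) c(3)] *(9) d(3) by simp
  then have cE: "c \<in> E" using E_pb dE E_O[OF m1E] M(2) w(1) by (metis homD(2))
  have "\<pi> \<in> E" using E_comp[OF c(1) M(2) cE m1E] c(2) by simp
  then have "Square \<pi> \<gamma> p1 p2 \<in> ext_class C E"
    using ext_I[OF *(7) pE _ \<gamma>E M(1)] c M(2) cE by (simp add: homD)
  then show ?thesis using *(3) by simp
qed

lemma arr_zero_comps: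
  assumes "is_zero_ob (arrow_cat C) z"
  shows "z \<in> hom C (Dom C z) (Cod C z)" "is_zero_ob C (Dom C z)" "is_zero_ob C (Cod C z)" "is_iso C z"
proof -
  have z: "z \<in> Mor C" using arr.zero_ob_Ob[OF assms] by simp
  then show zh: "z \<in> hom C (Dom C z) (Cod C z)" by (rule Mor_hom)
  obtain Z where Z: "is_zero_ob C Z" "Z \<in> Ob C" using zero_obE .
  obtain i where i: "i \<in> hom (arrow_cat C) (Id C Z) z" "is_iso (arrow_cat C) i"
    using arr.zero_ob_iso[OF arr_zero_ob[OF Z(1)] assms] .
  obtain u u' where u: "i = Square (Id C Z) z u u'" "u \<in> hom C Z (Dom C z)" "u' \<in> hom C Z (Cod C z)"
    using arr_homE[OF i(1) id_hom[OF Z(2)] zh] .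
  show 1: "is_zero_ob C (Dom C z)" "is_zero_ob C (Cod C z)"
    using zero_ob_of_iso[OF Z(1)] u arr_isoD[OF i(2)[unfolded u(1)]] by auto
  show "is_iso C z" using zero_ob_iso[OF 1] to_zero_unique[OF 1(2) zh] by metis
qed

theorem hml_ext_arrow: "hml_ext (arrow_cat C) (sqQ C Q) E (ext_class C E)"
proof -
  interpret A: hml "arrow_cat C" "sqQ C Q" by (rule hml_arrow)
  show ?thesis
  proof unfold_locales
    fix X assume "X \<in> E" then show "X \<in> Ob (arrow_cat C)" using E_Mor by simp
  next
    fix f assume "f \<in> ext_class C E"
    then obtain a b f1 f2 where "f = Square a b f1 f2" "Square a b f1 f2 \<in> hom (arrow_cat C) a b" "f1 \<in> E" "f2 \<in> E"
      using ext_E ext_D by metis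
    then show "f \<in> sqQ C Q" using sqQ_iff E_Q by blast
  next
    fix f assume f: "f \<in> ext_class C E"
    then obtain a b f1 f2 where "f = Square a b f1 f2" using ext_E by metis
    then show "Dom (arrow_cat C) f \<in> E \<and> Cod (arrow_cat C) f \<in> E" using ext_D f by auto
  next
    fix f X Y assume "is_iso (arrow_cat C) f" "f \<in> hom (arrow_cat C) X Y" "X \<in> E"
    then show "f \<in> ext_class C E" by (rule ext_iso)
  next
    fix f g X Y Z assume "f \<in> hom (arrow_cat C) X Y" "g \<in> hom (arrow_cat C) Y Z" "f \<in> ext_class C E" "g \<in> ext_class C E"
    then show "g \<cdot>\<^bsub>arrow_cat C\<^esub> f \<in> ext_class C E" by (rule ext_comp)
  next
    fix f g p q assume "is_pullback (arrow_cat C) f g p q" "g \<in> ext_class C E" "Dom (arrow_cat C) f \<in> E"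
    then show "p \<in> ext_class C E" by (rule ext_pb)
  next
    fix f g X Y Z assume "f \<in> hom (arrow_cat C) X Y" "g \<in> hom (arrow_cat C) Y Z" "f \<in> ext_class C E"
      "g \<cdot>\<^bsub>arrow_cat C\<^esub> f \<in> ext_class C E"
    then show "g \<in> ext_class C E" by (rule ext_cancel)
  next
    fix Z f X assume a: "is_zero_ob (arrow_cat C) Z" "f \<in> hom (arrow_cat C) X Z" "X \<in> E"
    note O = arr_hom_Ob[OF a(2)]
    obtain g g' where g: "f = Square X Z g g'" "g \<in> hom C (Dom C X) (Dom C Z)" "g' \<in> hom C (Cod C X) (Cod C Z)"
      "Z \<cdot> g = g' \<cdot> X" using arr_homE[OF a(2) O] .
    note z = arr_zero_comps[OF a(1)]
    have gE: "g \<in> E" "g' \<in> E" using E_zero[OF z(2) g(2)] E_zero[OF z(3) g(3)] E_O[OF a(3)] by auto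
    have ZE: "Z \<in> E" using E_iso[OF z(4,1) O_zero[OF z(2)]] .
    obtain P p q where P: "is_pullback C g' Z p q" "p \<in> hom C P (Cod C X)" "q \<in> hom C P (Dom C Z)"
      using pbE[OF g(3) z(1)] .
    obtain c where c: "c \<in> hom C (Dom C X) P" "p \<cdot> c = X" "q \<cdot> c = g"
      using pullback_lift[OF P(1) g(3) z(1) P(2) O(1) g(2)] g(4) by metis
    \<comment> \<open>The arrow \<open>Z\<close> is invertible, hence so is its pullback
      \<open>p\<close>, and the comparison is \<open>X\<close> followed by the inverse of
      \<open>p\<close>.\<close>
    have "is_iso C p" using iso_pullback[OF P(1) z(4)] .
    then obtain j where j: "j \<in> hom C (Cod C X) P" "is_iso C j" "j \<cdot> p = Id C P" using iso_inv[OF _ P(2)] by metis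
    have "j \<cdot> (p \<cdot> c) = c" using j(1) P(2) c(1) by (simp add: cs cmp_eq[OF j(3)])
    moreover have "j \<in> E" using E_iso[OF j(2,1)] E_O[OF a(3)] by blast
    ultimately have "c \<in> E" using E_comp[OF O(1) j(1) a(3)] c(2) by simp
    then show "f \<in> ext_class C E" unfolding g(1)
      using ext_I[OF a(2)[unfolded g(1)] gE a(3) ZE P(1)] c P(2) by (simp add: homD)
  next
    fix Z assume a: "is_zero_ob (arrow_cat C) Z"
    note z = arr_zero_comps[OF a]
    show "Z \<in> E" using E_iso[OF z(4,1) O_zero[OF z(2)]] .
  next
    fix p y x q assume a: "is_pullback (arrow_cat C) p y x q" "p \<in> ext_class C E" "x \<in> ext_class C E"
    obtain a0 \<upsilon> b \<xi> p1 p2 y1 y2 x1 x2 q1 q2 where *: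
      "p = Square a0 b p1 p2" "y = Square \<upsilon> b y1 y2" "x = Square \<xi> a0 x1 x2" "q = Square \<xi> \<upsilon> q1 q2"
      "Square a0 b p1 p2 \<in> hom (arrow_cat C) a0 b" "Square \<upsilon> b y1 y2 \<in> hom (arrow_cat C) \<upsilon> b"
      "Square \<xi> a0 x1 x2 \<in> hom (arrow_cat C) \<xi> a0" "Square \<xi> \<upsilon> q1 q2 \<in> hom (arrow_cat C) \<xi> \<upsilon>"
      "is_pullback C p1 y1 x1 q1" "is_pullback C p2 y2 x2 q2" using arr_pb_squares[OF a(1)] .
    note P = ext_D[OF a(2)[unfolded *(1)]] and X = ext_D[OF a(3)[unfolded *(3)]]
    note O = arr_hom_Ob[OF *(8)] and O2 = arr_hom_Ob[OF *(6)]
    note q = arr_homD[OF *(8) O] and y = arr_homD[OF *(6) O2]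
    have "q1 \<in> E" "q2 \<in> E"
      using E_pb[OF pullback_sym[OF *(9)] P(2)] E_pb[OF pullback_sym[OF *(10)] P(3)]
        E_desc[OF *(9) P(2) X(2)] E_desc[OF *(10) P(3) X(3)] by auto
    \<comment> \<open>Once \<open>q1\<close> and \<open>q2\<close> are known to be in
      \<open>E\<close> by descent at each vertex,
      \<open>\<upsilon> \<cdot> q1 = q2 \<cdot> \<xi>\<close> is a composite of members of
      \<open>E\<close>, and \<open>q1\<close> can be cancelled.\<close>
    then have "\<upsilon> \<in> E" using E_cancel[OF q(1) O(2)] E_comp[OF O(1) q(2) X(4)] q(3) by simp
    then show "Dom (arrow_cat C) y \<in> E" using *(2) by simp
  qed
qed

end

text \<open>The codomain may be any zero object, so the class is closed under isomorphism from the
  start. \<open>Tsub_eq\<close> identifies its iterates with the replete images under the powers of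
  \<open>iota\<close>.\<close>

definition arrT :: "('o, 'm) cell_cat \<Rightarrow> ('o, 'm) cell set \<Rightarrow> ('o, 'm) cell set" where
  "arrT C T = {f \<in> Mor C. Dom C f \<in> T \<and> is_zero_ob C (Cod C f)}"

definition arrF :: "('o, 'm) cell_cat \<Rightarrow> ('o, 'm) cell set \<Rightarrow> ('o, 'm) cell set" where
  "arrF C F = {f \<in> Mor C. \<exists>k. is_kernel C k f \<and> Dom C k \<in> F}"

section \<open>The torsion theory of the arrow category\<close>

locale cell_tors = hml_tors C Q S E T F + cell_ext C Q S E for C :: "('o, 'm) cell_cat" (structure) and Q S E T F
begin

lemma arrF_kernel:
  assumes "a \<in> arrF C F" "is_kernel C k a" "k \<in> hom C K A"
  shows "K \<in> F"
proof -
  obtain k' where k': "is_kernel C k' a" "Dom C k' \<in> F" using assms(1) unfolding arrF_def by blast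
  have "k' \<in> hom C (Dom C k') A"
    using k'(1) assms(2,3) by (auto simp: is_kernel_def hom_def)
  then obtain i where "i \<in> hom C (Dom C k') K" "is_iso C i" using kernel_iso[OF assms(2) k'(1) assms(3)] by metis
  then show ?thesis using F_replete k'(2) by blast
qed

text \<open>\<open>tors_normal\<close> makes \<open>k \<cdot> t\<close> the kernel of some
  \<open>q\<close> in \<open>Q\<close>, and \<open>a\<close> factors as
  \<open>\<alpha> \<cdot> q\<close>. Dividing only at the domain, by \<open>q\<close> over the
  identity of \<open>A'\<close>, turns \<open>a\<close> into \<open>\<alpha>\<close>. The kernel of
  \<open>\<alpha>\<close> is the quotient of \<open>K\<close> by its torsion part, which is why
  \<open>\<alpha>\<close> is torsion free.\<close>

lemma arr_torsion:
  assumes "a \<in> hom C A A'" "k \<in> hom C K A" "is_kernel C k a" "t \<in> hom C T0 K" "torsion_part C T F t" "is_zero_ob C Z"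
  defines "x \<equiv> Square (zm C T0 Z) a (k \<cdot> t) (zm C Z A')"
  obtains q \<alpha> D where "q \<in> Q" "q \<in> hom C A D" "a \<in> E \<Longrightarrow> q \<in> E" "\<alpha> \<in> hom C D A'" "\<alpha> \<cdot> q = a"
    "x \<in> hom (arrow_cat C) (zm C T0 Z) a" "Square a \<alpha> q (Id C A') \<in> hom (arrow_cat C) a \<alpha>"
    "is_kernel (arrow_cat C) x (Square a \<alpha> q (Id C A'))" "is_cokernel (arrow_cat C) (Square a \<alpha> q (Id C A')) x"
    "\<alpha> \<in> arrF C F" "zm C T0 Z \<in> arrT C T"
proof -
  note Z = zero_ob_Ob[OF assms(6)]
  obtain e Y where e: "e \<in> hom C K Y" "is_kernel C t e" "is_cokernel C e t" "T0 \<in> T" "Y \<in> F"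
    using torsion_partE[OF assms(5,4)] .
  note O = hom_Ob1[OF assms(1)] hom_Ob2[OF assms(1)] hom_Ob1[OF assms(4)]
  have kt: "k \<cdot> t \<in> hom C T0 A" using comp_hom assms(2,4) by blast
  obtain q where q: "q \<in> Q" "is_kernel C (k \<cdot> t) q" "a \<in> E \<Longrightarrow> q \<in> E"
    using tors_normal[OF assms(3,5)] assms(2,4) by (auto simp: homD)
  obtain D where D: "q \<in> hom C A D" using kernelE[OF q(2)] kt by (metis homD(3))
  note qc = Q_coker[OF q(1,2)]
  have akt: "a \<cdot> (k \<cdot> t) = zm C T0 A'"
    using assoc[OF assms(4,2,1)] kernel_zero[OF assms(3,2,1)] zm_comp[OF assms(4) O(2)] by simp
  obtain \<alpha> where \<alpha>: "\<alpha> \<in> hom C D A'" "\<alpha> \<cdot> q = a" using cokernel_desc[OF qc kt D assms(1) akt] .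
  have tz: "zm C T0 Z \<in> hom C T0 Z" using zm_hom O(3) Z by blast
  note zA = zm_hom[OF Z O(2)]
  have x: "x \<in> hom (arrow_cat C) (zm C T0 Z) a" unfolding x_def
    using tz assms(1) kt zA akt zm_comp[OF tz O(2)] by (intro arr_homI) auto
  have \<eta>: "Square a \<alpha> q (Id C A') \<in> hom (arrow_cat C) a \<alpha>"
    using assms(1) \<alpha> D id_hom[OF O(2)] by (intro arr_homI) (auto simp: id_left)
  have ker: "is_kernel (arrow_cat C) x (Square a \<alpha> q (Id C A'))" unfolding x_def
    by (rule arr_kernelI[OF tz assms(1) \<alpha>(1) x[unfolded x_def] \<eta> q(2) zero_kernel_id(1)[OF O(2) assms(6)]])
  have coker: "is_cokernel (arrow_cat C) (Square a \<alpha> q (Id C A')) x" unfolding x_def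
    by (rule arr_cokernelI[OF tz assms(1) \<alpha>(1) x[unfolded x_def] \<eta> qc zero_kernel_id(2)[OF O(2) assms(6)]])
  obtain K1 \<kappa> where \<kappa>: "\<kappa> \<in> hom C K1 D" "is_kernel C \<kappa> \<alpha>" using kernel_ex[OF \<alpha>(1)] .
  have qk: "q \<cdot> k \<in> hom C K D" using comp_hom[OF D assms(2)] .
  have "\<alpha> \<cdot> (q \<cdot> k) = zm C K A'"
    using assoc[OF assms(2) D \<alpha>(1)] \<alpha>(2) kernel_zero[OF assms(3,2,1)] by simp
  then obtain e' where e': "e' \<in> hom C K K1" "\<kappa> \<cdot> e' = q \<cdot> k" using kernel_lift[OF \<kappa>(2,1) \<alpha>(1) qk] by metis
  \<comment> \<open>\<open>e'\<close> is the pullback of \<open>q\<close> along the kernel of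
    \<open>\<alpha>\<close>. It is therefore a member of \<open>Q\<close> with kernel
    \<open>t\<close>, hence another cokernel of \<open>t\<close>, and its codomain is isomorphic to
    the torsion free quotient \<open>Y\<close>.\<close>
  have pb: "is_pullback C \<kappa> q e' k"
  proof (rule pullbackI[OF \<kappa>(1) D e'(1) assms(2) e'(2)])
    fix W u v assume uv: "u \<in> hom C W K1" "v \<in> hom C W A" "\<kappa> \<cdot> u = q \<cdot> v"
    have "a \<cdot> v = (\<alpha> \<cdot> \<kappa>) \<cdot> u" using uv \<kappa>(1) D \<alpha>(1) unfolding \<alpha>(2)[symmetric] by (simp add: cs)
    then have "a \<cdot> v = zm C W A'" using kernel_zero[OF \<kappa>(2,1) \<alpha>(1)] zm_comp[OF uv(1) O(2)] by simp
    then obtain h where h: "h \<in> hom C W K" "k \<cdot> h = v" using kernel_lift[OF assms(3,2,1) uv(2)] by metis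
    have "e' \<cdot> h = u"
    proof (rule kernel_mono[OF \<kappa>(2,1) comp_hom[OF e'(1) h(1)] uv(1)])
      have "\<kappa> \<cdot> (e' \<cdot> h) = q \<cdot> (k \<cdot> h)" using \<kappa>(1) D e'(1) h(1) assms(2) by (simp add: cs cmp_eq[OF e'(2)])
      then show "\<kappa> \<cdot> (e' \<cdot> h) = \<kappa> \<cdot> u" using h(2) uv(3) by simp
    qed
    then show "\<exists>h\<in>hom C W K. e' \<cdot> h = u \<and> k \<cdot> h = v" using h by blast
  qed (use kernel_mono[OF assms(3,2)] in blast)
  have e'Q: "e' \<in> Q" using Q_pb[OF pb q(1)] .
  have e't: "e' \<cdot> t = zm C T0 K1"
  proof (rule kernel_mono[OF \<kappa>(2,1) comp_hom[OF e'(1) assms(4)] zm_hom[OF O(3) hom_Ob1[OF \<kappa>(1)]]])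
    have "\<kappa> \<cdot> (e' \<cdot> t) = q \<cdot> (k \<cdot> t)" using \<kappa>(1) D e'(1) assms(2,4) by (simp add: cs cmp_eq[OF e'(2)])
    then show "\<kappa> \<cdot> (e' \<cdot> t) = \<kappa> \<cdot> zm C T0 K1"
      using kernel_zero[OF q(2) kt D] comp_zm[OF \<kappa>(1) O(3)] by simp
  qed
  have "is_kernel C t e'" by (rule kernel_pullback'[OF pb e'(1) assms(2) q(2) assms(4) refl e't])
  then obtain i where "i \<in> hom C Y K1" "is_iso C i"
    using cokernel_iso[OF e(3) Q_coker[OF e'Q] e(1) e'(1)] by metis
  then have "K1 \<in> F" using F_replete e(5) by blast
  then have "\<alpha> \<in> arrF C F" unfolding arrF_def using \<kappa> \<alpha>(1) by (auto simp: homD)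
  moreover have "zm C T0 Z \<in> arrT C T" unfolding arrT_def using tz e(4) assms(6) by (auto simp: homD)
  ultimately show thesis using that[OF q(1) D q(3) \<alpha> x \<eta> ker coker] by blast
qed

lemma arr_torsion_theory: "torsion_theory (arrow_cat C) (arrT C T) (arrF C F)"
  unfolding torsion_theory_def
proof (intro conjI ballI)
  show "category (arrow_cat C)" "pointed (arrow_cat C)" by (rule arr_category, rule arr.is_pointed)
  have iso: "\<exists>u u'. u \<in> hom C (Dom C X) (Dom C Y) \<and> u' \<in> hom C (Cod C X) (Cod C Y) \<and> is_iso C u \<and> is_iso C u' \<and>
      Y \<cdot> u = u' \<cdot> X" if iso: "isomorphic (arrow_cat C) X Y" for X Y
  proof -
    obtain z where z: "z \<in> hom (arrow_cat C) X Y" "is_iso (arrow_cat C) z" using iso unfolding isomorphic_def by blast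
    note O = arr_hom_Ob[OF z(1)]
    obtain u u' where u: "z = Square X Y u u'" "u \<in> hom C (Dom C X) (Dom C Y)" "u' \<in> hom C (Cod C X) (Cod C Y)"
      "Y \<cdot> u = u' \<cdot> X" using arr_homE[OF z(1) O] .
    then show ?thesis using arr_isoD[OF z(2)[unfolded u(1)]] by blast
  qed
  show "replete (arrow_cat C) (arrT C T)"
    unfolding replete_def
  proof (intro conjI ballI impI)
    show "arrT C T \<subseteq> Ob (arrow_cat C)" unfolding arrT_def by auto
    fix X Y assume XY: "X \<in> arrT C T" "Y \<in> Ob (arrow_cat C)" "isomorphic (arrow_cat C) X Y"
    then show "Y \<in> arrT C T" unfolding arrT_def using iso[OF XY(3)] T_replete zero_ob_of_iso by auto
  qed
  show "replete (arrow_cat C) (arrF C F)"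
    unfolding replete_def
  proof (intro conjI ballI impI)
    show "arrF C F \<subseteq> Ob (arrow_cat C)" unfolding arrF_def by auto
    fix X Y assume XY: "X \<in> arrF C F" "Y \<in> Ob (arrow_cat C)" "isomorphic (arrow_cat C) X Y"
    obtain k where k: "is_kernel C k X" "Dom C k \<in> F" using XY(1) unfolding arrF_def by blast
    obtain u u' where u: "u \<in> hom C (Dom C X) (Dom C Y)" "u' \<in> hom C (Cod C X) (Cod C Y)" "is_iso C u" "is_iso C u'"
      "Y \<cdot> u = u' \<cdot> X" using iso[OF XY(3)] by blast
    have X: "X \<in> hom C (Dom C X) (Cod C X)" and Y: "Y \<in> hom C (Dom C Y) (Cod C Y)"
      using XY(1,2) Mor_hom by (auto simp: arrF_def)
    have kh: "k \<in> hom C (Dom C k) (Dom C X)" using k(1) by (auto simp: is_kernel_def hom_def)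
    have "is_kernel C k (u' \<cdot> X)"
      using kernel_comp_mono[OF k(1) X u(2)] iso_mono[OF u(4,2)] by blast
    then have ky: "is_kernel C k (Y \<cdot> u)" using u(5) by simp
    obtain v where v: "v \<in> hom C (Dom C Y) (Dom C X)" "v \<cdot> u = Id C (Dom C X)" "u \<cdot> v = Id C (Dom C Y)"
      using isoE[OF u(3,1)] .
    have uk: "u \<cdot> k \<in> hom C (Dom C k) (Dom C Y)" using comp_hom u kh by blast
    have "is_kernel C (u \<cdot> k) Y"
    proof (rule kernelI[OF uk Y])
      show "Y \<cdot> (u \<cdot> k) = zm C (Dom C k) (Cod C Y)"
        using kernel_zero[OF ky kh comp_hom[OF Y u(1)]] assoc[OF kh u(1) Y] by simp
    next
      fix W g assume g: "g \<in> hom C W (Dom C Y)" "Y \<cdot> g = zm C W (Cod C Y)"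
      have "u \<cdot> (v \<cdot> g) = g" using assoc[OF g(1) v(1) u(1)] v(3) id_left[OF g(1)] by simp
      then have "(Y \<cdot> u) \<cdot> (v \<cdot> g) = zm C W (Cod C Y)" using assoc[OF comp_hom[OF v(1) g(1)] u(1) Y] g(2) by simp
      then obtain h where h: "h \<in> hom C W (Dom C k)" "k \<cdot> h = v \<cdot> g"
        using kernel_lift[OF ky kh comp_hom[OF Y u(1)] comp_hom[OF v(1) g(1)]] by metis
      then show "\<exists>h\<in>hom C W (Dom C k). (u \<cdot> k) \<cdot> h = g"
        using \<open>u \<cdot> (v \<cdot> g) = g\<close> assoc[OF h(1) kh u(1)] by auto
    next
      fix W g h assume gh: "g \<in> hom C W (Dom C k)" "h \<in> hom C W (Dom C k)" "(u \<cdot> k) \<cdot> g = (u \<cdot> k) \<cdot> h"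
      have "k \<cdot> g = k \<cdot> h"
        using iso_mono[OF u(3,1) comp_hom[OF kh gh(1)] comp_hom[OF kh gh(2)]] gh(3)
          assoc[OF gh(1) kh u(1)] assoc[OF gh(2) kh u(1)] by simp
      then show "g = h" using kernel_mono[OF k(1) kh gh(1,2)] by blast
    qed
    then show "Y \<in> arrF C F" unfolding arrF_def using k(2) XY(2) uk by (auto simp: homD)
  qed
next
  fix X Y x assume a: "X \<in> arrT C T" "Y \<in> arrF C F" "x \<in> hom (arrow_cat C) X Y"
  note O = arr_hom_Ob[OF a(3)]
  obtain m m' where m: "x = Square X Y m m'" "m \<in> hom C (Dom C X) (Dom C Y)" "m' \<in> hom C (Cod C X) (Cod C Y)"
    "Y \<cdot> m = m' \<cdot> X" using arr_homE[OF a(3) O] .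
  have X: "Dom C X \<in> T" "is_zero_ob C (Cod C X)" using a(1) unfolding arrT_def by auto
  note XO = hom_Ob1[OF m(2)] hom_Ob1[OF m(3)] hom_Ob2[OF m(3)]
  \<comment> \<open>The codomain component starts at a zero object. Consequently the domain
    component lands in the kernel of \<open>Y\<close>, which is torsion free.\<close>
  have m': "m' = zm C (Cod C X) (Cod C Y)" using zm_from_zero[OF X(2) m(3)] .
  have Ym: "Y \<cdot> m = zm C (Dom C X) (Cod C Y)" using m(4) m' zm_comp[OF O(1) XO(3)] by simp
  obtain K k where k: "k \<in> hom C K (Dom C Y)" "is_kernel C k Y" using kernel_ex[OF O(2)] .
  obtain h where h: "h \<in> hom C (Dom C X) K" "k \<cdot> h = m" using kernel_lift[OF k(2,1) O(2) m(2) Ym] .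
  have "h = zm C (Dom C X) K" using T_F_zero[OF h(1) X(1) arrF_kernel[OF a(2) k(2,1)]] .
  then have "m = zm C (Dom C X) (Dom C Y)" using h(2) comp_zm[OF k(1) XO(1)] by simp
  then have "x = zm (arrow_cat C) X Y" using m(1) m' arr_zm[OF O] by simp
  then show "is_zero_mor (arrow_cat C) x" using arr.zero_iff[OF a(3)] by simp
next
  fix a assume "a \<in> Ob (arrow_cat C)"
  then have a: "a \<in> hom C (Dom C a) (Cod C a)" by (simp add: Mor_hom)
  obtain K k where k: "k \<in> hom C K (Dom C a)" "is_kernel C k a" using kernel_ex[OF a] .
  obtain T0 t where t: "t \<in> hom C T0 K" "torsion_part C T F t" using torsion_part_ex[OF hom_Ob1[OF k(1)]] .
  obtain Z where Z: "is_zero_ob C Z" using zero_obE by metis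
  let ?x = "Square (zm C T0 Z) a (k \<cdot> t) (zm C Z (Cod C a))"
  obtain q \<alpha> D where *: "?x \<in> hom (arrow_cat C) (zm C T0 Z) a"
    "is_kernel (arrow_cat C) ?x (Square a \<alpha> q (Id C (Cod C a)))" 
    "is_cokernel (arrow_cat C) (Square a \<alpha> q (Id C (Cod C a))) ?x"
    "\<alpha> \<in> arrF C F" "zm C T0 Z \<in> arrT C T"
    by (rule arr_torsion[OF a k t Z])
  show "\<exists>t e. short_exact (arrow_cat C) t e \<and> Cod (arrow_cat C) t = a \<and> Dom (arrow_cat C) t \<in> arrT C T \<and>
      Cod (arrow_cat C) e \<in> arrF C F"
    unfolding short_exact_def using *
    by (intro exI[of _ ?x] exI[of _ "Square a \<alpha> q (Id C (Cod C a))"]) simp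
qed

sublocale arrt: tors_cat "arrow_cat C" "arrT C T" "arrF C F"
  by unfold_locales (rule arr_torsion_theory)

lemma arr_torsion_part:
  assumes "a \<in> hom C A A'" "k \<in> hom C K A" "is_kernel C k a" "t \<in> hom C T0 K" "torsion_part C T F t" "is_zero_ob C Z"
  shows "torsion_part (arrow_cat C) (arrT C T) (arrF C F) (Square (zm C T0 Z) a (k \<cdot> t) (zm C Z A'))"
    "Square (zm C T0 Z) a (k \<cdot> t) (zm C Z A') \<in> hom (arrow_cat C) (zm C T0 Z) a"
proof -
  let ?x = "Square (zm C T0 Z) a (k \<cdot> t) (zm C Z A')"
  obtain q \<alpha> D where *: "?x \<in> hom (arrow_cat C) (zm C T0 Z) a"
    "Square a \<alpha> q (Id C A') \<in> hom (arrow_cat C) a \<alpha>"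
    "is_kernel (arrow_cat C) ?x (Square a \<alpha> q (Id C A'))"
    "is_cokernel (arrow_cat C) (Square a \<alpha> q (Id C A')) ?x"
    "\<alpha> \<in> arrF C F" "zm C T0 Z \<in> arrT C T"
    by (rule arr_torsion[OF assms])
  show "torsion_part (arrow_cat C) (arrT C T) (arrF C F) ?x"
    by (rule arrt.torsion_partI[OF *(1,2,3,4,6,5)])
  show "?x \<in> hom (arrow_cat C) (zm C T0 Z) a" by (rule *(1))
qed

text \<open>The composite inclusion is concentrated at the domain vertex, where it is the torsion
  part of the intersection of the kernels of \<open>f\<close> and \<open>a\<close>. That
  intersection is the kernel of the comparison \<open>g\<close> from \<open>A\<close> to the
  pullback, so the axiom one level below applies to \<open>g\<close>. If \<open>ff\<close> is an
  extension then \<open>g\<close> is in \<open>E\<close>, and this yields a quotient in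
  \<open>E\<close>.\<close>

lemma arr_tors_normal:
  assumes "is_kernel (arrow_cat C) \<kappa>\<kappa> ff" "torsion_part (arrow_cat C) (arrT C T) (arrF C F) \<tau>"
    "Cod (arrow_cat C) \<tau> = Dom (arrow_cat C) \<kappa>\<kappa>"
  shows "\<exists>q \<in> sqQ C Q. is_kernel (arrow_cat C) (\<kappa>\<kappa> \<cdot>\<^bsub>arrow_cat C\<^esub> \<tau>) q \<and> (ff \<in> ext_class C E \<longrightarrow> q \<in> ext_class C E)"
proof -
  obtain \<kappa> a b u u' f f' where *: "\<kappa>\<kappa> = Square \<kappa> a u u'" "ff = Square a b f f'"
    "Square \<kappa> a u u' \<in> hom (arrow_cat C) \<kappa> a" "Square a b f f' \<in> hom (arrow_cat C) a b"
    "is_kernel C u f" "is_kernel C u' f'" using arr_ker_squares[OF assms(1)] .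
  obtain K K' A A' B B' where h: "\<kappa> \<in> hom C K K'" "a \<in> hom C A A'" "b \<in> hom C B B'"
    using arr_hom_Ob[OF *(3)] arr_hom_Ob[OF *(4)] by blast
  note u = arr_homD[OF *(3) h(1,2)] and f = arr_homD[OF *(4) h(2,3)]
  have \<tau>: "\<tau> \<in> hom (arrow_cat C) (Dom (arrow_cat C) \<tau>) \<kappa>"
    using assms(2,3) *(1) by (auto simp: torsion_part_def short_exact_def is_kernel_def hom_def)
  obtain Z where Z: "is_zero_ob C Z" "Z \<in> Ob C" using zero_obE .
  obtain K2 j where j: "j \<in> hom C K2 K" "is_kernel C j \<kappa>" using kernel_ex[OF h(1)] .
  obtain T2 t where t: "t \<in> hom C T2 K2" "torsion_part C T F t" using torsion_part_ex[OF hom_Ob1[OF j(1)]] .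
  note x = arr_torsion_part[OF h(1) j t Z(1)]
  \<comment> \<open>An arbitrary torsion part of \<open>\<kappa>\<close> differs from the explicit
    one by an isomorphism, which does not affect being a kernel.\<close>
  obtain i where i: "i \<in> hom (arrow_cat C) (Dom (arrow_cat C) \<tau>) (zm C T2 Z)" "is_iso (arrow_cat C) i"
    "Square (zm C T2 Z) \<kappa> (j \<cdot> t) (zm C Z K') \<cdot>\<^bsub>arrow_cat C\<^esub> i = \<tau>"
    using arrt.torsion_part_unique[OF x assms(2) \<tau>] .
  obtain P p q where P: "is_pullback C f' b p q" "p \<in> hom C P A'" "q \<in> hom C P B" using pbE[OF f(2) h(3)] .
  obtain g where g: "g \<in> hom C A P" "p \<cdot> g = a" "q \<cdot> g = f"
    using pullback_lift[OF P(1) f(2) h(3) P(2) h(2) f(1)] f(3) by metis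
  note O = hom_Ob1[OF j(1)] hom_Ob2[OF P(2)] hom_Ob2[OF P(3)] hom_Ob1[OF P(2)] hom_Ob1[OF t(1)]
  have uj: "u \<cdot> j \<in> hom C K2 A" using comp_hom u j by blast
  have K': "K' \<in> Ob C" using h hom_Ob2 by blast
  have auj: "a \<cdot> (u \<cdot> j) = zm C K2 A'"
  proof -
    have "a \<cdot> (u \<cdot> j) = u' \<cdot> (\<kappa> \<cdot> j)" using u h j(1) by (simp add: cs cmp_eq[OF u(3)])
    then show ?thesis using kernel_zero[OF j(2,1) h(1)] comp_zm[OF u(2) O(1)] by simp
  qed
  \<comment> \<open>Killed by \<open>g\<close> means killed by both \<open>a\<close> and
    \<open>f\<close>: the latter gives a factorization through \<open>u\<close>, and the former then
    one through the kernel \<open>j\<close> of \<open>\<kappa>\<close>, because \<open>u'\<close> is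
    monic.\<close>
  have guj: "is_kernel C (u \<cdot> j) g"
  proof (rule kernelI[OF uj g(1)])
    show "g \<cdot> (u \<cdot> j) = zm C K2 P"
    proof (rule pullback_unique[OF P(1,2) comp_hom[OF g(1) uj] zm_hom[OF O(1,4)]])
      show "p \<cdot> (g \<cdot> (u \<cdot> j)) = p \<cdot> zm C K2 P"
        using assoc[OF uj g(1) P(2)] g(2) auj comp_zm[OF P(2) O(1)] by simp
      show "q \<cdot> (g \<cdot> (u \<cdot> j)) = q \<cdot> zm C K2 P"
        using assoc[OF uj g(1) P(3)] g(3) assoc[OF j(1) u(1) f(1)] kernel_zero[OF *(5) u(1) f(1)]
          zm_comp[OF j(1) O(3)] comp_zm[OF P(3) O(1)] by simp
    qed
  next
    fix W v assume v: "v \<in> hom C W A" "g \<cdot> v = zm C W P"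
    have W: "W \<in> Ob C" using v hom_Ob1 by blast
    have "a \<cdot> v = zm C W A'" "f \<cdot> v = zm C W B"
      using assoc[OF v(1) g(1) P(2)] assoc[OF v(1) g(1) P(3)] g(2,3) v(2) comp_zm[OF P(2) W] comp_zm[OF P(3) W] by auto
    then obtain w where w: "w \<in> hom C W K" "u \<cdot> w = v" using kernel_lift[OF *(5) u(1) f(1) v(1)] by metis
    have "u' \<cdot> (\<kappa> \<cdot> w) = a \<cdot> (u \<cdot> w)" using u h w(1) by (simp add: cs cmp_eq[OF u(3)])
    then have "u' \<cdot> (\<kappa> \<cdot> w) = u' \<cdot> zm C W K'" using w(2) \<open>a \<cdot> v = zm C W A'\<close> comp_zm[OF u(2) W] by simp
    then have "\<kappa> \<cdot> w = zm C W K'" using kernel_mono[OF *(6) u(2) comp_hom[OF h(1) w(1)] zm_hom[OF W K']] by blast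
    then obtain l where "l \<in> hom C W K2" "j \<cdot> l = w" using kernel_lift[OF j(2,1) h(1) w(1)] by metis
    then show "\<exists>h\<in>hom C W K2. (u \<cdot> j) \<cdot> h = v" using w(2) assoc[OF _ j(1) u(1)] by metis
  next
    fix W v w assume vw: "v \<in> hom C W K2" "w \<in> hom C W K2" "(u \<cdot> j) \<cdot> v = (u \<cdot> j) \<cdot> w"
    then have "u \<cdot> (j \<cdot> v) = u \<cdot> (j \<cdot> w)" using assoc[OF _ j(1) u(1)] by metis
    then have "j \<cdot> v = j \<cdot> w" using kernel_mono[OF *(5) u(1) comp_hom[OF j(1) vw(1)] comp_hom[OF j(1) vw(2)]] by blast
    then show "v = w" using kernel_mono[OF j(2,1) vw(1,2)] by blast
  qed
  obtain r where r: "r \<in> Q" "is_kernel C ((u \<cdot> j) \<cdot> t) r" "g \<in> E \<Longrightarrow> r \<in> E"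
    using tors_normal[OF guj t(2)] t(1) uj by (auto simp: homD)
  have ujt: "(u \<cdot> j) \<cdot> t \<in> hom C T2 A" using comp_hom[OF uj t(1)] .
  obtain D where D: "r \<in> hom C A D" using kernelE[OF r(2)] ujt by (metis homD(3))
  have "a \<cdot> ((u \<cdot> j) \<cdot> t) = zm C T2 A'"
    using assoc[OF t(1) uj h(2)] auj zm_comp[OF t(1) O(2)] by simp
  then obtain \<alpha> where \<alpha>: "\<alpha> \<in> hom C D A'" "\<alpha> \<cdot> r = a"
    using cokernel_desc[OF Q_coker[OF r(1,2)] ujt D h(2)] by metis
  let ?y = "Square a \<alpha> r (Id C A')"
  note iA = id_hom[OF O(2)]
  have y: "?y \<in> hom (arrow_cat C) a \<alpha>" using h(2) \<alpha> D iA by (intro arr_homI) (auto simp: id_left)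
  have yQ: "?y \<in> sqQ C Q" using sqQ_iff[OF y] r(1) Q_iso iso_id O(2) by blast
  have tz: "zm C T2 Z \<in> hom C T2 Z" using zm_hom O Z by blast
  have xc: "\<kappa>\<kappa> \<cdot>\<^bsub>arrow_cat C\<^esub> Square (zm C T2 Z) \<kappa> (j \<cdot> t) (zm C Z K') = Square (zm C T2 Z) a ((u \<cdot> j) \<cdot> t) (zm C Z A')"
    unfolding *(1) using assoc[OF t(1) j(1) u(1)] comp_zm[OF u(2) Z(2)] by simp
  have xh: "Square (zm C T2 Z) a ((u \<cdot> j) \<cdot> t) (zm C Z A') \<in> hom (arrow_cat C) (zm C T2 Z) a"
    using arr.comp_hom[OF *(3) x(2)] xc *(1) by simp
  have "is_kernel (arrow_cat C) (Square (zm C T2 Z) a ((u \<cdot> j) \<cdot> t) (zm C Z A')) ?y"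
    by (rule arr_kernelI[OF tz h(2) \<alpha>(1) xh y r(2) zero_kernel_id(1)[OF O(2) Z(1)]])
  then have "is_kernel (arrow_cat C) (Square (zm C T2 Z) a ((u \<cdot> j) \<cdot> t) (zm C Z A') \<cdot>\<^bsub>arrow_cat C\<^esub> i) ?y"
    using arr.kernel_of_iso[OF _ xh i(1,2)] by blast
  moreover have "Square (zm C T2 Z) a ((u \<cdot> j) \<cdot> t) (zm C Z A') \<cdot>\<^bsub>arrow_cat C\<^esub> i = \<kappa>\<kappa> \<cdot>\<^bsub>arrow_cat C\<^esub> \<tau>"
    using arr.assoc[OF i(1) x(2) *(3)] i(3) xc *(1) by simp
  moreover have "?y \<in> ext_class C E" if "ff \<in> ext_class C E"
  proof -
    note X = ext_D[OF that[unfolded *(2)]]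
    have gE: "g \<in> E" using ext_comparison[OF that[unfolded *(2)] P(1,2) g] .
    have rE: "r \<in> E" using r(3)[OF gE] .
    have \<alpha>E: "\<alpha> \<in> E" using E_cancel[OF D \<alpha>(1) rE] \<alpha>(2) X(4) by simp
    have iE: "Id C A' \<in> E" using E_iso[OF iso_id[OF O(2)] iA] E_O2[OF X(4) h(2)] by blast
    \<comment> \<open>The codomain component of \<open>?y\<close> is an identity, so the relevant
      pullback object is the domain of \<open>\<alpha>\<close> and the comparison morphism is
      \<open>r\<close> itself.\<close>
    show ?thesis
      using ext_I[OF y rE iE X(4) \<alpha>E id_pullback[OF \<alpha>(1)] _ \<alpha>(2) id_left[OF D] rE] h(2) D \<alpha>(1) by (simp add: homD)
  qed
  ultimately show ?thesis using yQ by auto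
qed

text \<open>Taking kernels of the vertical arrows \<open>\<kappa>\<close>, \<open>r\<close> and
  \<open>a\<close> turns the split exact sequence of arrows into the split exact sequence
  \<open>k0\<close>, \<open>p0\<close>, \<open>s0\<close> one level below. The torsion parts of
  arrows are those of their kernels, so the isomorphism of torsion parts found there lifts.\<close>

lemma arr_tors_split:
  assumes "split_short_exact (arrow_cat C) \<kappa>\<kappa> pp ss" "Dom (arrow_cat C) \<kappa>\<kappa> \<in> arrF C F"
  shows "\<exists>t. torsion_part (arrow_cat C) (arrT C T) (arrF C F) t \<and> Cod (arrow_cat C) t = Dom (arrow_cat C) pp \<and>
    torsion_part (arrow_cat C) (arrT C T) (arrF C F) (pp \<cdot>\<^bsub>arrow_cat C\<^esub> t)"
proof -
  have sec: "section_of (arrow_cat C) ss pp" and ker: "is_kernel (arrow_cat C) \<kappa>\<kappa> pp"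
    using assms(1) unfolding split_short_exact_def by auto
  obtain \<kappa> r a k k' p p' where *: "\<kappa>\<kappa> = Square \<kappa> r k k'" "pp = Square r a p p'"
    "Square \<kappa> r k k' \<in> hom (arrow_cat C) \<kappa> r" "Square r a p p' \<in> hom (arrow_cat C) r a"
    "is_kernel C k p" "is_kernel C k' p'" using arr_ker_squares[OF ker] .
  obtain K K' R R' A A' where h: "\<kappa> \<in> hom C K K'" "r \<in> hom C R R'" "a \<in> hom C A A'"
    using arr_hom_Ob[OF *(3)] arr_hom_Ob[OF *(4)] by blast
  have ssh: "ss \<in> hom (arrow_cat C) a r" using sec *(2) by (simp add: section_of_def)
  obtain s s' where s: "ss = Square a r s s'" "s \<in> hom C A R" "s' \<in> hom C A' R'" "r \<cdot> s = s' \<cdot> a"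
    using arr_homE[OF ssh h(3,2)] .
  note k = arr_homD[OF *(3) h(1,2)] and p = arr_homD[OF *(4) h(2,3)]
  have ps: "p \<cdot> s = Id C A"
    using arr_section_iff[OF h(2,3) *(4) ssh[unfolded s(1)]] sec p(1) unfolding *(2) s(1) section_of_def by (simp add: homD)
  obtain K0 j\<kappa> where j\<kappa>: "j\<kappa> \<in> hom C K0 K" "is_kernel C j\<kappa> \<kappa>" using kernel_ex[OF h(1)] .
  obtain R0 jr where jr: "jr \<in> hom C R0 R" "is_kernel C jr r" using kernel_ex[OF h(2)] .
  obtain A0 ja where ja: "ja \<in> hom C A0 A" "is_kernel C ja a" using kernel_ex[OF h(3)] .
  note O = hom_Ob1[OF j\<kappa>(1)] hom_Ob1[OF jr(1)] hom_Ob1[OF ja(1)]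
  have K0: "K0 \<in> F" using arrF_kernel[OF _ j\<kappa>(2,1)] assms(2) *(1) by simp
  have "a \<cdot> (p \<cdot> jr) = p' \<cdot> (r \<cdot> jr)" using p h jr(1) by (simp add: cs cmp_eq[OF p(3)])
  then have "a \<cdot> (p \<cdot> jr) = zm C R0 A'" using kernel_zero[OF jr(2,1) h(2)] comp_zm[OF p(2) O(2)] by simp
  then obtain p0 where p0: "p0 \<in> hom C R0 A0" "ja \<cdot> p0 = p \<cdot> jr"
    using kernel_lift[OF ja(2,1) h(3) comp_hom[OF p(1) jr(1)]] by metis
  have "r \<cdot> (s \<cdot> ja) = s' \<cdot> (a \<cdot> ja)" using s h ja(1) by (simp add: cs cmp_eq[OF s(4)])
  then have "r \<cdot> (s \<cdot> ja) = zm C A0 R'" using kernel_zero[OF ja(2,1) h(3)] comp_zm[OF s(3) O(3)] by simp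
  then obtain s0 where s0: "s0 \<in> hom C A0 R0" "jr \<cdot> s0 = s \<cdot> ja"
    using kernel_lift[OF jr(2,1) h(2) comp_hom[OF s(2) ja(1)]] by metis
  have "r \<cdot> (k \<cdot> j\<kappa>) = k' \<cdot> (\<kappa> \<cdot> j\<kappa>)" using k h j\<kappa>(1) by (simp add: cs cmp_eq[OF k(3)])
  then have "r \<cdot> (k \<cdot> j\<kappa>) = zm C K0 R'" using kernel_zero[OF j\<kappa>(2,1) h(1)] comp_zm[OF k(2) O(1)] by simp
  then obtain k0 where k0: "k0 \<in> hom C K0 R0" "jr \<cdot> k0 = k \<cdot> j\<kappa>"
    using kernel_lift[OF jr(2,1) h(2) comp_hom[OF k(1) j\<kappa>(1)]] by metis
  have "p0 \<cdot> s0 = Id C A0"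
  proof (rule kernel_mono[OF ja(2,1) comp_hom[OF p0(1) s0(1)] id_hom[OF O(3)]])
    have "ja \<cdot> (p0 \<cdot> s0) = p \<cdot> (s \<cdot> ja)" using ja(1) p0 s0 p(1) jr(1) by (simp add: cs cmp_eq[OF p0(2)])
    also have "\<dots> = ja" using p(1) s(2) ja(1) by (simp add: cs cmp_eq[OF ps])
    finally show "ja \<cdot> (p0 \<cdot> s0) = ja \<cdot> Id C A0" using ja(1) by (simp add: id_right)
  qed
  then have sec0: "section_of C s0 p0" unfolding section_of_def using p0(1) s0(1) by (simp add: homD)
  have ker0: "is_kernel C k0 p0"
  proof (rule kernelI[OF k0(1) p0(1)])
    show "p0 \<cdot> k0 = zm C K0 A0"
    proof (rule kernel_mono[OF ja(2,1) comp_hom[OF p0(1) k0(1)] zm_hom[OF O(1,3)]])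
      have "ja \<cdot> (p0 \<cdot> k0) = (p \<cdot> k) \<cdot> j\<kappa>" using ja(1) p0 k0 p(1) k(1) jr(1) j\<kappa>(1) by (simp add: cs cmp_eq[OF p0(2)])
      then show "ja \<cdot> (p0 \<cdot> k0) = ja \<cdot> zm C K0 A0"
        using kernel_zero[OF *(5) k(1) p(1)] zm_comp[OF j\<kappa>(1) hom_Ob1[OF h(3)]] comp_zm[OF ja(1) O(1)] by simp
    qed
  next
    fix W v assume v: "v \<in> hom C W R0" "p0 \<cdot> v = zm C W A0"
    have W: "W \<in> Ob C" using v hom_Ob1 by blast
    have "p \<cdot> (jr \<cdot> v) = ja \<cdot> (p0 \<cdot> v)" using p(1) jr(1) v(1) ja(1) p0(1) by (simp add: cs cmp_eq[OF p0(2)])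
    then have "p \<cdot> (jr \<cdot> v) = zm C W A" using v(2) comp_zm[OF ja(1) W] by simp
    then obtain w where w: "w \<in> hom C W K" "k \<cdot> w = jr \<cdot> v"
      using kernel_lift[OF *(5) k(1) p(1) comp_hom[OF jr(1) v(1)]] by metis
    have "k' \<cdot> (\<kappa> \<cdot> w) = r \<cdot> (k \<cdot> w)" using k h w(1) by (simp add: cs cmp_eq[OF k(3)])
    also have "\<dots> = (r \<cdot> jr) \<cdot> v" using w(2) h(2) jr(1) v(1) by (simp add: cs)
    also have "\<dots> = k' \<cdot> zm C W K'"
      using kernel_zero[OF jr(2,1) h(2)] zm_comp[OF v(1) hom_Ob2[OF h(2)]] comp_zm[OF k(2) W] by simp
    finally have "\<kappa> \<cdot> w = zm C W K'"
      using kernel_mono[OF *(6) k(2) comp_hom[OF h(1) w(1)] zm_hom[OF W hom_Ob2[OF h(1)]]] by blast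
    then obtain l where l: "l \<in> hom C W K0" "j\<kappa> \<cdot> l = w" using kernel_lift[OF j\<kappa>(2,1) h(1) w(1)] by metis
    have "k0 \<cdot> l = v"
    proof (rule kernel_mono[OF jr(2,1) comp_hom[OF k0(1) l(1)] v(1)])
      show "jr \<cdot> (k0 \<cdot> l) = jr \<cdot> v" using jr(1) k0 l w(2) k(1) j\<kappa>(1) by (simp add: cs cmp_eq[OF k0(2)])
    qed
    then show "\<exists>h\<in>hom C W K0. k0 \<cdot> h = v" using l by blast
  next
    fix W v w assume vw: "v \<in> hom C W K0" "w \<in> hom C W K0" "k0 \<cdot> v = k0 \<cdot> w"
    have "k \<cdot> (j\<kappa> \<cdot> v) = jr \<cdot> (k0 \<cdot> v)" "k \<cdot> (j\<kappa> \<cdot> w) = jr \<cdot> (k0 \<cdot> w)"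
      using vw(1,2) k(1) j\<kappa>(1) jr(1) k0(1) by (simp_all add: cs cmp_eq[OF k0(2)])
    then have "k \<cdot> (j\<kappa> \<cdot> v) = k \<cdot> (j\<kappa> \<cdot> w)" using vw(3) by simp
    then have "j\<kappa> \<cdot> v = j\<kappa> \<cdot> w" using kernel_mono[OF *(5) k(1) comp_hom[OF j\<kappa>(1) vw(1)] comp_hom[OF j\<kappa>(1) vw(2)]] by blast
    then show "v = w" using kernel_mono[OF j\<kappa>(2,1) vw(1,2)] by blast
  qed
  obtain t where t: "torsion_part C T F t" "Cod C t = R0" "torsion_part C T F (p0 \<cdot> t)"
    using tors_split[of k0 p0 s0] ker0 sec0 K0 k0(1) p0(1) unfolding split_short_exact_def by (auto simp: homD)
  have th: "t \<in> hom C (Dom C t) R0"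
    using t(1,2) by (auto simp: torsion_part_def short_exact_def is_kernel_def hom_def)
  obtain Z where Z: "is_zero_ob C Z" "Z \<in> Ob C" using zero_obE .
  note x = arr_torsion_part[OF h(2) jr th t(1) Z(1)]
  have "pp \<cdot>\<^bsub>arrow_cat C\<^esub> Square (zm C (Dom C t) Z) r (jr \<cdot> t) (zm C Z R') =
      Square (zm C (Dom C t) Z) a (ja \<cdot> (p0 \<cdot> t)) (zm C Z A')"
    unfolding *(2) using p(1) jr(1) th ja(1) p0(1) comp_zm[OF p(2) Z(2)] by (simp add: cs cmp_eq[OF p0(2)])
  then have "torsion_part (arrow_cat C) (arrT C T) (arrF C F)
      (pp \<cdot>\<^bsub>arrow_cat C\<^esub> Square (zm C (Dom C t) Z) r (jr \<cdot> t) (zm C Z R'))"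
    using arr_torsion_part(1)[OF h(3) ja comp_hom[OF p0(1) th] t(3) Z(1)] by simp
  then show ?thesis using x(1) *(2) by (intro exI[of _ "Square (zm C (Dom C t) Z) r (jr \<cdot> t) (zm C Z R')"]) simp
qed

theorem hml_tors_arrow:
  "hml_tors (arrow_cat C) (sqQ C Q) E (ext_class C E) (arrT C T) (arrF C F)"
proof -
  interpret A: hml_ext "arrow_cat C" "sqQ C Q" E "ext_class C E" by (rule hml_ext_arrow)
  show ?thesis
  proof unfold_locales
    fix k f t assume "is_kernel (arrow_cat C) k f" "torsion_part (arrow_cat C) (arrT C T) (arrF C F) t"
      "Cod (arrow_cat C) t = Dom (arrow_cat C) k"
    then show "\<exists>q \<in> sqQ C Q. is_kernel (arrow_cat C) (k \<cdot>\<^bsub>arrow_cat C\<^esub> t) q \<and> (f \<in> ext_class C E \<longrightarrow> q \<in> ext_class C E)"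
      by (rule arr_tors_normal)
  next
    fix k p s assume "split_short_exact (arrow_cat C) k p s" "Dom (arrow_cat C) k \<in> arrF C F"
    then show "\<exists>t. torsion_part (arrow_cat C) (arrT C T) (arrF C F) t \<and> Cod (arrow_cat C) t = Dom (arrow_cat C) p \<and>
      torsion_part (arrow_cat C) (arrT C T) (arrF C F) (p \<cdot>\<^bsub>arrow_cat C\<^esub> t)" by (rule arr_tors_split)
  qed
qed

end

section \<open>Monadicity of change of base\<close>

lemma functor_simps:
  assumes "is_functor C D F"
  shows "X \<in> Ob C \<Longrightarrow> on_ob F X \<in> Ob D"
    and "X \<in> Ob C \<Longrightarrow> on_mor F (Id C X) = Id D (on_ob F X)"
    and "f \<in> hom C X Y \<Longrightarrow> on_mor F f \<in> hom D (on_ob F X) (on_ob F Y)"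
    and "f \<in> hom C X Y \<Longrightarrow> g \<in> hom C Y Z \<Longrightarrow> on_mor F (g \<cdot>\<^bsub>C\<^esub> f) = on_mor F g \<cdot>\<^bsub>D\<^esub> on_mor F f"
  using assms unfolding is_functor_def hom_def by auto

lemma functorI:
  assumes "category C"
    and "\<And>X. X \<in> Ob C \<Longrightarrow> on_ob F X \<in> Ob D"
    and "\<And>X. X \<in> Ob C \<Longrightarrow> on_mor F (Id C X) = Id D (on_ob F X)"
    and "\<And>f X Y. f \<in> hom C X Y \<Longrightarrow> on_mor F f \<in> hom D (on_ob F X) (on_ob F Y)"
    and "\<And>f g X Y Z. f \<in> hom C X Y \<Longrightarrow> g \<in> hom C Y Z \<Longrightarrow> on_mor F (g \<cdot>\<^bsub>C\<^esub> f) = on_mor F g \<cdot>\<^bsub>D\<^esub> on_mor F f"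
  shows "is_functor C D F"
  unfolding is_functor_def
proof (intro conjI ballI impI)
  fix f g assume "f \<in> Mor C" "g \<in> Mor C" "Dom C g = Cod C f"
  then show "on_mor F (g \<cdot>\<^bsub>C\<^esub> f) = on_mor F g \<cdot>\<^bsub>D\<^esub> on_mor F f"
    using assms(5)[of f "Dom C f" "Cod C f" g "Cod C g"] by (simp add: hom_def)
qed (use assms in \<open>auto simp: hom_def\<close>)

lemma nat_transI:
  assumes "\<And>X. X \<in> Ob C \<Longrightarrow> \<tau> X \<in> hom D (on_ob F X) (on_ob G X)"
    and "\<And>f X Y. f \<in> hom C X Y \<Longrightarrow> \<tau> Y \<cdot>\<^bsub>D\<^esub> on_mor F f = on_mor G f \<cdot>\<^bsub>D\<^esub> \<tau> X"
  shows "nat_trans C D F G \<tau>"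
  using assms unfolding nat_trans_def hom_def by auto

lemma nat_transD:
  assumes "nat_trans C D F G \<tau>"
  shows "X \<in> Ob C \<Longrightarrow> \<tau> X \<in> hom D (on_ob F X) (on_ob G X)"
    and "f \<in> hom C X Y \<Longrightarrow> \<tau> Y \<cdot>\<^bsub>D\<^esub> on_mor F f = on_mor G f \<cdot>\<^bsub>D\<^esub> \<tau> X"
  using assms unfolding nat_trans_def hom_def by auto

lemma func_simps [simp]:
  "on_ob id_func X = X" "on_mor id_func f = f"
  "on_ob (comp_func G F) X = on_ob G (on_ob F X)" "on_mor (comp_func G F) f = on_mor G (on_mor F f)"
  by (simp_all add: id_func_def comp_func_def)

text \<open>The quasi-inverse is obtained by choosing a preimage of every object up to isomorphism;
  morphisms are conjugated by the chosen isomorphisms and pulled back by \<open>lft\<close>, the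
  inverse of \<open>F\<close> on hom-sets.\<close>

theorem equivalence_of_fully_faithful:
  assumes C: "category C" and D: "category D" and F: "is_functor C D F"
    and ff: "\<And>X Y g. X \<in> Ob C \<Longrightarrow> Y \<in> Ob C \<Longrightarrow> g \<in> hom D (on_ob F X) (on_ob F Y) \<Longrightarrow>
      \<exists>!f. f \<in> hom C X Y \<and> on_mor F f = g"
    and es: "\<And>Z. Z \<in> Ob D \<Longrightarrow> \<exists>X \<in> Ob C. isomorphic D (on_ob F X) Z"
  shows "is_equivalence C D F"
proof -
  interpret C: cat_loc C using C by unfold_locales
  interpret D: cat_loc D using D by unfold_locales
  note Fs = functor_simps[OF F]
  have "\<exists>X t s. X \<in> Ob C \<and> t \<in> hom D (on_ob F X) Z \<and> s \<in> hom D Z (on_ob F X) \<and> s \<cdot>\<^bsub>D\<^esub> t = Id D (on_ob F X) \<and> t \<cdot>\<^bsub>D\<^esub> s = Id D Z"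
    if "Z \<in> Ob D" for Z
    using es[OF that] unfolding isomorphic_def by (metis D.isoE)
  then obtain G0 t s where G0: "G0 Z \<in> Ob C" "t Z \<in> hom D (on_ob F (G0 Z)) Z" "s Z \<in> hom D Z (on_ob F (G0 Z))"
      "s Z \<cdot>\<^bsub>D\<^esub> t Z = Id D (on_ob F (G0 Z))" "t Z \<cdot>\<^bsub>D\<^esub> s Z = Id D Z" if "Z \<in> Ob D" for Z
    by metis
  define lft where "lft X Y g = (THE f. f \<in> hom C X Y \<and> on_mor F f = g)" for X Y g
  have lft: "lft X Y g \<in> hom C X Y \<and> on_mor F (lft X Y g) = g"
    if "X \<in> Ob C" "Y \<in> Ob C" "g \<in> hom D (on_ob F X) (on_ob F Y)" for X Y g
    unfolding lft_def by (rule theI', rule ff[OF that])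
  have faithful: "f = g" if "f \<in> hom C X Y" "g \<in> hom C X Y" "on_mor F f = on_mor F g" for f g X Y
    using ff[OF C.hom_Ob1[OF that(1)] C.hom_Ob2[OF that(1)] Fs(3)[OF that(2)]] that by metis
  define G where "G = \<lparr>on_ob = G0, on_mor = (\<lambda>g. lft (G0 (Dom D g)) (G0 (Cod D g))
      (s (Cod D g) \<cdot>\<^bsub>D\<^esub> (g \<cdot>\<^bsub>D\<^esub> t (Dom D g))))\<rparr>"
  have Go: "on_ob G Z = G0 Z" for Z by (simp add: G_def)
  have Gm: "on_mor G g \<in> hom C (G0 X) (G0 Y)" "on_mor F (on_mor G g) = s Y \<cdot>\<^bsub>D\<^esub> (g \<cdot>\<^bsub>D\<^esub> t X)"
    if g: "g \<in> hom D X Y" for g X Y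
  proof -
    have "s Y \<cdot>\<^bsub>D\<^esub> (g \<cdot>\<^bsub>D\<^esub> t X) \<in> hom D (on_ob F (G0 X)) (on_ob F (G0 Y))"
      using D.comp_hom[OF G0(3)[OF D.hom_Ob2[OF g]] D.comp_hom[OF g G0(2)[OF D.hom_Ob1[OF g]]]] .
    from lft[OF G0(1)[OF D.hom_Ob1[OF g]] G0(1)[OF D.hom_Ob2[OF g]] this]
    show "on_mor G g \<in> hom C (G0 X) (G0 Y)" "on_mor F (on_mor G g) = s Y \<cdot>\<^bsub>D\<^esub> (g \<cdot>\<^bsub>D\<^esub> t X)"
      unfolding G_def using homD(2,3)[OF g] by auto
  qed
  have Gf: "is_functor D C G"
  proof (rule functorI[OF D])
    fix X assume X: "X \<in> Ob D"
    show "on_ob G X \<in> Ob C" using G0 X Go by simp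
    show "on_mor G (Id D X) = Id C (on_ob G X)"
      unfolding Go
      by (rule faithful[OF Gm(1)[OF D.id_hom[OF X]] C.id_hom[OF G0(1)[OF X]]])
        (use Gm(2)[OF D.id_hom[OF X]] G0[OF X] Fs(2) in \<open>simp add: D.id_left[OF G0(2)[OF X]]\<close>)
  next
    fix g X Y assume "g \<in> hom D X Y"
    then show "on_mor G g \<in> hom C (on_ob G X) (on_ob G Y)" using Gm(1) Go by simp
  next
    fix g h X Y Z assume gh: "g \<in> hom D X Y" "h \<in> hom D Y Z"
    note O = D.hom_Ob1[OF gh(1)] D.hom_Ob2[OF gh(1)] D.hom_Ob2[OF gh(2)]
    show "on_mor G (h \<cdot>\<^bsub>D\<^esub> g) = on_mor G h \<cdot>\<^bsub>C\<^esub> on_mor G g"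
    proof (rule faithful[OF Gm(1)[OF D.comp_hom[OF gh(2,1)]] C.comp_hom[OF Gm(1)[OF gh(2)] Gm(1)[OF gh(1)]]])
      have "on_mor F (on_mor G h \<cdot>\<^bsub>C\<^esub> on_mor G g) = (s Z \<cdot>\<^bsub>D\<^esub> (h \<cdot>\<^bsub>D\<^esub> t Y)) \<cdot>\<^bsub>D\<^esub> (s Y \<cdot>\<^bsub>D\<^esub> (g \<cdot>\<^bsub>D\<^esub> t X))"
        using Fs(4)[OF Gm(1)[OF gh(1)] Gm(1)[OF gh(2)]] Gm(2)[OF gh(1)] Gm(2)[OF gh(2)] by simp
      also have "\<dots> = s Z \<cdot>\<^bsub>D\<^esub> ((h \<cdot>\<^bsub>D\<^esub> g) \<cdot>\<^bsub>D\<^esub> t X)"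
        using gh G0(2,3)[OF O(1)] G0(2,3)[OF O(2)] G0(2,3)[OF O(3)] by (simp add: D.cs D.cmp_eq[OF G0(5)[OF O(2)]] O)
      finally show "on_mor F (on_mor G (h \<cdot>\<^bsub>D\<^esub> g)) = on_mor F (on_mor G h \<cdot>\<^bsub>C\<^esub> on_mor G g)"
        using Gm(2)[OF D.comp_hom[OF gh(2,1)]] by simp
    qed
  qed
  define \<sigma> where "\<sigma> X = lft X (G0 (on_ob F X)) (s (on_ob F X))" for X
  have \<sigma>: "\<sigma> X \<in> hom C X (G0 (on_ob F X))" "on_mor F (\<sigma> X) = s (on_ob F X)" if "X \<in> Ob C" for X
    using lft[OF that G0(1,3)[OF Fs(1)[OF that]]] unfolding \<sigma>_def by auto
  have "nat_iso C C id_func (comp_func G F) \<sigma>"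
    unfolding nat_iso_def
  proof (intro conjI ballI nat_transI)
    fix X assume X: "X \<in> Ob C"
    show "\<sigma> X \<in> hom C (on_ob id_func X) (on_ob (comp_func G F) X)" using \<sigma>(1)[OF X] Go by simp
    note g0 = G0[OF Fs(1)[OF X]]
    have r: "lft (G0 (on_ob F X)) X (t (on_ob F X)) \<in> hom C (G0 (on_ob F X)) X"
      "on_mor F (lft (G0 (on_ob F X)) X (t (on_ob F X))) = t (on_ob F X)"
      using lft[OF g0(1) X g0(2)] by auto
    show "is_iso C (\<sigma> X)"
    proof (rule C.isoI[OF \<sigma>(1)[OF X] r(1)])
      show "lft (G0 (on_ob F X)) X (t (on_ob F X)) \<cdot>\<^bsub>C\<^esub> \<sigma> X = Id C X"
        by (rule faithful[OF C.comp_hom[OF r(1) \<sigma>(1)[OF X]] C.id_hom[OF X]])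
          (use Fs(4)[OF \<sigma>(1)[OF X] r(1)] r(2) \<sigma>(2)[OF X] g0 Fs(2)[OF X] in simp)
      show "\<sigma> X \<cdot>\<^bsub>C\<^esub> lft (G0 (on_ob F X)) X (t (on_ob F X)) = Id C (G0 (on_ob F X))"
        by (rule faithful[OF C.comp_hom[OF \<sigma>(1)[OF X] r(1)] C.id_hom[OF g0(1)]])
          (use Fs(4)[OF r(1) \<sigma>(1)[OF X]] r(2) \<sigma>(2)[OF X] g0 Fs(2)[OF g0(1)] in simp)
    qed
  next
    fix f X Y assume f: "f \<in> hom C X Y"
    note O = C.hom_Ob1[OF f] C.hom_Ob2[OF f]
    note Ff = Fs(3)[OF f]
    note g0 = G0[OF Fs(1)[OF O(1)]] and g1 = G0[OF Fs(1)[OF O(2)]]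
    have "\<sigma> Y \<cdot>\<^bsub>C\<^esub> f = on_mor G (on_mor F f) \<cdot>\<^bsub>C\<^esub> \<sigma> X"
    proof (rule faithful[OF C.comp_hom[OF \<sigma>(1)[OF O(2)] f] C.comp_hom[OF Gm(1)[OF Ff] \<sigma>(1)[OF O(1)]]])
      have "on_mor F (on_mor G (on_mor F f) \<cdot>\<^bsub>C\<^esub> \<sigma> X) = (s (on_ob F Y) \<cdot>\<^bsub>D\<^esub> (on_mor F f \<cdot>\<^bsub>D\<^esub> t (on_ob F X))) \<cdot>\<^bsub>D\<^esub> s (on_ob F X)"
        using Fs(4)[OF \<sigma>(1)[OF O(1)] Gm(1)[OF Ff]] Gm(2)[OF Ff] \<sigma>(2)[OF O(1)] by simp
      also have "\<dots> = s (on_ob F Y) \<cdot>\<^bsub>D\<^esub> on_mor F f"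
        using Ff g0(2,3,5) g1(3) Fs(1)[OF O(1)] by (simp add: D.cs)
      finally show "on_mor F (\<sigma> Y \<cdot>\<^bsub>C\<^esub> f) = on_mor F (on_mor G (on_mor F f) \<cdot>\<^bsub>C\<^esub> \<sigma> X)"
        using Fs(4)[OF f \<sigma>(1)[OF O(2)]] \<sigma>(2)[OF O(2)] by simp
    qed
    then show "\<sigma> Y \<cdot>\<^bsub>C\<^esub> on_mor id_func f = on_mor (comp_func G F) f \<cdot>\<^bsub>C\<^esub> \<sigma> X" by simp
  qed
  moreover have "nat_iso D D (comp_func F G) id_func t"
    unfolding nat_iso_def
  proof (intro conjI ballI nat_transI)
    fix Z assume Z: "Z \<in> Ob D"
    show "t Z \<in> hom D (on_ob (comp_func F G) Z) (on_ob id_func Z)" using G0[OF Z] Go by simp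
    show "is_iso D (t Z)" using D.isoI G0[OF Z] by blast
  next
    fix g X Y assume g: "g \<in> hom D X Y"
    note O = D.hom_Ob1[OF g] D.hom_Ob2[OF g]
    have "t Y \<cdot>\<^bsub>D\<^esub> (s Y \<cdot>\<^bsub>D\<^esub> (g \<cdot>\<^bsub>D\<^esub> t X)) = g \<cdot>\<^bsub>D\<^esub> t X"
      using g G0(2,3)[OF O(1)] G0(2,3)[OF O(2)] by (simp add: D.cs D.cmp_eq[OF G0(5)[OF O(2)]])
    then show "t Y \<cdot>\<^bsub>D\<^esub> on_mor (comp_func F G) g = on_mor id_func g \<cdot>\<^bsub>D\<^esub> t X" using Gm(2)[OF g] by simp
  qed
  ultimately show ?thesis unfolding is_equivalence_def using F Gf by blast
qed

section \<open>Adjunctions and their Eilenberg-Moore categories\<close>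

lemma em_cat_simps [simp]:
  "Ob (em_cat C T \<eta> \<mu>) = em_algs C T \<eta> \<mu>"
  "Dom (em_cat C T \<eta> \<mu>) (a, f, b) = a" "Cod (em_cat C T \<eta> \<mu>) (a, f, b) = b"
  "Id (em_cat C T \<eta> \<mu>) a = (a, Id C (fst a), a)"
  "Cmp (em_cat C T \<eta> \<mu>) (b', g, c) (a, f, b) = (a, g \<cdot>\<^bsub>C\<^esub> f, c)"
  by (simp_all add: em_cat_def)

lemma em_hom_iff:
  "z \<in> hom (em_cat C T \<eta> \<mu>) a b \<longleftrightarrow> (\<exists>f. z = (a, f, b) \<and> a \<in> em_algs C T \<eta> \<mu> \<and> b \<in> em_algs C T \<eta> \<mu> \<and>
     f \<in> hom C (fst a) (fst b) \<and> f \<cdot>\<^bsub>C\<^esub> snd a = snd b \<cdot>\<^bsub>C\<^esub> on_mor T f)"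
  by (auto simp: em_cat_def hom_def)

locale adj_loc = C: cat_loc C + D: cat_loc D for C :: "('o, 'm) cat" and D :: "('p, 'q) cat" +
  fixes L :: "('o, 'm, 'p, 'q) func" and R :: "('p, 'q, 'o, 'm) func" and \<eta> \<epsilon>
  assumes adj: "adjunction C D L R \<eta> \<epsilon>"
begin

lemma L_functor: "is_functor C D L" and R_functor: "is_functor D C R"
  using adj by (auto simp: adjunction_def)

lemmas Ls = functor_simps[OF L_functor] and Rs = functor_simps[OF R_functor]

lemma eta_hom: "X \<in> Ob C \<Longrightarrow> \<eta> X \<in> hom C X (on_ob R (on_ob L X))"
  and eta_nat: "f \<in> hom C X Y \<Longrightarrow> \<eta> Y \<cdot>\<^bsub>C\<^esub> f = on_mor R (on_mor L f) \<cdot>\<^bsub>C\<^esub> \<eta> X"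
  using adj nat_transD[of C C id_func "comp_func R L" \<eta>] by (auto simp: adjunction_def)

lemma eps_hom: "Y \<in> Ob D \<Longrightarrow> \<epsilon> Y \<in> hom D (on_ob L (on_ob R Y)) Y"
  and eps_nat: "g \<in> hom D X Y \<Longrightarrow> \<epsilon> Y \<cdot>\<^bsub>D\<^esub> on_mor L (on_mor R g) = g \<cdot>\<^bsub>D\<^esub> \<epsilon> X"
  using adj nat_transD[of D D "comp_func L R" id_func \<epsilon>] by (auto simp: adjunction_def)

lemma tri1: "X \<in> Ob C \<Longrightarrow> \<epsilon> (on_ob L X) \<cdot>\<^bsub>D\<^esub> on_mor L (\<eta> X) = Id D (on_ob L X)"
  and tri2: "Y \<in> Ob D \<Longrightarrow> on_mor R (\<epsilon> Y) \<cdot>\<^bsub>C\<^esub> \<eta> (on_ob R Y) = Id C (on_ob R Y)"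
  using adj by (auto simp: adjunction_def)

abbreviation "algs \<equiv> em_algs C (comp_func R L) \<eta> (\<lambda>X. on_mor R (\<epsilon> (on_ob L X)))"
abbreviation "emc \<equiv> em_cat C (comp_func R L) \<eta> (\<lambda>X. on_mor R (\<epsilon> (on_ob L X)))"

lemma em_category: "category emc"
  unfolding category_def
proof (intro conjI ballI impI)
  have m: "\<exists>a f b. z = (a, f, b) \<and> a \<in> algs \<and> b \<in> algs \<and> f \<in> hom C (fst a) (fst b) \<and>
     f \<cdot>\<^bsub>C\<^esub> snd a = snd b \<cdot>\<^bsub>C\<^esub> on_mor R (on_mor L f)" if "z \<in> Mor emc" for z
    using that by (auto simp: em_cat_def)
  fix z assume z: "z \<in> Mor emc"
  obtain a f b where f: "z = (a, f, b)" "a \<in> algs" "b \<in> algs" "f \<in> hom C (fst a) (fst b)"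
     "f \<cdot>\<^bsub>C\<^esub> snd a = snd b \<cdot>\<^bsub>C\<^esub> on_mor R (on_mor L f)" using m[OF z] by blast
  show "Dom emc z \<in> Ob emc" "Cod emc z \<in> Ob emc" using f by auto
  show "z \<cdot>\<^bsub>emc\<^esub> Id emc (Dom emc z) = z" "Id emc (Cod emc z) \<cdot>\<^bsub>emc\<^esub> z = z"
    using f C.id_left[OF f(4)] C.id_right[OF f(4)] by auto
  fix y assume y: "y \<in> Mor emc"
  obtain b' g c where g: "y = (b', g, c)" "b' \<in> algs" "c \<in> algs" "g \<in> hom C (fst b') (fst c)"
     "g \<cdot>\<^bsub>C\<^esub> snd b' = snd c \<cdot>\<^bsub>C\<^esub> on_mor R (on_mor L g)" using m[OF y] by blast
  {
    assume e: "Dom emc y = Cod emc z"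
    then have b: "b' = b" using f(1) g(1) by simp
    have h: "snd a \<in> hom C (on_ob R (on_ob L (fst a))) (fst a)" "snd b \<in> hom C (on_ob R (on_ob L (fst b))) (fst b)"
      "snd c \<in> hom C (on_ob R (on_ob L (fst c))) (fst c)" using f(2,3) g(3) by (auto simp: em_algs_def)
    note T = Rs(3)[OF Ls(3)[OF f(4)]] Rs(3)[OF Ls(3)[OF g(4)[unfolded b]]]
    have "(g \<cdot>\<^bsub>C\<^esub> f) \<cdot>\<^bsub>C\<^esub> snd a = (g \<cdot>\<^bsub>C\<^esub> snd b) \<cdot>\<^bsub>C\<^esub> on_mor R (on_mor L f)"
      using h f(4,5) g(4)[unfolded b] T by (simp add: C.cs)
    also have "\<dots> = snd c \<cdot>\<^bsub>C\<^esub> on_mor R (on_mor L (g \<cdot>\<^bsub>C\<^esub> f))"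
      using h g(4,5)[unfolded b] T Ls(4)[OF f(4) g(4)[unfolded b]] Rs(4)[OF Ls(3)[OF f(4)] Ls(3)[OF g(4)[unfolded b]]]
      by (simp add: C.cs)
    finally show "y \<cdot>\<^bsub>emc\<^esub> z \<in> hom emc (Dom emc z) (Cod emc y)"
      unfolding em_hom_iff using f g b C.comp_hom[OF g(4)[unfolded b] f(4)] by simp
    fix x assume x: "x \<in> Mor emc" "Dom emc x = Cod emc y"
    obtain c' h d where h: "x = (c', h, d)" "h \<in> hom C (fst c') (fst d)" using m[OF x(1)] by blast
    have "c' = c" using x(2) h(1) g(1) by simp
    then show "x \<cdot>\<^bsub>emc\<^esub> (y \<cdot>\<^bsub>emc\<^esub> z) = x \<cdot>\<^bsub>emc\<^esub> y \<cdot>\<^bsub>emc\<^esub> z"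
      using f(1,4) g(1,4) h b C.assoc[OF f(4) g(4)[unfolded b] h(2)[unfolded \<open>c' = c\<close>]] by simp
  }
next
  fix a assume a: "a \<in> Ob emc"
  then have h: "snd a \<in> hom C (on_ob R (on_ob L (fst a))) (fst a)" "fst a \<in> Ob C" by (auto simp: em_algs_def)
  have "on_mor R (on_mor L (Id C (fst a))) = Id C (on_ob R (on_ob L (fst a)))"
    using Ls(2)[OF h(2)] Rs(2)[OF Ls(1)[OF h(2)]] by simp
  then show "Id emc a \<in> hom emc a a"
    unfolding em_hom_iff using a C.id_hom[OF h(2)] C.id_left[OF h(1)] C.id_right[OF h(1)] by simp
qed

lemma comparison_simps:
  "on_ob (comparison D R \<epsilon>) Y = (on_ob R Y, on_mor R (\<epsilon> Y))"
  "g \<in> hom D X Y \<Longrightarrow> on_mor (comparison D R \<epsilon>) g = ((on_ob R X, on_mor R (\<epsilon> X)), on_mor R g, (on_ob R Y, on_mor R (\<epsilon> Y)))"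
  unfolding comparison_def Let_def by (auto simp: homD)

lemma comparison_alg:
  assumes Y: "Y \<in> Ob D"
  shows "(on_ob R Y, on_mor R (\<epsilon> Y)) \<in> algs"
proof -
  note e = eps_hom[OF Y]
  note e2 = eps_hom[OF Ls(1)[OF Rs(1)[OF Y]]]
  have "on_mor R (\<epsilon> Y \<cdot>\<^bsub>D\<^esub> on_mor L (on_mor R (\<epsilon> Y))) = on_mor R (\<epsilon> Y \<cdot>\<^bsub>D\<^esub> \<epsilon> (on_ob L (on_ob R Y)))"
    using eps_nat[OF e] by simp
  then show ?thesis unfolding em_algs_def
    using Rs(1)[OF Y] Rs(3)[OF e] tri2[OF Y] Rs(4)[OF Ls(3)[OF Rs(3)[OF e]] e] Rs(4)[OF e2 e] by simp
qed

lemma comparison_functor: "is_functor D emc (comparison D R \<epsilon>)"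
proof (rule functorI[OF D.is_cat])
  fix X assume X: "X \<in> Ob D"
  show "on_ob (comparison D R \<epsilon>) X \<in> Ob emc" using comparison_alg[OF X] comparison_simps(1) by simp
  show "on_mor (comparison D R \<epsilon>) (Id D X) = Id emc (on_ob (comparison D R \<epsilon>) X)"
    using comparison_simps(1) comparison_simps(2)[OF D.id_hom[OF X]] Rs(2)[OF X] by simp
next
  fix g X Y assume g: "g \<in> hom D X Y"
  note O = D.hom_Ob1[OF g] D.hom_Ob2[OF g]
  have "on_mor R g \<cdot>\<^bsub>C\<^esub> on_mor R (\<epsilon> X) = on_mor R (\<epsilon> Y) \<cdot>\<^bsub>C\<^esub> on_mor R (on_mor L (on_mor R g))"
    using Rs(4)[OF eps_hom[OF O(1)] g] Rs(4)[OF Ls(3)[OF Rs(3)[OF g]] eps_hom[OF O(2)]] eps_nat[OF g] by simp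
  then show "on_mor (comparison D R \<epsilon>) g \<in> hom emc (on_ob (comparison D R \<epsilon>) X) (on_ob (comparison D R \<epsilon>) Y)"
    unfolding em_hom_iff comparison_simps(1) comparison_simps(2)[OF g] using comparison_alg[OF O(1)] comparison_alg[OF O(2)] Rs(3)[OF g] by simp
next
  fix f g X Y Z assume fg: "f \<in> hom D X Y" "g \<in> hom D Y Z"
  show "on_mor (comparison D R \<epsilon>) (g \<cdot>\<^bsub>D\<^esub> f) = on_mor (comparison D R \<epsilon>) g \<cdot>\<^bsub>emc\<^esub> on_mor (comparison D R \<epsilon>) f"
    using comparison_simps(2)[OF fg(1)] comparison_simps(2)[OF fg(2)] comparison_simps(2)[OF D.comp_hom[OF fg(2,1)]]
      Rs(4)[OF fg] by simp
qed

lemma em_iso: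
  assumes "z \<in> hom emc (X, h) (X', h')" "is_iso emc z"
  obtains i where "z = ((X, h), i, (X', h'))" "i \<in> hom C X X'" "is_iso C i" "i \<cdot>\<^bsub>C\<^esub> h = h' \<cdot>\<^bsub>C\<^esub> on_mor R (on_mor L i)"
proof -
  interpret E: cat_loc emc by unfold_locales (rule em_category)
  obtain i where i: "z = ((X, h), i, (X', h'))" "i \<in> hom C X X'" "i \<cdot>\<^bsub>C\<^esub> h = h' \<cdot>\<^bsub>C\<^esub> on_mor R (on_mor L i)"
    using assms(1) unfolding em_hom_iff by auto
  obtain w where w: "w \<in> hom emc (X', h') (X, h)" "w \<cdot>\<^bsub>emc\<^esub> z = Id emc (X, h)" "z \<cdot>\<^bsub>emc\<^esub> w = Id emc (X', h')"
    using E.isoE[OF assms(2,1)] .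
  obtain j where j: "w = ((X', h'), j, (X, h))" "j \<in> hom C X' X" using w(1) unfolding em_hom_iff by auto
  have "is_iso C i" using C.isoI[OF i(2) j(2)] w(2,3) i(1) j(1) by simp
  then show thesis using that i by blast
qed

text \<open>The inverse of a morphism compatible with the actions is compatible as well, by
  cancelling the image of \<open>i\<close> under the monad.\<close>

lemma em_isoI:
  assumes "(X, h) \<in> algs" "(X', h') \<in> algs" "i \<in> hom C X X'" "is_iso C i" "i \<cdot>\<^bsub>C\<^esub> h = h' \<cdot>\<^bsub>C\<^esub> on_mor R (on_mor L i)"
  shows "isomorphic emc (X, h) (X', h')"
proof -
  interpret E: cat_loc emc by unfold_locales (rule em_category)
  obtain j where j: "j \<in> hom C X' X" "j \<cdot>\<^bsub>C\<^esub> i = Id C X" "i \<cdot>\<^bsub>C\<^esub> j = Id C X'" using C.isoE[OF assms(4,3)] .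
  have O: "X \<in> Ob C" "X' \<in> Ob C" using assms(3) C.hom_Ob1 C.hom_Ob2 by auto
  have h: "h \<in> hom C (on_ob R (on_ob L X)) X" "h' \<in> hom C (on_ob R (on_ob L X')) X'"
    using assms(1,2) by (auto simp: em_algs_def)
  note Ti = Rs(3)[OF Ls(3)[OF assms(3)]] and Tj = Rs(3)[OF Ls(3)[OF j(1)]]
  have Tij: "on_mor R (on_mor L i) \<cdot>\<^bsub>C\<^esub> on_mor R (on_mor L j) = Id C (on_ob R (on_ob L X'))"
    using Rs(4)[OF Ls(3)[OF j(1)] Ls(3)[OF assms(3)]] Ls(4)[OF j(1) assms(3)] j(3) Ls(2)[OF O(2)] Rs(2)[OF Ls(1)[OF O(2)]] by simp
  have "j \<cdot>\<^bsub>C\<^esub> h' = j \<cdot>\<^bsub>C\<^esub> ((h' \<cdot>\<^bsub>C\<^esub> on_mor R (on_mor L i)) \<cdot>\<^bsub>C\<^esub> on_mor R (on_mor L j))"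
    using C.assoc[OF Tj Ti h(2)] Tij C.id_right[OF h(2)] by simp
  also have "\<dots> = j \<cdot>\<^bsub>C\<^esub> ((i \<cdot>\<^bsub>C\<^esub> h) \<cdot>\<^bsub>C\<^esub> on_mor R (on_mor L j))" using assms(5) by simp
  also have "\<dots> = h \<cdot>\<^bsub>C\<^esub> on_mor R (on_mor L j)"
    using j(1) assms(3) h(1) Tj by (simp add: C.cs C.cmp_eq[OF j(2)])
  finally have bwd: "((X', h'), j, (X, h)) \<in> hom emc (X', h') (X, h)" unfolding em_hom_iff using assms j by simp
  have fwd: "((X, h), i, (X', h')) \<in> hom emc (X, h) (X', h')" unfolding em_hom_iff using assms by simp
  have "is_iso emc ((X, h), i, (X', h'))" by (rule E.isoI[OF fwd bwd]) (use j in simp_all)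
  then show ?thesis unfolding isomorphic_def using fwd by blast
qed

end

text \<open>Any two left adjoints of \<open>R\<close> induce isomorphic monads, so essential surjectivity of the
  comparison functor does not depend on the left adjoint.\<close>

lemma monadic_algebra:
  assumes "monadic D C R" "category C" "category D" "adjunction C D L R \<eta> \<epsilon>"
    and "(X, h) \<in> em_algs C (comp_func R L) \<eta> (\<lambda>X. on_mor R (\<epsilon> (on_ob L X)))"
  obtains Y i where "Y \<in> Ob D" "i \<in> hom C (on_ob R Y) X" "is_iso C i"
    "i \<cdot>\<^bsub>C\<^esub> on_mor R (\<epsilon> Y) = h \<cdot>\<^bsub>C\<^esub> on_mor R (on_mor L i)"
proof -
  interpret A: adj_loc C D L R \<eta> \<epsilon> using assms(2-4) by unfold_locales
  obtain L' \<eta>' \<epsilon>' where adj': "adjunction C D L' R \<eta>' \<epsilon>'" and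
    eq: "is_equivalence D (em_cat C (comp_func R L') \<eta>' (\<lambda>X. on_mor R (\<epsilon>' (on_ob L' X)))) (comparison D R \<epsilon>')"
    using assms(1) unfolding monadic_def by blast
  interpret B: adj_loc C D L' R \<eta>' \<epsilon>' using assms(2,3) adj' by unfold_locales
  have X: "X \<in> Ob C" and h: "h \<in> hom C (on_ob R (on_ob L X)) X" "h \<cdot>\<^bsub>C\<^esub> \<eta> X = Id C X"
      "h \<cdot>\<^bsub>C\<^esub> on_mor R (on_mor L h) = h \<cdot>\<^bsub>C\<^esub> on_mor R (\<epsilon> (on_ob L X))"
    using assms(5) by (auto simp: em_algs_def)
  \<comment> \<open>The canonical transformation from \<open>L'\<close> to \<open>L\<close>. It is
    compatible with both units and both counits, and so induces a morphism of monads.\<close>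
  define \<theta> where "\<theta> X = \<epsilon>' (on_ob L X) \<cdot>\<^bsub>D\<^esub> on_mor L' (\<eta> X)" for X
  have \<theta>: "\<theta> X \<in> hom D (on_ob L' X) (on_ob L X)" if "X \<in> Ob C" for X
    unfolding \<theta>_def using A.D.comp_hom[OF B.eps_hom[OF A.Ls(1)[OF that]] B.Ls(3)[OF A.eta_hom[OF that]]] .
  have \<theta>_nat: "\<theta> Y \<cdot>\<^bsub>D\<^esub> on_mor L' g = on_mor L g \<cdot>\<^bsub>D\<^esub> \<theta> W" if g: "g \<in> hom C W Y" for g W Y
  proof -
    note O = A.C.hom_Ob1[OF g] A.C.hom_Ob2[OF g]
    note a = B.eps_hom[OF A.Ls(1)[OF O(1)]] B.eps_hom[OF A.Ls(1)[OF O(2)]] A.eta_hom[OF O(1)] A.eta_hom[OF O(2)] A.Ls(3)[OF g]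
    have "\<theta> Y \<cdot>\<^bsub>D\<^esub> on_mor L' g = \<epsilon>' (on_ob L Y) \<cdot>\<^bsub>D\<^esub> on_mor L' (\<eta> Y \<cdot>\<^bsub>C\<^esub> g)"
      unfolding \<theta>_def B.Ls(4)[OF g a(4)] by (rule A.D.assoc[OF B.Ls(3)[OF g] B.Ls(3)[OF a(4)] a(2)])
    also have "\<dots> = \<epsilon>' (on_ob L Y) \<cdot>\<^bsub>D\<^esub> (on_mor L' (on_mor R (on_mor L g)) \<cdot>\<^bsub>D\<^esub> on_mor L' (\<eta> W))"
      unfolding A.eta_nat[OF g] using B.Ls(4)[OF a(3) A.Rs(3)[OF a(5)]] by simp
    also have "\<dots> = (on_mor L g \<cdot>\<^bsub>D\<^esub> \<epsilon>' (on_ob L W)) \<cdot>\<^bsub>D\<^esub> on_mor L' (\<eta> W)"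
      using A.D.assoc[OF B.Ls(3)[OF a(3)] B.Ls(3)[OF A.Rs(3)[OF a(5)]] a(2)] B.eps_nat[OF a(5)] by simp
    also have "\<dots> = on_mor L g \<cdot>\<^bsub>D\<^esub> \<theta> W" unfolding \<theta>_def by (rule A.D.assoc[OF B.Ls(3)[OF a(3)] a(1) a(5)])
    finally show ?thesis .
  qed
  have \<theta>_eta: "on_mor R (\<theta> X) \<cdot>\<^bsub>C\<^esub> \<eta>' X = \<eta> X" if X: "X \<in> Ob C" for X
  proof -
    note a = B.eps_hom[OF A.Ls(1)[OF X]] A.eta_hom[OF X] B.eta_hom[OF X] B.eta_hom[OF A.Rs(1)[OF A.Ls(1)[OF X]]]
    have "on_mor R (\<theta> X) \<cdot>\<^bsub>C\<^esub> \<eta>' X = on_mor R (\<epsilon>' (on_ob L X)) \<cdot>\<^bsub>C\<^esub> (on_mor R (on_mor L' (\<eta> X)) \<cdot>\<^bsub>C\<^esub> \<eta>' X)"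
      unfolding \<theta>_def A.Rs(4)[OF B.Ls(3)[OF a(2)] a(1)]
      by (rule A.C.assoc[OF a(3) A.Rs(3)[OF B.Ls(3)[OF a(2)]] A.Rs(3)[OF a(1)]])
    also have "\<dots> = (on_mor R (\<epsilon>' (on_ob L X)) \<cdot>\<^bsub>C\<^esub> \<eta>' (on_ob R (on_ob L X))) \<cdot>\<^bsub>C\<^esub> \<eta> X"
      using B.eta_nat[OF a(2)] A.C.assoc[OF a(2,4) A.Rs(3)[OF a(1)]] by simp
    also have "\<dots> = \<eta> X" using B.tri2[OF A.Ls(1)[OF X]] A.C.id_left[OF a(2)] by simp
    finally show ?thesis .
  qed
  have \<theta>_eps: "\<epsilon> Y \<cdot>\<^bsub>D\<^esub> \<theta> (on_ob R Y) = \<epsilon>' Y" if Y: "Y \<in> Ob D" for Y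
  proof -
    note RY = A.Rs(1)[OF Y]
    note a = A.eps_hom[OF Y] A.eta_hom[OF RY] B.eps_hom[OF A.Ls(1)[OF RY]] B.eps_hom[OF Y]
    have "\<epsilon> Y \<cdot>\<^bsub>D\<^esub> \<theta> (on_ob R Y) = (\<epsilon> Y \<cdot>\<^bsub>D\<^esub> \<epsilon>' (on_ob L (on_ob R Y))) \<cdot>\<^bsub>D\<^esub> on_mor L' (\<eta> (on_ob R Y))"
      unfolding \<theta>_def using A.D.assoc[OF B.Ls(3)[OF a(2)] a(3,1)] by simp
    also have "\<dots> = \<epsilon>' Y \<cdot>\<^bsub>D\<^esub> on_mor L' (on_mor R (\<epsilon> Y) \<cdot>\<^bsub>C\<^esub> \<eta> (on_ob R Y))"
      using B.eps_nat[OF a(1)] A.D.assoc[OF B.Ls(3)[OF a(2)] B.Ls(3)[OF A.Rs(3)[OF a(1)]] a(4)]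
        B.Ls(4)[OF a(2) A.Rs(3)[OF a(1)]] by simp
    also have "\<dots> = \<epsilon>' Y" using A.tri2[OF Y] B.Ls(2)[OF RY] A.D.id_right[OF a(4)] by simp
    finally show ?thesis .
  qed
  \<comment> \<open>The action \<open>h\<close> restricted along the morphism of monads induced by
    \<open>\<theta>\<close>.\<close>
  define k where "k = h \<cdot>\<^bsub>C\<^esub> on_mor R (\<theta> X)"
  note LX = A.Ls(1)[OF X] and L'X = B.Ls(1)[OF X]
  note RX' = A.Rs(1)[OF L'X]
  note R\<theta> = A.Rs(3)[OF \<theta>[OF X]]
  have k: "k \<in> hom C (on_ob R (on_ob L' X)) X" unfolding k_def using A.C.comp_hom[OF h(1) R\<theta>] .
  have "k \<cdot>\<^bsub>C\<^esub> \<eta>' X = Id C X"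
    unfolding k_def using A.C.assoc[OF B.eta_hom[OF X] R\<theta> h(1)] \<theta>_eta[OF X] h(2) by simp
  moreover have "k \<cdot>\<^bsub>C\<^esub> on_mor R (on_mor L' k) = k \<cdot>\<^bsub>C\<^esub> on_mor R (\<epsilon>' (on_ob L' X))"
  proof -
    note \<theta>2 = \<theta>[OF RX'] and L'k = B.Ls(3)[OF k]
    note LR\<theta> = A.Ls(3)[OF R\<theta>] and Lh = A.Ls(3)[OF h(1)]
    note e1 = A.eps_hom[OF LX] and e2 = A.eps_hom[OF L'X] and e3 = B.eps_hom[OF L'X]
    have "k \<cdot>\<^bsub>C\<^esub> on_mor R (on_mor L' k) = h \<cdot>\<^bsub>C\<^esub> on_mor R (\<theta> X \<cdot>\<^bsub>D\<^esub> on_mor L' k)"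
      unfolding k_def[THEN arg_cong[of _ _ "\<lambda>z. z \<cdot>\<^bsub>C\<^esub> on_mor R (on_mor L' k)"]]
      using A.C.assoc[OF A.Rs(3)[OF L'k] R\<theta> h(1)] A.Rs(4)[OF L'k \<theta>[OF X]] by simp
    also have "\<dots> = h \<cdot>\<^bsub>C\<^esub> on_mor R (on_mor L k \<cdot>\<^bsub>D\<^esub> \<theta> (on_ob R (on_ob L' X)))"
      using \<theta>_nat[OF k] by simp
    also have "\<dots> = h \<cdot>\<^bsub>C\<^esub> on_mor R (on_mor L h \<cdot>\<^bsub>D\<^esub> (on_mor L (on_mor R (\<theta> X)) \<cdot>\<^bsub>D\<^esub> \<theta> (on_ob R (on_ob L' X))))"
      unfolding k_def A.Ls(4)[OF R\<theta> h(1)] using A.D.assoc[OF \<theta>2 LR\<theta> Lh] by simp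
    also have "\<dots> = (h \<cdot>\<^bsub>C\<^esub> on_mor R (on_mor L h)) \<cdot>\<^bsub>C\<^esub> on_mor R (on_mor L (on_mor R (\<theta> X)) \<cdot>\<^bsub>D\<^esub> \<theta> (on_ob R (on_ob L' X)))"
      using A.Rs(4)[OF A.D.comp_hom[OF LR\<theta> \<theta>2] Lh] A.C.assoc[OF A.Rs(3)[OF A.D.comp_hom[OF LR\<theta> \<theta>2]] A.Rs(3)[OF Lh] h(1)] by simp
    also have "\<dots> = h \<cdot>\<^bsub>C\<^esub> on_mor R (\<epsilon> (on_ob L X) \<cdot>\<^bsub>D\<^esub> (on_mor L (on_mor R (\<theta> X)) \<cdot>\<^bsub>D\<^esub> \<theta> (on_ob R (on_ob L' X))))"
      using h(3) A.Rs(4)[OF A.D.comp_hom[OF LR\<theta> \<theta>2] e1] A.C.assoc[OF A.Rs(3)[OF A.D.comp_hom[OF LR\<theta> \<theta>2]] A.Rs(3)[OF e1] h(1)] by simp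
    also have "\<dots> = h \<cdot>\<^bsub>C\<^esub> on_mor R (\<theta> X \<cdot>\<^bsub>D\<^esub> (\<epsilon> (on_ob L' X) \<cdot>\<^bsub>D\<^esub> \<theta> (on_ob R (on_ob L' X))))"
      using A.D.assoc[OF \<theta>2 LR\<theta> e1] A.eps_nat[OF \<theta>[OF X]] A.D.assoc[OF \<theta>2 e2 \<theta>[OF X]] by simp
    also have "\<dots> = h \<cdot>\<^bsub>C\<^esub> on_mor R (\<theta> X \<cdot>\<^bsub>D\<^esub> \<epsilon>' (on_ob L' X))" using \<theta>_eps[OF L'X] by simp
    also have "\<dots> = k \<cdot>\<^bsub>C\<^esub> on_mor R (\<epsilon>' (on_ob L' X))"
      unfolding k_def using A.Rs(4)[OF e3 \<theta>[OF X]] A.C.assoc[OF A.Rs(3)[OF e3] R\<theta> h(1)] by simp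
    finally show ?thesis .
  qed
  ultimately have alg: "(X, k) \<in> B.algs" using X k by (simp add: em_algs_def)
  obtain G \<tau> where G: "is_functor B.emc D G" "nat_iso B.emc B.emc (comp_func (comparison D R \<epsilon>') G) id_func \<tau>"
    using eq unfolding is_equivalence_def by blast
  define Y where "Y = on_ob G (X, k)"
  have Y: "Y \<in> Ob D" unfolding Y_def using functor_simps(1)[OF G(1)] alg by simp
  have "\<tau> (X, k) \<in> hom B.emc (on_ob R Y, on_mor R (\<epsilon>' Y)) (X, k)" "is_iso B.emc (\<tau> (X, k))"
    using G(2) alg nat_transD(1)[of B.emc B.emc "comp_func (comparison D R \<epsilon>') G" id_func \<tau> "(X, k)"]
    unfolding nat_iso_def Y_def by (simp_all add: B.comparison_simps(1))
  then obtain i where i: "i \<in> hom C (on_ob R Y) X" "is_iso C i"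
    "i \<cdot>\<^bsub>C\<^esub> on_mor R (\<epsilon>' Y) = k \<cdot>\<^bsub>C\<^esub> on_mor R (on_mor L' i)" using B.em_iso by metis
  note RY = A.Rs(1)[OF Y]
  note \<theta>Y = \<theta>[OF RY] and Li = A.Ls(3)[OF i(1)] and L'i = B.Ls(3)[OF i(1)] and eY = A.eps_hom[OF Y]
  have "(i \<cdot>\<^bsub>C\<^esub> on_mor R (\<epsilon> Y)) \<cdot>\<^bsub>C\<^esub> on_mor R (\<theta> (on_ob R Y)) = i \<cdot>\<^bsub>C\<^esub> on_mor R (\<epsilon>' Y)"
    using A.C.assoc[OF A.Rs(3)[OF \<theta>Y] A.Rs(3)[OF eY] i(1)] A.Rs(4)[OF \<theta>Y eY] \<theta>_eps[OF Y] by simp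
  also have "\<dots> = h \<cdot>\<^bsub>C\<^esub> on_mor R (\<theta> X \<cdot>\<^bsub>D\<^esub> on_mor L' i)"
    unfolding i(3) k_def using A.C.assoc[OF A.Rs(3)[OF L'i] R\<theta> h(1)] A.Rs(4)[OF L'i \<theta>[OF X]] by simp
  also have "\<dots> = (h \<cdot>\<^bsub>C\<^esub> on_mor R (on_mor L i)) \<cdot>\<^bsub>C\<^esub> on_mor R (\<theta> (on_ob R Y))"
    unfolding \<theta>_nat[OF i(1)] using A.Rs(4)[OF \<theta>Y Li] A.C.assoc[OF A.Rs(3)[OF \<theta>Y] A.Rs(3)[OF Li] h(1)] by simp
  finally have e: "(i \<cdot>\<^bsub>C\<^esub> on_mor R (\<epsilon> Y)) \<cdot>\<^bsub>C\<^esub> on_mor R (\<theta> (on_ob R Y)) =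
    (h \<cdot>\<^bsub>C\<^esub> on_mor R (on_mor L i)) \<cdot>\<^bsub>C\<^esub> on_mor R (\<theta> (on_ob R Y))" .
  \<comment> \<open>The transformation in the opposite direction. It is a section of
    \<open>\<theta>\<close>, which allows \<open>\<theta>\<close> to be cancelled on the right in
    \<open>e\<close>.\<close>
  define \<phi> where "\<phi> = \<epsilon> (on_ob L' (on_ob R Y)) \<cdot>\<^bsub>D\<^esub> on_mor L (\<eta>' (on_ob R Y))"
  note a = A.eps_hom[OF B.Ls(1)[OF RY]] B.eta_hom[OF RY] A.eps_hom[OF A.Ls(1)[OF RY]]
  have \<phi>: "\<phi> \<in> hom D (on_ob L (on_ob R Y)) (on_ob L' (on_ob R Y))"
    unfolding \<phi>_def using A.D.comp_hom[OF a(1) A.Ls(3)[OF a(2)]] .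
  have "\<theta> (on_ob R Y) \<cdot>\<^bsub>D\<^esub> \<phi> = \<epsilon> (on_ob L (on_ob R Y)) \<cdot>\<^bsub>D\<^esub> (on_mor L (on_mor R (\<theta> (on_ob R Y))) \<cdot>\<^bsub>D\<^esub> on_mor L (\<eta>' (on_ob R Y)))"
    unfolding \<phi>_def using A.D.assoc[OF A.Ls(3)[OF a(2)] a(1) \<theta>Y] A.eps_nat[OF \<theta>Y]
      A.D.assoc[OF A.Ls(3)[OF a(2)] A.Ls(3)[OF A.Rs(3)[OF \<theta>Y]] a(3)] by simp
  also have "\<dots> = Id D (on_ob L (on_ob R Y))"
    using A.Ls(4)[OF a(2) A.Rs(3)[OF \<theta>Y]] \<theta>_eta[OF RY] A.tri1[OF RY] by simp
  finally have "on_mor R (\<theta> (on_ob R Y)) \<cdot>\<^bsub>C\<^esub> on_mor R \<phi> = Id C (on_ob R (on_ob L (on_ob R Y)))"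
    using A.Rs(4)[OF \<phi> \<theta>Y] A.Rs(2)[OF A.Ls(1)[OF RY]] by simp
  then have c: "(w \<cdot>\<^bsub>C\<^esub> on_mor R (\<theta> (on_ob R Y))) \<cdot>\<^bsub>C\<^esub> on_mor R \<phi> = w"
    if "w \<in> hom C (on_ob R (on_ob L (on_ob R Y))) X" for w
    using A.C.assoc[OF A.Rs(3)[OF \<phi>] A.Rs(3)[OF \<theta>Y] that] A.C.id_right[OF that] by simp
  have "i \<cdot>\<^bsub>C\<^esub> on_mor R (\<epsilon> Y) = h \<cdot>\<^bsub>C\<^esub> on_mor R (on_mor L i)"
    using e c[OF A.C.comp_hom[OF i(1) A.Rs(3)[OF eY]]] c[OF A.C.comp_hom[OF h(1) A.Rs(3)[OF Li]]] by metis
  then show thesis using that Y i by blast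
qed

section \<open>Slice categories and change of base\<close>

lemma slice_simps [simp]:
  "Ob (slice C B) = {x \<in> Mor C. Cod C x = B}"
  "Dom (slice C B) (x, g, y) = x" "Cod (slice C B) (x, g, y) = y"
  "Id (slice C B) x = (x, Id C (Dom C x), x)"
  "Cmp (slice C B) (y', g, z) (x, f, y) = (x, g \<cdot>\<^bsub>C\<^esub> f, z)"
  by (simp_all add: slice_def)

lemma slice_hom_iff:
  "w \<in> hom (full_sub (slice C B) E) x y \<longleftrightarrow> x \<in> E \<and> y \<in> E \<and>
    (\<exists>g X Y. w = (x, g, y) \<and> x \<in> hom C X B \<and> y \<in> hom C Y B \<and> g \<in> hom C X Y \<and> y \<cdot>\<^bsub>C\<^esub> g = x)"
  by (auto simp: slice_def hom_def full_sub_def)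

lemma slice_hom_tuple:
  assumes "x \<in> hom C X B" "y \<in> hom C Y B"
  shows "(x', g, y') \<in> hom (full_sub (slice C B) E) x y \<longleftrightarrow>
    x' = x \<and> y' = y \<and> x \<in> E \<and> y \<in> E \<and> g \<in> hom C X Y \<and> y \<cdot>\<^bsub>C\<^esub> g = x"
  using assms by (auto simp: slice_def hom_def full_sub_def)

lemma slice_homE:
  assumes "w \<in> hom (full_sub (slice C B) E) x y" "x \<in> hom C X B" "y \<in> hom C Y B"
  obtains g where "w = (x, g, y)" "g \<in> hom C X Y" "y \<cdot>\<^bsub>C\<^esub> g = x"
  using assms by (auto simp: slice_def hom_def full_sub_def)

context cat_loc
begin

lemma slice_category: "category (slice C B)"
  unfolding category_def
proof (intro conjI ballI impI)
  have m: "\<exists>x g y X Y. w = (x, g, y) \<and> x \<in> hom C X B \<and> y \<in> hom C Y B \<and> g \<in> hom C X Y \<and> y \<cdot> g = x"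
    if "w \<in> Mor (slice C B)" for w
    using that by (auto simp: slice_def hom_def)
  fix w assume w: "w \<in> Mor (slice C B)"
  obtain x g y X Y where g: "w = (x, g, y)" "x \<in> hom C X B" "y \<in> hom C Y B" "g \<in> hom C X Y" "y \<cdot> g = x"
    using m[OF w] by blast
  show "Dom (slice C B) w \<in> Ob (slice C B)" "Cod (slice C B) w \<in> Ob (slice C B)" using g by (auto simp: homD)
  show "w \<cdot>\<^bsub>slice C B\<^esub> Id (slice C B) (Dom (slice C B) w) = w"
    "Id (slice C B) (Cod (slice C B) w) \<cdot>\<^bsub>slice C B\<^esub> w = w"
    using g by (simp_all add: homD(2)[OF g(2)] homD(2)[OF g(3)] id_left[OF g(4)] id_right[OF g(4)])
  fix v assume v: "v \<in> Mor (slice C B)" "Dom (slice C B) v = Cod (slice C B) w"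
  obtain x' h z X' Z where h: "v = (x', h, z)" "x' \<in> hom C X' B" "z \<in> hom C Z B" "h \<in> hom C X' Z" "z \<cdot> h = x'"
    using m[OF v(1)] by blast
  have e: "x' = y" "X' = Y" using v(2) g(1,3) h(1,2) by (auto simp: hom_def)
  have hg: "h \<cdot> g \<in> hom C X Z" using comp_hom h(4) g(4) e by blast
  have "z \<cdot> (h \<cdot> g) = x" using assoc[OF g(4) h(4)[unfolded e] h(3)] h(5) g(5) e by simp
  then show "v \<cdot>\<^bsub>slice C B\<^esub> w \<in> hom (slice C B) (Dom (slice C B) w) (Cod (slice C B) v)"
    using g(1,2) h(1,3) hg by (simp add: slice_def hom_def)
  fix u assume u: "u \<in> Mor (slice C B)" "Dom (slice C B) u = Cod (slice C B) v"
  obtain z' k t Z' T where k: "u = (z', k, t)" "z' \<in> hom C Z' B" "t \<in> hom C T B" "k \<in> hom C Z' T" "t \<cdot> k = z'"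
    using m[OF u(1)] by blast
  have e': "z' = z" "Z' = Z" using u(2) h(1,3) k(1,2) by (auto simp: hom_def)
  show "u \<cdot>\<^bsub>slice C B\<^esub> (v \<cdot>\<^bsub>slice C B\<^esub> w) = u \<cdot>\<^bsub>slice C B\<^esub> v \<cdot>\<^bsub>slice C B\<^esub> w"
    using g(1) h(1) k(1) assoc[OF g(4) h(4)[unfolded e] k(4)[unfolded e']] by simp
next
  fix x assume "x \<in> Ob (slice C B)"
  then have x: "x \<in> hom C (Dom C x) B" by (simp add: hom_def)
  show "Id (slice C B) x \<in> hom (slice C B) x x"
    using x id_hom[OF hom_Ob1[OF x]] id_right[OF x] by (auto simp: slice_def hom_def)
qed

end

text \<open>\<open>push\<close> restricts composition with \<open>f\<close>, the left adjoint, to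
  the objects of the slices that lie in \<open>E\<close>; \<open>pull_ex\<close> and
  \<open>pull\<close> do the same for pulling back. Taking all morphisms for \<open>E\<close> gives
  the unrestricted slices of effective descent, and taking the extensions gives those of monadic
  extensions.\<close>

locale base_change = cat_loc C for C :: "('o, 'm) cat" (structure) +
  fixes E :: "'m set" and f A B
  assumes f: "f \<in> hom C A B"
    and push: "x \<in> E \<Longrightarrow> x \<in> hom C X A \<Longrightarrow> f \<cdot> x \<in> E"
    and pull_ex: "y \<in> E \<Longrightarrow> y \<in> hom C Y B \<Longrightarrow> \<exists>p q. is_pullback C f y p q"
    and pull: "y \<in> E \<Longrightarrow> is_pullback C f y p q \<Longrightarrow> p \<in> E"
begin

abbreviation "SA \<equiv> full_sub (slice C A) E"
abbreviation "SB \<equiv> full_sub (slice C B) E"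
abbreviation "U y \<equiv> fst (pb_choice C f y)"
abbreviation "V y \<equiv> snd (pb_choice C f y)"
abbreviation "P y \<equiv> Dom C (U y)"

lemma SA_cat: "category SA" and SB_cat: "category SB"
  by (simp_all add: category_full_sub slice_category)

lemma choice:
  assumes "y \<in> E" "y \<in> hom C Y B"
  shows "is_pullback C f y (U y) (V y)" "U y \<in> hom C (P y) A" "V y \<in> hom C (P y) Y" "U y \<in> E" "f \<cdot> U y = y \<cdot> V y"
proof -
  obtain p q where "is_pullback C f y p q" using pull_ex[OF assms] by blast
  then show *: "is_pullback C f y (U y) (V y)"
    unfolding pb_choice_def by (rule someI[of "\<lambda>uv. is_pullback C f y (fst uv) (snd uv)" "(p, q)", simplified])
  show "U y \<in> hom C (P y) A" "V y \<in> hom C (P y) Y" using pullback_homs[OF * f assms(2)] by auto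
  show "U y \<in> E" using pull[OF assms(1) *] .
  show "f \<cdot> U y = y \<cdot> V y" using pullback_comm[OF *] .
qed

text \<open>The morphism part of \<open>change_base\<close> without its source and target labels, so
  that it can be characterized by its two projections.\<close>

definition pbm :: "'m \<Rightarrow> 'm \<Rightarrow> 'm \<Rightarrow> 'm" where
  "pbm y g y' = (THE h. h \<in> hom C (P y) (P y') \<and> U y' \<cdot> h = U y \<and> V y' \<cdot> h = g \<cdot> V y)"

lemma pbm:
  assumes "y \<in> E" "y \<in> hom C Y B" "y' \<in> E" "y' \<in> hom C Y' B" "g \<in> hom C Y Y'" "y' \<cdot> g = y"
  shows "pbm y g y' \<in> hom C (P y) (P y')" "U y' \<cdot> pbm y g y' = U y" "V y' \<cdot> pbm y g y' = g \<cdot> V y"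
    and "k \<in> hom C (P y) (P y') \<Longrightarrow> U y' \<cdot> k = U y \<Longrightarrow> V y' \<cdot> k = g \<cdot> V y \<Longrightarrow> pbm y g y' = k"
proof -
  note c = choice[OF assms(1,2)] and c' = choice[OF assms(3,4)]
  have "f \<cdot> U y = y' \<cdot> (g \<cdot> V y)" using c(3,5) assms by (simp add: cs cmp_eq[OF assms(6)])
  then obtain h where h: "h \<in> hom C (P y) (P y')" "U y' \<cdot> h = U y" "V y' \<cdot> h = g \<cdot> V y"
    using pullback_lift[OF c'(1) f assms(4) c'(2) c(2) comp_hom[OF assms(5) c(3)]] by metis
  have u: "k = h" if "k \<in> hom C (P y) (P y')" "U y' \<cdot> k = U y" "V y' \<cdot> k = g \<cdot> V y" for k
    using pullback_unique[OF c'(1,2) that(1) h(1)] that h by simp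
  then have e: "pbm y g y' = h" unfolding pbm_def using h by (intro the_equality) blast+
  show "pbm y g y' \<in> hom C (P y) (P y')" "U y' \<cdot> pbm y g y' = U y" "V y' \<cdot> pbm y g y' = g \<cdot> V y"
    unfolding e by (rule h)+
  show "k \<in> hom C (P y) (P y') \<Longrightarrow> U y' \<cdot> k = U y \<Longrightarrow> V y' \<cdot> k = g \<cdot> V y \<Longrightarrow> pbm y g y' = k"
    unfolding e using u by simp
qed

abbreviation "R \<equiv> change_base C f"

lemma R_simps: "on_ob R y = U y" "on_mor R (y, g, y') = (U y, pbm y g y', U y')"
  by (simp_all add: change_base_def pbm_def split: prod.split)

lemma slice_obj_iff: "y \<in> Ob SB \<longleftrightarrow> y \<in> E \<and> y \<in> hom C (Dom C y) B"
  "x \<in> Ob SA \<longleftrightarrow> x \<in> E \<and> x \<in> hom C (Dom C x) A"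
  by (auto simp: hom_def)

lemma R_functor: "is_functor SB SA R"
proof (rule functorI[OF SB_cat])
  fix y assume "y \<in> Ob SB"
  then have y: "y \<in> E" "y \<in> hom C (Dom C y) B" using slice_obj_iff by auto
  note c = choice[OF y]
  note O = hom_Ob1[OF c(2)] hom_Ob1[OF y(2)]
  show "on_ob R y \<in> Ob SA" using c(2,4) by (simp add: R_simps hom_def)
  have "pbm y (Id C (Dom C y)) y = Id C (P y)"
    using pbm(4)[OF y y id_hom[OF O(2)] id_right[OF y(2)] id_hom[OF O(1)]] id_right[OF c(2)] id_right[OF c(3)] id_left[OF c(3)]
    by simp
  then show "on_mor R (Id SB y) = Id SA (on_ob R y)" by (simp add: R_simps)
next
  fix w x y assume "w \<in> hom SB x y"
  then obtain g X Y where g: "x \<in> E" "x \<in> hom C X B" "y \<in> E" "y \<in> hom C Y B" "g \<in> hom C X Y" "y \<cdot> g = x" "w = (x, g, y)"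
    unfolding slice_hom_iff by blast
  show "on_mor R w \<in> hom SA (on_ob R x) (on_ob R y)"
    unfolding g(7) R_simps slice_hom_iff using choice[OF g(1,2)] choice[OF g(3,4)] pbm[OF g(1-6)] by blast
next
  fix w v x y z assume wv: "w \<in> hom SB x y" "v \<in> hom SB y z"
  obtain g X Y where g: "x \<in> E" "x \<in> hom C X B" "y \<in> E" "y \<in> hom C Y B" "g \<in> hom C X Y" "y \<cdot> g = x" "w = (x, g, y)"
    using wv(1) unfolding slice_hom_iff by blast
  obtain h Y' Z where h': "y \<in> hom C Y' B" "z \<in> E" "z \<in> hom C Z B" "h \<in> hom C Y' Z" "z \<cdot> h = y" "v = (y, h, z)"
    using wv(2) unfolding slice_hom_iff by blast
  have "Y' = Y" using g(4) h'(1) by (simp add: hom_def)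
  note h = h'[unfolded this]
  note cx = choice[OF g(1,2)] and cy = choice[OF g(3,4)] and cz = choice[OF h(2,3)]
  note pg = pbm[OF g(1-6)] and ph = pbm[OF g(3,4) h(2,3,4,5)]
  have zhg: "z \<cdot> (h \<cdot> g) = x" using assoc[OF g(5) h(4,3)] h(5) g(6) by simp
  have "pbm x (h \<cdot> g) z = pbm y h z \<cdot> pbm x g y"
  proof (rule pbm(4)[OF g(1,2) h(2,3) comp_hom[OF h(4) g(5)] zhg comp_hom[OF ph(1) pg(1)]])
    show "U z \<cdot> (pbm y h z \<cdot> pbm x g y) = U x" using assoc[OF pg(1) ph(1) cz(2)] ph(2) pg(2) by simp
    show "V z \<cdot> (pbm y h z \<cdot> pbm x g y) = (h \<cdot> g) \<cdot> V x"
      using assoc[OF pg(1) ph(1) cz(3)] ph(3) assoc[OF pg(1) cy(3) h(4)] pg(3) assoc[OF cx(3) g(5) h(4)] by simp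
  qed
  then show "on_mor R (v \<cdot>\<^bsub>SB\<^esub> w) = on_mor R v \<cdot>\<^bsub>SA\<^esub> on_mor R w" using g(7) h(6) by (simp add: R_simps)
qed

definition L :: "('m, 'm \<times> 'm \<times> 'm, 'm, 'm \<times> 'm \<times> 'm) func" where
  "L = \<lparr>on_ob = (\<lambda>x. f \<cdot> x), on_mor = (\<lambda>(x, g, y). (f \<cdot> x, g, f \<cdot> y))\<rparr>"

lemma L_simps: "on_ob L x = f \<cdot> x" "on_mor L (x, g, y) = (f \<cdot> x, g, f \<cdot> y)"
  by (simp_all add: L_def)

lemma L_functor: "is_functor SA SB L"
proof (rule functorI[OF SA_cat])
  fix x assume "x \<in> Ob SA"
  then have x: "x \<in> E" "x \<in> hom C (Dom C x) A" using slice_obj_iff by auto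
  have fx: "f \<cdot> x \<in> hom C (Dom C x) B" using comp_hom[OF f x(2)] .
  then show "on_ob L x \<in> Ob SB" using push[OF x] slice_obj_iff by (simp add: L_simps homD)
  show "on_mor L (Id SA x) = Id SB (on_ob L x)" using fx by (simp add: L_simps homD)
next
  fix w x y assume "w \<in> hom SA x y"
  then obtain g X Y where g: "x \<in> E" "x \<in> hom C X A" "y \<in> E" "y \<in> hom C Y A" "g \<in> hom C X Y" "y \<cdot> g = x" "w = (x, g, y)"
    unfolding slice_hom_iff by blast
  have "(f \<cdot> y) \<cdot> g = f \<cdot> x" using assoc[OF g(5,4) f] g(6) by simp
  then show "on_mor L w \<in> hom SB (on_ob L x) (on_ob L y)"
    unfolding g(7) L_simps slice_hom_iff using push g comp_hom[OF f] by blast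
next
  fix w v x y z assume wv: "w \<in> hom SA x y" "v \<in> hom SA y z"
  then show "on_mor L (v \<cdot>\<^bsub>SA\<^esub> w) = on_mor L v \<cdot>\<^bsub>SB\<^esub> on_mor L w"
    unfolding slice_hom_iff by (auto simp: L_simps)
qed

definition uni :: "'m \<Rightarrow> 'm" where
  "uni x = (THE h. h \<in> hom C (Dom C x) (P (f \<cdot> x)) \<and> U (f \<cdot> x) \<cdot> h = x \<and> V (f \<cdot> x) \<cdot> h = Id C (Dom C x))"

lemma uni:
  assumes "x \<in> E" "x \<in> hom C X A"
  shows "uni x \<in> hom C X (P (f \<cdot> x))" "U (f \<cdot> x) \<cdot> uni x = x" "V (f \<cdot> x) \<cdot> uni x = Id C X"
proof -
  note c = choice[OF push[OF assms] comp_hom[OF f assms(2)]]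
  note i = id_hom[OF hom_Ob1[OF assms(2)]]
  have "f \<cdot> x = (f \<cdot> x) \<cdot> Id C X" using id_right[OF comp_hom[OF f assms(2)]] by simp
  then obtain h where h: "h \<in> hom C X (P (f \<cdot> x))" "U (f \<cdot> x) \<cdot> h = x" "V (f \<cdot> x) \<cdot> h = Id C X"
    using pullback_lift[OF c(1) f comp_hom[OF f assms(2)] c(2) assms(2) i] by metis
  have "k = h" if "k \<in> hom C X (P (f \<cdot> x))" "U (f \<cdot> x) \<cdot> k = x" "V (f \<cdot> x) \<cdot> k = Id C X" for k
    using pullback_unique[OF c(1,2) that(1) h(1)] that h by simp
  then have "uni x = h" unfolding uni_def homD(2)[OF assms(2)] using h by (intro the_equality) blast+
  then show "uni x \<in> hom C X (P (f \<cdot> x))" "U (f \<cdot> x) \<cdot> uni x = x" "V (f \<cdot> x) \<cdot> uni x = Id C X" using h by auto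
qed

definition \<eta> where "\<eta> x = (x, uni x, U (f \<cdot> x))"
definition \<epsilon> where "\<epsilon> y = (f \<cdot> U y, V y, y)"

lemma push_pull:
  assumes "y \<in> E" "y \<in> hom C Y B"
  shows "f \<cdot> U y \<in> E" "f \<cdot> U y \<in> hom C (P y) B" "y \<cdot> V y = f \<cdot> U y"
proof -
  note c = choice[OF assms]
  show "f \<cdot> U y \<in> E" "f \<cdot> U y \<in> hom C (P y) B" "y \<cdot> V y = f \<cdot> U y"
    using push[OF c(4,2)] comp_hom[OF f c(2)] c(5) by auto
qed

lemma base_change_adjunction: "adjunction SA SB L R \<eta> \<epsilon>"
  unfolding adjunction_def
proof (intro conjI ballI nat_transI)
  show "is_functor SA SB L" by (rule L_functor)
  show "is_functor SB SA R" by (rule R_functor)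
next
  fix x assume "x \<in> Ob SA"
  then have x: "x \<in> E" "x \<in> hom C (Dom C x) A" using slice_obj_iff by auto
  note fx = push[OF x] comp_hom[OF f x(2)]
  note c = choice[OF fx]
  have uo: "U (f \<cdot> x) \<in> E" "U (f \<cdot> x) \<in> hom C (P (f \<cdot> x)) A" by fact+
  show "\<eta> x \<in> hom SA (on_ob id_func x) (on_ob (comp_func R L) x)"
    unfolding \<eta>_def slice_hom_iff using x uo uni[OF x] by (auto simp: R_simps L_simps)
  show "\<epsilon> (on_ob L x) \<cdot>\<^bsub>SB\<^esub> on_mor L (\<eta> x) = Id SB (on_ob L x)"
    unfolding \<eta>_def \<epsilon>_def using uni(3)[OF x] fx(2) by (simp add: L_simps homD)
next
  fix w x y assume "w \<in> hom SA x y"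
  then obtain g X Y where g: "x \<in> E" "x \<in> hom C X A" "y \<in> E" "y \<in> hom C Y A" "g \<in> hom C X Y" "y \<cdot> g = x" "w = (x, g, y)"
    unfolding slice_hom_iff by blast
  note fx = push[OF g(1,2)] comp_hom[OF f g(2)] and fy = push[OF g(3,4)] comp_hom[OF f g(4)]
  have e: "(f \<cdot> y) \<cdot> g = f \<cdot> x" using assoc[OF g(5,4) f] g(6) by simp
  note p = pbm[OF fx fy g(5) e]
  note cy = choice[OF fy] and cx = choice[OF fx]
  note ux = uni[OF g(1,2)] and uy = uni[OF g(3,4)]
  have "uni y \<cdot> g = pbm (f \<cdot> x) g (f \<cdot> y) \<cdot> uni x"
  proof (rule pullback_unique[OF cy(1,2) comp_hom[OF uy(1) g(5)] comp_hom[OF p(1) ux(1)]])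
    show "U (f \<cdot> y) \<cdot> (uni y \<cdot> g) = U (f \<cdot> y) \<cdot> (pbm (f \<cdot> x) g (f \<cdot> y) \<cdot> uni x)"
      using assoc[OF g(5) uy(1) cy(2)] assoc[OF ux(1) p(1) cy(2)] uy(2) p(2) ux(2) g(6) by simp
    show "V (f \<cdot> y) \<cdot> (uni y \<cdot> g) = V (f \<cdot> y) \<cdot> (pbm (f \<cdot> x) g (f \<cdot> y) \<cdot> uni x)"
      using assoc[OF g(5) uy(1) cy(3)] assoc[OF ux(1) p(1) cy(3)] uy(3) p(3) ux(3)
        assoc[OF ux(1) cx(3) g(5)] id_left[OF g(5)] id_right[OF g(5)] by simp
  qed
  then show "\<eta> y \<cdot>\<^bsub>SA\<^esub> on_mor id_func w = on_mor (comp_func R L) w \<cdot>\<^bsub>SA\<^esub> \<eta> x"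
    unfolding g(7) \<eta>_def by (simp add: R_simps L_simps)
next
  fix y assume "y \<in> Ob SB"
  then have y: "y \<in> E" "y \<in> hom C (Dom C y) B" using slice_obj_iff by auto
  note c = choice[OF y] and pp = push_pull[OF y]
  show "\<epsilon> y \<in> hom SB (on_ob (comp_func L R) y) (on_ob id_func y)"
    unfolding \<epsilon>_def slice_hom_iff using y c(3) pp by (auto simp: R_simps L_simps)
  note p = pbm[OF pp(1,2) y c(3) pp(3)]
  note u = uni[OF c(4,2)] and c2 = choice[OF pp(1,2)]
  have "pbm (f \<cdot> U y) (V y) y \<cdot> uni (U y) = Id C (P y)"
  proof (rule pullback_unique[OF c(1,2) comp_hom[OF p(1) u(1)] id_hom[OF hom_Ob1[OF c(2)]]])
    show "U y \<cdot> (pbm (f \<cdot> U y) (V y) y \<cdot> uni (U y)) = U y \<cdot> Id C (P y)"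
      using assoc[OF u(1) p(1) c(2)] p(2) u(2) id_right[OF c(2)] by simp
    show "V y \<cdot> (pbm (f \<cdot> U y) (V y) y \<cdot> uni (U y)) = V y \<cdot> Id C (P y)"
      using assoc[OF u(1) p(1) c(3)] p(3) u(3) assoc[OF u(1) c2(3) c(3)] by simp
  qed
  then show "on_mor R (\<epsilon> y) \<cdot>\<^bsub>SA\<^esub> \<eta> (on_ob R y) = Id SA (on_ob R y)"
    unfolding \<epsilon>_def \<eta>_def by (simp add: R_simps)
next
  fix w x y assume "w \<in> hom SB x y"
  then obtain g X Y where g: "x \<in> E" "x \<in> hom C X B" "y \<in> E" "y \<in> hom C Y B" "g \<in> hom C X Y" "y \<cdot> g = x" "w = (x, g, y)"
    unfolding slice_hom_iff by blast
  show "\<epsilon> y \<cdot>\<^bsub>SB\<^esub> on_mor (comp_func L R) w = on_mor id_func w \<cdot>\<^bsub>SB\<^esub> \<epsilon> x"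
    unfolding g(7) \<epsilon>_def using pbm(3)[OF g(1-6)] by (simp add: R_simps L_simps)
qed

sublocale adj: adj_loc SA SB L R \<eta> \<epsilon>
  by unfold_locales (rule SA_cat SB_cat base_change_adjunction)+

text \<open>For the unit law, \<open>u \<cdot> m = x \<cdot> (v \<cdot> m)\<close> says that
  \<open>m\<close> factors through \<open>uni x\<close>. For associativity, elements
  \<open>m\<close>, \<open>m'\<close>, \<open>m''\<close> as in \<open>descent_alg\<close> are the
  images of a single element \<open>w\<close> of the iterated pullback, under the two structure maps
  and the projection.\<close>

lemma alg_iff:
  assumes "x \<in> E" "x \<in> hom C X A"
  shows "(x, (U (f \<cdot> x), h, x)) \<in> adj.algs \<longleftrightarrow> descent_alg C f x (U (f \<cdot> x)) (V (f \<cdot> x)) h"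
proof -
  note fx = push[OF assms] comp_hom[OF f assms(2)]
  note c = choice[OF fx] and pp = push_pull[OF fx]
  note c2 = choice[OF pp(1,2)] and u = uni[OF assms]
  note pv = pbm[OF pp(1,2) fx c(3) pp(3)]
  have xO: "x \<in> Ob SA" using assms by (simp add: hom_def)
  have hiff: "(U (f \<cdot> x), h, x) \<in> hom SA (on_ob R (on_ob L x)) x \<longleftrightarrow> h \<in> hom C (P (f \<cdot> x)) X \<and> x \<cdot> h = U (f \<cdot> x)"
    unfolding R_simps L_simps slice_hom_tuple[OF c(2) assms(2)] using c(4) assms(1) by simp
  have push_h: "(f \<cdot> x) \<cdot> h = f \<cdot> U (f \<cdot> x)" if "h \<in> hom C (P (f \<cdot> x)) X" "x \<cdot> h = U (f \<cdot> x)"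
    using assoc[OF that(1) assms(2) f] that(2) by simp
  show ?thesis
  proof
    assume a: "(x, (U (f \<cdot> x), h, x)) \<in> adj.algs"
    then have h: "h \<in> hom C (P (f \<cdot> x)) X" "x \<cdot> h = U (f \<cdot> x)" using hiff unfolding em_algs_def by auto
    note ph = pbm[OF pp(1,2) fx h(1) push_h[OF h]]
    have un: "h \<cdot> uni x = Id C X" using a assms unfolding em_algs_def by (simp add: \<eta>_def homD)
    have as: "h \<cdot> pbm (f \<cdot> U (f \<cdot> x)) h (f \<cdot> x) = h \<cdot> pbm (f \<cdot> U (f \<cdot> x)) (V (f \<cdot> x)) (f \<cdot> x)"
      using a unfolding em_algs_def by (simp add: R_simps L_simps \<epsilon>_def)
    show "descent_alg C f x (U (f \<cdot> x)) (V (f \<cdot> x)) h"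
      unfolding descent_alg_def
    proof (intro conjI allI ballI impI)
      show "x \<in> Mor C" "Cod C x = Dom C f" using assms f by (auto simp: hom_def)
      show "is_pullback C f (f \<cdot> x) (U (f \<cdot> x)) (V (f \<cdot> x))" by fact
      show "h \<in> hom C (P (f \<cdot> x)) (Dom C x)" "x \<cdot> h = U (f \<cdot> x)" using h assms by (auto simp: homD)
    next
      fix W m assume m: "m \<in> hom C W (P (f \<cdot> x))" "U (f \<cdot> x) \<cdot> m = x \<cdot> (V (f \<cdot> x) \<cdot> m)"
      note vm = comp_hom[OF c(3) m(1)]
      have "uni x \<cdot> (V (f \<cdot> x) \<cdot> m) = m"
        by (rule pullback_unique[OF c(1,2) comp_hom[OF u(1) vm] m(1)])
          (use assoc[OF vm u(1) c(2)] assoc[OF vm u(1) c(3)] u(2,3) m(2) id_left[OF vm] in simp_all)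
      then have "h \<cdot> m = (h \<cdot> uni x) \<cdot> (V (f \<cdot> x) \<cdot> m)" using assoc[OF vm u(1) h(1)] by simp
      then show "h \<cdot> m = V (f \<cdot> x) \<cdot> m" using un id_left[OF vm] by simp
    next
      fix W m m' m'' assume m: "m \<in> hom C W (P (f \<cdot> x))" "m' \<in> hom C W (P (f \<cdot> x))" "m'' \<in> hom C W (P (f \<cdot> x))" and
        e: "V (f \<cdot> x) \<cdot> m'' = h \<cdot> m'" "U (f \<cdot> x) \<cdot> m'' = U (f \<cdot> x) \<cdot> m" "V (f \<cdot> x) \<cdot> m = V (f \<cdot> x) \<cdot> m'"
      note um = comp_hom[OF c(2) m(1)]
      have "f \<cdot> (U (f \<cdot> x) \<cdot> m) = (f \<cdot> x) \<cdot> (V (f \<cdot> x) \<cdot> m)"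
        using assoc[OF m(1) c(2) f] c(5) assoc[OF m(1) c(3) fx(2)] by simp
      also have "\<dots> = (f \<cdot> U (f \<cdot> x)) \<cdot> m'" using e(3) assoc[OF m(2) c(3) fx(2)] c(5) by simp
      finally obtain w where w: "w \<in> hom C W (P (f \<cdot> U (f \<cdot> x)))" "U (f \<cdot> U (f \<cdot> x)) \<cdot> w = U (f \<cdot> x) \<cdot> m" "V (f \<cdot> U (f \<cdot> x)) \<cdot> w = m'"
        using pullback_lift[OF c2(1) f pp(2) c2(2) um m(2)] by metis
      have 1: "pbm (f \<cdot> U (f \<cdot> x)) h (f \<cdot> x) \<cdot> w = m''"
        by (rule pullback_unique[OF c(1,2) comp_hom[OF ph(1) w(1)] m(3)])
          (use assoc[OF w(1) ph(1) c(2)] assoc[OF w(1) ph(1) c(3)] ph(2,3) w(2,3) e assoc[OF w(1) c2(3) h(1)] in simp_all)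
      have 2: "pbm (f \<cdot> U (f \<cdot> x)) (V (f \<cdot> x)) (f \<cdot> x) \<cdot> w = m"
        by (rule pullback_unique[OF c(1,2) comp_hom[OF pv(1) w(1)] m(1)])
          (use assoc[OF w(1) pv(1) c(2)] assoc[OF w(1) pv(1) c(3)] pv(2,3) w(2,3) e assoc[OF w(1) c2(3) c(3)] in simp_all)
      have "h \<cdot> m'' = (h \<cdot> pbm (f \<cdot> U (f \<cdot> x)) h (f \<cdot> x)) \<cdot> w" using 1 assoc[OF w(1) ph(1) h(1)] by simp
      also have "\<dots> = h \<cdot> m" unfolding as using 2 assoc[OF w(1) pv(1) h(1)] by simp
      finally show "h \<cdot> m'' = h \<cdot> m" .
    qed
  next
    assume a: "descent_alg C f x (U (f \<cdot> x)) (V (f \<cdot> x)) h"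
    then have h: "h \<in> hom C (P (f \<cdot> x)) X" "x \<cdot> h = U (f \<cdot> x)" using assms unfolding descent_alg_def by (auto simp: homD)
    note ph = pbm[OF pp(1,2) fx h(1) push_h[OF h]]
    have "U (f \<cdot> x) \<cdot> uni x = x \<cdot> (V (f \<cdot> x) \<cdot> uni x)" using u id_right[OF assms(2)] by simp
    then have un: "h \<cdot> uni x = Id C X" using a u(1,3) unfolding descent_alg_def by metis
    have as: "h \<cdot> pbm (f \<cdot> U (f \<cdot> x)) h (f \<cdot> x) = h \<cdot> pbm (f \<cdot> U (f \<cdot> x)) (V (f \<cdot> x)) (f \<cdot> x)"
      by (rule descent_alg_act[OF a pv(1) c2(3) ph(1) ph(3)]) (use ph(2) pv(2,3) in simp_all)
    show "(x, (U (f \<cdot> x), h, x)) \<in> adj.algs"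
      unfolding em_algs_def using xO hiff h un as assms by (simp add: \<eta>_def homD R_simps L_simps \<epsilon>_def)
  qed
qed

lemma slice_iso:
  assumes "w \<in> hom SA x y" "x \<in> hom C X A" "y \<in> hom C Y A"
  shows "is_iso SA w \<longleftrightarrow> (\<exists>i. w = (x, i, y) \<and> i \<in> hom C X Y \<and> is_iso C i \<and> y \<cdot> i = x)"
proof -
  obtain i X' Y' where i': "w = (x, i, y)" "x \<in> E" "y \<in> E" "x \<in> hom C X' A" "y \<in> hom C Y' A" "i \<in> hom C X' Y'" "y \<cdot> i = x"
    using assms(1) unfolding slice_hom_iff by blast
  have e: "X' = X" "Y' = Y" using i'(4,5) assms(2,3) by (auto simp: hom_def)
  note i = i'[unfolded e]
  show ?thesis
  proof
    assume "is_iso SA w"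
    then obtain v where v: "v \<in> hom SA y x" "v \<cdot>\<^bsub>SA\<^esub> w = Id SA x" "w \<cdot>\<^bsub>SA\<^esub> v = Id SA y" using adj.C.isoE assms(1) by metis
    obtain j X' Y' where j: "v = (y, j, x)" "y \<in> hom C Y' A" "x \<in> hom C X' A" "j \<in> hom C Y' X'"
      using v(1) unfolding slice_hom_iff by blast
    have "X' = X" "Y' = Y" using j(2,3) assms(2,3) by (auto simp: hom_def)
    then have "is_iso C i" using isoI[OF i(6)] j(4) v(2,3) i(1) j(1) assms(2,3) by (simp add: homD)
    then show "\<exists>i. w = (x, i, y) \<and> i \<in> hom C X Y \<and> is_iso C i \<and> y \<cdot> i = x" using i by blast
  next
    assume "\<exists>i. w = (x, i, y) \<and> i \<in> hom C X Y \<and> is_iso C i \<and> y \<cdot> i = x"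
    then have ii: "is_iso C i" using i(1) by auto
    obtain j where j: "j \<in> hom C Y X" "j \<cdot> i = Id C X" "i \<cdot> j = Id C Y" using isoE[OF ii i(6)] .
    have "x \<cdot> j = y" unfolding i(7)[symmetric] using assoc[OF j(1) i(6) assms(3)] j(3) id_right[OF assms(3)] by simp
    then have v: "(y, j, x) \<in> hom SA y x" unfolding slice_hom_iff using i j by blast
    show "is_iso SA w" by (rule adj.C.isoI[OF assms(1) v]) (use i(1) j assms(2,3) in \<open>simp_all add: homD\<close>)
  qed
qed

end

text \<open>\<open>descent_alg\<close> allows any pullback whereas \<open>change_base\<close> works
  with a chosen one; this moves an algebra from one to the other.\<close>

lemma (in cat_loc) descent_alg_reindex:
  assumes "descent_alg C p x u v h" "is_pullback C p (p \<cdot> x) u' v'" "i \<in> hom C P (Dom C u)" "is_iso C i"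
    "u \<cdot> i = u'" "v \<cdot> i = v'" "u' \<in> hom C P A" "v' \<in> hom C P X" "x \<in> hom C X A"
  shows "descent_alg C p x u' v' (h \<cdot> i)"
proof -
  have a: "x \<in> Mor C" "Cod C x = Dom C p" "is_pullback C p (p \<cdot> x) u v" "h \<in> hom C (Dom C u) (Dom C x)" "x \<cdot> h = u"
    using assms(1) unfolding descent_alg_def by auto
  have unit: "h \<cdot> m = v \<cdot> m" if "m \<in> hom C W (Dom C u)" "u \<cdot> m = x \<cdot> (v \<cdot> m)" for W m
    using assms(1) that unfolding descent_alg_def by blast
  have u: "u \<in> hom C (Dom C u) A" and v: "v \<in> hom C (Dom C u) X" and h: "h \<in> hom C (Dom C u) X"
    using a(2-4) assms(9) by (auto simp: is_pullback_def hom_def) (metis a(1) cmp_Dom)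
  show ?thesis
    unfolding descent_alg_def homD(2)[OF assms(7)]
  proof (intro conjI allI ballI impI)
    show "x \<in> Mor C" "Cod C x = Dom C p" "is_pullback C p (p \<cdot> x) u' v'" by fact+
    show "h \<cdot> i \<in> hom C P (Dom C x)" using comp_hom[OF a(4) assms(3)] .
    show "x \<cdot> (h \<cdot> i) = u'" using assoc[OF assms(3) h assms(9)] a(5) assms(5) by simp
  next
    fix W m assume m: "m \<in> hom C W P" "u' \<cdot> m = x \<cdot> (v' \<cdot> m)"
    show "(h \<cdot> i) \<cdot> m = v' \<cdot> m"
      using unit[OF comp_hom[OF assms(3) m(1)]] assoc[OF m(1) assms(3) h] assoc[OF m(1) assms(3) u] assoc[OF m(1) assms(3) v]
        assms(5,6) m(2) by simp
  next
    fix W m m' m'' assume m: "m \<in> hom C W P" "m' \<in> hom C W P" "m'' \<in> hom C W P" and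
      e: "v' \<cdot> m'' = (h \<cdot> i) \<cdot> m'" "u' \<cdot> m'' = u' \<cdot> m" "v' \<cdot> m = v' \<cdot> m'"
    note im = comp_hom[OF assms(3) m(1)] comp_hom[OF assms(3) m(2)] comp_hom[OF assms(3) m(3)]
    have "h \<cdot> (i \<cdot> m'') = h \<cdot> (i \<cdot> m)"
      by (rule descent_alg_act[OF assms(1) im])
        (use e assms(5,6) assoc[OF m(1) assms(3) u] assoc[OF m(3) assms(3) u] assoc[OF m(1) assms(3) v]
           assoc[OF m(2) assms(3) v] assoc[OF m(3) assms(3) v] assoc[OF m(2) assms(3) h] in simp_all)
    then show "(h \<cdot> i) \<cdot> m'' = (h \<cdot> i) \<cdot> m" using assoc[OF m(1) assms(3) h] assoc[OF m(3) assms(3) h] by simp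
  qed
qed

context base_change
begin

text \<open>With all morphisms in \<open>E\<close>, every descent datum is an algebra, and
  \<open>monadic_algebra\<close> gives some \<open>y\<close> whose pullback is isomorphic to it. The
  isomorphism carries the pullback square of \<open>y\<close> to one over \<open>x\<close>, and its
  compatibility with the actions says that \<open>q\<close> does not distinguish \<open>h\<close>
  from \<open>v\<close>.\<close>

theorem effective_algs_of_monadic:
  assumes "monadic SB SA R" "\<And>x. x \<in> Mor C \<Longrightarrow> x \<in> E"
  shows "effective_algs C f"
  unfolding effective_algs_def
proof (intro allI impI)
  fix x u v h assume alg: "descent_alg C f x u v h"
  define X where "X = Dom C x"
  have x: "x \<in> hom C X A" "x \<in> E"
    using alg assms(2) f unfolding descent_alg_def X_def by (auto simp: hom_def)
  note fx = push[OF x(2,1)] comp_hom[OF f x(1)]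
  note c = choice[OF fx]
  have pb: "is_pullback C f (f \<cdot> x) u v" using alg unfolding descent_alg_def by auto
  note uv = pullback_homs[OF pb f fx(2)]
  have h: "h \<in> hom C (Dom C u) X" using alg unfolding descent_alg_def X_def by auto
  obtain i where i: "i \<in> hom C (P (f \<cdot> x)) (Dom C u)" "is_iso C i" "u \<cdot> i = U (f \<cdot> x)" "v \<cdot> i = V (f \<cdot> x)"
    using pullback_iso[OF pb c(1) uv(1) c(2)] .
  have "descent_alg C f x (U (f \<cdot> x)) (V (f \<cdot> x)) (h \<cdot> i)"
    by (rule descent_alg_reindex[OF alg c(1) i c(2,3) x(1)])
  then have "(x, (U (f \<cdot> x), h \<cdot> i, x)) \<in> adj.algs" using alg_iff[OF x(2,1)] by simp
  then obtain y w where y: "y \<in> Ob SB" "w \<in> hom SA (on_ob R y) x" "is_iso SA w"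
    "w \<cdot>\<^bsub>SA\<^esub> on_mor R (\<epsilon> y) = (U (f \<cdot> x), h \<cdot> i, x) \<cdot>\<^bsub>SA\<^esub> on_mor R (on_mor L w)"
    using monadic_algebra[OF assms(1) SA_cat SB_cat base_change_adjunction] by metis
  have yh: "y \<in> E" "y \<in> hom C (Dom C y) B" using y(1) slice_obj_iff by auto
  note cy = choice[OF yh] and pp = push_pull[OF yh]
  obtain j where j: "w = (U y, j, x)" "j \<in> hom C (P y) X" "is_iso C j" "x \<cdot> j = U y"
    using slice_iso[OF y(2), unfolded R_simps, OF cy(2) x(1)] y(3) by blast
  obtain k where k: "k \<in> hom C X (P y)" "k \<cdot> j = Id C (P y)" "j \<cdot> k = Id C X" "is_iso C k" using iso_inv[OF j(3,2)] .
  define q where "q = V y \<cdot> k"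
  have Uk: "U y \<cdot> k = x" unfolding j(4)[symmetric] using assoc[OF k(1) j(2) x(1)] k(3) id_right[OF x(1)] by simp
  have q: "is_pullback C f y x q" using pullback_of_iso[OF cy(1) k(1,4) cy(2)] Uk unfolding q_def by simp
  have pj: "(f \<cdot> x) \<cdot> j = f \<cdot> U y" using assoc[OF j(2) x(1) f] j(4) by simp
  note pe = pbm[OF pp(1,2) yh cy(3) pp(3)] and pL = pbm[OF pp(1,2) fx j(2) pj]
  note c2 = choice[OF pp(1,2)]
  have act: "j \<cdot> pbm (f \<cdot> U y) (V y) y = (h \<cdot> i) \<cdot> pbm (f \<cdot> U y) j (f \<cdot> x)"
    using y(4) unfolding j(1) by (simp add: R_simps L_simps \<epsilon>_def)
  have fxk: "(f \<cdot> U y) \<cdot> k = f \<cdot> x" using assoc[OF k(1) cy(2) f] Uk by simp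
  note pk = pbm[OF fx pp(1,2) k(1) fxk]
  \<comment> \<open>The morphism induced by \<open>k\<close> is a section of the one induced by
    \<open>j\<close>; composing with it removes the latter from the equation
    \<open>act\<close>.\<close>
  have kk: "pbm (f \<cdot> U y) j (f \<cdot> x) \<cdot> pbm (f \<cdot> x) k (f \<cdot> U y) = Id C (P (f \<cdot> x))"
  proof (rule pullback_unique[OF c(1,2) comp_hom[OF pL(1) pk(1)] id_hom[OF hom_Ob1[OF c(2)]]])
    show "U (f \<cdot> x) \<cdot> (pbm (f \<cdot> U y) j (f \<cdot> x) \<cdot> pbm (f \<cdot> x) k (f \<cdot> U y)) = U (f \<cdot> x) \<cdot> Id C (P (f \<cdot> x))"
      using assoc[OF pk(1) pL(1) c(2)] pL(2) pk(2) id_right[OF c(2)] by simp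
    show "V (f \<cdot> x) \<cdot> (pbm (f \<cdot> U y) j (f \<cdot> x) \<cdot> pbm (f \<cdot> x) k (f \<cdot> U y)) = V (f \<cdot> x) \<cdot> Id C (P (f \<cdot> x))"
      using assoc[OF pk(1) pL(1) c(3)] pL(3) pk(3) assoc[OF pk(1) c2(3) j(2)] assoc[OF c(3) k(1) j(2)] k(3)
        id_left[OF c(3)] id_right[OF c(3)] by simp
  qed
  note hi = comp_hom[OF h i(1)] and kp = pk(1)
  have qh: "q \<in> hom C X (Dom C y)" unfolding q_def using comp_hom[OF cy(3) k(1)] .
  have qj: "q \<cdot> j = V y" unfolding q_def using assoc[OF j(2) k(1) cy(3)] k(2) id_right[OF cy(3)] by simp
  have "q \<cdot> (h \<cdot> i) = q \<cdot> (((h \<cdot> i) \<cdot> pbm (f \<cdot> U y) j (f \<cdot> x)) \<cdot> pbm (f \<cdot> x) k (f \<cdot> U y))"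
    using assoc[OF kp pL(1) hi] kk id_right[OF hi] by simp
  also have "\<dots> = ((q \<cdot> j) \<cdot> pbm (f \<cdot> U y) (V y) y) \<cdot> pbm (f \<cdot> x) k (f \<cdot> U y)"
    unfolding act[symmetric] using assoc[OF kp comp_hom[OF j(2) pe(1)] qh] assoc[OF pe(1) j(2) qh] by simp
  also have "\<dots> = (V y \<cdot> V (f \<cdot> U y)) \<cdot> pbm (f \<cdot> x) k (f \<cdot> U y)" unfolding qj pe(3) ..
  also have "\<dots> = q \<cdot> V (f \<cdot> x)"
    unfolding q_def using assoc[OF kp c2(3) cy(3)] pk(3) assoc[OF c(3) k(1) cy(3)] by simp
  finally have e: "q \<cdot> (h \<cdot> i) = q \<cdot> (v \<cdot> i)" using i(4) by simp
  obtain i' where i': "i' \<in> hom C (Dom C u) (P (f \<cdot> x))" "i \<cdot> i' = Id C (Dom C u)" using isoE[OF i(2,1)] by metis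
  have "q \<cdot> h = (q \<cdot> (h \<cdot> i)) \<cdot> i'"
    using assoc[OF i'(1) hi qh] assoc[OF i'(1) i(1) h] i'(2) id_right[OF h] by simp
  also have "\<dots> = q \<cdot> v"
    unfolding e using assoc[OF i'(1) comp_hom[OF uv(2) i(1)] qh] assoc[OF i'(1) i(1) uv(2)] i'(2) id_right[OF uv(2)] by simp
  finally show "\<exists>y q. is_pullback C f y x q \<and> q \<cdot> h = q \<cdot> v" using q by blast
qed

text \<open>\<open>quot\<close> states that the projection from the pulled back object to
  \<open>y\<close> is a quotient map with respect to generalized elements, and it makes the
  comparison functor full and faithful. \<open>eff\<close> makes it essentially surjective.\<close>

theorem monadic_of_effective_algs:
  assumes eff: "\<And>x X u v h. x \<in> E \<Longrightarrow> x \<in> hom C X A \<Longrightarrow> descent_alg C f x u v h \<Longrightarrow>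
      \<exists>y q. y \<in> E \<and> is_pullback C f y x q \<and> q \<cdot> h = q \<cdot> v"
    and quot: "\<And>y Y u v W g. y \<in> E \<Longrightarrow> y \<in> hom C Y B \<Longrightarrow> is_pullback C f y u v \<Longrightarrow> g \<in> hom C (Dom C u) W \<Longrightarrow>
      (\<And>V a b. a \<in> hom C V (Dom C u) \<Longrightarrow> b \<in> hom C V (Dom C u) \<Longrightarrow> v \<cdot> a = v \<cdot> b \<Longrightarrow> g \<cdot> a = g \<cdot> b) \<Longrightarrow>
      \<exists>!m. m \<in> hom C Y W \<and> m \<cdot> v = g"
  shows "monadic SB SA R"
  unfolding monadic_def
proof (intro exI conjI)
  show "adjunction SA SB L R \<eta> \<epsilon>" by (rule base_change_adjunction)
  show "is_equivalence SB adj.emc (comparison SB R \<epsilon>)"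
  proof (rule equivalence_of_fully_faithful[OF SB_cat adj.em_category adj.comparison_functor])
    fix y y' G assume yy: "y \<in> Ob SB" "y' \<in> Ob SB" and
      G: "G \<in> hom adj.emc (on_ob (comparison SB R \<epsilon>) y) (on_ob (comparison SB R \<epsilon>) y')"
    have y: "y \<in> E" "y \<in> hom C (Dom C y) B" and y': "y' \<in> E" "y' \<in> hom C (Dom C y') B" using yy slice_obj_iff by auto
    note c = choice[OF y] and c' = choice[OF y'] and pp = push_pull[OF y] and pp' = push_pull[OF y']
    note c2 = choice[OF pp(1,2)] and c2' = choice[OF pp'(1,2)]
    obtain w where w: "G = ((U y, on_mor R (\<epsilon> y)), w, (U y', on_mor R (\<epsilon> y')))" "w \<in> hom SA (U y) (U y')"
      "w \<cdot>\<^bsub>SA\<^esub> on_mor R (\<epsilon> y) = on_mor R (\<epsilon> y') \<cdot>\<^bsub>SA\<^esub> on_mor R (on_mor L w)"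
      using G unfolding em_hom_iff by (auto simp: adj.comparison_simps(1) R_simps)
    obtain g where g: "w = (U y, g, U y')" "g \<in> hom C (P y) (P y')" "U y' \<cdot> g = U y"
      by (rule slice_homE[OF w(2) c(2) c'(2)])
    have fg: "(f \<cdot> U y') \<cdot> g = f \<cdot> U y" using assoc[OF g(2) c'(2) f] g(3) by simp
    note pe = pbm[OF pp(1,2) y c(3) pp(3)] and pe' = pbm[OF pp'(1,2) y' c'(3) pp'(3)] and pg = pbm[OF pp(1,2) pp'(1,2) g(2) fg]
    have act: "g \<cdot> pbm (f \<cdot> U y) (V y) y = pbm (f \<cdot> U y') (V y') y' \<cdot> pbm (f \<cdot> U y) g (f \<cdot> U y')"
      using w(3) unfolding g(1) by (simp add: R_simps L_simps \<epsilon>_def)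
    \<comment> \<open>Elements \<open>a\<close> and \<open>b\<close> with the same image in the
      domain of \<open>y\<close> combine to one element \<open>m\<close> of the iterated pullback.
      There the law \<open>act\<close> of an algebra morphism turns
      \<open>V y' \<cdot> g \<cdot> b\<close> into \<open>V y' \<cdot> g \<cdot> a\<close>.\<close>
    have "(V y' \<cdot> g) \<cdot> a = (V y' \<cdot> g) \<cdot> b" if ab: "a \<in> hom C W (P y)" "b \<in> hom C W (P y)" "V y \<cdot> a = V y \<cdot> b" for W a b
    proof -
      have "f \<cdot> (U y \<cdot> b) = (f \<cdot> U y) \<cdot> a"
        using assoc[OF ab(2) c(2) f] assoc[OF ab(1) c(3) y(2)] assoc[OF ab(2) c(3) y(2)] c(5) ab(3) by simp
      then obtain m where m: "m \<in> hom C W (P (f \<cdot> U y))" "U (f \<cdot> U y) \<cdot> m = U y \<cdot> b" "V (f \<cdot> U y) \<cdot> m = a"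
        using pullback_lift[OF c2(1) f pp(2) c2(2) comp_hom[OF c(2) ab(2)] ab(1)] by metis
      have mb: "pbm (f \<cdot> U y) (V y) y \<cdot> m = b"
        by (rule pullback_unique[OF c(1,2) comp_hom[OF pe(1) m(1)] ab(2)])
          (use assoc[OF m(1) pe(1) c(2)] assoc[OF m(1) pe(1) c(3)] pe(2,3) m(2,3) ab(3) assoc[OF m(1) c2(3) c(3)] in simp_all)
      have "(V y' \<cdot> g) \<cdot> b = V y' \<cdot> ((g \<cdot> pbm (f \<cdot> U y) (V y) y) \<cdot> m)"
        using assoc[OF ab(2) g(2) c'(3)] assoc[OF m(1) pe(1) g(2)] mb by simp
      also have "\<dots> = ((V y' \<cdot> pbm (f \<cdot> U y') (V y') y') \<cdot> pbm (f \<cdot> U y) g (f \<cdot> U y')) \<cdot> m"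
        unfolding act using assoc[OF m(1) comp_hom[OF pe'(1) pg(1)] c'(3)] assoc[OF pg(1) pe'(1) c'(3)] by simp
      also have "\<dots> = V y' \<cdot> ((V (f \<cdot> U y') \<cdot> pbm (f \<cdot> U y) g (f \<cdot> U y')) \<cdot> m)"
        unfolding pe'(3) using assoc[OF pg(1) c2'(3) c'(3)] assoc[OF m(1) comp_hom[OF c2'(3) pg(1)] c'(3)] by simp
      also have "\<dots> = (V y' \<cdot> g) \<cdot> a"
        unfolding pg(3) using assoc[OF m(1) c2(3) g(2)] m(3) assoc[OF ab(1) g(2) c'(3)] by simp
      finally show ?thesis by simp
    qed
    then have ex: "\<exists>!m. m \<in> hom C (Dom C y) (Dom C y') \<and> m \<cdot> V y = V y' \<cdot> g"
      using quot[OF y c(1) comp_hom[OF c'(3) g(2)]] by blast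
    have epi: "m = n" if "m \<in> hom C (Dom C y) W" "n \<in> hom C (Dom C y) W" "m \<cdot> V y = n \<cdot> V y" for m n W
    proof -
      have "\<exists>!k. k \<in> hom C (Dom C y) W \<and> k \<cdot> V y = m \<cdot> V y"
      proof (rule quot[OF y c(1) comp_hom[OF that(1) c(3)]])
        fix V' a b assume ab: "a \<in> hom C V' (P y)" "b \<in> hom C V' (P y)" "V y \<cdot> a = V y \<cdot> b"
        show "(m \<cdot> V y) \<cdot> a = (m \<cdot> V y) \<cdot> b"
          using assoc[OF ab(1) c(3) that(1)] assoc[OF ab(2) c(3) that(1)] ab(3) by simp
      qed
      then show ?thesis using that by metis
    qed
    \<comment> \<open>Full faithfulness is thereby reduced to the unique existence of a
      factorization of \<open>V y' \<cdot> g\<close> through \<open>V y\<close>. That such a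
      factorization lies over the base follows by cancelling \<open>V y\<close>.\<close>
    have conv: "z \<in> hom SB y y' \<and> on_mor (comparison SB R \<epsilon>) z = G \<longleftrightarrow>
       (\<exists>m. z = (y, m, y') \<and> m \<in> hom C (Dom C y) (Dom C y') \<and> m \<cdot> V y = V y' \<cdot> g)" for z
    proof
      assume z: "z \<in> hom SB y y' \<and> on_mor (comparison SB R \<epsilon>) z = G"
      then obtain m where m: "z = (y, m, y')" "m \<in> hom C (Dom C y) (Dom C y')" "y' \<cdot> m = y"
        using slice_homE[OF _ y(2) y'(2)] by metis
      have "on_mor R z = w" using z w(1) adj.comparison_simps(2)[of z y y'] by simp
      then have "pbm y m y' = g" using m(1) g(1) by (simp add: R_simps)
      then show "\<exists>m. z = (y, m, y') \<and> m \<in> hom C (Dom C y) (Dom C y') \<and> m \<cdot> V y = V y' \<cdot> g"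
        using m pbm(3)[OF y y' m(2,3)] by metis
    next
      assume "\<exists>m. z = (y, m, y') \<and> m \<in> hom C (Dom C y) (Dom C y') \<and> m \<cdot> V y = V y' \<cdot> g"
      then obtain m where m: "z = (y, m, y')" "m \<in> hom C (Dom C y) (Dom C y')" "m \<cdot> V y = V y' \<cdot> g" by blast
      have "(y' \<cdot> m) \<cdot> V y = y' \<cdot> (V y' \<cdot> g)" using assoc[OF c(3) m(2) y'(2)] m(3) by simp
      also have "\<dots> = f \<cdot> U y" using assoc[OF g(2) c'(3) y'(2)] c'(5) fg by simp
      also have "\<dots> = y \<cdot> V y" by (rule c(5))
      finally have my: "y' \<cdot> m = y" using epi[OF comp_hom[OF y'(2) m(2)] y(2)] by blast
      have zh: "z \<in> hom SB y y'" unfolding slice_hom_iff m(1) using y y' m(2) my by blast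
      have "pbm y m y' = g" using pbm(4)[OF y y' m(2) my g(2,3)] m(3) by simp
      then have "on_mor R z = w" using m(1) g(1) by (simp add: R_simps)
      then show "z \<in> hom SB y y' \<and> on_mor (comparison SB R \<epsilon>) z = G"
        using zh w(1) adj.comparison_simps(2)[OF zh] by (simp add: R_simps)
    qed
    obtain m where m: "m \<in> hom C (Dom C y) (Dom C y')" "m \<cdot> V y = V y' \<cdot> g"
      "\<And>n. n \<in> hom C (Dom C y) (Dom C y') \<Longrightarrow> n \<cdot> V y = V y' \<cdot> g \<Longrightarrow> n = m" using ex by metis
    show "\<exists>!z. z \<in> hom SB y y' \<and> on_mor (comparison SB R \<epsilon>) z = G"
      unfolding conv
    proof (rule ex1I[of _ "(y, m, y')"])
      show "\<exists>n. (y, m, y') = (y, n, y') \<and> n \<in> hom C (Dom C y) (Dom C y') \<and> n \<cdot> V y = V y' \<cdot> g"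
        using m(1,2) by blast
    qed (use m(3) in blast)
  next
    fix Z :: "'m \<times> 'm \<times> 'm \<times> 'm" assume "Z \<in> Ob adj.emc"
    then have Z: "Z \<in> adj.algs" by simp
    obtain x H where ZH: "Z = (x, H)" by (cases Z)
    have xO: "x \<in> Ob SA" and H: "H \<in> hom SA (on_ob R (on_ob L x)) x" using Z ZH by (auto simp: em_algs_def)
    have x: "x \<in> E" "x \<in> hom C (Dom C x) A" using xO slice_obj_iff by auto
    note fx = push[OF x] comp_hom[OF f x(2)]
    note c = choice[OF fx]
    obtain h where h: "H = (U (f \<cdot> x), h, x)" "h \<in> hom C (P (f \<cdot> x)) (Dom C x)" "x \<cdot> h = U (f \<cdot> x)"
      by (rule slice_homE[OF H[unfolded R_simps L_simps] c(2) x(2)])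
    have "descent_alg C f x (U (f \<cdot> x)) (V (f \<cdot> x)) h" using alg_iff[OF x] Z ZH h(1) by simp
    then obtain y q where y: "y \<in> E" "is_pullback C f y x q" "q \<cdot> h = q \<cdot> V (f \<cdot> x)" using eff[OF x] by blast
    have yh: "y \<in> hom C (Dom C y) B" and q: "q \<in> hom C (Dom C x) (Dom C y)"
      using y(2) f by (auto simp: is_pullback_def hom_def)
    note cy = choice[OF y(1) yh] and pp = push_pull[OF y(1) yh]
    note c2 = choice[OF pp(1,2)]
    obtain i where i: "i \<in> hom C (P y) (Dom C x)" "is_iso C i" "x \<cdot> i = U y" "q \<cdot> i = V y"
      using pullback_iso[OF y(2) cy(1) x(2) cy(2)] .
    have yO: "y \<in> Ob SB" using y(1) yh slice_obj_iff by blast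
    have fi: "(f \<cdot> x) \<cdot> i = f \<cdot> U y" using assoc[OF i(1) x(2) f] i(3) by simp
    note pe = pbm[OF pp(1,2) y(1) yh cy(3) pp(3)] and pi = pbm[OF pp(1,2) fx i(1) fi]
    have "i \<cdot> pbm (f \<cdot> U y) (V y) y = h \<cdot> pbm (f \<cdot> U y) i (f \<cdot> x)"
    proof (rule pullback_unique[OF y(2) x(2) comp_hom[OF i(1) pe(1)] comp_hom[OF h(2) pi(1)]])
      show "x \<cdot> (i \<cdot> pbm (f \<cdot> U y) (V y) y) = x \<cdot> (h \<cdot> pbm (f \<cdot> U y) i (f \<cdot> x))"
        using assoc[OF pe(1) i(1) x(2)] assoc[OF pi(1) h(2) x(2)] i(3) h(3) pe(2) pi(2) by simp
      have "q \<cdot> (i \<cdot> pbm (f \<cdot> U y) (V y) y) = V y \<cdot> V (f \<cdot> U y)" using assoc[OF pe(1) i(1) q] i(4) pe(3) by simp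
      also have "\<dots> = q \<cdot> (V (f \<cdot> x) \<cdot> pbm (f \<cdot> U y) i (f \<cdot> x))"
        using i(4) assoc[OF c2(3) i(1) q] pi(3) by simp
      also have "\<dots> = q \<cdot> (h \<cdot> pbm (f \<cdot> U y) i (f \<cdot> x))"
        using assoc[OF pi(1) h(2) q] assoc[OF pi(1) c(3) q] y(3) by simp
      finally show "q \<cdot> (i \<cdot> pbm (f \<cdot> U y) (V y) y) = q \<cdot> (h \<cdot> pbm (f \<cdot> U y) i (f \<cdot> x))" .
    qed
    then have e: "(U y, i, x) \<cdot>\<^bsub>SA\<^esub> on_mor R (\<epsilon> y) = H \<cdot>\<^bsub>SA\<^esub> on_mor R (on_mor L (U y, i, x))"
      unfolding h(1) by (simp add: R_simps L_simps \<epsilon>_def)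
    have w: "(U y, i, x) \<in> hom SA (U y) x" unfolding slice_hom_iff using cy(2,4) x i by blast
    have "is_iso SA (U y, i, x)" using slice_iso[OF w cy(2) x(2)] i by blast
    then have "isomorphic adj.emc (on_ob (comparison SB R \<epsilon>) y) Z"
      using adj.em_isoI[of "U y" "on_mor R (\<epsilon> y)" x H "(U y, i, x)"] adj.comparison_alg[OF yO] Z w e
      unfolding ZH adj.comparison_simps(1) R_simps by simp
    then show "\<exists>y \<in> Ob SB. isomorphic adj.emc (on_ob (comparison SB R \<epsilon>) y) Z" using yO by blast
  qed
qed

end

section \<open>Homological categories\<close>

lemma hom_full_subI: "f \<in> hom C X Y \<Longrightarrow> X \<in> S \<Longrightarrow> Y \<in> S \<Longrightarrow> f \<in> hom (full_sub C S) X Y"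
  by (simp add: hom_full_sub)

context pt_cat
begin

text \<open>A zero object of \<open>C\<close> inside \<open>S\<close> is what makes vanishing in the
  subcategory agree with vanishing in \<open>C\<close>; kernels and cokernels whose objects lie in
  \<open>S\<close> can then be restricted.\<close>

lemma full_sub_zero_ob:
  assumes "is_zero_ob C Z" "Z \<in> S" "X \<in> S"
  shows "is_zero_ob (full_sub C S) X \<longleftrightarrow> is_zero_ob C X"
proof
  assume X: "is_zero_ob (full_sub C S) X"
  then have O: "X \<in> Ob C" by (auto simp: is_zero_ob_def is_terminal_def)
  have "\<exists>!f. f \<in> hom (full_sub C S) X X" using X O assms(3) unfolding is_zero_ob_def is_terminal_def by auto
  then have "Id C X = zm C X X"
    using hom_full_subI[OF id_hom[OF O] assms(3,3)] hom_full_subI[OF zm_hom[OF O O] assms(3,3)] by blast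
  then have i: "zm C Z X \<cdot> zm C X Z = Id C X" "zm C X Z \<cdot> zm C Z X = Id C Z"
    using zm_comp[OF zm_hom[OF O zero_ob_Ob[OF assms(1)]] O]
      to_zero_unique[OF assms(1) comp_hom[OF zm_hom zm_hom] id_hom] O zero_ob_Ob[OF assms(1)] by auto
  then have "is_iso C (zm C Z X)" using isoI zm_hom O zero_ob_Ob[OF assms(1)] by metis
  then show "is_zero_ob C X" using zero_ob_of_iso[OF assms(1)] zm_hom O zero_ob_Ob[OF assms(1)] by metis
next
  assume X: "is_zero_ob C X"
  show "is_zero_ob (full_sub C S) X"
    using X assms(3) hom_full_sub[of _ S _ C] unfolding is_zero_ob_def is_terminal_def by auto
qed

lemma full_sub_zero_mor:
  assumes "is_zero_ob C Z" "Z \<in> S" "f \<in> hom (full_sub C S) X Y"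
  shows "is_zero_mor (full_sub C S) f \<longleftrightarrow> is_zero_mor C f"
proof
  have f: "f \<in> hom C X Y" "X \<in> S" "Y \<in> S" using hom_full_subD[OF assms(3)] by auto
  note O = hom_Ob1[OF f(1)] hom_Ob2[OF f(1)]
  {
    assume "is_zero_mor (full_sub C S) f"
    then obtain Z' g h where z: "is_zero_ob (full_sub C S) Z'" "g \<in> hom (full_sub C S) X Z'" "h \<in> hom (full_sub C S) Z' Y" "f = h \<cdot> g"
      using homD(2,3)[OF assms(3)] unfolding is_zero_mor_def by auto
    have "Z' \<in> S" using hom_full_subD z(2) by metis
    then have "is_zero_ob C Z'" using full_sub_zero_ob[OF assms(1,2)] z(1) by blast
    then show "is_zero_mor C f"
      unfolding is_zero_mor_def using z(2-4) homD(2,3)[OF f(1)] hom_full_subD by metis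
  next
    assume "is_zero_mor C f"
    then have "f = zm C Z Y \<cdot> zm C X Z"
      using zero_iff[OF f(1)] zm_comp[OF zm_hom[OF O(1) zero_ob_Ob[OF assms(1)]] O(2)] by simp
    then show "is_zero_mor (full_sub C S) f"
      unfolding is_zero_mor_def full_sub_simps homD(2,3)[OF f(1)]
      using full_sub_zero_ob[OF assms(1,2,2)] assms(1)
        hom_full_subI[OF zm_hom[OF O(1) zero_ob_Ob[OF assms(1)]] f(2) assms(2)]
        hom_full_subI[OF zm_hom[OF zero_ob_Ob[OF assms(1)] O(2)] assms(2) f(3)] by blast
  }
qed

lemma full_sub_pointed: "is_zero_ob C Z \<Longrightarrow> Z \<in> S \<Longrightarrow> pointed (full_sub C S)"
  unfolding pointed_def using full_sub_zero_ob by blast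

lemma full_sub_zm:
  assumes "is_zero_ob C Z" "Z \<in> S" "g \<in> hom (full_sub C S) X Y"
  shows "g = zm C X Y \<longleftrightarrow> g = zm (full_sub C S) X Y"
proof -
  interpret s: pt_cat "full_sub C S"
    by unfold_locales (rule category_full_sub[OF is_cat], rule full_sub_pointed[OF assms(1,2)])
  show ?thesis
    using s.zero_iff[OF assms(3)] full_sub_zero_mor[OF assms] zero_iff conjunct1[OF hom_full_subD[OF assms(3)]] by simp
qed

lemma full_sub_kernel:
  assumes "is_zero_ob C Z" "Z \<in> S" "is_kernel C k f" "k \<in> hom (full_sub C S) K A" "f \<in> hom (full_sub C S) A B"
  shows "is_kernel (full_sub C S) k f"
proof -
  interpret s: pt_cat "full_sub C S"
    by unfold_locales (rule category_full_sub[OF is_cat], rule full_sub_pointed[OF assms(1,2)])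
  have kf: "k \<in> hom C K A" "f \<in> hom C A B" "K \<in> S" "A \<in> S" "B \<in> S"
    using hom_full_subD[OF assms(4)] hom_full_subD[OF assms(5)] by auto
  have zz: "g = zm C X Y \<longleftrightarrow> g = zm (full_sub C S) X Y" if "g \<in> hom (full_sub C S) X Y" for g X Y
    by (rule full_sub_zm[OF assms(1,2) that])
  show ?thesis
  proof (rule s.kernelI[OF assms(4,5)])
    show "f \<cdot>\<^bsub>full_sub C S\<^esub> k = zm (full_sub C S) K B"
      using zz[OF s.comp_hom[OF assms(5,4)]] kernel_zero[OF assms(3) kf(1,2)] by simp
  next
    fix W g assume g: "g \<in> hom (full_sub C S) W A" "f \<cdot>\<^bsub>full_sub C S\<^esub> g = zm (full_sub C S) W B"
    have "f \<cdot> g = zm C W B" using zz[OF s.comp_hom[OF assms(5) g(1)]] g(2) by simp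
    then obtain h where "h \<in> hom C W K" "k \<cdot> h = g" using kernel_lift[OF assms(3) kf(1,2)] hom_full_subD[OF g(1)] by metis
    then show "\<exists>h\<in>hom (full_sub C S) W K. k \<cdot>\<^bsub>full_sub C S\<^esub> h = g"
      using hom_full_sub[OF _ kf(3)] hom_full_subD[OF g(1)] by (metis full_sub_simps(6))
  next
    fix W g h assume "g \<in> hom (full_sub C S) W K" "h \<in> hom (full_sub C S) W K" "k \<cdot>\<^bsub>full_sub C S\<^esub> g = k \<cdot>\<^bsub>full_sub C S\<^esub> h"
    then show "g = h" using kernel_mono[OF assms(3) kf(1)] hom_full_subD by (metis full_sub_simps(6))
  qed
qed

lemma full_sub_cokernel:
  assumes "is_zero_ob C Z" "Z \<in> S" "is_cokernel C c f" "f \<in> hom (full_sub C S) A B" "c \<in> hom (full_sub C S) B D"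
  shows "is_cokernel (full_sub C S) c f"
proof -
  interpret s: pt_cat "full_sub C S"
    by unfold_locales (rule category_full_sub[OF is_cat], rule full_sub_pointed[OF assms(1,2)])
  have cf: "f \<in> hom C A B" "c \<in> hom C B D" "A \<in> S" "B \<in> S" "D \<in> S"
    using hom_full_subD[OF assms(4)] hom_full_subD[OF assms(5)] by auto
  have zz: "g = zm C X Y \<longleftrightarrow> g = zm (full_sub C S) X Y" if "g \<in> hom (full_sub C S) X Y" for g X Y
    by (rule full_sub_zm[OF assms(1,2) that])
  show ?thesis
  proof (rule s.cokernelI[OF assms(5,4)])
    show "c \<cdot>\<^bsub>full_sub C S\<^esub> f = zm (full_sub C S) A D"
      using zz[OF s.comp_hom[OF assms(5,4)]] cokernel_zero[OF assms(3) cf(1,2)] by simp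
  next
    fix W g assume g: "g \<in> hom (full_sub C S) B W" "g \<cdot>\<^bsub>full_sub C S\<^esub> f = zm (full_sub C S) A W"
    have "g \<cdot> f = zm C A W" using zz[OF s.comp_hom[OF g(1) assms(4)]] g(2) by simp
    then obtain h where "h \<in> hom C D W" "h \<cdot> c = g" using cokernel_desc[OF assms(3) cf(1,2)] hom_full_subD[OF g(1)] by metis
    then show "\<exists>h\<in>hom (full_sub C S) D W. h \<cdot>\<^bsub>full_sub C S\<^esub> c = g"
      using hom_full_sub[OF cf(5)] hom_full_subD[OF g(1)] by (metis full_sub_simps(6))
  next
    fix W g h assume "g \<in> hom (full_sub C S) D W" "h \<in> hom (full_sub C S) D W" "g \<cdot>\<^bsub>full_sub C S\<^esub> c = h \<cdot>\<^bsub>full_sub C S\<^esub> c"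
    then show "g = h" using cokernel_epi[OF assms(3) cf(2)] hom_full_subD by (metis full_sub_simps(6))
  qed
qed

end

section \<open>Regular and normal epimorphisms in a homological category\<close>

locale homological_loc =
  fixes C :: "('o, 'm) cat" (structure)
  assumes hom_cat: "homological C"

sublocale homological_loc \<subseteq> pt_cat C
  by unfold_locales (use hom_cat in \<open>simp_all add: homological_def\<close>)

context homological_loc
begin

definition mono :: "'m \<Rightarrow> bool" where
  "mono m \<longleftrightarrow> m \<in> Mor C \<and> (\<forall>W. \<forall>g \<in> hom C W (Dom C m). \<forall>h \<in> hom C W (Dom C m). m \<cdot> g = m \<cdot> h \<longrightarrow> g = h)"

lemma monoD: "mono m \<Longrightarrow> m \<in> hom C X Y \<Longrightarrow> g \<in> hom C W X \<Longrightarrow> h \<in> hom C W X \<Longrightarrow> m \<cdot> g = m \<cdot> h \<Longrightarrow> g = h"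
  unfolding mono_def using homD(2) by metis

lemma monoI: "m \<in> hom C X Y \<Longrightarrow> (\<And>W g h. g \<in> hom C W X \<Longrightarrow> h \<in> hom C W X \<Longrightarrow> m \<cdot> g = m \<cdot> h \<Longrightarrow> g = h) \<Longrightarrow> mono m"
  unfolding mono_def by (auto simp: homD)

lemma ssfive: "split_short_five C"
  using hom_cat by (simp add: homological_def protomodular_def)

lemma fc: "finitely_complete C" and reg: "regular C"
  using hom_cat by (simp_all add: homological_def regular_def)

lemma pbk_ex: "f \<in> hom C X Z \<Longrightarrow> g \<in> hom C Y Z \<Longrightarrow> \<exists>p q. is_pullback C f g p q"
  using fc unfolding finitely_complete_def hom_def by auto

lemma pbkE:
  assumes "f \<in> hom C X Z" "g \<in> hom C Y Z"
  obtains P p q where "is_pullback C f g p q" "p \<in> hom C P X" "q \<in> hom C P Y"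
  using pbk_ex[OF assms] pullback_homs assms by metis

lemma reg_pb: "is_pullback C f g p q \<Longrightarrow> regular_epi C g \<Longrightarrow> regular_epi C p"
  using reg unfolding regular_def by blast

text \<open>The kernel pair projection \<open>p\<close> is split by the diagonal and has zero
  kernel, so comparing it with an identity by the split short five lemma makes it invertible. The
  two projections then coincide.\<close>

lemma mono_of_trivial_kernel:
  assumes "m \<in> hom C X Y" "\<And>W g. g \<in> hom C W X \<Longrightarrow> m \<cdot> g = zm C W Y \<Longrightarrow> g = zm C W X"
  shows "mono m"
proof -
  obtain P p q where P: "is_pullback C m m p q" "p \<in> hom C P X" "q \<in> hom C P X" using pbkE[OF assms(1,1)] .
  obtain Z where Z: "is_zero_ob C Z" "Z \<in> Ob C" using zero_obE .
  note O = hom_Ob1[OF assms(1)] hom_Ob1[OF P(2)] hom_Ob2[OF assms(1)]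
  obtain s where s: "s \<in> hom C X P" "p \<cdot> s = Id C X" "q \<cdot> s = Id C X"
    using pullback_lift[OF P(1) assms(1,1) P(2) id_hom[OF O(1)] id_hom[OF O(1)]] by metis
  note zP = zm_hom[OF Z(2) O(2)] and zX = zm_hom[OF Z(2) O(1)]
  have k: "is_kernel C (zm C Z P) p"
  proof (rule kernelI[OF zP P(2)])
    show "p \<cdot> zm C Z P = zm C Z X" by (rule comp_zm[OF P(2) Z(2)])
  next
    fix W g assume g: "g \<in> hom C W P" "p \<cdot> g = zm C W X"
    have W: "W \<in> Ob C" using g hom_Ob1 by blast
    have "m \<cdot> (q \<cdot> g) = m \<cdot> (p \<cdot> g)"
      using pullback_comm[OF P(1)] assoc[OF g(1) P(2) assms(1)] assoc[OF g(1) P(3) assms(1)] by simp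
    then have "q \<cdot> g = zm C W X" using assms(2)[OF comp_hom[OF P(3) g(1)]] g(2) comp_zm[OF assms(1) W] by simp
    then have "g = zm C W P"
      using pullback_unique[OF P(1,2) g(1) zm_hom[OF W O(2)]] g(2) comp_zm[OF P(2) W] comp_zm[OF P(3) W] by simp
    then have "zm C Z P \<cdot> zm C W Z = g" using zm_comp[OF zm_hom[OF W Z(2)] O(2)] by simp
    then show "\<exists>h\<in>hom C W Z. zm C Z P \<cdot> h = g" using zm_hom[OF W Z(2)] by blast
  qed (use to_zero_unique[OF Z(1)] in blast)
  have "is_iso C p"
  proof (rule ssfive[unfolded split_short_five_def, rule_format, where k = "zm C Z P" and f = p and s = s and
        k' = "zm C Z X" and f' = "Id C X" and s' = "Id C X" and u = "Id C Z" and w = "Id C X"])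
    show "split_short_exact C (zm C Z P) p s" "split_short_exact C (zm C Z X) (Id C X) (Id C X)"
      unfolding split_short_exact_def section_of_def
      using k zero_kernel_id(1)[OF O(1) Z(1)] s P(2) id_hom[OF O(1)] id_left[OF id_hom[OF O(1)]] by (simp_all add: homD)
  qed (use P(2) s(2) id_hom[OF O(1)] id_hom[OF Z(2)] iso_id[OF O(1)] iso_id[OF Z(2)] in
      \<open>simp_all add: homD[OF zP] homD[OF zX] homD[OF P(2)] homD[OF id_hom[OF O(1)]]
        comp_zm[OF P(2) Z(2)] id_right[OF zX] id_left[OF id_hom[OF O(1)]]\<close>)
  then obtain p' where p': "p' \<in> hom C X P" "p' \<cdot> p = Id C P" using isoE[OF _ P(2)] by metis
  have "s = p' \<cdot> (p \<cdot> s)" using assoc[OF s(1) P(2) p'(1)] p'(2) id_left[OF s(1)] by simp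
  then have "s = p'" using s(2) id_right[OF p'(1)] by simp
  then have "q = (q \<cdot> s) \<cdot> p" using assoc[OF P(2) s(1) P(3)] p'(2) id_right[OF P(3)] by simp
  then have pq: "q = p" using s(3) id_left[OF P(2)] by simp
  show ?thesis
  proof (rule monoI[OF assms(1)])
    fix W g h assume gh: "g \<in> hom C W X" "h \<in> hom C W X" "m \<cdot> g = m \<cdot> h"
    obtain l where "p \<cdot> l = g" "q \<cdot> l = h" using pullback_lift[OF P(1) assms(1,1) P(2) gh] .
    then show "g = h" using pq by simp
  qed
qed

lemma coequalizerE:
  assumes "regular_epi C c" "c \<in> hom C X Y"
  obtains D p q where "p \<in> hom C D X" "q \<in> hom C D X" "c \<cdot> p = c \<cdot> q"
    "\<And>W g. g \<in> hom C X W \<Longrightarrow> g \<cdot> p = g \<cdot> q \<Longrightarrow> \<exists>h \<in> hom C Y W. h \<cdot> c = g"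
    "\<And>W g h. g \<in> hom C Y W \<Longrightarrow> h \<in> hom C Y W \<Longrightarrow> g \<cdot> c = h \<cdot> c \<Longrightarrow> g = h"
proof -
  obtain p q where pq: "is_coequalizer C p q c" using assms(1) unfolding regular_epi_def by blast
  have h: "p \<in> hom C (Dom C p) X" "q \<in> hom C (Dom C p) X" "c \<cdot> p = c \<cdot> q"
    using pq assms(2) by (auto simp: is_coequalizer_def hom_def)
  have u: "\<exists>!h. h \<in> hom C Y W \<and> h \<cdot> c = g" if g: "g \<in> hom C X W" "g \<cdot> p = g \<cdot> q" for W g
  proof -
    have "\<forall>g \<in> Mor C. Dom C g = Cod C p \<longrightarrow> g \<cdot> p = g \<cdot> q \<longrightarrow> (\<exists>!h. h \<in> hom C (Cod C c) (Cod C g) \<and> h \<cdot> c = g)"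
      using pq unfolding is_coequalizer_def by blast
    then show ?thesis using g homD[OF g(1)] homD(3)[OF h(1)] homD(3)[OF assms(2)] by metis
  qed
  have e: "g = h'" if gh: "g \<in> hom C Y W" "h' \<in> hom C Y W" "g \<cdot> c = h' \<cdot> c" for W g h'
  proof -
    have "(g \<cdot> c) \<cdot> p = (g \<cdot> c) \<cdot> q" using assoc[OF h(1) assms(2) gh(1)] assoc[OF h(2) assms(2) gh(1)] h(3) by simp
    then show ?thesis using u[OF comp_hom[OF gh(1) assms(2)]] gh by metis
  qed
  show thesis using that[OF h] u e by blast
qed

lemma regular_epi_Mor: "regular_epi C c \<Longrightarrow> c \<in> Mor C"
  by (auto simp: regular_epi_def is_coequalizer_def)

lemma regular_epi_epi:
  assumes "regular_epi C c" "c \<in> hom C X Y" "g \<in> hom C Y W" "h \<in> hom C Y W" "g \<cdot> c = h \<cdot> c"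
  shows "g = h"
  using coequalizerE[OF assms(1,2)] assms(3-5) by metis

text \<open>\<open>c\<close> is the coequalizer of the kernel pair of \<open>f\<close>. An element
  \<open>g\<close> of the kernel of \<open>m\<close> lifts to \<open>q'\<close> after pulling back
  along \<open>c\<close>; since \<open>f \<cdot> q'\<close> is zero, \<open>q'\<close> and zero form
  an element of the kernel pair, so \<open>c\<close> sends \<open>q'\<close> to zero, and the pulled
  back regular epimorphism can be cancelled.\<close>

lemma image_factorization:
  assumes "f \<in> hom C X Y"
  obtains I c m where "c \<in> hom C X I" "m \<in> hom C I Y" "m \<cdot> c = f" "regular_epi C c" "mono m"
proof -
  obtain P p q where P: "is_pullback C f f p q" "p \<in> hom C P X" "q \<in> hom C P X" using pbkE[OF assms assms] .
  obtain c where c: "is_coequalizer C p q c" using reg P(1) unfolding regular_def by blast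
  define I where "I = Cod C c"
  have ch: "c \<in> hom C X I" "c \<cdot> p = c \<cdot> q" using c P(2) unfolding I_def by (auto simp: is_coequalizer_def hom_def)
  have re: "regular_epi C c" using c unfolding regular_epi_def by blast
  have "\<exists>!h. h \<in> hom C (Cod C c) (Cod C f) \<and> h \<cdot> c = f"
    using c pullback_comm[OF P(1)] homD[OF assms] homD[OF P(2)] unfolding is_coequalizer_def by metis
  then obtain m where m: "m \<in> hom C I Y" "m \<cdot> c = f" unfolding I_def using homD(3)[OF assms] by metis
  have "mono m"
  proof (rule mono_of_trivial_kernel[OF m(1)])
    fix W g assume g: "g \<in> hom C W I" "m \<cdot> g = zm C W Y"
    obtain P' p' q' where P': "is_pullback C g c p' q'" "p' \<in> hom C P' W" "q' \<in> hom C P' X" using pbkE[OF g(1) ch(1)] .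
    note O = hom_Ob1[OF P'(2)] hom_Ob1[OF assms] hom_Ob2[OF assms] hom_Ob1[OF g(1)] hom_Ob2[OF g(1)]
    have "f \<cdot> q' = m \<cdot> (g \<cdot> p')" using assoc[OF P'(3) ch(1) m(1)] m(2) pullback_comm[OF P'(1)] by simp
    then have "f \<cdot> q' = f \<cdot> zm C P' X"
      using assoc[OF P'(2) g(1) m(1)] g(2) zm_comp[OF P'(2) O(3)] comp_zm[OF assms O(1)] by simp
    then obtain l where l: "l \<in> hom C P' P" "p \<cdot> l = q'" "q \<cdot> l = zm C P' X"
      using pullback_lift[OF P(1) assms assms P(2) P'(3) zm_hom[OF O(1,2)]] by metis
    have "g \<cdot> p' = (c \<cdot> p) \<cdot> l" using pullback_comm[OF P'(1)] l(2) assoc[OF l(1) P(2) ch(1)] by simp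
    also have "\<dots> = zm C W I \<cdot> p'"
      unfolding ch(2) using assoc[OF l(1) P(3) ch(1)] l(3) comp_zm[OF ch(1) O(1)] zm_comp[OF P'(2) O(5)] by simp
    finally show "g = zm C W I"
      using regular_epi_epi[OF reg_pb[OF P'(1) re] P'(2) g(1) zm_hom[OF O(4,5)]] by blast
  qed
  then show thesis using that ch(1) m re by blast
qed

text \<open>Regular epimorphisms are extremal: \<open>e\<close> makes the identifications that
  define \<open>c\<close> because \<open>m\<close> is monic, so it factors through \<open>c\<close>,
  and the factor is inverse to \<open>m\<close>.\<close>

lemma mono_iso_of_regular_epi:
  assumes "regular_epi C c" "c \<in> hom C X Y" "e \<in> hom C X I" "m \<in> hom C I Y" "m \<cdot> e = c" "mono m"
  shows "is_iso C m"
proof -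
  obtain D p q where pq: "p \<in> hom C D X" "q \<in> hom C D X" "c \<cdot> p = c \<cdot> q"
    "\<And>W g. g \<in> hom C X W \<Longrightarrow> g \<cdot> p = g \<cdot> q \<Longrightarrow> \<exists>h \<in> hom C Y W. h \<cdot> c = g"
    "\<And>W g h. g \<in> hom C Y W \<Longrightarrow> h \<in> hom C Y W \<Longrightarrow> g \<cdot> c = h \<cdot> c \<Longrightarrow> g = h"
    by (rule coequalizerE[OF assms(1,2)]) (rule that; assumption)
  have "m \<cdot> (e \<cdot> p) = m \<cdot> (e \<cdot> q)"
    using pq(3) assms(5) assoc[OF pq(1) assms(3,4)] assoc[OF pq(2) assms(3,4)] by simp
  then have "e \<cdot> p = e \<cdot> q" using monoD[OF assms(6,4) comp_hom[OF assms(3) pq(1)] comp_hom[OF assms(3) pq(2)]] by blast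
  then obtain d where d: "d \<in> hom C Y I" "d \<cdot> c = e" using pq(4)[OF assms(3)] by blast
  note O = hom_Ob2[OF assms(4)] hom_Ob1[OF assms(4)]
  have md: "m \<cdot> d = Id C Y"
    by (rule pq(5)[OF comp_hom[OF assms(4) d(1)] id_hom[OF O(1)]])
      (use assoc[OF assms(2) d(1) assms(4)] d(2) assms(5) id_left[OF assms(2)] in simp)
  have "d \<cdot> m = Id C I"
    by (rule monoD[OF assms(6,4) comp_hom[OF d(1) assms(4)] id_hom[OF O(2)]])
      (use assoc[OF assms(4) d(1) assms(4)] md id_left[OF assms(4)] id_right[OF assms(4)] in simp)
  then show ?thesis using isoI[OF assms(4) d(1)] md by blast
qed

lemma coequalizerI:
  assumes "c \<in> hom C X Y" "p \<in> hom C D X" "q \<in> hom C D X" "c \<cdot> p = c \<cdot> q"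
    "\<And>W g. g \<in> hom C X W \<Longrightarrow> g \<cdot> p = g \<cdot> q \<Longrightarrow> \<exists>h \<in> hom C Y W. h \<cdot> c = g"
    "\<And>W g h. g \<in> hom C Y W \<Longrightarrow> h \<in> hom C Y W \<Longrightarrow> g \<cdot> c = h \<cdot> c \<Longrightarrow> g = h"
  shows "regular_epi C c"
proof -
  have "\<exists>!h. h \<in> hom C (Cod C c) (Cod C g) \<and> h \<cdot> c = g" if g: "g \<in> Mor C" "Dom C g = Cod C p" "g \<cdot> p = g \<cdot> q" for g
  proof -
    have "g \<in> hom C X (Cod C g)" using g(1,2) homD(3)[OF assms(2)] by (simp add: hom_def)
    then show ?thesis unfolding homD(3)[OF assms(1)] using assms(5)[OF _ g(3)] assms(6) by metis
  qed
  then have "is_coequalizer C p q c" unfolding is_coequalizer_def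
    using assms(4) homD[OF assms(1)] homD[OF assms(2)] homD[OF assms(3)] by auto
  then show ?thesis unfolding regular_epi_def by blast
qed

lemma regular_epi_iso_comp:
  assumes "regular_epi C c" "c \<in> hom C X Y" "i \<in> hom C Y Y'" "is_iso C i"
  shows "regular_epi C (i \<cdot> c)"
proof -
  obtain D p q where pq: "p \<in> hom C D X" "q \<in> hom C D X" "c \<cdot> p = c \<cdot> q"
    "\<And>W g. g \<in> hom C X W \<Longrightarrow> g \<cdot> p = g \<cdot> q \<Longrightarrow> \<exists>h \<in> hom C Y W. h \<cdot> c = g"
    "\<And>W g h. g \<in> hom C Y W \<Longrightarrow> h \<in> hom C Y W \<Longrightarrow> g \<cdot> c = h \<cdot> c \<Longrightarrow> g = h"
    by (rule coequalizerE[OF assms(1,2)]) (rule that; assumption)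
  obtain j where j: "j \<in> hom C Y' Y" "j \<cdot> i = Id C Y" "i \<cdot> j = Id C Y'" using isoE[OF assms(4,3)] .
  show ?thesis
  proof (rule coequalizerI[OF comp_hom[OF assms(3,2)] pq(1,2)])
    show "(i \<cdot> c) \<cdot> p = (i \<cdot> c) \<cdot> q" using assoc[OF pq(1) assms(2,3)] assoc[OF pq(2) assms(2,3)] pq(3) by simp
  next
    fix W g assume g: "g \<in> hom C X W" "g \<cdot> p = g \<cdot> q"
    obtain h where h: "h \<in> hom C Y W" "h \<cdot> c = g" using pq(4)[OF g] by blast
    have "(h \<cdot> j) \<cdot> (i \<cdot> c) = g" using h j assms(2,3) by (simp add: cs cmp_eq[OF j(2)])
    then show "\<exists>h\<in>hom C Y' W. h \<cdot> (i \<cdot> c) = g" using comp_hom[OF h(1) j(1)] by blast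
  next
    fix W g h assume gh: "g \<in> hom C Y' W" "h \<in> hom C Y' W" "g \<cdot> (i \<cdot> c) = h \<cdot> (i \<cdot> c)"
    have "g \<cdot> i = h \<cdot> i"
      by (rule pq(5)[OF comp_hom[OF gh(1) assms(3)] comp_hom[OF gh(2) assms(3)]])
        (use gh(3) assoc[OF assms(2,3) gh(1)] assoc[OF assms(2,3) gh(2)] in simp)
    then have "(g \<cdot> i) \<cdot> j = (h \<cdot> i) \<cdot> j" by simp
    then show "g = h" using assoc[OF j(1) assms(3) gh(1)] assoc[OF j(1) assms(3) gh(2)] j(3)
        id_right[OF gh(1)] id_right[OF gh(2)] by simp
  qed
qed

text \<open>The monic part \<open>m\<close> of the image of \<open>g\<close> is also a right factor
  through which \<open>g \<cdot> f\<close> passes, so it is invertible and \<open>g\<close> agrees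
  with its regular part up to isomorphism.\<close>

lemma regular_epi_cancel:
  assumes "f \<in> hom C X Y" "g \<in> hom C Y Z" "regular_epi C (g \<cdot> f)"
  shows "regular_epi C g"
proof -
  obtain I c m where c: "c \<in> hom C Y I" "m \<in> hom C I Z" "m \<cdot> c = g" "regular_epi C c" "mono m"
    using image_factorization[OF assms(2)] .
  have "m \<cdot> (c \<cdot> f) = g \<cdot> f" using assoc[OF assms(1) c(1,2)] c(3) by simp
  then have "is_iso C m"
    using mono_iso_of_regular_epi[OF assms(3) comp_hom[OF assms(2,1)] comp_hom[OF c(1) assms(1)] c(2) _ c(5)] by blast
  then show ?thesis using regular_epi_iso_comp[OF c(4,1,2)] c(3) by simp
qed

text \<open>The regular part \<open>c\<close> of the composite makes the identifications of
  \<open>f\<close>, so it factors through \<open>f\<close>. Then \<open>g\<close> factors through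
  the monomorphism \<open>m\<close>, which is therefore invertible.\<close>

lemma regular_epi_comp:
  assumes "f \<in> hom C X Y" "g \<in> hom C Y Z" "regular_epi C f" "regular_epi C g"
  shows "regular_epi C (g \<cdot> f)"
proof -
  obtain I c m where c: "c \<in> hom C X I" "m \<in> hom C I Z" "m \<cdot> c = g \<cdot> f" "regular_epi C c" "mono m"
    using image_factorization[OF comp_hom[OF assms(2,1)]] .
  obtain D p q where pq: "p \<in> hom C D X" "q \<in> hom C D X" "f \<cdot> p = f \<cdot> q"
    "\<And>W g. g \<in> hom C X W \<Longrightarrow> g \<cdot> p = g \<cdot> q \<Longrightarrow> \<exists>h \<in> hom C Y W. h \<cdot> f = g"
    using coequalizerE[OF assms(3,1)] by metis
  have "m \<cdot> (c \<cdot> p) = m \<cdot> (c \<cdot> q)"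
    using assoc[OF pq(1) c(1,2)] assoc[OF pq(2) c(1,2)] c(3) assoc[OF pq(1) assms(1,2)] assoc[OF pq(2) assms(1,2)] pq(3)
    by simp
  then have "c \<cdot> p = c \<cdot> q" using monoD[OF c(5,2) comp_hom[OF c(1) pq(1)] comp_hom[OF c(1) pq(2)]] by blast
  then obtain d where d: "d \<in> hom C Y I" "d \<cdot> f = c" using pq(4)[OF c(1)] by blast
  have "m \<cdot> d = g"
    by (rule regular_epi_epi[OF assms(3,1) comp_hom[OF c(2) d(1)] assms(2)])
      (use assoc[OF assms(1) d(1) c(2)] d(2) c(3) in simp)
  then have "is_iso C m" using mono_iso_of_regular_epi[OF assms(4,2) d(1) c(2) _ c(5)] by blast
  then show ?thesis using regular_epi_iso_comp[OF c(4,1,2)] c(3) by simp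
qed

lemma kernel_exists:
  assumes "f \<in> hom C A B"
  obtains K k where "k \<in> hom C K A" "is_kernel C k f"
proof -
  obtain Z where Z: "is_zero_ob C Z" "Z \<in> Ob C" using zero_obE .
  have B: "B \<in> Ob C" using assms hom_Ob2 by blast
  note z = zm_hom[OF Z(2) B]
  obtain K k q where k: "is_pullback C f (zm C Z B) k q" "k \<in> hom C K A" "q \<in> hom C K Z"
    using pbkE[OF assms z] .
  have "is_kernel C (k \<cdot> Id C K) f"
    by (rule kernel_pullback[OF pullback_sym[OF k(1)] k(3,2) _ id_hom[OF hom_Ob1[OF k(2)]]])
      (rule kernelI[OF id_hom[OF hom_Ob1[OF k(2)]] k(3)],
        use id_right[OF k(3)] zm_to_zero[OF Z(1) k(3)] id_hom[OF hom_Ob1[OF k(2)]] id_left in auto)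
  then show thesis using that k(2) id_right[OF k(2)] by simp
qed

text \<open>The image of \<open>\<langle>c, g\<rangle>\<close> is isomorphic to the codomain of \<open>c\<close> as soon as \<open>g\<close> vanishes on the kernel of \<open>c\<close>.\<close>

lemma regular_epi_cokernel:
  assumes "regular_epi C c" "is_kernel C k c"
  shows "is_cokernel C c k"
proof -
  obtain K X Y where h: "k \<in> hom C K X" "c \<in> hom C X Y" "c \<cdot> k = zm C K Y" using kernelE[OF assms(2)] .
  show ?thesis
  proof (rule cokernelI[OF h(2,1,3)])
    fix W g assume g: "g \<in> hom C X W" "g \<cdot> k = zm C K W"
    obtain Z where Z: "is_zero_ob C Z" "Z \<in> Ob C" using zero_obE .
    note O = hom_Ob2[OF h(2)] hom_Ob2[OF g(1)] hom_Ob1[OF h(2)]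
    note zY = zm_hom[OF O(1) Z(2)] and zW = zm_hom[OF O(2) Z(2)]
    \<comment> \<open>A pullback over a zero object is a product, here of \<open>Y\<close> and
      \<open>W\<close>; \<open>j\<close> below is the pairing of \<open>c\<close> and
      \<open>g\<close>.\<close>
    obtain P p q where P: "is_pullback C (zm C Y Z) (zm C W Z) p q" "p \<in> hom C P Y" "q \<in> hom C P W"
      using pbkE[OF zY zW] .
    have "zm C Y Z \<cdot> c = zm C W Z \<cdot> g" using zm_comp[OF h(2) Z(2)] zm_comp[OF g(1) Z(2)] by simp
    then obtain j where j: "j \<in> hom C X P" "p \<cdot> j = c" "q \<cdot> j = g"
      using pullback_lift[OF P(1) zY zW P(2) h(2) g(1)] by metis
    obtain I e m where e: "e \<in> hom C X I" "m \<in> hom C I P" "m \<cdot> e = j" "regular_epi C e" "mono m"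
      using image_factorization[OF j(1)] .
    have pm: "p \<cdot> m \<in> hom C I Y" using comp_hom[OF P(2) e(2)] .
    have pme: "(p \<cdot> m) \<cdot> e = c" using assoc[OF e(1,2) P(2)] e(3) j(2) by simp
    \<comment> \<open>After pulling back along \<open>e\<close>, an element killed by
      \<open>p \<cdot> m\<close> lifts to one in the kernel of \<open>c\<close>. There
      \<open>g\<close> vanishes as well, so both components of \<open>j\<close> do.\<close>
    have "mono (p \<cdot> m)"
    proof (rule mono_of_trivial_kernel[OF pm])
      fix V x assume x: "x \<in> hom C V I" "(p \<cdot> m) \<cdot> x = zm C V Y"
      obtain V' e' x' where V': "is_pullback C x e e' x'" "e' \<in> hom C V' V" "x' \<in> hom C V' X"
        using pbkE[OF x(1) e(1)] .
      note VO = hom_Ob1[OF V'(2)] hom_Ob2[OF V'(2)] hom_Ob1[OF e(2)] hom_Ob2[OF e(2)]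
      have "c \<cdot> x' = ((p \<cdot> m) \<cdot> x) \<cdot> e'"
        unfolding pme[symmetric] using assoc[OF V'(3) e(1) pm] pullback_comm[OF V'(1)] assoc[OF V'(2) x(1) pm] by simp
      then have cx: "c \<cdot> x' = zm C V' Y" using x(2) zm_comp[OF V'(2) O(1)] by simp
      then obtain y where y: "y \<in> hom C V' K" "k \<cdot> y = x'" using kernel_lift[OF assms(2) h(1,2) V'(3)] by metis
      have gx: "g \<cdot> x' = zm C V' W" using y(2) assoc[OF y(1) h(1) g(1)] g(2) zm_comp[OF y(1) O(2)] by simp
      have "j \<cdot> x' = zm C V' P"
        by (rule pullback_unique[OF P(1,2) comp_hom[OF j(1) V'(3)] zm_hom[OF VO(1,4)]])
          (use assoc[OF V'(3) j(1) P(2)] assoc[OF V'(3) j(1) P(3)] j(2,3) cx gx comp_zm[OF P(2) VO(1)] comp_zm[OF P(3) VO(1)] in simp_all)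
      then have "m \<cdot> (e \<cdot> x') = m \<cdot> zm C V' I" using assoc[OF V'(3) e(1,2)] e(3) comp_zm[OF e(2) VO(1)] by simp
      then have "e \<cdot> x' = zm C V' I" using monoD[OF e(5,2) comp_hom[OF e(1) V'(3)] zm_hom[OF VO(1,3)]] by blast
      then have "x \<cdot> e' = zm C V I \<cdot> e'" using pullback_comm[OF V'(1)] zm_comp[OF V'(2) VO(3)] by simp
      then show "x = zm C V I" using regular_epi_epi[OF reg_pb[OF V'(1) e(4)] V'(2) x(1) zm_hom[OF VO(2,3)]] by blast
    qed
    then have "is_iso C (p \<cdot> m)" using mono_iso_of_regular_epi[OF assms(1) h(2) e(1) pm pme] by blast
    then obtain n where n: "n \<in> hom C Y I" "n \<cdot> (p \<cdot> m) = Id C I" using isoE[OF _ pm] by metis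
    have "n \<cdot> c = e" unfolding pme[symmetric] using assoc[OF e(1) pm n(1)] n(2) id_left[OF e(1)] by simp
    then have "((q \<cdot> m) \<cdot> n) \<cdot> c = g"
      using assoc[OF h(2) n(1) comp_hom[OF P(3) e(2)]] assoc[OF e(1,2) P(3)] e(3) j(3) by simp
    then show "\<exists>h\<in>hom C Y W. h \<cdot> c = g" using comp_hom[OF comp_hom[OF P(3) e(2)] n(1)] by blast
  qed (use regular_epi_epi[OF assms(1) h(2)] in blast)
qed

text \<open>A cokernel of \<open>f\<close> is a coequalizer of \<open>f\<close> and zero; the
  converse is \<open>regular_epi_cokernel\<close> applied to an existing kernel. Stability
  properties of regular epimorphisms thereby become available for \<open>Q\<close>.\<close>

lemma normal_epi_iff: "normal_epi C c \<longleftrightarrow> regular_epi C c"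
proof
  assume "normal_epi C c"
  then obtain f where f: "is_cokernel C c f" unfolding normal_epi_def by blast
  obtain A B D where h: "f \<in> hom C A B" "c \<in> hom C B D" "c \<cdot> f = zm C A D" using cokernelE[OF f] .
  note O = hom_Ob1[OF h(1)] hom_Ob2[OF h(1)]
  show "regular_epi C c"
  proof (rule coequalizerI[OF h(2,1) zm_hom[OF O]])
    show "c \<cdot> f = c \<cdot> zm C A B" using h(3) comp_zm[OF h(2) O(1)] by simp
  next
    fix W g assume "g \<in> hom C B W" "g \<cdot> f = g \<cdot> zm C A B"
    then show "\<exists>h\<in>hom C D W. h \<cdot> c = g" using cokernel_desc[OF f h(1,2)] comp_zm O(1) by metis
  qed (use cokernel_epi[OF f h(2)] in blast)
next
  assume c: "regular_epi C c"
  obtain K k where "is_kernel C k c" using kernel_exists[OF Mor_hom[OF regular_epi_Mor[OF c]]] by metis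
  then show "normal_epi C c" using regular_epi_cokernel[OF c] unfolding normal_epi_def by blast
qed

lemma iso_regular_epi:
  assumes "is_iso C i"
  shows "regular_epi C i"
proof -
  have i: "i \<in> hom C (Dom C i) (Cod C i)" using assms Mor_hom by (auto simp: is_iso_def)
  obtain j where j: "j \<in> hom C (Cod C i) (Dom C i)" "j \<cdot> i = Id C (Dom C i)" "i \<cdot> j = Id C (Cod C i)" using isoE[OF assms i] .
  note d = id_hom[OF hom_Ob1[OF i]]
  show ?thesis
  proof (rule coequalizerI[OF i d d refl])
    fix W g assume g: "g \<in> hom C (Dom C i) W"
    have "(g \<cdot> j) \<cdot> i = g" using assoc[OF i j(1) g] j(2) id_right[OF g] by simp
    then show "\<exists>h\<in>hom C (Cod C i) W. h \<cdot> i = g" using comp_hom[OF g j(1)] by blast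
  next
    fix W g h assume gh: "g \<in> hom C (Cod C i) W" "h \<in> hom C (Cod C i) W" "g \<cdot> i = h \<cdot> i"
    then have "(g \<cdot> i) \<cdot> j = (h \<cdot> i) \<cdot> j" by simp
    then show "g = h" using assoc[OF j(1) i gh(1)] assoc[OF j(1) i gh(2)] j(3) id_right[OF gh(1)] id_right[OF gh(2)] by simp
  qed
qed

theorem homological_hml:
  assumes "\<And>p. normal_epi C p \<Longrightarrow> effective_descent C p"
  shows "hml C {f. normal_epi C f}"
proof unfold_locales
  show "f \<in> hom C X Z \<Longrightarrow> g \<in> hom C Y Z \<Longrightarrow> \<exists>p q. is_pullback C f g p q" for f g X Y Z by (rule pbk_ex)
  show "split_short_five C" by (rule ssfive)
  show "f \<in> {f. normal_epi C f} \<Longrightarrow> f \<in> Mor C" for f using normal_epi_iff regular_epi_Mor by blast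
  show "is_pullback C f g p q \<Longrightarrow> g \<in> {f. normal_epi C f} \<Longrightarrow> p \<in> {f. normal_epi C f}" for f g p q
    using normal_epi_iff reg_pb by blast
  show "q \<in> {f. normal_epi C f} \<Longrightarrow> is_kernel C k q \<Longrightarrow> is_cokernel C q k" for q k
    using normal_epi_iff regular_epi_cokernel by blast
  show "f \<in> hom C X Y \<Longrightarrow> g \<in> hom C Y Z \<Longrightarrow> g \<cdot> f \<in> {f. normal_epi C f} \<Longrightarrow> g \<in> {f. normal_epi C f}" for f g X Y Z
    using normal_epi_iff regular_epi_cancel by blast
  show "is_iso C f \<Longrightarrow> f \<in> {f. normal_epi C f}" for f using normal_epi_iff iso_regular_epi by blast
next
  fix k f assume k: "is_kernel C k f"
  obtain K A B where h: "k \<in> hom C K A" "f \<in> hom C A B" "f \<cdot> k = zm C K B" using kernelE[OF k] .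
  \<comment> \<open>Since \<open>m\<close> is monic, the kernel of \<open>f\<close> is also the
    kernel of the regular epimorphism \<open>c\<close>, which provides the required member of
    \<open>Q\<close>.\<close>
  obtain I c m where c: "c \<in> hom C A I" "m \<in> hom C I B" "m \<cdot> c = f" "regular_epi C c" "mono m"
    using image_factorization[OF h(2)] .
  note O = hom_Ob1[OF h(1)] hom_Ob2[OF c(1)] hom_Ob2[OF c(2)]
  have "is_kernel C k c"
  proof (rule kernelI[OF h(1) c(1)])
    have "m \<cdot> (c \<cdot> k) = m \<cdot> zm C K I" using assoc[OF h(1) c(1,2)] c(3) h(3) comp_zm[OF c(2) O(1)] by simp
    then show "c \<cdot> k = zm C K I" using monoD[OF c(5,2) comp_hom[OF c(1) h(1)] zm_hom[OF O(1,2)]] by blast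
  next
    fix W g assume g: "g \<in> hom C W A" "c \<cdot> g = zm C W I"
    have "f \<cdot> g = zm C W B" using assoc[OF g(1) c(1,2)] c(3) g(2) comp_zm[OF c(2) hom_Ob1[OF g(1)]] by simp
    then show "\<exists>h\<in>hom C W K. k \<cdot> h = g" using kernel_lift[OF k h(1,2) g(1)] by metis
  qed (use kernel_mono[OF k h(1)] in blast)
  then show "\<exists>q\<in>{f. normal_epi C f}. is_kernel C k q" using c(4) normal_epi_iff by blast
next
  fix f assume "f \<in> {f. normal_epi C f}"
  then have e: "effective_descent C f" using assms by blast
  then have f: "f \<in> hom C (Dom C f) (Cod C f)" unfolding effective_descent_def by (simp add: Mor_hom)
  \<comment> \<open>With the class of all morphisms the slices are unrestricted, as in
    \<open>effective_descent\<close>.\<close>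
  interpret base_change C UNIV f "Dom C f" "Cod C f"
    by unfold_locales (use f pbk_ex in auto)
  show "effective_algs C f"
    by (rule effective_algs_of_monadic) (use e in \<open>auto simp: effective_descent_def full_sub_UNIV\<close>)
qed

theorem homological_hml_ext:
  assumes "\<And>p. normal_epi C p \<Longrightarrow> effective_descent C p"
  shows "hml_ext C {f. normal_epi C f} (Ob C) {f. normal_epi C f}"
proof -
  interpret H: hml C "{f. normal_epi C f}" by (rule homological_hml[OF assms])
  show ?thesis
  proof unfold_locales
    show "f \<in> {f. normal_epi C f} \<Longrightarrow> Dom C f \<in> Ob C \<and> Cod C f \<in> Ob C" for f
      using H.Q_Mor[of f] hom_Ob1[OF Mor_hom] hom_Ob2[OF Mor_hom] by blast
    show "f \<in> hom C X Y \<Longrightarrow> g \<in> hom C Y Z \<Longrightarrow> f \<in> {f. normal_epi C f} \<Longrightarrow> g \<in> {f. normal_epi C f} \<Longrightarrow>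
       g \<cdot> f \<in> {f. normal_epi C f}" for f g X Y Z using normal_epi_iff regular_epi_comp by blast
    show "is_zero_ob C Z \<Longrightarrow> Z \<in> Ob C" for Z by (rule zero_ob_Ob)
    show "is_pullback C p y x q \<Longrightarrow> Dom C y \<in> Ob C" for p y x q
      using pullbackE hom_Ob1 homD(2) by metis
    fix Z f X assume a: "is_zero_ob C Z" "f \<in> hom C X Z"
    note O = hom_Ob1[OF a(2)] zero_ob_Ob[OF a(1)]
    have "f \<cdot> zm C Z X = Id C Z"
      using to_zero_unique[OF a(1) comp_hom[OF a(2) zm_hom[OF O(2,1)]] id_hom[OF O(2)]] .
    then show "f \<in> {f. normal_epi C f}"
      using H.Q_cancel[OF zm_hom[OF O(2,1)] a(2)] H.Q_iso[OF iso_id[OF O(2)]] by simp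
  qed (use H.Q_iso H.Q_pb H.Q_cancel in blast)+
qed

text \<open>Condition (P) is spent here. Protoadditivity and the split short five lemma make the
  naturality square of a split epimorphism with torsion free kernel a pullback. Parallel sides of a
  pullback have the same kernel, and the kernels of the units are the torsion parts, so
  \<open>p\<close> maps one torsion part isomorphically to the other.\<close>

theorem homological_hml_tors:
  assumes "\<And>p. normal_epi C p \<Longrightarrow> effective_descent C p"
    and "torsion_theory C T F" "condition_P C F" "condition_N C T F"
  shows "hml_tors C {f. normal_epi C f} (Ob C) {f. normal_epi C f} T F"
proof -
  interpret H: hml_ext C "{f. normal_epi C f}" "Ob C" "{f. normal_epi C f}" by (rule homological_hml_ext[OF assms(1)])
  interpret T: tors_cat C T F by unfold_locales (rule assms(2))
  show ?thesis
  proof unfold_locales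
    fix k f t assume a: "is_kernel C k f" "torsion_part C T F t" "Cod C t = Dom C k"
    then have "normal_mono C (k \<cdot> t)" using assms(4) unfolding condition_N_def torsion_part_def by blast
    then obtain g where "is_kernel C (k \<cdot> t) g" unfolding normal_mono_def by blast
    \<comment> \<open>Condition (N) gives some morphism with this kernel; \<open>Q_normal\<close>
      replaces it by a normal epimorphism, and at this level \<open>E\<close> and \<open>Q\<close>
      coincide.\<close>
    then show "\<exists>q\<in>{f. normal_epi C f}. is_kernel C (k \<cdot> t) q \<and> (f \<in> {f. normal_epi C f} \<longrightarrow> q \<in> {f. normal_epi C f})"
      using H.Q_normal by blast
  next
    fix k p s assume a: "split_short_exact C k p s" "Dom C k \<in> F"
    obtain R \<eta> where refl: "reflection C F R \<eta>" and pa: "protoadditive C (full_sub C F) R"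
      using assms(3) unfolding condition_P_def by blast
    note Rs = functor_simps[OF pa[unfolded protoadditive_def, THEN conjunct1]]
    have \<eta>: "X \<in> Ob C \<Longrightarrow> \<eta> X \<in> hom C X (on_ob R X)"
      "f \<in> hom C X Y \<Longrightarrow> \<eta> Y \<cdot> f = on_mor R f \<cdot> \<eta> X" for X f Y
      using nat_transD[of C C id_func R \<eta>] refl by (auto simp: reflection_def)
    have RF: "on_ob R X \<in> F" if "X \<in> Ob C" for X using Rs(1)[OF that] by simp
    have Rh: "on_mor R f \<in> hom C (on_ob R X) (on_ob R Y)" if "f \<in> hom C X Y" for f X Y
      using hom_full_subD[OF Rs(3)[OF that]] by blast
    have univ: "\<exists>!h. h \<in> hom C (on_ob R X) Y \<and> h \<cdot> \<eta> X = g" if "g \<in> hom C X Y" "Y \<in> F" for X Y g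
      using refl that hom_Ob1[OF that(1)] unfolding reflection_def by blast
    obtain Z where Z: "is_zero_ob C Z" "Z \<in> Ob C" using zero_obE .
    have ZF: "Z \<in> F"
      by (rule T.F_subobject[OF \<eta>(1)[OF Z(2)] RF[OF Z(2)]]) (rule to_zero_unique[OF Z(1)])
    have ker: "is_kernel C k p" and sec: "section_of C s p" using a(1) unfolding split_short_exact_def by auto
    obtain K X B where h: "k \<in> hom C K X" "p \<in> hom C X B" "p \<cdot> k = zm C K B" using kernelE[OF ker] .
    have s: "s \<in> hom C B X" "p \<cdot> s = Id C B" using sec h(2) unfolding section_of_def by (auto simp: homD)
    have K: "K \<in> F" using a(2) h(1) by (simp add: homD)
    note O = hom_Ob1[OF h(1)] hom_Ob2[OF h(1)] hom_Ob2[OF h(2)]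
    have kR: "is_kernel (full_sub C F) (on_mor R k) (on_mor R p)"
      using pa a(1) unfolding protoadditive_def split_short_exact_def by blast
    obtain K1 \<kappa> where \<kappa>: "\<kappa> \<in> hom C K1 (on_ob R X)" "is_kernel C \<kappa> (on_mor R p)" using H.kernel_ex[OF Rh[OF h(2)]] .
    \<comment> \<open>Protoadditivity yields a kernel in the subcategory of torsion free objects.
      The kernel formed in \<open>C\<close> is a subobject of a torsion free object, hence torsion
      free itself, and so the two agree up to isomorphism.\<close>
    have K1: "K1 \<in> F" by (rule T.F_subobject[OF \<kappa>(1) RF[OF O(2)]]) (rule kernel_mono[OF \<kappa>(2,1)])
    interpret FS: pt_cat "full_sub C F"
      by unfold_locales (rule category_full_sub[OF is_cat], rule full_sub_pointed[OF Z(1) ZF])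
    note RkF = Rs(3)[OF h(1)] and RpF = Rs(3)[OF h(2)]
    have \<kappa>F: "\<kappa> \<in> hom (full_sub C F) K1 (on_ob R X)" by (rule hom_full_subI[OF \<kappa>(1) K1 RF[OF O(2)]])
    have z: "g = zm C X Y \<longleftrightarrow> g = zm (full_sub C F) X Y" if "g \<in> hom (full_sub C F) X Y" for g X Y
      by (rule full_sub_zm[OF Z(1) ZF that])
    have "on_mor R p \<cdot>\<^bsub>full_sub C F\<^esub> \<kappa> = zm (full_sub C F) K1 (on_ob R B)"
      using z[OF FS.comp_hom[OF RpF \<kappa>F]] kernel_zero[OF \<kappa>(2,1) Rh[OF h(2)]] by simp
    then obtain l where l: "l \<in> hom (full_sub C F) K1 (on_ob R K)" "on_mor R k \<cdot>\<^bsub>full_sub C F\<^esub> l = \<kappa>"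
      using FS.kernel_lift[OF kR RkF RpF \<kappa>F] by metis
    have "on_mor R p \<cdot> on_mor R k = zm C (on_ob R K) (on_ob R B)"
      using FS.kernel_zero[OF kR RkF RpF] z[OF FS.comp_hom[OF RpF RkF]] by simp
    then obtain l' where l': "l' \<in> hom C (on_ob R K) K1" "\<kappa> \<cdot> l' = on_mor R k"
      using kernel_lift[OF \<kappa>(2,1) Rh[OF h(2)] Rh[OF h(1)]] by metis
    have lh: "l \<in> hom C K1 (on_ob R K)" "on_mor R k \<cdot> l = \<kappa>" using hom_full_subD[OF l(1)] l(2) by auto
    have l'F: "l' \<in> hom (full_sub C F) (on_ob R K) K1" by (rule hom_full_subI[OF l'(1) RF[OF O(1)] K1])
    have "l \<cdot> l' = Id C (on_ob R K)"
      using FS.kernel_mono[OF kR RkF FS.comp_hom[OF l(1) l'F] FS.id_hom[OF FS.hom_Ob1[OF RkF]]]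
        assoc[OF l'(1) lh(1) Rh[OF h(1)]] lh(2) l'(2) id_right[OF Rh[OF h(1)]] by simp
    moreover have "l' \<cdot> l = Id C K1"
      by (rule kernel_mono[OF \<kappa>(2,1) comp_hom[OF l'(1) lh(1)] id_hom[OF hom_Ob1[OF \<kappa>(1)]]])
        (use assoc[OF lh(1) l'(1) \<kappa>(1)] l'(2) lh(2) id_right[OF \<kappa>(1)] in simp)
    ultimately have "is_iso C l'" using isoI[OF l'(1) lh(1)] by blast
    then have RK: "is_kernel C (on_mor R k) (on_mor R p)" using kernel_of_iso[OF \<kappa>(2,1) l'(1)] l'(2) by simp
    note \<eta>K = \<eta>(1)[OF O(1)] and \<eta>X = \<eta>(1)[OF O(2)] and \<eta>B = \<eta>(1)[OF O(3)]
    obtain r where r: "r \<in> hom C (on_ob R K) K" "r \<cdot> \<eta> K = Id C K" using univ[OF id_hom[OF O(1)] K] by blast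
    have "(\<eta> K \<cdot> r) \<cdot> \<eta> K = \<eta> K" using assoc[OF \<eta>K r(1) \<eta>K] r(2) id_right[OF \<eta>K] by simp
    then have "\<eta> K \<cdot> r = Id C (on_ob R K)"
      using univ[OF \<eta>K RF[OF O(1)]] comp_hom[OF \<eta>K r(1)] id_hom[OF hom_Ob2[OF \<eta>K]] id_left[OF \<eta>K] by blast
    then have \<eta>iso: "is_iso C (\<eta> K)" using isoI[OF \<eta>K r(1)] r(2) by blast
    \<comment> \<open>The naturality square of \<open>p\<close> is compared with a genuine pullback.
      On kernels the comparison \<open>c\<close> is the unit at \<open>K\<close>, which is
      invertible because \<open>K\<close> is torsion free.\<close>
    obtain P \<pi>1 \<pi>2 where P: "is_pullback C (\<eta> B) (on_mor R p) \<pi>1 \<pi>2" "\<pi>1 \<in> hom C P B" "\<pi>2 \<in> hom C P (on_ob R X)"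
      using H.pbE[OF \<eta>B Rh[OF h(2)]] .
    obtain c where c: "c \<in> hom C X P" "\<pi>1 \<cdot> c = p" "\<pi>2 \<cdot> c = \<eta> X"
      using pullback_lift[OF P(1) \<eta>B Rh[OF h(2)] P(2) h(2) \<eta>X \<eta>(2)[OF h(2)]] .
    have zK: "zm C (on_ob R K) B \<in> hom C (on_ob R K) B" using zm_hom hom_Ob1[OF Rh[OF h(1)]] O(3) by blast
    have "\<eta> B \<cdot> zm C (on_ob R K) B = on_mor R p \<cdot> on_mor R k"
      using comp_zm[OF \<eta>B hom_Ob1[OF Rh[OF h(1)]]] kernel_zero[OF RK Rh[OF h(1)] Rh[OF h(2)]] by simp
    then obtain k' where k': "k' \<in> hom C (on_ob R K) P" "\<pi>1 \<cdot> k' = zm C (on_ob R K) B" "\<pi>2 \<cdot> k' = on_mor R k"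
      using pullback_lift[OF P(1) \<eta>B Rh[OF h(2)] P(2) zK Rh[OF h(1)]] by metis
    have K': "is_kernel C k' \<pi>1" by (rule kernel_pullback'[OF P RK k'(1,3,2)])
    have cs1: "\<pi>1 \<cdot> (c \<cdot> s) = Id C B" using assoc[OF s(1) c(1) P(2)] c(2) s(2) by simp
    have ck: "c \<cdot> k = k' \<cdot> \<eta> K"
    proof (rule pullback_unique[OF P(1,2) comp_hom[OF c(1) h(1)] comp_hom[OF k'(1) \<eta>K]])
      show "\<pi>1 \<cdot> (c \<cdot> k) = \<pi>1 \<cdot> (k' \<cdot> \<eta> K)"
        using assoc[OF h(1) c(1) P(2)] c(2) h(3) assoc[OF \<eta>K k'(1) P(2)] k'(2) zm_comp[OF \<eta>K O(3)] by simp
      show "\<pi>2 \<cdot> (c \<cdot> k) = \<pi>2 \<cdot> (k' \<cdot> \<eta> K)"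
        using assoc[OF h(1) c(1) P(3)] c(3) assoc[OF \<eta>K k'(1) P(3)] k'(3) \<eta>(2)[OF h(1)] by simp
    qed
    have "is_iso C c"
    proof (rule ssfive[unfolded split_short_five_def, rule_format, where k = k and f = p and s = s and
          k' = k' and f' = \<pi>1 and s' = "c \<cdot> s" and u = "\<eta> K" and w = "Id C B"])
      show "split_short_exact C k p s" by fact
      show "split_short_exact C k' \<pi>1 (c \<cdot> s)"
        unfolding split_short_exact_def section_of_def using K' cs1 P(2) comp_hom[OF c(1) s(1)] by (simp add: homD)
    qed (use h(1,2) k'(1) P(2) c \<eta>K \<eta>iso ck iso_id[OF O(3)] id_hom[OF O(3)] id_left[OF h(2)] id_right[OF comp_hom[OF c(1) s(1)]]
        in \<open>simp_all add: homD[OF h(1)] homD[OF h(2)] homD[OF k'(1)] homD[OF P(2)]\<close>)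
    then have sq: "is_pullback C (\<eta> B) (on_mor R p) p (\<eta> X)"
      using pullback_of_iso[OF P(1) c(1) _ P(2)] c(2,3) by simp
    \<comment> \<open>The reflection comes from condition (P) and is not built from the torsion
      sequences. Its unit is related to them by universality: the quotient \<open>e\<close> factors
      through the unit, so both have kernel \<open>t\<close>.\<close>
    have eta_ker: "is_kernel C t (\<eta> Y)" if t: "t \<in> hom C T0 Y" "torsion_part C T F t" for t T0 Y
    proof -
      note Y = hom_Ob2[OF t(1)]
      obtain e Y0 where e: "e \<in> hom C Y Y0" "is_kernel C t e" "is_cokernel C e t" "T0 \<in> T" "Y0 \<in> F"
        using T.torsion_partE[OF t(2,1)] .
      obtain j where j: "j \<in> hom C (on_ob R Y) Y0" "j \<cdot> \<eta> Y = e" using univ[OF e(1,5)] by blast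
      note \<eta>Y = \<eta>(1)[OF Y]
      show ?thesis
      proof (rule kernelI[OF t(1) \<eta>Y])
        show "\<eta> Y \<cdot> t = zm C T0 (on_ob R Y)" by (rule T.T_F_zero[OF comp_hom[OF \<eta>Y t(1)] e(4) RF[OF Y]])
      next
        fix W g assume g: "g \<in> hom C W Y" "\<eta> Y \<cdot> g = zm C W (on_ob R Y)"
        have "e \<cdot> g = zm C W Y0"
          using assoc[OF g(1) \<eta>Y j(1)] j(2) g(2) comp_zm[OF j(1) hom_Ob1[OF g(1)]] by simp
        then show "\<exists>h\<in>hom C W T0. t \<cdot> h = g" using kernel_lift[OF e(2) t(1) e(1) g(1)] by metis
      qed (use kernel_mono[OF e(2) t(1)] in blast)
    qed
    obtain T0 t where t: "t \<in> hom C T0 X" "torsion_part C T F t" using T.torsion_part_ex[OF O(2)] .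
    obtain T1 t' where t': "t' \<in> hom C T1 B" "torsion_part C T F t'" using T.torsion_part_ex[OF O(3)] .
    have "is_kernel C (p \<cdot> t) (\<eta> B)"
      by (rule kernel_pullback[OF pullback_sym[OF sq] \<eta>X h(2) eta_ker[OF t] t(1)])
    then obtain i where "i \<in> hom C T0 T1" "is_iso C i" "t' \<cdot> i = p \<cdot> t"
      using kernel_iso[OF eta_ker[OF t'] _ t'(1) comp_hom[OF h(2) t(1)]] by metis
    then have "torsion_part C T F (p \<cdot> t)" using T.torsion_part_iso[OF t'(2,1)] by metis
    then show "\<exists>t. torsion_part C T F t \<and> Cod C t = Dom C p \<and> torsion_part C T F (p \<cdot> t)"
      using t h(2) by (auto simp: homD)
  qed
qed

end

section \<open>The category of zero-fold arrows\<close>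

lemma base_cat_simps [simp]:
  "Ob (base_cat A) = Vertex ` Ob A" "Mor (base_cat A) = Edge ` Mor A"
  "Dom (base_cat A) (Edge f) = Vertex (Dom A f)" "Cod (base_cat A) (Edge f) = Vertex (Cod A f)"
  "Id (base_cat A) (Vertex X) = Edge (Id A X)"
  "Cmp (base_cat A) (Edge g) (Edge f) = Edge (g \<cdot>\<^bsub>A\<^esub> f)"
  by (simp_all add: base_cat_def)

lemma base_hom [simp]: "hom (base_cat A) (Vertex X) (Vertex Y) = Edge ` hom A X Y"
  by (auto simp: hom_def)

lemma base_homE:
  assumes "x \<in> hom (base_cat A) a b"
  obtains f X Y where "x = Edge f" "a = Vertex X" "b = Vertex Y" "f \<in> hom A X Y"
  using assms by (auto simp: hom_def)

lemma Edge_in_iff [simp]: "Edge f \<in> Edge ` S \<longleftrightarrow> f \<in> S" and Vertex_in_iff [simp]: "Vertex X \<in> Vertex ` S' \<longleftrightarrow> X \<in> S'"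
  by auto

text \<open>Universal properties assert unique existence in a hom-set, and the hom-sets of
  \<open>base_cat\<close> are images under \<open>Edge\<close>; this rule transfers them to
  \<open>A\<close>.\<close>

lemma ex1_Edge: "(\<exists>!h. h \<in> Edge ` S \<and> P h) \<longleftrightarrow> (\<exists>!h. h \<in> S \<and> P (Edge h))"
proof
  assume "\<exists>!h. h \<in> Edge ` S \<and> P h"
  then obtain h where h: "h \<in> S" "P (Edge h)" and u: "\<And>k. k \<in> Edge ` S \<Longrightarrow> P k \<Longrightarrow> k = Edge h" by blast
  show "\<exists>!h. h \<in> S \<and> P (Edge h)" by (rule ex1I[of _ h]) (use h u in auto)
next
  assume "\<exists>!h. h \<in> S \<and> P (Edge h)"
  then obtain h where h: "h \<in> S" "P (Edge h)" and u: "\<And>k. k \<in> S \<Longrightarrow> P (Edge k) \<Longrightarrow> k = h" by blast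
  show "\<exists>!h. h \<in> Edge ` S \<and> P h"
  proof (rule ex1I[of _ "Edge h"])
    show "Edge h \<in> Edge ` S \<and> P (Edge h)" using h by blast
  qed (use u in blast)
qed

lemma base_category: "category A \<Longrightarrow> category (base_cat A)"
  unfolding category_def by auto

lemma base_pullback: "is_pullback (base_cat A) (Edge f) (Edge g) (Edge p) (Edge q) \<longleftrightarrow> is_pullback A f g p q"
  unfolding is_pullback_def by (simp add: ex1_Edge)

lemma base_iso: "is_iso (base_cat A) (Edge f) \<longleftrightarrow> is_iso A f"
  unfolding is_iso_def by auto

lemma base_zero_ob: "is_zero_ob (base_cat A) (Vertex Z) \<longleftrightarrow> is_zero_ob A Z"
proof -
  have "(\<exists>!f. f \<in> hom (base_cat A) (Vertex X) (Vertex Y)) \<longleftrightarrow> (\<exists>!f. f \<in> hom A X Y)" for X Y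
    using ex1_Edge[of "hom A X Y" "\<lambda>_. True"] by simp
  then show ?thesis unfolding is_zero_ob_def is_terminal_def by (simp del: base_hom)
qed

lemma base_zero_obE:
  assumes "is_zero_ob (base_cat A) z"
  obtains Z where "z = Vertex Z" "is_zero_ob A Z"
proof -
  have "z \<in> Ob (base_cat A)" using assms by (simp only: is_zero_ob_def is_terminal_def)
  then obtain Z where "z = Vertex Z" by auto
  then show thesis using that assms by (simp add: base_zero_ob)
qed

lemma base_zero_mor: "is_zero_mor (base_cat A) (Edge f) \<longleftrightarrow> is_zero_mor A f"
proof
  assume "is_zero_mor (base_cat A) (Edge f)"
  then obtain z g h where z: "is_zero_ob (base_cat A) z" "g \<in> hom (base_cat A) (Vertex (Dom A f)) z"
    "h \<in> hom (base_cat A) z (Vertex (Cod A f))" "Edge f = h \<cdot>\<^bsub>base_cat A\<^esub> g" unfolding is_zero_mor_def by auto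
  obtain Z where Z: "z = Vertex Z" "is_zero_ob A Z" using base_zero_obE[OF z(1)] .
  obtain g' h' where "g = Edge g'" "g' \<in> hom A (Dom A f) Z" "h = Edge h'" "h' \<in> hom A Z (Cod A f)"
    using z(2,3) unfolding Z(1) by auto
  then show "is_zero_mor A f" unfolding is_zero_mor_def using z(4) Z(2) by auto
next
  assume "is_zero_mor A f"
  then obtain Z g h where "is_zero_ob A Z" "g \<in> hom A (Dom A f) Z" "h \<in> hom A Z (Cod A f)" "f = h \<cdot>\<^bsub>A\<^esub> g"
    unfolding is_zero_mor_def by auto
  then show "is_zero_mor (base_cat A) (Edge f)"
    unfolding is_zero_mor_def by (intro exI[of _ "Vertex Z"]) (auto simp: base_zero_ob)
qed

lemma base_kernel: "is_kernel (base_cat A) (Edge k) (Edge f) \<longleftrightarrow> is_kernel A k f"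
  unfolding is_kernel_def by (simp add: ex1_Edge base_zero_mor)

lemma base_cokernel: "is_cokernel (base_cat A) (Edge c) (Edge f) \<longleftrightarrow> is_cokernel A c f"
  unfolding is_cokernel_def by (simp add: ex1_Edge base_zero_mor)

lemma base_kernelE:
  assumes "is_kernel (base_cat A) x y"
  obtains k f where "x = Edge k" "y = Edge f" "is_kernel A k f"
proof -
  have "x \<in> Mor (base_cat A)" "y \<in> Mor (base_cat A)" using assms by (simp_all only: is_kernel_def)
  then obtain k f where "x = Edge k" "y = Edge f" by auto
  then show thesis using that assms by (simp add: base_kernel)
qed

lemma base_pullbackE:
  assumes "is_pullback (base_cat A) x y z w"
  obtains f g p q where "x = Edge f" "y = Edge g" "z = Edge p" "w = Edge q" "is_pullback A f g p q"
proof -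
  have "x \<in> Mor (base_cat A)" "y \<in> Mor (base_cat A)" "z \<in> Mor (base_cat A)" "w \<in> Mor (base_cat A)"
    using assms by (simp_all only: is_pullback_def)
  then obtain f g p q where "x = Edge f" "y = Edge g" "z = Edge p" "w = Edge q" by auto
  then show thesis using that assms by (simp add: base_pullback)
qed

lemma base_short_exact: "short_exact (base_cat A) (Edge k) (Edge f) \<longleftrightarrow> short_exact A k f"
  unfolding short_exact_def base_kernel base_cokernel ..

lemma base_section: "section_of (base_cat A) (Edge s) (Edge f) \<longleftrightarrow> section_of A s f"
  unfolding section_of_def by auto

lemma base_split_short_exactE:
  assumes "split_short_exact (base_cat A) x y z"
  obtains k f s where "x = Edge k" "y = Edge f" "z = Edge s" "split_short_exact A k f s"
proof -
  obtain k f where k: "x = Edge k" "y = Edge f" "is_kernel A k f"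
    using assms base_kernelE unfolding split_short_exact_def by metis
  have "z \<in> hom (base_cat A) (Cod (base_cat A) y) (Dom (base_cat A) y)"
    using assms unfolding split_short_exact_def section_of_def by blast
  then obtain s where "z = Edge s" using base_homE by metis
  then show thesis using that k assms base_section unfolding split_short_exact_def by metis
qed

lemma base_torsion_part:
  "torsion_part (base_cat A) (Vertex ` T) (Vertex ` F) x \<longleftrightarrow> (\<exists>t. x = Edge t \<and> torsion_part A T F t)"
proof
  assume x: "torsion_part (base_cat A) (Vertex ` T) (Vertex ` F) x"
  then obtain y where y: "short_exact (base_cat A) x y" "Cod (base_cat A) y \<in> Vertex ` F" "Dom (base_cat A) x \<in> Vertex ` T"
    unfolding torsion_part_def by blast
  obtain t e where "x = Edge t" "y = Edge e" using y(1) base_kernelE unfolding short_exact_def by metis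
  then show "\<exists>t. x = Edge t \<and> torsion_part A T F t"
    using y unfolding torsion_part_def by (auto simp: base_short_exact)
next
  assume "\<exists>t. x = Edge t \<and> torsion_part A T F t"
  then obtain t e where t: "x = Edge t" "Dom A t \<in> T" "short_exact A t e" "Cod A e \<in> F" unfolding torsion_part_def by blast
  then have "short_exact (base_cat A) x (Edge e)" by (simp add: base_short_exact)
  then show "torsion_part (base_cat A) (Vertex ` T) (Vertex ` F) x"
    unfolding torsion_part_def using t by (auto intro!: exI[of _ "Edge e"])
qed

lemma base_isomorphic: "isomorphic (base_cat A) (Vertex X) (Vertex Y) \<longleftrightarrow> isomorphic A X Y"
  unfolding isomorphic_def by (simp add: base_iso)

lemma base_replete:
  assumes "replete A S"
  shows "replete (base_cat A) (Vertex ` S)"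
  using assms unfolding replete_def by (auto simp: base_isomorphic)

lemma base_effective_algs:
  assumes "effective_algs A p" "p \<in> Mor A"
  shows "effective_algs (base_cat A) (Edge p)"
  unfolding effective_algs_def
proof (intro allI impI)
  fix x' u' v' h'
  assume a: "descent_alg (base_cat A) (Edge p) x' u' v' h'"
  have pb: "is_pullback (base_cat A) (Edge p) (Edge p \<cdot>\<^bsub>base_cat A\<^esub> x') u' v'"
    and xh: "x' \<in> Mor (base_cat A)" "h' \<in> hom (base_cat A) (Dom (base_cat A) u') (Dom (base_cat A) x')"
    using a unfolding descent_alg_def by blast+
  obtain x where x: "x' = Edge x" using xh(1) by auto
  obtain u v where uv: "u' = Edge u" "v' = Edge v" using base_pullbackE[OF pb] by metis
  obtain h where h: "h' = Edge h" using base_homE[OF xh(2)] by metis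
  have "descent_alg A p x u v h"
    unfolding descent_alg_def
  proof (intro conjI allI ballI impI)
    show "x \<in> Mor A" "Cod A x = Dom A p" using a x unfolding descent_alg_def by auto
    show "is_pullback A p (p \<cdot>\<^bsub>A\<^esub> x) u v" using pb unfolding x uv by (simp add: base_pullback)
    show "h \<in> hom A (Dom A u) (Dom A x)" using xh(2) x uv h by auto
    show "x \<cdot>\<^bsub>A\<^esub> h = u" using a x uv h unfolding descent_alg_def by auto
  next
    fix W m assume "m \<in> hom A W (Dom A u)" "u \<cdot>\<^bsub>A\<^esub> m = x \<cdot>\<^bsub>A\<^esub> (v \<cdot>\<^bsub>A\<^esub> m)"
    then have m: "Edge m \<in> hom (base_cat A) (Vertex W) (Dom (base_cat A) u')"
      "u' \<cdot>\<^bsub>base_cat A\<^esub> Edge m = x' \<cdot>\<^bsub>base_cat A\<^esub> (v' \<cdot>\<^bsub>base_cat A\<^esub> Edge m)" using x uv by auto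
    then have "h' \<cdot>\<^bsub>base_cat A\<^esub> Edge m = v' \<cdot>\<^bsub>base_cat A\<^esub> Edge m" using a unfolding descent_alg_def by blast
    then show "h \<cdot>\<^bsub>A\<^esub> m = v \<cdot>\<^bsub>A\<^esub> m" using h uv by simp
  next
    fix W m m' m'' assume m: "m \<in> hom A W (Dom A u)" "m' \<in> hom A W (Dom A u)" "m'' \<in> hom A W (Dom A u)" and
      e: "v \<cdot>\<^bsub>A\<^esub> m'' = h \<cdot>\<^bsub>A\<^esub> m'" "u \<cdot>\<^bsub>A\<^esub> m'' = u \<cdot>\<^bsub>A\<^esub> m" "v \<cdot>\<^bsub>A\<^esub> m = v \<cdot>\<^bsub>A\<^esub> m'"
    have "h' \<cdot>\<^bsub>base_cat A\<^esub> Edge m'' = h' \<cdot>\<^bsub>base_cat A\<^esub> Edge m"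
      by (rule descent_alg_act[OF a, where W = "Vertex W" and m' = "Edge m'"]) (use m e x uv h in auto)
    then show "h \<cdot>\<^bsub>A\<^esub> m'' = h \<cdot>\<^bsub>A\<^esub> m" using h by simp
  qed
  then obtain y q where yq: "is_pullback A p y x q" "q \<cdot>\<^bsub>A\<^esub> h = q \<cdot>\<^bsub>A\<^esub> v"
    using assms(1) unfolding effective_algs_def by blast
  then show "\<exists>y q. is_pullback (base_cat A) (Edge p) y x' q \<and> q \<cdot>\<^bsub>base_cat A\<^esub> h' = q \<cdot>\<^bsub>base_cat A\<^esub> v'"
    using base_pullback[of A p y x q] x h uv by (intro exI[of _ "Edge y"] exI[of _ "Edge q"]) simp
qed

lemma base_split_short_five:
  assumes "split_short_five A"
  shows "split_short_five (base_cat A)"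
  unfolding split_short_five_def
proof (intro allI impI)
  fix k f s k' f' s' u v w
  assume E: "split_short_exact (base_cat A) k f s" "split_short_exact (base_cat A) k' f' s'"
    and u: "u \<in> hom (base_cat A) (Dom (base_cat A) k) (Dom (base_cat A) k')"
    and v: "v \<in> hom (base_cat A) (Dom (base_cat A) f) (Dom (base_cat A) f')"
    and w: "w \<in> hom (base_cat A) (Cod (base_cat A) f) (Cod (base_cat A) f')"
    and c: "v \<cdot>\<^bsub>base_cat A\<^esub> k = k' \<cdot>\<^bsub>base_cat A\<^esub> u" "w \<cdot>\<^bsub>base_cat A\<^esub> f = f' \<cdot>\<^bsub>base_cat A\<^esub> v"
      "v \<cdot>\<^bsub>base_cat A\<^esub> s = s' \<cdot>\<^bsub>base_cat A\<^esub> w"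
    and i: "is_iso (base_cat A) u" "is_iso (base_cat A) w"
  obtain k1 f1 s1 where 1: "k = Edge k1" "f = Edge f1" "s = Edge s1" "split_short_exact A k1 f1 s1"
    using base_split_short_exactE[OF E(1)] .
  obtain k2 f2 s2 where 2: "k' = Edge k2" "f' = Edge f2" "s' = Edge s2" "split_short_exact A k2 f2 s2"
    using base_split_short_exactE[OF E(2)] .
  obtain u1 where u1: "u = Edge u1" using base_homE[OF u] by metis
  obtain v1 where v1: "v = Edge v1" using base_homE[OF v] by metis
  obtain w1 where w1: "w = Edge w1" using base_homE[OF w] by metis
  have "is_iso A v1"
    by (rule assms[unfolded split_short_five_def, rule_format, OF 1(4) 2(4), where u = u1 and w = w1])
      (use u v w c i 1 2 u1 v1 w1 in \<open>auto simp: base_iso\<close>)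
  then show "is_iso (base_cat A) v" using v1 by (simp add: base_iso)
qed

text \<open>\<open>base_cat\<close> is a copy of \<open>A\<close> with cells as objects and
  morphisms, so that all levels share one type. Each axiom is read off through the injective
  constructors.\<close>

theorem base_hml_tors:
  fixes A :: "('o, 'm) cat"
  assumes "hml_tors A N (Ob A) N T F"
  shows "hml_tors (base_cat A) (Edge ` N) (Vertex ` Ob A) (Edge ` N) (Vertex ` T) (Vertex ` F)"
proof -
  interpret H: hml_tors A N "Ob A" N T F by fact
  obtain Z where Z: "is_zero_ob A Z" using H.zero_obE by metis
  have pt: "pt_cat (base_cat A)"
  proof unfold_locales
    show "category (base_cat A)" by (rule base_category[OF H.is_cat])
    have "is_zero_ob (base_cat A) (Vertex Z)" using Z by (simp add: base_zero_ob)
    then show "pointed (base_cat A)" unfolding pointed_def by blast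
  qed
  interpret B: pt_cat "base_cat A" by (rule pt)
  have tt: "torsion_theory (base_cat A) (Vertex ` T) (Vertex ` F)"
    unfolding torsion_theory_def
  proof (intro conjI ballI)
    show "replete (base_cat A) (Vertex ` T)" "replete (base_cat A) (Vertex ` F)"
      using base_replete H.tt unfolding torsion_theory_def by blast+
  next
    fix X Y f assume "X \<in> Vertex ` T" "Y \<in> Vertex ` F" "f \<in> hom (base_cat A) X Y"
    then show "is_zero_mor (base_cat A) f" using H.tt unfolding torsion_theory_def by (auto simp: base_zero_mor)
  next
    fix X assume "X \<in> Ob (base_cat A)"
    then obtain X' where X: "X = Vertex X'" "X' \<in> Ob A" by auto
    then obtain t e where te: "short_exact A t e" "Cod A t = X'" "Dom A t \<in> T" "Cod A e \<in> F"
      using H.tt unfolding torsion_theory_def by blast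
    then have "short_exact (base_cat A) (Edge t) (Edge e)" by (simp add: base_short_exact)
    then show "\<exists>t e. short_exact (base_cat A) t e \<and> Cod (base_cat A) t = X \<and> Dom (base_cat A) t \<in> Vertex ` T \<and>
        Cod (base_cat A) e \<in> Vertex ` F"
      using te X by (intro exI[of _ "Edge t"] exI[of _ "Edge e"]) auto
  qed (rule B.is_cat B.is_pointed)+
  have pbN: "p \<in> Edge ` N" if "is_pullback (base_cat A) f g p q" "g \<in> Edge ` N" for f g p q :: "('o, 'm) cell"
    using that H.Q_pb by (auto elim!: base_pullbackE)
  have canN: "g \<in> Edge ` N" if "f \<in> hom (base_cat A) X Y" "g \<in> hom (base_cat A) Y Z'" "g \<cdot>\<^bsub>base_cat A\<^esub> f \<in> Edge ` N"
    for f g X Y Z' :: "('o, 'm) cell"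
    using that H.Q_cancel by (auto elim!: base_homE)
  show ?thesis
  proof unfold_locales
    fix f g :: "('o, 'm) cell" and X Z' Y assume fg: "f \<in> hom (base_cat A) X Z'" "g \<in> hom (base_cat A) Y Z'"
    obtain f1 X1 Z1 where f: "f = Edge f1" "Z' = Vertex Z1" "f1 \<in> hom A X1 Z1" using base_homE[OF fg(1)] by metis
    obtain g1 Y1 where g: "g = Edge g1" "g1 \<in> hom A Y1 Z1" using base_homE[OF fg(2)] f(2) by (metis cell.inject(1))
    obtain p q where "is_pullback A f1 g1 p q" using H.pb_ex[OF f(3) g(2)] by blast
    then have "is_pullback (base_cat A) f g (Edge p) (Edge q)" unfolding f g by (simp add: base_pullback)
    then show "\<exists>p q. is_pullback (base_cat A) f g p q" by blast
  next
    show "split_short_five (base_cat A)" using base_split_short_five H.ssf by blast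
  next
    fix f g p q :: "('o, 'm) cell" assume "is_pullback (base_cat A) f g p q" "g \<in> Edge ` N"
    then show "p \<in> Edge ` N" by (rule pbN)
  next
    fix q k :: "('o, 'm) cell" assume "q \<in> Edge ` N" "is_kernel (base_cat A) k q"
    then show "is_cokernel (base_cat A) q k" using H.Q_coker by (auto elim!: base_kernelE simp: base_cokernel)
  next
    fix k f :: "('o, 'm) cell" assume "is_kernel (base_cat A) k f"
    then obtain k1 f1 where "k = Edge k1" "is_kernel A k1 f1" using base_kernelE by metis
    then show "\<exists>q\<in>Edge ` N. is_kernel (base_cat A) k q" using H.Q_normal by (simp add: base_kernel)
  next
    fix f g X Y Z' :: "('o, 'm) cell" assume "f \<in> hom (base_cat A) X Y" "g \<in> hom (base_cat A) Y Z'" "g \<cdot>\<^bsub>base_cat A\<^esub> f \<in> Edge ` N"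
    then show "g \<in> Edge ` N" by (rule canN)
  next
    fix f :: "('o, 'm) cell" assume i: "is_iso (base_cat A) f"
    then obtain f1 where "f = Edge f1" by (auto simp: is_iso_def)
    then show "f \<in> Edge ` N" using i H.Q_iso by (simp add: base_iso)
  next
    fix f :: "('o, 'm) cell" assume "f \<in> Edge ` N" then show "effective_algs (base_cat A) f"
      using H.Q_descent H.Q_Mor by (auto intro!: base_effective_algs)
  next
    fix f :: "('o, 'm) cell" assume "f \<in> Edge ` N"
    then show "Dom (base_cat A) f \<in> Vertex ` Ob A \<and> Cod (base_cat A) f \<in> Vertex ` Ob A" using H.E_O by auto
  next
    fix f :: "('o, 'm) cell" and X Y assume i: "is_iso (base_cat A) f" "f \<in> hom (base_cat A) X Y"
    then show "f \<in> Edge ` N" using H.Q_iso by (auto elim!: base_homE simp: base_iso)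
  next
    fix f g X Y Z' :: "('o, 'm) cell" assume "f \<in> hom (base_cat A) X Y" "g \<in> hom (base_cat A) Y Z'" "f \<in> Edge ` N" "g \<in> Edge ` N"
    then show "g \<cdot>\<^bsub>base_cat A\<^esub> f \<in> Edge ` N" using H.E_comp by (auto elim!: base_homE)
  next
    fix Z' f X :: "('o, 'm) cell" assume "is_zero_ob (base_cat A) Z'" "f \<in> hom (base_cat A) X Z'" "X \<in> Vertex ` Ob A"
    then show "f \<in> Edge ` N" using H.E_zero by (auto elim!: base_homE base_zero_obE)
  next
    fix Z' :: "('o, 'm) cell" assume "is_zero_ob (base_cat A) Z'"
    then show "Z' \<in> Vertex ` Ob A" using B.zero_ob_Ob by fastforce
  next
    fix p y x q :: "('o, 'm) cell" assume "is_pullback (base_cat A) p y x q"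
    then show "Dom (base_cat A) y \<in> Vertex ` Ob A"
      using H.hom_Ob1 by (auto elim!: base_pullbackE H.pullbackE simp: homD(2))
  next
    fix k f t :: "('o, 'm) cell" assume a: "is_kernel (base_cat A) k f" "torsion_part (base_cat A) (Vertex ` T) (Vertex ` F) t"
      "Cod (base_cat A) t = Dom (base_cat A) k"
    obtain k1 f1 where k: "k = Edge k1" "f = Edge f1" "is_kernel A k1 f1" using base_kernelE[OF a(1)] .
    obtain t1 where t: "t = Edge t1" "torsion_part A T F t1" using a(2) base_torsion_part by metis
    obtain q where "q \<in> N" "is_kernel A (k1 \<cdot>\<^bsub>A\<^esub> t1) q" "f1 \<in> N \<longrightarrow> q \<in> N"
      using H.tors_normal[OF k(3) t(2)] a(3) k t by auto
    then show "\<exists>q\<in>Edge ` N. is_kernel (base_cat A) (k \<cdot>\<^bsub>base_cat A\<^esub> t) q \<and> (f \<in> Edge ` N \<longrightarrow> q \<in> Edge ` N)"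
      using k t by (intro bexI[of _ "Edge q"]) (auto simp: base_kernel)
  next
    fix k p s :: "('o, 'm) cell" assume a: "split_short_exact (base_cat A) k p s" "Dom (base_cat A) k \<in> Vertex ` F"
    obtain k1 f1 s1 where 1: "k = Edge k1" "p = Edge f1" "s = Edge s1" "split_short_exact A k1 f1 s1"
      using base_split_short_exactE[OF a(1)] .
    obtain t where "torsion_part A T F t" "Cod A t = Dom A f1" "torsion_part A T F (f1 \<cdot>\<^bsub>A\<^esub> t)"
      using H.tors_split[OF 1(4)] a(2) 1(1) by auto
    then show "\<exists>t. torsion_part (base_cat A) (Vertex ` T) (Vertex ` F) t \<and> Cod (base_cat A) t = Dom (base_cat A) p \<and>
        torsion_part (base_cat A) (Vertex ` T) (Vertex ` F) (p \<cdot>\<^bsub>base_cat A\<^esub> t)"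
      using 1 by (intro exI[of _ "Edge t"]) (simp add: base_torsion_part)
  next
    show "f \<in> Edge ` N \<Longrightarrow> f \<in> Mor (base_cat A)" for f :: "('o, 'm) cell" using H.Q_Mor by auto
    show "X \<in> Vertex ` Ob A \<Longrightarrow> X \<in> Ob (base_cat A)" for X :: "('o, 'm) cell" by simp
  qed (use pbN canN tt in blast)+
qed

section \<open>Normal extensions\<close>

context cat_loc
begin

lemma full_sub_pullback:
  assumes "is_pullback C f g p q" "Dom C f \<in> S" "Cod C f \<in> S" "Dom C g \<in> S" "Dom C p \<in> S"
  shows "is_pullback (full_sub C S) f g p q"
proof -
  interpret F: cat_loc "full_sub C S" by unfold_locales (rule category_full_sub[OF is_cat])
  obtain X Y Z P where h: "f \<in> hom C X Z" "g \<in> hom C Y Z" "p \<in> hom C P X" "q \<in> hom C P Y" "f \<cdot> p = g \<cdot> q"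
    using pullbackE[OF assms(1)] .
  have o: "X \<in> S" "Z \<in> S" "Y \<in> S" "P \<in> S" using assms(2-5) h by (auto simp: hom_def)
  show ?thesis
  proof (rule F.pullbackI[OF hom_full_subI[OF h(1) o(1,2)] hom_full_subI[OF h(2) o(3,2)]
        hom_full_subI[OF h(3) o(4,1)] hom_full_subI[OF h(4) o(4,3)]])
    show "f \<cdot>\<^bsub>full_sub C S\<^esub> p = g \<cdot>\<^bsub>full_sub C S\<^esub> q" using h(5) by simp
  next
    fix W u v assume uv: "u \<in> hom (full_sub C S) W X" "v \<in> hom (full_sub C S) W Y"
      "f \<cdot>\<^bsub>full_sub C S\<^esub> u = g \<cdot>\<^bsub>full_sub C S\<^esub> v"
    have uv': "u \<in> hom C W X" "v \<in> hom C W Y" "W \<in> S" "f \<cdot> u = g \<cdot> v"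
      using hom_full_subD[OF uv(1)] hom_full_subD[OF uv(2)] uv(3) by auto
    obtain a where "a \<in> hom C W P" "p \<cdot> a = u" "q \<cdot> a = v"
      using pullback_lift[OF assms(1) h(1-3) uv'(1,2,4)] .
    then show "\<exists>h\<in>hom (full_sub C S) W P. p \<cdot>\<^bsub>full_sub C S\<^esub> h = u \<and> q \<cdot>\<^bsub>full_sub C S\<^esub> h = v"
      by (intro bexI[of _ a]) (simp_all add: hom_full_subI[OF _ uv'(3) o(4)])
  next
    fix W a b assume ab: "a \<in> hom (full_sub C S) W P" "b \<in> hom (full_sub C S) W P"
      "p \<cdot>\<^bsub>full_sub C S\<^esub> a = p \<cdot>\<^bsub>full_sub C S\<^esub> b" "q \<cdot>\<^bsub>full_sub C S\<^esub> a = q \<cdot>\<^bsub>full_sub C S\<^esub> b"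
    show "a = b"
      using pullback_unique[OF assms(1) h(3)] hom_full_subD[OF ab(1)] hom_full_subD[OF ab(2)] ab(3,4) by simp
  qed
qed

lemma full_sub_isoD:
  assumes "is_iso (full_sub C S) f"
  shows "is_iso C f"
  using assms hom_full_subD unfolding is_iso_def by fastforce

end

context hml_ext
begin

text \<open>The kernel is the pullback of \<open>f\<close> along the morphism from a zero object.
  Hence the morphism from it to zero is again an extension, and extensions have their domain in
  \<open>S\<close>.\<close>

lemma kernel_in_S:
  assumes "f \<in> E" "is_kernel C k f" "k \<in> hom C K X"
  shows "K \<in> S"
proof -
  obtain Y where f: "f \<in> hom C X Y" using assms(2,3) by (metis kernelE homD(3))
  obtain Z where Z: "is_zero_ob C Z" "Z \<in> Ob C" using zero_obE .
  note z = zm_hom[OF Z(2) hom_Ob2[OF f]]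
  obtain P p q where P: "is_pullback C (zm C Z Y) f p q" "p \<in> hom C P Z" "q \<in> hom C P X" using pbE[OF z f] .
  have "p \<in> E" using E_pb[OF P(1) assms(1)] O_zero[OF Z(1)] homD(2)[OF z] by simp
  then have PS: "P \<in> S" using E_O1 P(2) by blast
  have PO: "P \<in> Ob C" using P(2) hom_Ob1 by blast
  have "is_kernel C (Id C P) p"
  proof (rule kernelI[OF id_hom[OF PO] P(2)])
    show "p \<cdot> Id C P = zm C P Z" using id_right[OF P(2)] zm_to_zero[OF Z(1) P(2)] by simp
  next
    fix W g assume "g \<in> hom C W P"
    then show "\<exists>h\<in>hom C W P. Id C P \<cdot> h = g" using id_left by blast
  next
    fix W g h assume "g \<in> hom C W P" "h \<in> hom C W P" "Id C P \<cdot> g = Id C P \<cdot> h"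
    then show "g = h" using id_left by metis
  qed
  then have "is_kernel C q f" using kernel_pullback[OF P _ id_hom[OF PO]] id_right[OF P(3)] by simp
  then obtain i where "i \<in> hom C P K" "is_iso C i" using kernel_iso[OF assms(2) _ assms(3) P(3)] by metis
  then show ?thesis using E_iso E_O2 PS by blast
qed

text \<open>The pullback of an extension formed in \<open>C\<close> already lies in
  \<open>S\<close>, so it is also a pullback in the subcategory and is isomorphic to the given
  one.\<close>

lemma ext_pullbackD:
  assumes "is_pullback (full_sub C S) f g p q" "g \<in> E"
  shows "is_pullback C f g p q"
proof -
  interpret F: cat_loc "full_sub C S" by unfold_locales (rule category_full_sub[OF is_cat])
  obtain X Y Z P where F: "f \<in> hom (full_sub C S) X Z" "g \<in> hom (full_sub C S) Y Z"
    "p \<in> hom (full_sub C S) P X" "q \<in> hom (full_sub C S) P Y"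
    using F.pullbackE[OF assms(1)] by metis
  note h = hom_full_subD[OF F(1)] hom_full_subD[OF F(2)] hom_full_subD[OF F(3)] hom_full_subD[OF F(4)]
  obtain P0 p0 q0 where P0: "is_pullback C f g p0 q0" "p0 \<in> hom C P0 X" "q0 \<in> hom C P0 Y" using pbE h by metis
  have "p0 \<in> E" using E_pb[OF P0(1) assms(2)] h homD(2) by metis
  then have P0S: "P0 \<in> S" using E_O1 P0(2) by blast
  have "is_pullback (full_sub C S) f g p0 q0"
    by (rule full_sub_pullback[OF P0(1)]) (use h P0S P0(2) homD in metis)+
  then obtain i where i: "i \<in> hom (full_sub C S) P P0" "is_iso (full_sub C S) i"
    "p0 \<cdot>\<^bsub>full_sub C S\<^esub> i = p" "q0 \<cdot>\<^bsub>full_sub C S\<^esub> i = q"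
    using F.pullback_iso[OF _ assms(1) hom_full_subI[OF P0(2) P0S] F(3)] h by metis
  then show ?thesis
    using pullback_of_iso[OF P0(1) conjunct1[OF hom_full_subD[OF i(1)]] full_sub_isoD[OF i(2)] P0(2)] by simp
qed

text \<open>An algebra in the subcategory satisfies its axioms only on elements with domain in
  \<open>S\<close>. Each axiom has a universal instance, over \<open>X\<close> for the unit and over
  \<open>P2\<close> for associativity, and both of these objects lie in \<open>S\<close>; every
  other instance is obtained by composition.\<close>

lemma ext_descent_alg:
  assumes "f \<in> E" "f \<in> hom C A B" "x \<in> E" "x \<in> hom C X A" "descent_alg (full_sub C S) f x u v h"
  shows "descent_alg C f x u v h"
proof -
  note XS = E_O1[OF assms(3,4)] and AS = E_O1[OF assms(1,2)] and BS = E_O2[OF assms(1,2)]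
  have fx: "f \<cdot> x \<in> hom C X B" "f \<cdot> x \<in> E" using comp_hom[OF assms(2,4)] E_comp[OF assms(4,2,3,1)] by auto
  have "is_pullback (full_sub C S) f (f \<cdot> x) u v" using assms(5) unfolding descent_alg_def by simp
  then have pb: "is_pullback C f (f \<cdot> x) u v" using ext_pullbackD fx(2) by blast
  define P where "P = Dom C u"
  have u: "u \<in> hom C P A" and v: "v \<in> hom C P X" using pullback_homs[OF pb assms(2) fx(1)] unfolding P_def by auto
  have uE: "u \<in> E" using E_pb[OF pb fx(2)] AS homD(2)[OF assms(2)] by simp
  note PS = E_O1[OF uE u]
  have h0: "h \<in> hom (full_sub C S) (Dom C u) (Dom C x)" and h2: "x \<cdot> h = u"
    using assms(5) by (simp_all add: descent_alg_def)
  have h: "h \<in> hom C P X" "x \<cdot> h = u"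
    using hom_full_subD[OF h0] h2 homD(2)[OF assms(4)] unfolding P_def by simp_all
  have in_sub: "m \<in> hom (full_sub C S) W (Dom (full_sub C S) u)" if "W \<in> S" "m \<in> hom C W P" for W m
    using hom_full_subI[OF that(2,1) PS] unfolding P_def by simp
  have act: "h \<cdot> m'' = h \<cdot> m"
    if "W \<in> S" "m \<in> hom C W P" "m' \<in> hom C W P" "m'' \<in> hom C W P" "v \<cdot> m'' = h \<cdot> m'" "u \<cdot> m'' = u \<cdot> m" "v \<cdot> m = v \<cdot> m'" for W m m' m''
    by (rule descent_alg_act[OF assms(5) in_sub[OF that(1,2)] in_sub[OF that(1,3)] in_sub[OF that(1,4)], unfolded full_sub_simps])
      (use that in simp_all)
  have unit: "h \<cdot> m = v \<cdot> m" if "W \<in> S" "m \<in> hom C W P" "u \<cdot> m = x \<cdot> (v \<cdot> m)" for W m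
  proof -
    have "m \<in> hom (full_sub C S) W (Dom (full_sub C S) u)" using hom_full_subI[OF that(2,1) PS] unfolding P_def by simp
    then show ?thesis using assms(5) that(3) unfolding descent_alg_def by simp
  qed
  have "f \<cdot> x = (f \<cdot> x) \<cdot> Id C X" using id_right[OF fx(1)] by simp
  then obtain e where e: "e \<in> hom C X P" "u \<cdot> e = x" "v \<cdot> e = Id C X"
    using pullback_lift[OF pb assms(2) fx(1) u assms(4) id_hom[OF hom_Ob1[OF assms(4)]]] by metis
  have he: "h \<cdot> e = Id C X" using unit[OF XS e(1)] e(2,3) id_right[OF assms(4)] by simp
  have fu: "f \<cdot> u \<in> hom C P B" "f \<cdot> u \<in> E" using comp_hom[OF assms(2) u] E_comp[OF u assms(2) uE assms(1)] by auto
  \<comment> \<open>\<open>P2\<close> is the iterated pullback. Below, \<open>pm\<close> and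
    \<open>ph\<close> are its maps to \<open>P\<close> induced by the projection \<open>v\<close>
    and by the action \<open>h\<close>, and associativity for all elements follows from
    \<open>hh\<close>.\<close>
  obtain P2 r w where P2: "is_pullback C f (f \<cdot> u) r w" "r \<in> hom C P2 A" "w \<in> hom C P2 P" using pbE[OF assms(2) fu(1)] .
  have "r \<in> E" using E_pb[OF P2(1) fu(2)] AS homD(2)[OF assms(2)] by simp
  then have P2S: "P2 \<in> S" using E_O1 P2(2) by blast
  have comm: "f \<cdot> u = (f \<cdot> x) \<cdot> v" by (rule pullback_comm[OF pb])
  have "f \<cdot> r = (f \<cdot> x) \<cdot> (v \<cdot> w)"
    using pullback_comm[OF P2(1)] comm assoc[OF P2(3) v fx(1)] by simp
  then obtain pm where pm: "pm \<in> hom C P2 P" "u \<cdot> pm = r" "v \<cdot> pm = v \<cdot> w"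
    using pullback_lift[OF pb assms(2) fx(1) u P2(2) comp_hom[OF v P2(3)]] by metis
  have "f \<cdot> r = (f \<cdot> x) \<cdot> (h \<cdot> w)"
    using pullback_comm[OF P2(1)] assoc[OF P2(3) h(1) fx(1)] assoc[OF h(1) assms(4,2)] h(2) by simp
  then obtain ph where ph: "ph \<in> hom C P2 P" "u \<cdot> ph = r" "v \<cdot> ph = h \<cdot> w"
    using pullback_lift[OF pb assms(2) fx(1) u P2(2) comp_hom[OF h(1) P2(3)]] by metis
  have hh: "h \<cdot> ph = h \<cdot> pm" using act[OF P2S pm(1) P2(3) ph(1)] pm ph by simp
  show ?thesis
    unfolding descent_alg_def P_def[symmetric] homD(2)[OF assms(4)]
  proof (intro conjI allI ballI impI)
    show "x \<in> Mor C" "Cod C x = Dom C f" using assms(2,4) by (auto simp: hom_def)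
    show "is_pullback C f (f \<cdot> x) u v" "h \<in> hom C P X" "x \<cdot> h = u" by fact+
  next
    fix W m assume m: "m \<in> hom C W P" "u \<cdot> m = x \<cdot> (v \<cdot> m)"
    note vm = comp_hom[OF v m(1)]
    have "e \<cdot> (v \<cdot> m) = m"
      by (rule pullback_unique[OF pb u comp_hom[OF e(1) vm] m(1)])
        (use assoc[OF vm e(1) u] assoc[OF vm e(1) v] e(2,3) m(2) id_left[OF vm] in simp_all)
    then show "h \<cdot> m = v \<cdot> m" using assoc[OF vm e(1) h(1)] he id_left[OF vm] by simp
  next
    fix W m m' m'' assume m: "m \<in> hom C W P" "m' \<in> hom C W P" "m'' \<in> hom C W P" and
      e: "v \<cdot> m'' = h \<cdot> m'" "u \<cdot> m'' = u \<cdot> m" "v \<cdot> m = v \<cdot> m'"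
    have "f \<cdot> (u \<cdot> m) = (f \<cdot> u) \<cdot> m'"
      using assoc[OF m(1) u assms(2)] comm assoc[OF m(1) v fx(1)] assoc[OF m(2) v fx(1)] e(3) by simp
    then obtain z where z: "z \<in> hom C W P2" "r \<cdot> z = u \<cdot> m" "w \<cdot> z = m'"
      using pullback_lift[OF P2(1) assms(2) fu(1) P2(2) comp_hom[OF u m(1)] m(2)] by metis
    have "ph \<cdot> z = m''"
      by (rule pullback_unique[OF pb u comp_hom[OF ph(1) z(1)] m(3)])
        (use assoc[OF z(1) ph(1) u] assoc[OF z(1) ph(1) v] ph z assoc[OF z(1) P2(3) h(1)] e in simp_all)
    moreover have "pm \<cdot> z = m"
      by (rule pullback_unique[OF pb u comp_hom[OF pm(1) z(1)] m(1)])
        (use assoc[OF z(1) pm(1) u] assoc[OF z(1) pm(1) v] pm z assoc[OF z(1) P2(3) v] e in simp_all)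
    ultimately show "h \<cdot> m'' = h \<cdot> m" using assoc[OF z(1) ph(1) h(1)] assoc[OF z(1) pm(1) h(1)] hh by simp
  qed
qed

lemma ext_base_change:
  assumes "f \<in> E" "f \<in> hom C A B"
  shows "base_change (full_sub C S) E f A B"
proof unfold_locales
  note AS = E_O1[OF assms] and BS = E_O2[OF assms]
  show "category (full_sub C S)" by (rule category_full_sub[OF is_cat])
  show "f \<in> hom (full_sub C S) A B" by (rule hom_full_subI[OF assms(2) AS BS])
  show "f \<cdot>\<^bsub>full_sub C S\<^esub> x \<in> E" if "x \<in> E" "x \<in> hom (full_sub C S) X A" for x X
    using E_comp[OF conjunct1[OF hom_full_subD[OF that(2)]] assms(2) that(1) assms(1)] by simp
  show "\<exists>p q. is_pullback (full_sub C S) f y p q" if "y \<in> E" "y \<in> hom (full_sub C S) Y B" for y Y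
  proof -
    have y: "y \<in> hom C Y B" "Y \<in> S" using hom_full_subD[OF that(2)] by auto
    obtain P p q where P: "is_pullback C f y p q" "p \<in> hom C P A" using pbE[OF assms(2) y(1)] .
    have "p \<in> E" using E_pb[OF P(1) that(1)] AS homD(2)[OF assms(2)] by simp
    then have "is_pullback (full_sub C S) f y p q"
      using full_sub_pullback[OF P(1)] AS BS y E_O[of p] homD[OF assms(2)] homD[OF y(1)] by simp
    then show ?thesis by blast
  qed
  show "p \<in> E" if "y \<in> E" "is_pullback (full_sub C S) f y p q" for y p q
    using E_pb[OF ext_pullbackD[OF that(2,1)] that(1)] AS homD(2)[OF assms(2)] by simp
qed

text \<open>Descent of the object is inherited from \<open>Q\<close>; \<open>E_desc\<close> places
  the result in \<open>S\<close>, and cancellation makes it an extension. For full faithfulness, the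
  projection \<open>v\<close> is an extension, hence the cokernel of its kernel, and this kernel
  lies in \<open>S\<close>, so the vanishing of \<open>g\<close> on it is among the conditions
  available in the subcategory.\<close>

theorem ext_monadic:
  assumes "f \<in> E"
  shows "monadic_extension (full_sub C S) E f"
proof -
  define A B where "A = Dom C f" and "B = Cod C f"
  have f: "f \<in> hom C A B" unfolding A_def B_def using Mor_hom[OF E_Mor[OF assms]] .
  note AS = E_O1[OF assms f] and BS = E_O2[OF assms f]
  interpret BC: base_change "full_sub C S" E f A B by (rule ext_base_change[OF assms f])
  have "monadic BC.SB BC.SA BC.R"
  proof (rule BC.monadic_of_effective_algs)
    fix x X u v h
    assume x: "x \<in> E" "x \<in> hom (full_sub C S) X A" and alg: "descent_alg (full_sub C S) f x u v h"
    have xh: "x \<in> hom C X A" using hom_full_subD[OF x(2)] by blast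
    obtain y q where y: "is_pullback C f y x q" "q \<cdot> h = q \<cdot> v"
      using Q_descent[OF E_Q[OF assms]] ext_descent_alg[OF assms f x(1) xh alg] unfolding effective_algs_def by blast
    have YS: "Dom C y \<in> S" using E_desc[OF y(1) assms x(1)] .
    have yh: "y \<in> hom C (Dom C y) B" and q: "q \<in> hom C X (Dom C y)"
      using y(1) f xh by (auto simp: is_pullback_def hom_def)
    have qE: "q \<in> E" using E_pb[OF pullback_sym[OF y(1)] assms YS] .
    have "y \<cdot> q \<in> E" using E_comp[OF xh f x(1) assms] pullback_comm[OF y(1)] by simp
    then have "y \<in> E" using E_cancel[OF q yh qE] by blast
    moreover have "is_pullback (full_sub C S) f y x q"
      by (rule full_sub_pullback[OF y(1)]) (use AS BS YS E_O1[OF x(1) xh] f xh in \<open>auto simp: homD\<close>)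
    ultimately show "\<exists>y q. y \<in> E \<and> is_pullback (full_sub C S) f y x q \<and> q \<cdot>\<^bsub>full_sub C S\<^esub> h = q \<cdot>\<^bsub>full_sub C S\<^esub> v"
      using y(2) by auto
  next
    fix y Y u v W g
    assume y: "y \<in> E" "y \<in> hom (full_sub C S) Y B" and pb0: "is_pullback (full_sub C S) f y u v"
      and g0: "g \<in> hom (full_sub C S) (Dom (full_sub C S) u) W"
      and eq: "\<And>V a b. a \<in> hom (full_sub C S) V (Dom (full_sub C S) u) \<Longrightarrow> b \<in> hom (full_sub C S) V (Dom (full_sub C S) u) \<Longrightarrow>
        v \<cdot>\<^bsub>full_sub C S\<^esub> a = v \<cdot>\<^bsub>full_sub C S\<^esub> b \<Longrightarrow> g \<cdot>\<^bsub>full_sub C S\<^esub> a = g \<cdot>\<^bsub>full_sub C S\<^esub> b"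
    have yh: "y \<in> hom C Y B" "Y \<in> S" using hom_full_subD[OF y(2)] by auto
    have g: "g \<in> hom C (Dom C u) W" "Dom C u \<in> S" "W \<in> S" using hom_full_subD[OF g0] by auto
    have pb: "is_pullback C f y u v" using ext_pullbackD[OF pb0 y(1)] .
    have v: "v \<in> hom C (Dom C u) Y" using pullback_homs[OF pb f yh(1)] by blast
    have vE: "v \<in> E" using E_pb[OF pullback_sym[OF pb] assms] yh homD(2)[OF yh(1)] by simp
    obtain K k where k: "k \<in> hom C K (Dom C u)" "is_kernel C k v" using kernel_ex[OF v] .
    have KS: "K \<in> S" using kernel_in_S[OF vE k(2,1)] .
    note O = hom_Ob1[OF k(1)] hom_Ob2[OF k(1)]
    have "v \<cdot> k = v \<cdot> zm C K (Dom C u)" using kernel_zero[OF k(2,1) v] comp_zm[OF v O(1)] by simp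
    then have "g \<cdot> k = zm C K W"
      using eq[of k K "zm C K (Dom C u)"] hom_full_subI[OF k(1) KS g(2)] hom_full_subI[OF zm_hom[OF O] KS g(2)]
        comp_zm[OF g(1) O(1)] by simp
    then obtain m where m: "m \<in> hom C Y W" "m \<cdot> v = g"
      using cokernel_desc[OF Q_coker[OF E_Q[OF vE] k(2)] k(1) v g(1)] by metis
    show "\<exists>!m. m \<in> hom (full_sub C S) Y W \<and> m \<cdot>\<^bsub>full_sub C S\<^esub> v = g"
    proof (rule ex1I[of _ m])
      show "m \<in> hom (full_sub C S) Y W \<and> m \<cdot>\<^bsub>full_sub C S\<^esub> v = g" using m hom_full_subI[OF m(1) yh(2) g(3)] by simp
      fix n assume n: "n \<in> hom (full_sub C S) Y W \<and> n \<cdot>\<^bsub>full_sub C S\<^esub> v = g"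
      have nh: "n \<in> hom C Y W" by (rule conjunct1[OF hom_full_subD[OF conjunct1[OF n]]])
      show "n = m" by (rule Q_epi[OF E_Q[OF vE] v nh m(1)]) (use n m(2) in simp)
    qed
  qed
  moreover have "f \<in> Mor (full_sub C S)" using homD(1)[OF BC.f] .
  ultimately show ?thesis
    unfolding monadic_extension_def full_sub_simps(3,4) A_def B_def using assms by blast
qed

end

section \<open>The reflection onto the torsion free objects\<close>

context tors_cat
begin

text \<open>The cokernel of a torsion part is universal among morphisms to torsion free objects,
  because those vanish on the torsion part. Functoriality follows from uniqueness of the
  factorizations.\<close>

theorem torsion_reflection: "\<exists>R \<eta>. reflection C F R \<eta>"
proof -
  have "\<exists>e t T0 Y. e \<in> hom C X Y \<and> t \<in> hom C T0 X \<and> is_cokernel C e t \<and> T0 \<in> T \<and> Y \<in> F" if X: "X \<in> Ob C" for X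
  proof -
    obtain T0 t where t: "t \<in> hom C T0 X" "torsion_part C T F t" using torsion_part_ex[OF X] .
    show ?thesis using torsion_partE[OF t(2,1)] t(1) by metis
  qed
  then obtain e t T0 Y where e: "\<And>X. X \<in> Ob C \<Longrightarrow> e X \<in> hom C X (Y X)" "\<And>X. X \<in> Ob C \<Longrightarrow> t X \<in> hom C (T0 X) X"
    "\<And>X. X \<in> Ob C \<Longrightarrow> is_cokernel C (e X) (t X)" "\<And>X. X \<in> Ob C \<Longrightarrow> T0 X \<in> T" "\<And>X. X \<in> Ob C \<Longrightarrow> Y X \<in> F" by metis
  have univ: "\<exists>!h. h \<in> hom C (Y X) V \<and> h \<cdot> e X = g" if g: "g \<in> hom C X V" "V \<in> F" for X V g
  proof -
    note X = hom_Ob1[OF g(1)]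
    have z: "g \<cdot> t X = zm C (T0 X) V" by (rule T_F_zero[OF comp_hom[OF g(1) e(2)[OF X]] e(4)[OF X] g(2)])
    obtain h where "h \<in> hom C (Y X) V" "h \<cdot> e X = g" using cokernel_desc[OF e(3)[OF X] e(2)[OF X] e(1)[OF X] g(1) z] .
    then show ?thesis using cokernel_epi[OF e(3)[OF X] e(1)[OF X]] by metis
  qed
  define r where "r f = (THE h. h \<in> hom C (Y (Dom C f)) (Y (Cod C f)) \<and> h \<cdot> e (Dom C f) = e (Cod C f) \<cdot> f)" for f
  have r: "r f \<in> hom C (Y X) (Y X')" "r f \<cdot> e X = e X' \<cdot> f"
    "\<And>h. h \<in> hom C (Y X) (Y X') \<Longrightarrow> h \<cdot> e X = e X' \<cdot> f \<Longrightarrow> r f = h" if f: "f \<in> hom C X X'" for f X X'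
  proof -
    note O = hom_Ob1[OF f] hom_Ob2[OF f]
    have u: "\<exists>!h. h \<in> hom C (Y X) (Y X') \<and> h \<cdot> e X = e X' \<cdot> f" using univ[OF comp_hom[OF e(1)[OF O(2)] f] e(5)[OF O(2)]] .
    have rd: "r f = (THE h. h \<in> hom C (Y X) (Y X') \<and> h \<cdot> e X = e X' \<cdot> f)" unfolding r_def homD(2,3)[OF f] ..
    show "r f \<in> hom C (Y X) (Y X')" "r f \<cdot> e X = e X' \<cdot> f" using theI'[OF u] rd by auto
    then show "\<And>h. h \<in> hom C (Y X) (Y X') \<Longrightarrow> h \<cdot> e X = e X' \<cdot> f \<Longrightarrow> r f = h" using u by blast
  qed
  define R where "R = \<lparr>on_ob = Y, on_mor = r\<rparr>"
  have Rs: "on_ob R X = Y X" "on_mor R f = r f" for X f by (simp_all add: R_def)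
  have "is_functor C (full_sub C F) R"
  proof (rule functorI[OF is_cat])
    fix X assume X: "X \<in> Ob C"
    show "on_ob R X \<in> Ob (full_sub C F)" using e(5)[OF X] F_Ob Rs by simp
    have "r (Id C X) = Id C (Y X)"
      using r(3)[OF id_hom[OF X] id_hom[OF hom_Ob2[OF e(1)[OF X]]]] id_left[OF e(1)[OF X]] id_right[OF e(1)[OF X]] by simp
    then show "on_mor R (Id C X) = Id (full_sub C F) (on_ob R X)" using Rs by simp
  next
    fix f X X' assume f: "f \<in> hom C X X'"
    show "on_mor R f \<in> hom (full_sub C F) (on_ob R X) (on_ob R X')"
      unfolding Rs by (rule hom_full_subI[OF r(1)[OF f] e(5)[OF hom_Ob1[OF f]] e(5)[OF hom_Ob2[OF f]]])
  next
    fix f g X X' X'' assume fg: "f \<in> hom C X X'" "g \<in> hom C X' X''"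
    note O = hom_Ob1[OF fg(1)] hom_Ob2[OF fg(1)] hom_Ob2[OF fg(2)]
    have "(r g \<cdot> r f) \<cdot> e X = e X'' \<cdot> (g \<cdot> f)"
      using assoc[OF e(1)[OF O(1)] r(1)[OF fg(1)] r(1)[OF fg(2)]] r(2)[OF fg(1)] r(2)[OF fg(2)]
        assoc[OF fg(1) e(1)[OF O(2)] r(1)[OF fg(2)]] assoc[OF fg e(1)[OF O(3)]] by simp
    then show "on_mor R (g \<cdot> f) = on_mor R g \<cdot>\<^bsub>full_sub C F\<^esub> on_mor R f"
      using r(3)[OF comp_hom[OF fg(2,1)] comp_hom[OF r(1)[OF fg(2)] r(1)[OF fg(1)]]] Rs by simp
  qed
  moreover have "nat_trans C C id_func R e"
    by (rule nat_transI) (use e(1) r(2) Rs in simp_all)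
  ultimately have "reflection C F R e" unfolding reflection_def using F_Ob univ Rs by auto
  then show ?thesis by blast
qed

end

section \<open>Torsion quotients and normality of extensions\<close>

context hml_tors
begin

text \<open>The axiom \<open>tors_normal\<close> is applied to the morphism from \<open>X\<close> to
  a zero object: its kernel is the identity of \<open>X\<close>, and it is an extension by
  \<open>E_zero\<close>. This is what puts the torsion free quotient of an object of
  \<open>S\<close> back into \<open>S\<close>.\<close>

lemma ext_quotient:
  assumes "X \<in> S" "t \<in> hom C T0 X" "torsion_part C T F t"
  obtains q D where "q \<in> E" "q \<in> hom C X D" "is_kernel C t q" "is_cokernel C q t" "D \<in> F" "D \<in> S" "T0 \<in> T"
proof -
  obtain Z where Z: "is_zero_ob C Z" "Z \<in> Ob C" using zero_obE .
  have X: "X \<in> Ob C" using O_Ob assms(1) .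
  note z = zm_hom[OF X Z(2)]
  have "is_kernel C (Id C X) (zm C X Z)"
  proof (rule kernelI[OF id_hom[OF X] z])
    show "zm C X Z \<cdot> Id C X = zm C X Z" by (rule id_right[OF z])
  next
    fix W g assume "g \<in> hom C W X"
    then show "\<exists>h\<in>hom C W X. Id C X \<cdot> h = g" using id_left by blast
  next
    fix W g h assume "g \<in> hom C W X" "h \<in> hom C W X" "Id C X \<cdot> g = Id C X \<cdot> h"
    then show "g = h" using id_left by metis
  qed
  moreover have "Cod C t = Dom C (Id C X)" using homD(3)[OF assms(2)] homD(2)[OF id_hom[OF X]] by simp
  ultimately have "\<exists>q\<in>Q. is_kernel C (Id C X \<cdot> t) q \<and> (zm C X Z \<in> E \<longrightarrow> q \<in> E)"
    using tors_normal assms(3) by blast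
  then obtain q where q: "q \<in> Q" "is_kernel C t q" "q \<in> E"
    using E_zero[OF Z(1) z assms(1)] id_left[OF assms(2)] by auto
  obtain D where D: "q \<in> hom C X D" using kernelE[OF q(2)] assms(2) by (metis homD(3))
  obtain e Y where e: "e \<in> hom C X Y" "is_kernel C t e" "is_cokernel C e t" "T0 \<in> T" "Y \<in> F"
    using torsion_partE[OF assms(3,2)] .
  note qc = Q_coker[OF q(1,2)]
  obtain i where "i \<in> hom C Y D" "is_iso C i" using cokernel_iso[OF e(3) qc e(1) D] by metis
  then have "D \<in> F" using F_replete e(5) by blast
  then show thesis using that[OF q(3) D q(2) qc _ E_O2[OF q(3) D] e(4)] by blast
qed

text \<open>The torsion sequence of an object of \<open>S\<close> stays in \<open>S\<close>: its
  quotient by \<open>ext_quotient\<close>, its torsion part by the assumption on \<open>T\<close>.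
  Exactness then restricts to the full subcategory because that contains the zero objects.\<close>

lemma ext_torsion_theory:
  assumes "T \<subseteq> S"
  shows "torsion_theory (full_sub C S) T (F \<inter> S)"
  unfolding torsion_theory_def
proof (intro conjI ballI)
  obtain Z where Z: "is_zero_ob C Z" "Z \<in> Ob C" using zero_obE .
  note ZS = O_zero[OF Z(1)]
  show "category (full_sub C S)" by (rule category_full_sub[OF is_cat])
  show "pointed (full_sub C S)" by (rule full_sub_pointed[OF Z(1) ZS])
  have iso: "isomorphic C X Y" if iso: "isomorphic (full_sub C S) X Y" for X Y
  proof -
    obtain i where "i \<in> hom (full_sub C S) X Y" "is_iso (full_sub C S) i" using iso unfolding isomorphic_def by blast
    then show ?thesis unfolding isomorphic_def using full_sub_isoD[of S i] hom_full_subD[of i C S X Y] by blast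
  qed
  have rep: "Y \<in> G" if "replete C G" "X \<in> G" "Y \<in> Ob C" "isomorphic C X Y" for G X Y
    using that unfolding replete_def by blast
  have rT: "replete C T" "replete C F" using tt unfolding torsion_theory_def by auto
  show "replete (full_sub C S) T"
    unfolding replete_def
  proof (intro conjI ballI impI)
    show "T \<subseteq> Ob (full_sub C S)" using T_Ob assms by auto
    show "Y \<in> T" if "X \<in> T" "Y \<in> Ob (full_sub C S)" "isomorphic (full_sub C S) X Y" for X Y
      using rep[OF rT(1) that(1) _ iso[OF that(3)]] that(2) by simp
  qed
  show "replete (full_sub C S) (F \<inter> S)"
    unfolding replete_def
  proof (intro conjI ballI impI)
    show "F \<inter> S \<subseteq> Ob (full_sub C S)" using F_Ob by auto
    show "Y \<in> F \<inter> S" if "X \<in> F \<inter> S" "Y \<in> Ob (full_sub C S)" "isomorphic (full_sub C S) X Y" for X Y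
      using rep[OF rT(2) _ _ iso[OF that(3)]] that(1,2) by simp
  qed
  {
    fix X Y f assume a: "X \<in> T" "Y \<in> F \<inter> S" "f \<in> hom (full_sub C S) X Y"
    then have "is_zero_mor C f" using tt hom_full_subD[OF a(3)] unfolding torsion_theory_def by blast
    then show "is_zero_mor (full_sub C S) f" using full_sub_zero_mor[OF Z(1) ZS a(3)] by blast
  next
    fix X assume "X \<in> Ob (full_sub C S)"
    then have X: "X \<in> Ob C" "X \<in> S" by auto
    obtain T0 t where t: "t \<in> hom C T0 X" "torsion_part C T F t" using torsion_part_ex[OF X(1)] .
    obtain q D where q: "q \<in> E" "q \<in> hom C X D" "is_kernel C t q" "is_cokernel C q t" "D \<in> F" "D \<in> S" "T0 \<in> T"
      using ext_quotient[OF X(2) t] .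
    have "T0 \<in> S" using q(7) assms by blast
    then have s: "t \<in> hom (full_sub C S) T0 X" "q \<in> hom (full_sub C S) X D"
      using hom_full_subI[OF t(1) _ X(2)] hom_full_subI[OF q(2) X(2) q(6)] by auto
    have "short_exact (full_sub C S) t q"
      unfolding short_exact_def using full_sub_kernel[OF Z(1) ZS q(3) s] full_sub_cokernel[OF Z(1) ZS q(4) s] by blast
    then show "\<exists>t e. short_exact (full_sub C S) t e \<and> Cod (full_sub C S) t = X \<and> Dom (full_sub C S) t \<in> T \<and>
        Cod (full_sub C S) e \<in> F \<inter> S"
      using t(1) q by (intro exI[of _ t] exI[of _ q]) (auto simp: homD)
  }
qed

text \<open>If \<open>f\<close> is a normal extension then \<open>K[f]\<close> embeds, via the kernel of the trivial kernel pair
  projection, into an object of \<open>F\<close>. Conversely, for \<open>K[f] \<in> F\<close> the kernel pair projection restricts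
  to an isomorphism of torsion parts, so that the short five lemma makes the naturality square a pullback.\<close>

theorem normal_extension_iff:
  assumes R: "reflection (full_sub C S) (F \<inter> S) R \<eta>" and fE: "f \<in> E"
  shows "normal_extension (full_sub C S) R \<eta> E f \<longleftrightarrow> (\<exists>k. is_kernel C k f \<and> Dom C k \<in> F)"
proof -
  define A B where "A = Dom C f" and "B = Cod C f"
  have f: "f \<in> hom C A B" unfolding A_def B_def using Mor_hom[OF E_Mor[OF fE]] .
  note AS = E_O1[OF fE f] and BS = E_O2[OF fE f]
  obtain Z where Z: "is_zero_ob C Z" "Z \<in> Ob C" using zero_obE .
  note ZS = O_zero[OF Z(1)]
  have Rf: "is_functor (full_sub C S) (full_sub (full_sub C S) (F \<inter> S)) R" using R unfolding reflection_def by blast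
  have RX: "on_ob R X \<in> F" "on_ob R X \<in> S" if "X \<in> S" for X
    using functor_simps(1)[OF Rf, of X] that O_Ob by auto
  have \<eta>h: "\<eta> X \<in> hom C X (on_ob R X)" if "X \<in> S" for X
  proof -
    have "nat_trans (full_sub C S) (full_sub C S) id_func R \<eta>" "X \<in> Ob (full_sub C S)"
      using R that O_Ob unfolding reflection_def by auto
    then have "\<eta> X \<in> hom (full_sub C S) X (on_ob R X)" using nat_transD(1) by fastforce
    then show ?thesis using hom_full_subD by fastforce
  qed
  have nat: "\<eta> Y \<cdot> g = on_mor R g \<cdot> \<eta> X" if "g \<in> hom (full_sub C S) X Y" for g X Y
    using R nat_transD(2)[of "full_sub C S" "full_sub C S" id_func R \<eta> g X Y] that unfolding reflection_def by auto
  have univ: "\<exists>!h. h \<in> hom C (on_ob R X) Y \<and> h \<cdot> \<eta> X = g" if g: "g \<in> hom C X Y" "X \<in> S" "Y \<in> F" "Y \<in> S" for g X Y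
  proof -
    have X: "X \<in> Ob (full_sub C S)" and Y: "Y \<in> F \<inter> S" using g O_Ob by auto
    have "\<exists>!h. h \<in> hom (full_sub C S) (on_ob R X) Y \<and> h \<cdot>\<^bsub>full_sub C S\<^esub> \<eta> X = g"
      using R X Y hom_full_subI[OF g(1,2,4)] unfolding reflection_def by blast
    then show ?thesis using hom_full_sub[OF RX(2)[OF g(2)] g(4), of C] by simp
  qed
  \<comment> \<open>The reflection is arbitrary. By universality its unit agrees up to isomorphism
    with the quotient from \<open>ext_quotient\<close>, so it is an extension whose kernel is the
    torsion part.\<close>
  have \<eta>E: "\<eta> X \<in> E" "is_kernel C t (\<eta> X)" if t: "X \<in> S" "t \<in> hom C T0 X" "torsion_part C T F t" for X t T0
  proof -
    obtain q D where q: "q \<in> E" "q \<in> hom C X D" "is_kernel C t q" "is_cokernel C q t" "D \<in> F" "D \<in> S" "T0 \<in> T"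
      using ext_quotient[OF t] .
    note \<eta>X = \<eta>h[OF t(1)]
    obtain j where j: "j \<in> hom C (on_ob R X) D" "j \<cdot> \<eta> X = q" using univ[OF q(2) t(1) q(5,6)] by blast
    have "\<eta> X \<cdot> t = zm C T0 (on_ob R X)" by (rule T_F_zero[OF comp_hom[OF \<eta>X t(2)] q(7) RX(1)[OF t(1)]])
    then obtain i where i: "i \<in> hom C D (on_ob R X)" "i \<cdot> q = \<eta> X" using cokernel_desc[OF q(4) t(2) q(2) \<eta>X] by metis
    have "j \<cdot> i = Id C D"
      by (rule cokernel_epi[OF q(4,2) comp_hom[OF j(1) i(1)] id_hom[OF hom_Ob2[OF q(2)]]])
        (use assoc[OF q(2) i(1) j(1)] i(2) j(2) id_left[OF q(2)] in simp)
    moreover have "i \<cdot> j = Id C (on_ob R X)"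
    proof -
      have "(i \<cdot> j) \<cdot> \<eta> X = \<eta> X" using assoc[OF \<eta>X j(1) i(1)] i(2) j(2) by simp
      then show ?thesis
        using univ[OF \<eta>X t(1) RX[OF t(1)]] comp_hom[OF i(1) j(1)] id_hom[OF hom_Ob2[OF \<eta>X]] id_left[OF \<eta>X] by blast
    qed
    ultimately have ii: "is_iso C i" using isoI[OF i(1) j(1)] by blast
    then show "\<eta> X \<in> E" using E_comp[OF q(2) i(1) q(1) E_iso[OF ii i(1) q(6)]] i(2) by simp
    show "is_kernel C t (\<eta> X)"
      using kernel_comp_mono[OF q(3,2) i(1)] iso_mono[OF ii i(1)] i(2) by metis
  qed
  have \<eta>E': "\<eta> X \<in> E" if X: "X \<in> S" for X
  proof -
    obtain T0 t where "t \<in> hom C T0 X" "torsion_part C T F t" using torsion_part_ex[OF O_Ob[OF X]] .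
    then show ?thesis using \<eta>E(1)[OF X] by blast
  qed
  interpret BC: base_change "full_sub C S" E f A B by (rule ext_base_change[OF fE f])
  \<comment> \<open>The kernel pair of \<open>f\<close>, taken from the choice of pullbacks made by
    \<open>change_base\<close>, so that \<open>p\<close> is the very morphism occurring in
    \<open>normal_extension\<close>.\<close>
  define p q P where "p = BC.U f" and "q = BC.V f" and "P = Dom C p"
  note ch = BC.choice[OF fE BC.f, folded p_def q_def]
  have pb: "is_pullback C f f p q" using ext_pullbackD[OF ch(1) fE] .
  have p: "p \<in> hom C P A" and q: "q \<in> hom C P A" using pullback_homs[OF pb f f] unfolding P_def by auto
  have pE: "p \<in> E" by (rule ch(4))
  note PS = E_O1[OF pE p]
  have pS: "p \<in> hom (full_sub C S) P A" using hom_full_subI[OF p PS AS] .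
  have Rp: "on_mor R p \<in> hom C (on_ob R P) (on_ob R A)"
    by (rule conjunct1[OF hom_full_subD[OF conjunct1[OF hom_full_subD[OF functor_simps(3)[OF Rf pS]]]]])
  obtain K k where k: "k \<in> hom C K A" "is_kernel C k f" using kernel_ex[OF f] .
  have KS: "K \<in> S" using kernel_in_S[OF fE k(2,1)] .
  note O = hom_Ob1[OF k(1)] hom_Ob2[OF k(1)] hom_Ob1[OF p]
  have "f \<cdot> zm C K A = f \<cdot> k" using comp_zm[OF f O(1)] kernel_zero[OF k(2,1) f] by simp
  then obtain k' where k': "k' \<in> hom C K P" "p \<cdot> k' = zm C K A" "q \<cdot> k' = k"
    using pullback_lift[OF pb f f p zm_hom[OF O(1,2)] k(1)] by metis
  have kp: "is_kernel C k' p" by (rule kernel_pullback'[OF pb p q k(2) k'(1,3,2)])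
  have KF: "(\<exists>k. is_kernel C k f \<and> Dom C k \<in> F) \<longleftrightarrow> K \<in> F"
  proof
    assume "\<exists>k. is_kernel C k f \<and> Dom C k \<in> F"
    then obtain k0 where k0: "is_kernel C k0 f" "Dom C k0 \<in> F" by blast
    have "k0 \<in> hom C (Dom C k0) A" using k0(1) f by (auto simp: is_kernel_def hom_def)
    then obtain i where "i \<in> hom C (Dom C k0) K" "is_iso C i" using kernel_iso[OF k(2) k0(1) k(1)] by metis
    then show "K \<in> F" using F_replete k0(2) by blast
  qed (use k homD(2)[OF k(1)] in auto)
  have triv: "normal_extension (full_sub C S) R \<eta> E f \<longleftrightarrow> is_pullback (full_sub C S) (\<eta> A) (on_mor R p) p (\<eta> P)"
    unfolding normal_extension_def trivial_extension_def BC.R_simps(1) p_def[symmetric]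
    using ext_monadic[OF fE] pE homD(3)[OF p] P_def by simp
  have "is_pullback (full_sub C S) (\<eta> A) (on_mor R p) p (\<eta> P) \<longleftrightarrow> K \<in> F"
  proof
    assume a: "is_pullback (full_sub C S) (\<eta> A) (on_mor R p) p (\<eta> P)"
    have sq: "is_pullback C (on_mor R p) (\<eta> A) (\<eta> P) p"
      using ext_pullbackD[OF BC.pullback_sym[OF a] \<eta>E'[OF AS]] .
    obtain T0 t where t: "t \<in> hom C T0 K" "torsion_part C T F t" using torsion_part_ex[OF O(1)] .
    obtain r D where r: "r \<in> E" "r \<in> hom C K D" "is_kernel C t r" "is_cokernel C r t" "D \<in> F" "D \<in> S" "T0 \<in> T"
      using ext_quotient[OF KS t] .
    have T0: "T0 \<in> Ob C" using t(1) hom_Ob1 by blast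
    note k't = comp_hom[OF k'(1) t(1)]
    \<comment> \<open>Both projections of the pullback square kill it: the unit because it would
      send a torsion object to a torsion free one, and \<open>p\<close> because \<open>k'\<close> is
      its kernel.\<close>
    have "k' \<cdot> t = zm C T0 P"
    proof (rule pullback_unique[OF sq \<eta>h[OF PS] k't zm_hom[OF T0 O(3)]])
      show "\<eta> P \<cdot> (k' \<cdot> t) = \<eta> P \<cdot> zm C T0 P"
        using T_F_zero[OF comp_hom[OF \<eta>h[OF PS] k't] r(7) RX(1)[OF PS]] comp_zm[OF \<eta>h[OF PS] T0] by simp
      show "p \<cdot> (k' \<cdot> t) = p \<cdot> zm C T0 P"
        using assoc[OF t(1) k'(1) p] k'(2) zm_comp[OF t(1) O(2)] comp_zm[OF p T0] by simp
    qed
    then have "k' \<cdot> t = k' \<cdot> zm C T0 K" using comp_zm[OF k'(1) T0] by simp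
    then have "t = zm C T0 K" using kernel_mono[OF kp k'(1) t(1) zm_hom[OF T0 O(1)]] by blast
    then have "is_iso C r" using cokernel_zero_iso[OF r(4) _ t(1) r(2)] by blast
    then obtain j where "j \<in> hom C D K" "is_iso C j" using iso_inv[OF _ r(2)] by metis
    then show "K \<in> F" using F_replete r(5) by blast
  next
    assume KF: "K \<in> F"
    obtain s where s: "s \<in> hom C A P" "p \<cdot> s = Id C A"
      using pullback_lift[OF pb f f p id_hom[OF O(2)] id_hom[OF O(2)]] by metis
    have "split_short_exact C k' p s"
      unfolding split_short_exact_def section_of_def using kp p s by (simp add: homD)
    then obtain t where t: "torsion_part C T F t" "Cod C t = P" "torsion_part C T F (p \<cdot> t)"
      using tors_split KF homD(2)[OF k'(1)] P_def by metis
    have th: "t \<in> hom C (Dom C t) P"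
      using t(1,2) by (auto simp: torsion_part_def short_exact_def is_kernel_def hom_def)
    note pt = comp_hom[OF p th]
    note \<eta>P = \<eta>E[OF PS th t(1)] \<eta>h[OF PS] and \<eta>A = \<eta>E[OF AS pt t(3)] \<eta>h[OF AS]
    \<comment> \<open>Because \<open>p \<cdot> t\<close> is a torsion part of \<open>A\<close>, it
      is the kernel of the unit there, and hence \<open>c \<cdot> t\<close> is the kernel of
      \<open>l1\<close>. So \<open>c\<close> compares two members of \<open>Q\<close> with the same
      kernel object \<open>Dom C t\<close>.\<close>
    obtain L l1 l2 where L: "is_pullback C (on_mor R p) (\<eta> A) l1 l2" "l1 \<in> hom C L (on_ob R P)" "l2 \<in> hom C L A"
      using pbE[OF Rp \<eta>A(3)] .
    obtain c where c: "c \<in> hom C P L" "l1 \<cdot> c = \<eta> P" "l2 \<cdot> c = p"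
      using pullback_lift[OF L(1) Rp \<eta>A(3) L(2) \<eta>P(3) p] nat[OF pS] by metis
    note ct = comp_hom[OF c(1) th]
    have "is_kernel C (c \<cdot> t) l1"
    proof (rule kernel_pullback'[OF L \<eta>A(2) ct])
      show "l2 \<cdot> (c \<cdot> t) = p \<cdot> t" using assoc[OF th c(1) L(3)] c(3) by simp
      show "l1 \<cdot> (c \<cdot> t) = zm C (Dom C t) (on_ob R P)"
        using assoc[OF th c(1) L(2)] c(2) kernel_zero[OF \<eta>P(2) th \<eta>P(3)] by simp
    qed
    then have ci: "is_iso C c"
      using Q_short_five[OF E_Q[OF \<eta>P(1)] Q_pb[OF L(1) E_Q[OF \<eta>A(1)]] \<eta>P(3) L(2) c(1,2) \<eta>P(2) th] by blast
    have "is_pullback C (on_mor R p) (\<eta> A) (\<eta> P) p"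
      using pullback_of_iso[OF L(1) c(1) ci L(2)] c(2,3) by simp
    then show "is_pullback (full_sub C S) (\<eta> A) (on_mor R p) p (\<eta> P)"
      by (intro full_sub_pullback[OF pullback_sym])
        (use AS PS RX \<eta>h[OF AS] Rp p in \<open>simp_all add: homD[OF \<eta>h[OF AS]] homD[OF Rp] homD[OF p]\<close>)
  qed
  then show ?thesis using triv KF by simp
qed

end

section \<open>Initial ribs\<close>

fun init_vertex :: "('o, 'm) cat \<Rightarrow> ('o, 'm) cell \<Rightarrow> 'o" where
  "init_vertex A (Vertex X) = X"
| "init_vertex A (Edge f) = Dom A f"
| "init_vertex A (Square a b f f') = init_vertex A a"

text \<open>The intersection of the kernels of the ribs, phrased without choosing the kernels and
  meaningful for an empty list, where it is an isomorphism onto \<open>X\<close>. This gives the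
  induction over the dimension a base case.\<close>

definition joint_kernel :: "('o, 'm) cat \<Rightarrow> 'o \<Rightarrow> 'm list \<Rightarrow> 'm \<Rightarrow> bool" where
  "joint_kernel A X rs m \<longleftrightarrow> m \<in> hom A (Dom A m) X \<and> (\<forall>r \<in> set rs. r \<cdot>\<^bsub>A\<^esub> m = zm A (Dom A m) (Cod A r)) \<and>
     (\<forall>W. \<forall>g \<in> hom A W X. (\<forall>r \<in> set rs. r \<cdot>\<^bsub>A\<^esub> g = zm A W (Cod A r)) \<longrightarrow>
        (\<exists>!h. h \<in> hom A W (Dom A m) \<and> m \<cdot>\<^bsub>A\<^esub> h = g))"

primrec Qcls :: "('o, 'm) cat \<Rightarrow> 'm set \<Rightarrow> nat \<Rightarrow> ('o, 'm) cell set" where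
  "Qcls A N 0 = Edge ` N"
| "Qcls A N (Suc n) = sqQ (Arr n A) (Qcls A N n)"

text \<open>The index shifts because an object of level \<open>Suc n\<close> is a morphism of level
  \<open>n\<close>: the extensions among these objects form \<open>Ncls A N n\<close>. At level 0
  every object counts as an extension.\<close>

primrec Ocls :: "('o, 'm) cat \<Rightarrow> 'm set \<Rightarrow> nat \<Rightarrow> ('o, 'm) cell set" where
  "Ocls A N 0 = Vertex ` Ob A"
| "Ocls A N (Suc n) = Ncls A N n"

primrec Tcls :: "('o, 'm) cat \<Rightarrow> 'o set \<Rightarrow> nat \<Rightarrow> ('o, 'm) cell set" where
  "Tcls A T 0 = Vertex ` T"
| "Tcls A T (Suc n) = arrT (Arr n A) (Tcls A T n)"

lemma list_all2_set:
  assumes "list_all2 P xs ys"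
  shows "y \<in> set ys \<Longrightarrow> \<exists>x \<in> set xs. P x y" and "x \<in> set xs \<Longrightarrow> \<exists>y \<in> set ys. P x y"
  using assms by (induction rule: list_all2_induct) auto

lemma Fsub_Suc: "Fsub A F (Suc n) = arrF (Arr n A) (Fsub A F n)"
  by (simp add: arrF_def)

locale arr_tower =
  fixes A :: "('o, 'm) cat" and N T F
  assumes base: "hml_tors A N (Ob A) N T F"

sublocale arr_tower \<subseteq> A: hml_tors A N "Ob A" N T F
  by (rule base)

context arr_tower
begin

text \<open>All axioms go through one induction together, since the torsion axioms one level up rest
  on the closure properties of \<open>Q\<close> and \<open>E\<close> below.\<close>

lemma tower: "cell_tors (Arr n A) (Qcls A N n) (Ocls A N n) (Ncls A N n) (Tcls A T n) (Fsub A F n)"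
proof (induction n)
  case 0
  interpret hml_tors "base_cat A" "Edge ` N" "Vertex ` Ob A" "Edge ` N" "Vertex ` T" "Vertex ` F"
    by (rule base_hml_tors[OF base])
  show ?case by simp unfold_locales
next
  case (Suc n)
  interpret C: cell_tors "Arr n A" "Qcls A N n" "Ocls A N n" "Ncls A N n" "Tcls A T n" "Fsub A F n" by (rule Suc.IH)
  interpret hml_tors "arrow_cat (Arr n A)" "sqQ (Arr n A) (Qcls A N n)" "Ncls A N n" "ext_class (Arr n A) (Ncls A N n)"
    "arrT (Arr n A) (Tcls A T n)" "arrF (Arr n A) (Fsub A F n)" by (rule C.hml_tors_arrow)
  show ?case unfolding Fsub_Suc by simp unfold_locales
qed

lemma Arr_category: "category (Arr n A)"
proof -
  interpret C: cell_tors "Arr n A" "Qcls A N n" "Ocls A N n" "Ncls A N n" "Tcls A T n" "Fsub A F n" by (rule tower)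
  show ?thesis by (rule C.is_cat)
qed

lemma Arr_MorE:
  assumes "x \<in> Mor (Arr n A)"
  obtains f where "n = 0" "x = Edge f" "f \<in> Mor A"
  | m a b f f' where "n = Suc m" "x = Square a b f f'" "a \<in> Mor (Arr m A)" "b \<in> Mor (Arr m A)"
      "f \<in> hom (Arr m A) (Dom (Arr m A) a) (Dom (Arr m A) b)"
proof (cases n)
  case 0
  then show thesis using assms that(1) by auto
next
  case (Suc m)
  then obtain a b f f' where "x = Square a b f f'" "x \<in> Mor (arrow_cat (Arr m A))"
    using assms by (auto simp: arrow_cat_def)
  then show thesis using that(2)[OF Suc] by (simp add: arr_Mor_iff)
qed

lemma init_vertex_Dom:
  assumes "x \<in> Mor (Arr n A)"
  shows "init_vertex A x = init_vertex A (Dom (Arr n A) x)"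
  using assms by (rule Arr_MorE) simp_all

lemma initial_ribs_Mor:
  assumes "x \<in> Mor (Arr n A)"
  shows "initial_ribs x = initial_edge x # initial_ribs (Dom (Arr n A) x)"
  using assms by (rule Arr_MorE) simp_all

lemma initial_edge_hom:
  assumes "x \<in> hom (Arr n A) a b"
  shows "initial_edge x \<in> hom A (init_vertex A a) (init_vertex A b)"
proof -
  have "x \<in> Mor (Arr n A) \<Longrightarrow>
      initial_edge x \<in> hom A (init_vertex A (Dom (Arr n A) x)) (init_vertex A (Cod (Arr n A) x))" for x
  proof (induction n arbitrary: x)
    case 0
    then show ?case by (auto simp: hom_def)
  next
    case (Suc n)
    from Suc.prems show ?case
    proof (rule Arr_MorE)
      fix m a b f f'
      assume "Suc n = Suc m" and x: "x = Square a b f f'" and ab: "a \<in> Mor (Arr m A)" "b \<in> Mor (Arr m A)" and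
        f: "f \<in> hom (Arr m A) (Dom (Arr m A) a) (Dom (Arr m A) b)"
      then have m: "m = n" by simp
      show ?thesis
        using Suc.IH[OF homD(1)[OF f[unfolded m]]] init_vertex_Dom[OF ab(1)] init_vertex_Dom[OF ab(2)] homD(2,3)[OF f] x
        unfolding m by simp
    qed simp
  qed
  then show ?thesis using homD[OF assms] by blast
qed

lemma initial_edge_comp:
  assumes "x \<in> hom (Arr n A) a b" "y \<in> hom (Arr n A) b c"
  shows "initial_edge (y \<cdot>\<^bsub>Arr n A\<^esub> x) = initial_edge y \<cdot>\<^bsub>A\<^esub> initial_edge x"
  using assms
proof (induction n arbitrary: x y a b c)
  case 0
  then show ?case by (auto elim!: base_homE)
next
  case (Suc n)
  have h: "x \<in> hom (arrow_cat (Arr n A)) a b" "y \<in> hom (arrow_cat (Arr n A)) b c" using Suc.prems by simp_all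
  obtain f f' where f: "x = Square a b f f'" "f \<in> hom (Arr n A) (Dom (Arr n A) a) (Dom (Arr n A) b)"
    using arr_homE[OF h(1) arr_hom_Ob[OF h(1)]] by metis
  obtain g g' where g: "y = Square b c g g'" "g \<in> hom (Arr n A) (Dom (Arr n A) b) (Dom (Arr n A) c)"
    using arr_homE[OF h(2) arr_hom_Ob[OF h(2)]] by metis
  show ?case using Suc.IH[OF f(2) g(2)] f(1) g(1) by simp
qed

lemma ribs_of_object:
  assumes "X \<in> Ob (Arr n A)" "r \<in> set (initial_ribs X)"
  shows "r \<in> hom A (init_vertex A X) (Cod A r)"
  using assms
proof (induction n arbitrary: X)
  case 0
  then show ?case by auto
next
  case (Suc n)
  interpret C: cell_tors "Arr n A" "Qcls A N n" "Ocls A N n" "Ncls A N n" "Tcls A T n" "Fsub A F n" by (rule tower)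
  have X: "X \<in> hom (Arr n A) (Dom (Arr n A) X) (Cod (Arr n A) X)" using Suc.prems(1) by (simp add: C.Mor_hom)
  then show ?case
    using Suc.IH[OF C.hom_Ob1[OF X]] Suc.prems(2) initial_ribs_Mor[OF homD(1)[OF X]] init_vertex_Dom[OF homD(1)[OF X]]
      initial_edge_hom[OF X] by (auto simp: hom_def)
qed

text \<open>Kernels of cubes are pointwise, so the edge at the initial vertex is again a
  kernel.\<close>

lemma kernel_initial:
  assumes "is_kernel (Arr n A) k x"
  shows "is_kernel A (initial_edge k) (initial_edge x)"
  using assms
proof (induction n arbitrary: k x)
  case 0
  then show ?case by (auto elim!: base_kernelE)
next
  case (Suc n)
  interpret C: cell_tors "Arr n A" "Qcls A N n" "Ocls A N n" "Ncls A N n" "Tcls A T n" "Fsub A F n" by (rule tower)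
  have "is_kernel (arrow_cat (Arr n A)) k x" using Suc.prems by simp
  then show ?case by (rule C.arr_ker_squares) (use Suc.IH in simp)
qed

text \<open>Each rib of the kernel object is the restriction of the corresponding rib of the ambient
  cube, up to the edge \<open>w\<close> between their endpoints. That edge is itself a kernel, hence
  monic, so a morphism is killed by one rib exactly when its image is killed by the other.\<close>

lemma kernel_ribs:
  assumes "is_kernel (Arr n A) k x"
  shows "list_all2 (\<lambda>r s. \<exists>w \<in> hom A (Cod A r) (Cod A s). s \<cdot>\<^bsub>A\<^esub> initial_edge k = w \<cdot>\<^bsub>A\<^esub> r \<and>
      (\<forall>W. \<forall>g \<in> hom A W (Cod A r). \<forall>h \<in> hom A W (Cod A r). w \<cdot>\<^bsub>A\<^esub> g = w \<cdot>\<^bsub>A\<^esub> h \<longrightarrow> g = h))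
    (initial_ribs (Dom (Arr n A) k)) (initial_ribs (Cod (Arr n A) k))"
  using assms
proof (induction n arbitrary: k x)
  case 0
  then show ?case by (auto elim!: base_kernelE)
next
  case (Suc n)
  interpret C: cell_tors "Arr n A" "Qcls A N n" "Ocls A N n" "Ncls A N n" "Tcls A T n" "Fsub A F n" by (rule tower)
  have "is_kernel (arrow_cat (Arr n A)) k x" using Suc.prems by simp
  then obtain \<kappa> a b u u' f f' where *: "k = Square \<kappa> a u u'" "x = Square a b f f'"
    "Square \<kappa> a u u' \<in> hom (arrow_cat (Arr n A)) \<kappa> a" "Square a b f f' \<in> hom (arrow_cat (Arr n A)) a b"
    "is_kernel (Arr n A) u f" "is_kernel (Arr n A) u' f'" by (rule C.arr_ker_squares)
  note O = arr_hom_Ob[OF *(3)]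
  note u = arr_homD[OF *(3) O]
  have e: "initial_edge a \<cdot>\<^bsub>A\<^esub> initial_edge u = initial_edge u' \<cdot>\<^bsub>A\<^esub> initial_edge \<kappa>"
    using initial_edge_comp[OF u(1) O(2)] initial_edge_comp[OF O(1) u(2)] u(3) by simp
  have cods: "Cod A (initial_edge \<kappa>) = init_vertex A (Cod (Arr n A) \<kappa>)" "Cod A (initial_edge a) = init_vertex A (Cod (Arr n A) a)"
    using initial_edge_hom[OF O(1)] initial_edge_hom[OF O(2)] by (auto simp: hom_def)
  note iu' = initial_edge_hom[OF u(2), folded cods]
  have "g = h" if "g \<in> hom A W (Cod A (initial_edge \<kappa>))" "h \<in> hom A W (Cod A (initial_edge \<kappa>))"
    "initial_edge u' \<cdot>\<^bsub>A\<^esub> g = initial_edge u' \<cdot>\<^bsub>A\<^esub> h" for W g h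
    using A.kernel_mono[OF kernel_initial[OF *(6)] iu' that] .
  then show ?case
    using Suc.IH[OF *(5)] *(1) iu' e initial_ribs_Mor[OF homD(1)[OF O(1)]] initial_ribs_Mor[OF homD(1)[OF O(2)]]
      homD(2,3)[OF u(1)] by auto
qed

lemma joint_kernelD:
  assumes "joint_kernel A X rs m"
  shows "m \<in> hom A (Dom A m) X" "\<And>r. r \<in> set rs \<Longrightarrow> r \<cdot>\<^bsub>A\<^esub> m = zm A (Dom A m) (Cod A r)"
    "\<And>W g. g \<in> hom A W X \<Longrightarrow> (\<And>r. r \<in> set rs \<Longrightarrow> r \<cdot>\<^bsub>A\<^esub> g = zm A W (Cod A r)) \<Longrightarrow>
        \<exists>!h. h \<in> hom A W (Dom A m) \<and> m \<cdot>\<^bsub>A\<^esub> h = g"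
  using assms unfolding joint_kernel_def by blast+

lemma joint_kernel_mono:
  assumes "joint_kernel A X rs m" "\<And>r. r \<in> set rs \<Longrightarrow> r \<in> hom A X (Cod A r)"
    "g \<in> hom A W (Dom A m)" "h \<in> hom A W (Dom A m)" "m \<cdot>\<^bsub>A\<^esub> g = m \<cdot>\<^bsub>A\<^esub> h"
  shows "g = h"
proof -
  note m = joint_kernelD[OF assms(1)]
  have "r \<cdot>\<^bsub>A\<^esub> (m \<cdot>\<^bsub>A\<^esub> g) = zm A W (Cod A r)" if r: "r \<in> set rs" for r
    using A.assoc[OF assms(3) m(1) assms(2)[OF r]] m(2)[OF r] A.zm_comp[OF assms(3) A.hom_Ob2[OF assms(2)[OF r]]] by simp
  then have "\<exists>!k. k \<in> hom A W (Dom A m) \<and> m \<cdot>\<^bsub>A\<^esub> k = m \<cdot>\<^bsub>A\<^esub> g" using m(3)[OF A.comp_hom[OF m(1) assms(3)]] by blast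
  then show ?thesis using assms(3-5) by metis
qed

lemma joint_kernel_unique:
  assumes "joint_kernel A X rs m" "joint_kernel A X rs m'" "\<And>r. r \<in> set rs \<Longrightarrow> r \<in> hom A X (Cod A r)"
  shows "Dom A m \<in> F \<longleftrightarrow> Dom A m' \<in> F"
proof -
  have imp: "Dom A m' \<in> F" if j: "joint_kernel A X rs m" "joint_kernel A X rs m'" and F: "Dom A m \<in> F" for m m'
  proof -
    note m = joint_kernelD[OF j(1)] and m' = joint_kernelD[OF j(2)]
    obtain i where i: "i \<in> hom A (Dom A m) (Dom A m')" "m' \<cdot>\<^bsub>A\<^esub> i = m" using m'(3)[OF m(1) m(2)] by blast
    obtain l where l: "l \<in> hom A (Dom A m') (Dom A m)" "m \<cdot>\<^bsub>A\<^esub> l = m'" using m(3)[OF m'(1) m'(2)] by blast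
    have "i \<cdot>\<^bsub>A\<^esub> l = Id A (Dom A m')"
      by (rule joint_kernel_mono[OF j(2) assms(3) A.comp_hom[OF i(1) l(1)] A.id_hom[OF A.hom_Ob1[OF m'(1)]]])
        (use A.assoc[OF l(1) i(1) m'(1)] i(2) l(2) A.id_right[OF m'(1)] in simp_all)
    moreover have "l \<cdot>\<^bsub>A\<^esub> i = Id A (Dom A m)"
      by (rule joint_kernel_mono[OF j(1) assms(3) A.comp_hom[OF l(1) i(1)] A.id_hom[OF A.hom_Ob1[OF m(1)]]])
        (use A.assoc[OF i(1) l(1) m(1)] i(2) l(2) A.id_right[OF m(1)] in simp_all)
    ultimately have "is_iso A i" using A.isoI[OF i(1) l(1)] by blast
    then show ?thesis using A.F_replete[OF F i(1)] by blast
  qed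
  show ?thesis using imp[OF assms(1,2)] imp[OF assms(2,1)] by blast
qed

text \<open>A morphism killed by all ribs of \<open>x\<close> is killed by the initial edge of
  \<open>x\<close> and so factors through that of \<open>k\<close>. By \<open>kernel_ribs\<close>
  the factor is killed by the ribs of the kernel object, which correspond to the remaining ribs of
  \<open>x\<close> up to monomorphisms.\<close>

lemma joint_kernel_step:
  assumes k: "is_kernel (Arr n A) k x" and m: "joint_kernel A (init_vertex A (Dom (Arr n A) k)) (initial_ribs (Dom (Arr n A) k)) m"
  shows "joint_kernel A (init_vertex A x) (initial_ribs x) (initial_edge k \<cdot>\<^bsub>A\<^esub> m)"
    "Dom A (initial_edge k \<cdot>\<^bsub>A\<^esub> m) = Dom A m"
proof -
  interpret C: cell_tors "Arr n A" "Qcls A N n" "Ocls A N n" "Ncls A N n" "Tcls A T n" "Fsub A F n" by (rule tower)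
  obtain \<kappa> a b where h: "k \<in> hom (Arr n A) \<kappa> a" "x \<in> hom (Arr n A) a b" using C.kernelE[OF k] by metis
  note D = homD(2,3)[OF h(1)] homD(2)[OF h(2)]
  note m = joint_kernelD[OF m[unfolded D]]
  note ik = initial_edge_hom[OF h(1)] and ix = initial_edge_hom[OF h(2)]
  note ki = kernel_initial[OF k]
  note rel = kernel_ribs[OF k, unfolded D]
  have ivx: "init_vertex A x = init_vertex A a" using init_vertex_Dom[OF homD(1)[OF h(2)]] D by simp
  have ribs: "initial_ribs x = initial_edge x # initial_ribs a" using initial_ribs_Mor[OF homD(1)[OF h(2)]] D by simp
  have ra: "r \<in> hom A (init_vertex A a) (Cod A r)" if "r \<in> set (initial_ribs a)" for r
    using ribs_of_object[OF C.hom_Ob2[OF h(1)] that] .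
  have r\<kappa>: "r \<in> hom A (init_vertex A \<kappa>) (Cod A r)" if "r \<in> set (initial_ribs \<kappa>)" for r
    using ribs_of_object[OF C.hom_Ob1[OF h(1)] that] .
  note km = A.comp_hom[OF ik m(1)]
  show dm: "Dom A (initial_edge k \<cdot>\<^bsub>A\<^esub> m) = Dom A m" using homD(2)[OF km] .
  note mO = A.hom_Ob1[OF m(1)]
  show "joint_kernel A (init_vertex A x) (initial_ribs x) (initial_edge k \<cdot>\<^bsub>A\<^esub> m)"
    unfolding joint_kernel_def dm ivx
  proof (intro conjI ballI allI impI)
    show "initial_edge k \<cdot>\<^bsub>A\<^esub> m \<in> hom A (Dom A m) (init_vertex A a)" by (rule km)
  next
    fix r assume "r \<in> set (initial_ribs x)"
    then consider "r = initial_edge x" | "r \<in> set (initial_ribs a)" using ribs by auto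
    then show "r \<cdot>\<^bsub>A\<^esub> (initial_edge k \<cdot>\<^bsub>A\<^esub> m) = zm A (Dom A m) (Cod A r)"
    proof cases
      case 1
      then show ?thesis
        using A.assoc[OF m(1) ik ix] A.kernel_zero[OF ki ik ix] A.zm_comp[OF m(1) A.hom_Ob2[OF ix]] homD(3)[OF ix] by simp
    next
      case 2
      obtain s w where s: "s \<in> set (initial_ribs \<kappa>)" "w \<in> hom A (Cod A s) (Cod A r)"
        "r \<cdot>\<^bsub>A\<^esub> initial_edge k = w \<cdot>\<^bsub>A\<^esub> s" using list_all2_set(1)[OF rel 2] by blast
      have "r \<cdot>\<^bsub>A\<^esub> (initial_edge k \<cdot>\<^bsub>A\<^esub> m) = w \<cdot>\<^bsub>A\<^esub> (s \<cdot>\<^bsub>A\<^esub> m)"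
        using A.assoc[OF m(1) ik ra[OF 2]] A.assoc[OF m(1) r\<kappa>[OF s(1)] s(2)] s(3) by simp
      then show ?thesis using m(2)[OF s(1)] A.comp_zm[OF s(2) mO] by simp
    qed
  next
    fix W g assume g: "g \<in> hom A W (init_vertex A a)" "\<forall>r\<in>set (initial_ribs x). r \<cdot>\<^bsub>A\<^esub> g = zm A W (Cod A r)"
    note W = A.hom_Ob1[OF g(1)]
    have "initial_edge x \<cdot>\<^bsub>A\<^esub> g = zm A W (init_vertex A b)" using g(2) ribs homD(3)[OF ix] by simp
    then obtain g' where g': "g' \<in> hom A W (init_vertex A \<kappa>)" "initial_edge k \<cdot>\<^bsub>A\<^esub> g' = g"
      using A.kernel_lift[OF ki ik ix g(1)] by metis
    have "s \<cdot>\<^bsub>A\<^esub> g' = zm A W (Cod A s)" if s: "s \<in> set (initial_ribs \<kappa>)" for s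
    proof -
      obtain r w where r: "r \<in> set (initial_ribs a)" "w \<in> hom A (Cod A s) (Cod A r)"
        "r \<cdot>\<^bsub>A\<^esub> initial_edge k = w \<cdot>\<^bsub>A\<^esub> s"
        and mono: "\<And>W g h. g \<in> hom A W (Cod A s) \<Longrightarrow> h \<in> hom A W (Cod A s) \<Longrightarrow> w \<cdot>\<^bsub>A\<^esub> g = w \<cdot>\<^bsub>A\<^esub> h \<Longrightarrow> g = h"
        using list_all2_set(2)[OF rel s] by blast
      have "w \<cdot>\<^bsub>A\<^esub> (s \<cdot>\<^bsub>A\<^esub> g') = r \<cdot>\<^bsub>A\<^esub> g"
        using A.assoc[OF g'(1) r\<kappa>[OF s] r(2)] A.assoc[OF g'(1) ik ra[OF r(1)]] r(3) g'(2) by simp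
      also have "\<dots> = w \<cdot>\<^bsub>A\<^esub> zm A W (Cod A s)" using g(2) ribs r(1) A.comp_zm[OF r(2) W] by simp
      finally show ?thesis
        using mono[OF A.comp_hom[OF r\<kappa>[OF s] g'(1)] A.zm_hom[OF W A.hom_Ob2[OF r\<kappa>[OF s]]]] by blast
    qed
    then have ex: "\<exists>!h. h \<in> hom A W (Dom A m) \<and> m \<cdot>\<^bsub>A\<^esub> h = g'" using m(3)[OF g'(1)] by blast
    have eq: "(initial_edge k \<cdot>\<^bsub>A\<^esub> m) \<cdot>\<^bsub>A\<^esub> h = g \<longleftrightarrow> m \<cdot>\<^bsub>A\<^esub> h = g'" if h: "h \<in> hom A W (Dom A m)" for h
      using A.assoc[OF h m(1) ik] A.kernel_mono[OF ki ik A.comp_hom[OF m(1) h] g'(1)] g'(2) by auto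
    show "\<exists>!h. h \<in> hom A W (Dom A m) \<and> (initial_edge k \<cdot>\<^bsub>A\<^esub> m) \<cdot>\<^bsub>A\<^esub> h = g"
      using ex eq by (metis (no_types, lifting))
  qed
qed

text \<open>Each kernel taken removes one direction of the cube and accounts for one rib, so the
  object left in dimension 0 is both the iterated kernel tested by \<open>Fsub\<close> and the
  domain of the joint kernel. Without ribs the joint kernel is an identity.\<close>

lemma joint_kernel_ex:
  assumes "X \<in> Ob (Arr n A)"
  shows "\<exists>m. joint_kernel A (init_vertex A X) (initial_ribs X) m \<and> (Dom A m \<in> F \<longleftrightarrow> X \<in> Fsub A F n)"
  using assms
proof (induction n arbitrary: X)
  case 0
  then obtain Y where Y: "X = Vertex Y" "Y \<in> Ob A" by auto
  have "joint_kernel A Y [] (Id A Y)"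
    unfolding joint_kernel_def homD(2)[OF A.id_hom[OF Y(2)]]
  proof (intro conjI ballI allI impI)
    fix W g assume "g \<in> hom A W Y"
    then show "\<exists>!h. h \<in> hom A W Y \<and> Id A Y \<cdot>\<^bsub>A\<^esub> h = g" using A.id_left by metis
  qed (use A.id_hom[OF Y(2)] in auto)
  then show ?case using Y homD(2)[OF A.id_hom[OF Y(2)]] by (intro exI[of _ "Id A Y"]) auto
next
  case (Suc n)
  interpret C: cell_tors "Arr n A" "Qcls A N n" "Ocls A N n" "Ncls A N n" "Tcls A T n" "Fsub A F n" by (rule tower)
  have X: "X \<in> hom (Arr n A) (Dom (Arr n A) X) (Cod (Arr n A) X)" using Suc.prems by (simp add: C.Mor_hom)
  obtain \<kappa> k where k: "k \<in> hom (Arr n A) \<kappa> (Dom (Arr n A) X)" "is_kernel (Arr n A) k X" using C.kernel_ex[OF X] .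
  obtain m where m: "joint_kernel A (init_vertex A \<kappa>) (initial_ribs \<kappa>) m" "Dom A m \<in> F \<longleftrightarrow> \<kappa> \<in> Fsub A F n"
    using Suc.IH[OF C.hom_Ob1[OF k(1)]] by blast
  note s = joint_kernel_step[OF k(2), unfolded homD(2)[OF k(1)], OF m(1)]
  have "X \<in> Fsub A F (Suc n) \<longleftrightarrow> \<kappa> \<in> Fsub A F n"
    unfolding Fsub_Suc using C.arrF_kernel[OF _ k(2,1)] k homD(1)[OF X] homD(2)[OF k(1)] by (auto simp: arrF_def)
  then show ?case using s m(2) by (intro exI[of _ "initial_edge k \<cdot>\<^bsub>A\<^esub> m"]) simp
qed

text \<open>Being annihilated by a rib and factoring through its kernel are the same condition, so
  joint kernels and intersections have the same universal property. The choice of intersection is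
  immaterial because \<open>F\<close> is closed under isomorphism.\<close>

lemma ribs_kernel_in_iff:
  assumes X: "X \<in> Ob (Arr (Suc n) A)"
  shows "ribs_kernel_in A F X \<longleftrightarrow> X \<in> Fsub A F (Suc n)"
proof -
  define V rs where "V = init_vertex A X" and "rs = initial_ribs X"
  have ne: "rs \<noteq> []" unfolding rs_def using initial_ribs_Mor[of X n] X by simp
  have r: "r \<in> hom A V (Cod A r)" if "r \<in> set rs" for r
    unfolding V_def using ribs_of_object[OF X] that unfolding rs_def .
  obtain m0 where m0: "joint_kernel A V rs m0" "Dom A m0 \<in> F \<longleftrightarrow> X \<in> Fsub A F (Suc n)"
    using joint_kernel_ex[OF X] unfolding V_def rs_def by blast
  have inter: "joint_kernel A V rs m \<longleftrightarrow> is_intersection A ks m" if ks: "list_all2 (is_kernel A) ks rs" for ks m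
  proof -
    have kr: "k \<in> hom A (Dom A k) V" if k: "k \<in> set ks" for k
    proof -
      obtain r0 where "r0 \<in> set rs" "is_kernel A k r0" using list_all2_set(2)[OF ks k] by blast
      then show ?thesis using r[of r0] by (auto simp: is_kernel_def hom_def)
    qed
    have "ks \<noteq> []" using ks ne by auto
    \<comment> \<open>A rib exists because the dimension is positive; its kernel forces the codomain
      of an intersection to be the initial vertex \<open>V\<close>.\<close>
    then obtain k1 where k1: "k1 \<in> set ks" by (cases ks) auto
    have fac: "(\<forall>r \<in> set rs. r \<cdot>\<^bsub>A\<^esub> g = zm A W (Cod A r)) \<longleftrightarrow> (\<forall>k \<in> set ks. \<exists>h \<in> hom A W (Dom A k). k \<cdot>\<^bsub>A\<^esub> h = g)"
      if g: "g \<in> hom A W V" for W g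
    proof (intro iffI ballI)
      fix k assume z: "\<forall>r \<in> set rs. r \<cdot>\<^bsub>A\<^esub> g = zm A W (Cod A r)" and k: "k \<in> set ks"
      obtain r0 where r0: "r0 \<in> set rs" "is_kernel A k r0" using list_all2_set(2)[OF ks k] by blast
      show "\<exists>h \<in> hom A W (Dom A k). k \<cdot>\<^bsub>A\<^esub> h = g"
        using A.kernel_lift[OF r0(2) kr[OF k] r[OF r0(1)] g] z r0(1) by blast
    next
      fix r0 assume z: "\<forall>k \<in> set ks. \<exists>h \<in> hom A W (Dom A k). k \<cdot>\<^bsub>A\<^esub> h = g" and r0: "r0 \<in> set rs"
      obtain k where k: "k \<in> set ks" "is_kernel A k r0" using list_all2_set(1)[OF ks r0] by blast
      obtain h where h: "h \<in> hom A W (Dom A k)" "k \<cdot>\<^bsub>A\<^esub> h = g" using z k(1) by blast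
      show "r0 \<cdot>\<^bsub>A\<^esub> g = zm A W (Cod A r0)"
        using A.assoc[OF h(1) kr[OF k(1)] r[OF r0]] h(2) A.kernel_zero[OF k(2) kr[OF k(1)] r[OF r0]]
          A.zm_comp[OF h(1) A.hom_Ob2[OF r[OF r0]]] by simp
    qed
    show ?thesis
    proof
      assume m: "joint_kernel A V rs m"
      note mD = joint_kernelD[OF m]
      have "\<forall>k \<in> set ks. \<exists>h \<in> hom A (Dom A m) (Dom A k). k \<cdot>\<^bsub>A\<^esub> h = m" using fac[OF mD(1)] mD(2) by blast
      moreover have "\<exists>!h. h \<in> hom A (Dom A g) (Dom A m) \<and> m \<cdot>\<^bsub>A\<^esub> h = g"
        if "g \<in> Mor A" "Cod A g = Cod A m" "\<forall>k \<in> set ks. \<exists>h \<in> hom A (Dom A g) (Dom A k). k \<cdot>\<^bsub>A\<^esub> h = g" for g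
      proof -
        have "g \<in> hom A (Dom A g) V" using that(1,2) homD(3)[OF mD(1)] by (simp add: hom_def)
        then show ?thesis using mD(3) fac that(3) by blast
      qed
      ultimately show "is_intersection A ks m"
        unfolding is_intersection_def using homD(1,3)[OF mD(1)] homD(1,3)[OF kr] by simp
    next
      assume m: "is_intersection A ks m"
      have mh: "m \<in> hom A (Dom A m) V"
        using m k1 homD(3)[OF kr[OF k1]] unfolding is_intersection_def by (auto simp: hom_def)
      have mk: "\<forall>k \<in> set ks. \<exists>h \<in> hom A (Dom A m) (Dom A k). k \<cdot>\<^bsub>A\<^esub> h = m" using m unfolding is_intersection_def by blast
      have mu: "\<exists>!h. h \<in> hom A W (Dom A m) \<and> m \<cdot>\<^bsub>A\<^esub> h = g"
        if "g \<in> hom A W V" "\<forall>k \<in> set ks. \<exists>h \<in> hom A W (Dom A k). k \<cdot>\<^bsub>A\<^esub> h = g" for W g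
      proof -
        have "g \<in> Mor A" "Cod A g = Cod A m" "Dom A g = W" using that(1) mh by (auto simp: hom_def)
        then show ?thesis using m that(2) unfolding is_intersection_def by blast
      qed
      show "joint_kernel A V rs m"
        unfolding joint_kernel_def using mh mk fac[OF mh] mu fac by blast
    qed
  qed
  show ?thesis
  proof
    assume "ribs_kernel_in A F X"
    then obtain ks m where ks: "list_all2 (is_kernel A) ks rs" "is_intersection A ks m" "Dom A m \<in> F"
      unfolding ribs_kernel_in_def rs_def by blast
    then have "joint_kernel A V rs m" using inter by blast
    then show "X \<in> Fsub A F (Suc n)" using joint_kernel_unique[OF m0(1) _ r] ks(3) m0(2) by blast
  next
    assume "X \<in> Fsub A F (Suc n)"
    then have m: "Dom A m0 \<in> F" using m0(2) by blast
    have "list_all2 (is_kernel A) (map (\<lambda>r. SOME k. is_kernel A k r) rs) rs"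
      unfolding list_all2_map1
    proof (rule list.rel_refl_strong)
      fix r0 assume "r0 \<in> set rs"
      then obtain K k where "is_kernel A k r0" using A.kernel_ex[OF r] by metis
      then show "is_kernel A (SOME k. is_kernel A k r0) r0" by (rule someI)
    qed
    then show "ribs_kernel_in A F X" unfolding ribs_kernel_in_def rs_def[symmetric] using inter m0(1) m by blast
  qed
qed

section \<open>The higher extensions and torsion objects in terms of the tower\<close>

lemma Ext_eq: "Ext A N n = full_sub (Arr n A) (Ocls A N n)"
proof (cases n)
  case 0
  then show ?thesis using full_sub_Ob[OF Arr_category[of 0]] by simp
qed simp

text \<open>Cubes concentrated at the initial vertex are extensions: at each level, a morphism from
  an extension to a zero object is again an extension.\<close>

lemma Tcls_subset: "Tcls A T n \<subseteq> Ocls A N n"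
proof (induction n)
  case 0
  then show ?case using A.T_Ob by auto
next
  case (Suc n)
  interpret C: cell_tors "Arr n A" "Qcls A N n" "Ocls A N n" "Ncls A N n" "Tcls A T n" "Fsub A F n" by (rule tower)
  show ?case
  proof
    fix f assume "f \<in> Tcls A T (Suc n)"
    then have "f \<in> Mor (Arr n A)" "Dom (Arr n A) f \<in> Tcls A T n" "is_zero_ob (Arr n A) (Cod (Arr n A) f)"
      by (auto simp: arrT_def)
    then show "f \<in> Ocls A N (Suc n)" using C.E_zero[OF _ C.Mor_hom] Suc.IH by auto
  qed
qed

lemma iota_pow_Tcls: "X \<in> T \<Longrightarrow> iota_pow A n X \<in> Tcls A T n"
proof (induction n)
  case (Suc n)
  interpret C: cell_tors "Arr n A" "Qcls A N n" "Ocls A N n" "Ncls A N n" "Tcls A T n" "Fsub A F n" by (rule tower)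
  define Z where "Z = (SOME Z. is_zero_ob (Arr n A) Z)"
  have Z: "is_zero_ob (Arr n A) Z" unfolding Z_def using C.zero_obE someI_ex by metis
  have "iota_pow A n X \<in> Ob (Arr n A)" using Suc C.T_Ob by blast
  then have u: "\<exists>!f. f \<in> hom (Arr n A) (iota_pow A n X) Z" using Z unfolding is_zero_ob_def is_terminal_def by blast
  have "iota_pow A (Suc n) X \<in> hom (Arr n A) (iota_pow A n X) Z"
    using theI'[OF u] by (simp add: iota_def Z_def)
  then show ?case using Suc Z by (simp add: arrT_def hom_def)
qed simp

text \<open>For the inclusion from right to left an isomorphism is built level by level: on domains
  it comes from the induction, on codomains from the uniqueness of zero objects, and the square
  commutes because it ends in a zero object.\<close>

lemma Tsub_eq: "Tsub A T n = Tcls A T n"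
proof
  interpret C: cell_tors "Arr n A" "Qcls A N n" "Ocls A N n" "Ncls A N n" "Tcls A T n" "Fsub A F n" by (rule tower)
  show "Tsub A T n \<subseteq> Tcls A T n"
    unfolding Tsub_def isomorphic_def using C.T_replete iota_pow_Tcls by blast
  have "\<exists>X \<in> T. isomorphic (Arr n A) (iota_pow A n X) Y" if "Y \<in> Tcls A T n" for Y
    using that
  proof (induction n arbitrary: Y)
    case 0
    then obtain X where X: "Y = Vertex X" "X \<in> T" by auto
    then show ?case using A.iso_refl[OF A.T_Ob] by (auto simp: base_isomorphic)
  next
    case (Suc n)
    interpret C: cell_tors "Arr n A" "Qcls A N n" "Ocls A N n" "Ncls A N n" "Tcls A T n" "Fsub A F n" by (rule tower)
    have Y: "Y \<in> hom (Arr n A) (Dom (Arr n A) Y) (Cod (Arr n A) Y)" "Dom (Arr n A) Y \<in> Tcls A T n"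
      "is_zero_ob (Arr n A) (Cod (Arr n A) Y)" using Suc.prems by (auto simp: arrT_def C.Mor_hom)
    obtain X i where X: "X \<in> T" "i \<in> hom (Arr n A) (iota_pow A n X) (Dom (Arr n A) Y)" "is_iso (Arr n A) i"
      using Suc.IH[OF Y(2)] unfolding isomorphic_def by blast
    obtain Z where I: "iota_pow A (Suc n) X \<in> hom (Arr n A) (iota_pow A n X) Z" "is_zero_ob (Arr n A) Z"
    proof -
      have t: "iota_pow A (Suc n) X \<in> arrT (Arr n A) (Tcls A T n)" using iota_pow_Tcls[OF X(1), of "Suc n"] by simp
      have "is_zero_ob (Arr n A) (SOME Z. is_zero_ob (Arr n A) Z)" using C.zero_obE someI_ex by metis
      then have "\<exists>!f. f \<in> hom (Arr n A) (iota_pow A n X) (SOME Z. is_zero_ob (Arr n A) Z)"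
        using C.T_Ob[OF iota_pow_Tcls[OF X(1)]] unfolding is_zero_ob_def is_terminal_def by blast
      from theI'[OF this] have "iota_pow A (Suc n) X \<in> hom (Arr n A) (iota_pow A n X) (SOME Z. is_zero_ob (Arr n A) Z)"
        by (simp add: iota_def)
      then show thesis using that t by (auto simp: arrT_def hom_def)
    qed
    obtain j where j: "j \<in> hom (Arr n A) Z (Cod (Arr n A) Y)" "is_iso (Arr n A) j" using C.zero_ob_iso[OF I(2) Y(3)] .
    have "Y \<cdot>\<^bsub>Arr n A\<^esub> i = j \<cdot>\<^bsub>Arr n A\<^esub> iota_pow A (Suc n) X"
      by (rule C.to_zero_unique[OF Y(3) C.comp_hom[OF Y(1) X(2)] C.comp_hom[OF j(1) I(1)]])
    then have s: "Square (iota_pow A (Suc n) X) Y i j \<in> hom (arrow_cat (Arr n A)) (iota_pow A (Suc n) X) Y"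
      by (rule arr_homI[OF I(1) Y(1) X(2) j(1)])
    then have "is_iso (arrow_cat (Arr n A)) (Square (iota_pow A (Suc n) X) Y i j)" by (rule C.arr_isoI[OF _ X(3) j(2)])
    then show ?case using X(1) s unfolding isomorphic_def by auto
  qed
  then show "Tcls A T n \<subseteq> Tsub A T n" unfolding Tsub_def using C.T_Ob by blast
qed

end

text \<open>Normality refers to a choice of reflection, so it is asserted for every reflection; the
  separate existence clause keeps that assertion from being vacuous.\<close>

theorem theorem4p11:
  fixes A :: "('o, 'm) cat" and T F :: "'o set" and N :: "'m set" and n :: nat
  assumes "homological A"
    and "N = {f. normal_epi A f}"
    and "\<And>p. p \<in> N \<Longrightarrow> effective_descent A p"
    and "torsion_theory A T F"
    and "condition_P A F"
    and "condition_N A T F"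
    and "n \<ge> 1"
  shows "torsion_theory (Ext A N n) (Tsub A T n) (NExt A N F n)
    \<and> (\<exists>R \<eta>. reflection (Ext A N (n - 1)) (NExt A N F (n - 1)) R \<eta>)
    \<and> (\<forall>R \<eta>. reflection (Ext A N (n - 1)) (NExt A N F (n - 1)) R \<eta> \<longrightarrow>
         NExt A N F n =
           {X \<in> Ob (Ext A N n). normal_extension (Ext A N (n - 1)) R \<eta> (Ncls A N (n - 1)) X})
    \<and> (\<forall>X \<in> Ob (Ext A N n). X \<in> NExt A N F n \<longleftrightarrow> ribs_kernel_in A F X)"
proof -
  interpret H: homological_loc A by unfold_locales (rule assms(1))
  have "hml_tors A N (Ob A) N T F"
    unfolding assms(2) by (rule H.homological_hml_tors[OF _ assms(4-6)]) (simp add: assms(2,3))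
  then interpret arr_tower A N T F by (rule arr_tower.intro)
  obtain m where n: "n = Suc m" using assms(7) by (cases n) auto
  have NExt_eq: "NExt A N F k = Fsub A F k \<inter> Ocls A N k" for k
  proof -
    interpret C: cell_tors "Arr k A" "Qcls A N k" "Ocls A N k" "Ncls A N k" "Tcls A T k" "Fsub A F k" by (rule tower)
    show ?thesis unfolding NExt_def Ext_eq using C.O_Ob by auto
  qed
  \<comment> \<open>The torsion theory is used at two levels: at \<open>n\<close> it is the claim
    itself, and at \<open>m\<close> it supplies the reflection with respect to which normality is
    measured. For \<open>m = 0\<close> the latter is the given theory on the copy of
    \<open>A\<close>.\<close>
  have tt: "torsion_theory (Ext A N k) (Tsub A T k) (NExt A N F k)" for k
  proof -
    interpret C: cell_tors "Arr k A" "Qcls A N k" "Ocls A N k" "Ncls A N k" "Tcls A T k" "Fsub A F k" by (rule tower)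
    show ?thesis unfolding Ext_eq Tsub_eq NExt_eq by (rule C.ext_torsion_theory[OF Tcls_subset])
  qed
  interpret C: cell_tors "Arr m A" "Qcls A N m" "Ocls A N m" "Ncls A N m" "Tcls A T m" "Fsub A F m" by (rule tower)
  have "tors_cat (Ext A N m) (Tsub A T m) (NExt A N F m)"
    by unfold_locales (use tt[of m] in \<open>auto simp: torsion_theory_def\<close>)
  then have "\<exists>R \<eta>. reflection (Ext A N m) (NExt A N F m) R \<eta>" by (rule tors_cat.torsion_reflection)
  moreover have "NExt A N F n = {X \<in> Ob (Ext A N n). normal_extension (Ext A N m) R \<eta> (Ncls A N m) X}"
    if "reflection (Ext A N m) (NExt A N F m) R \<eta>" for R \<eta>
  proof -
    have "X \<in> NExt A N F n \<longleftrightarrow> normal_extension (Ext A N m) R \<eta> (Ncls A N m) X" if X: "X \<in> Ncls A N m" for X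
      unfolding Ext_eq C.normal_extension_iff[OF \<open>reflection _ _ _ _\<close>[unfolded Ext_eq NExt_eq] X]
      using X C.E_Mor[OF X] by (auto simp: NExt_eq n)
    moreover have "Ob (Ext A N n) = Ncls A N m" using C.E_Mor by (auto simp: n)
    moreover have "NExt A N F n \<subseteq> Ncls A N m" by (auto simp: NExt_eq n)
    ultimately show ?thesis by blast
  qed
  moreover have "X \<in> NExt A N F n \<longleftrightarrow> ribs_kernel_in A F X" if "X \<in> Ob (Ext A N n)" for X
  proof -
    have "X \<in> Ob (Arr (Suc m) A)" "X \<in> Ocls A N n" using that unfolding Ext_eq n by auto
    then show ?thesis using ribs_kernel_in_iff unfolding NExt_eq n by blast
  qed
  ultimately show ?thesis using tt[of n] unfolding n diff_Suc_1 by blast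
qed

end
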